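(* Let $\operatorname{Im}\tau>0$, $E_\tau=\mathbb{C}/(\mathbb{Z}+\mathbb{Z}\tau)$, and let $n_1,n_2\in\mathbb{Z}_{\ge0}$ with $n_1\not\equiv n_2\pmod 3$ and $n_1<n_2$. Then there is a one-to-one correspondence between even solutions $(u,v)$ of the $SU(3)$ Toda system $$\begin{cases}\Delta u+2e^{u}-e^{v}=4\pi n_1\delta_{0}&\text{on }E_\tau,\\ \Delta v+2e^{v}-e^{u}=4\pi n_2\delta_{0}&\text{on }E_\tau\end{cases}$$ and those $(B,D_0,D)\in\mathbb{C}^3$ with $D_0=D=0$ such that $0$ is an apparent singularity of the ODE $$y'''-(\alpha\wp(z)+B)y'+(\beta\wp'(z)+D_0\wp(z)+D)y=0.$$ The correspondence assigns to $(u,v)$ the parameters of its associated ODE (described in the context).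
   Context: $\Delta=4\partial_{z\bar z}$; $\delta_0$ is the Dirac measure at $0$. A solution $(u,v)$ is a pair of real-valued functions on $E_\tau$, smooth away from $0$, satisfying the system on $E_\tau$ in the sense of distributions (equivalently, the equations without sources hold on $E_\tau\setminus\{0\}$ and $u=2n_1\ln|z|+O(1)$, $v=2n_2\ln|z|+O(1)$ near $0$). It is even if $u(-z)=u(z)$, $v(-z)=v(z)$. $\wp(z)=\wp(z;\tau)$ is the Weierstrass function with periods $1,\tau$. Constants: $\gamma_1=\frac{2n_1+n_2}{3}$, $\gamma_2=\frac{n_1+2n_2}{3}$, $\alpha=\gamma_1(\gamma_1+1)+\gamma_2(\gamma_2+1)-\gamma_1\gamma_2$, $\beta=-\frac12[2\gamma_1(\gamma_1+1)+\gamma_1\gamma_2(\gamma_1-\gamma_2-1)]$. The ODE has a regular singularity at $0$ with local exponents $-\gamma_1$, $-\gamma_1+n_1+1$, $-\gamma_1+n_1+n_2+2$; $0$ is an apparent singularity if the ODE has no solutions with a logarithmic singularity at $0$. Associated ODE of $(u,v)$: with $U=\frac{2u+v}{3}$, $V=\frac{u+2v}{3}$, one has $(\partial_z-V_z)(\partial_z+V_z-U_z)(\partial_z+U_z)=\partial_z^3+W_2\partial_z+W_3$ with $W_2=U_{zz}-U_z^2+V_{zz}-V_z^2+U_zV_z$ and $W_3=U_{zzz}-2U_zU_{zz}+U_zV_{zz}+V_zU_z^2-U_zV_z^2$, which are elliptic functions with poles only at $0$, of the form $W_2=-(\alpha\wp+B)$, $W_3=\beta\wp'+D_0\wp+D$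 with uniquely determined constants $B,D_0,D$. *)

theory Defs
  imports "HOL-Complex_Analysis.Complex_Analysis" "HOL-Library.Landau_Symbols"
begin

text \<open>
  Functions on the torus $E_\tau$ are represented as functions on the complex plane that are
  periodic with respect to the lattice below; the point $0$ of the torus is the whole lattice.
\<close>

definition lattice :: "complex \<Rightarrow> complex set" where
  "lattice \<tau> = {of_int m + of_int n * \<tau> | m n. True}"

definition wp :: "complex \<Rightarrow> complex \<Rightarrow> complex" where
  "wp \<tau> z = 1 / z\<^sup>2 + (\<Sum>\<^sub>\<infinity>\<omega>\<in>lattice \<tau> - {0}. 1 / (z - \<omega>)\<^sup>2 - 1 / \<omega>\<^sup>2)"

definition wp' :: "complex \<Rightarrow> complex \<Rightarrow> complex" where
  "wp' \<tau> = deriv (wp \<tau>)"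


text \<open>Real differentiability: the two partial derivatives in $x$ and $y$ are the values of the
  Frechet derivative at $1$ and $i$.\<close>

primrec Ck_on :: "nat \<Rightarrow> complex set \<Rightarrow> (complex \<Rightarrow> 'a::real_normed_vector) \<Rightarrow> bool" where
  "Ck_on 0 S f \<longleftrightarrow> continuous_on S f"
| "Ck_on (Suc k) S f \<longleftrightarrow> (\<forall>z\<in>S. f differentiable at z) \<and>
     Ck_on k S (\<lambda>z. frechet_derivative f (at z) 1) \<and>
     Ck_on k S (\<lambda>z. frechet_derivative f (at z) \<i>)"

definition smooth_on :: "complex set \<Rightarrow> (complex \<Rightarrow> 'a::real_normed_vector) \<Rightarrow> bool" where
  "smooth_on S f \<longleftrightarrow> (\<forall>k. Ck_on k S f)"

definition dz :: "(complex \<Rightarrow> complex) \<Rightarrow> complex \<Rightarrow> complex" where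
  "dz f z = (frechet_derivative f (at z) 1 - \<i> * frechet_derivative f (at z) \<i>) / 2"

definition dzbar :: "(complex \<Rightarrow> complex) \<Rightarrow> complex \<Rightarrow> complex" where
  "dzbar f z = (frechet_derivative f (at z) 1 + \<i> * frechet_derivative f (at z) \<i>) / 2"

definition laplacian :: "(complex \<Rightarrow> complex) \<Rightarrow> complex \<Rightarrow> complex" where
  "laplacian f z = 4 * dz (dzbar f) z"


definition torus_function :: "complex \<Rightarrow> (complex \<Rightarrow> real) \<Rightarrow> bool" where
  "torus_function \<tau> f \<longleftrightarrow> (\<forall>z. f (z + 1) = f z \<and> f (z + \<tau>) = f z)"

text \<open>
  Solutions of the Toda system with sources $4 \pi n_1 \delta_0$ and $4 \pi n_2 \delta_0$. The
  distributional equations on the torus are expressed as the source-free equations away from the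
  lattice together with $u = 2 n_1 \ln |z| + O(1)$ and $v = 2 n_2 \ln |z| + O(1)$ at $0$.
  A solution is a function on the punctured torus. Its representative is
  given the dummy value 0 on the lattice, so that distinct representatives are distinct solutions.
\<close>

definition toda_solution ::
    "complex \<Rightarrow> nat \<Rightarrow> nat \<Rightarrow> (complex \<Rightarrow> real) \<times> (complex \<Rightarrow> real) \<Rightarrow> bool" where
  "toda_solution \<tau> n1 n2 = (\<lambda>(u, v).
     torus_function \<tau> u \<and> torus_function \<tau> v \<and>
     (\<forall>z\<in>lattice \<tau>. u z = 0 \<and> v z = 0) \<and>
     smooth_on (- lattice \<tau>) u \<and> smooth_on (- lattice \<tau>) v \<and>
     (\<forall>z\<in>- lattice \<tau>.
        laplacian (\<lambda>w. of_real (u w)) z + 2 * of_real (exp (u z)) - of_real (exp (v z)) = 0 \<and>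
        laplacian (\<lambda>w. of_real (v w)) z + 2 * of_real (exp (v z)) - of_real (exp (u z)) = 0) \<and>
     (\<lambda>z. u z - 2 * real n1 * ln (norm z)) \<in> O[at 0](\<lambda>_. 1) \<and>
     (\<lambda>z. v z - 2 * real n2 * ln (norm z)) \<in> O[at 0](\<lambda>_. 1))"

definition even_toda_solutions ::
    "complex \<Rightarrow> nat \<Rightarrow> nat \<Rightarrow> ((complex \<Rightarrow> real) \<times> (complex \<Rightarrow> real)) set" where
  "even_toda_solutions \<tau> n1 n2 =
     {(u, v). toda_solution \<tau> n1 n2 (u, v) \<and> (\<forall>z. u (- z) = u z \<and> v (- z) = v z)}"


definition gamma1 :: "nat \<Rightarrow> nat \<Rightarrow> real" where
  "gamma1 n1 n2 = (2 * real n1 + real n2) / 3"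

definition gamma2 :: "nat \<Rightarrow> nat \<Rightarrow> real" where
  "gamma2 n1 n2 = (real n1 + 2 * real n2) / 3"

definition ode_alpha :: "nat \<Rightarrow> nat \<Rightarrow> real" where
  "ode_alpha n1 n2 = (let g1 = gamma1 n1 n2; g2 = gamma2 n1 n2 in
     g1 * (g1 + 1) + g2 * (g2 + 1) - g1 * g2)"

definition ode_beta :: "nat \<Rightarrow> nat \<Rightarrow> real" where
  "ode_beta n1 n2 = (let g1 = gamma1 n1 n2; g2 = gamma2 n1 n2 in
     - (1 / 2) * (2 * g1 * (g1 + 1) + g1 * g2 * (g1 - g2 - 1)))"

definition ode_solution ::
    "complex \<Rightarrow> nat \<Rightarrow> nat \<Rightarrow> complex \<times> complex \<times> complex \<Rightarrow> complex set \<Rightarrow>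
     (complex \<Rightarrow> complex) \<Rightarrow> bool" where
  "ode_solution \<tau> n1 n2 = (\<lambda>(B, D0, D) S y.
     y holomorphic_on S \<and>
     (\<forall>z\<in>S. (deriv ^^ 3) y z
        - (of_real (ode_alpha n1 n2) * wp \<tau> z + B) * deriv y z
        + (of_real (ode_beta n1 n2) * wp' \<tau> z + D0 * wp \<tau> z + D) * y z = 0))"

text \<open>
  The local exponents at $0$ are $-\gamma_1$, $-\gamma_1 + n_1 + 1$ and $-\gamma_1 + n_1 + n_2 + 2$.
  They differ by integers, so the Frobenius expansion of a solution at $0$ is
  $z^{-\gamma_1} (h_0 + h_1 \log z + h_2 \log^2 z)$ with $h_0, h_1, h_2$ holomorphic at $0$.
  A solution without logarithmic singularity is one where only $h_0$ occurs. Branches are fixed by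
  cutting the disc along the nonpositive reals and using the principal power.
\<close>

definition slit_ball :: "real \<Rightarrow> complex set" where
  "slit_ball r = ball 0 r - \<real>\<^sub>\<le>\<^sub>0"

definition log_singularity_at_0 ::
    "nat \<Rightarrow> nat \<Rightarrow> real \<Rightarrow> (complex \<Rightarrow> complex) \<Rightarrow> bool" where
  "log_singularity_at_0 n1 n2 r y \<longleftrightarrow>
     \<not> (\<exists>h. h holomorphic_on ball 0 r \<and>
          (\<forall>z\<in>slit_ball r. y z = z powr (- of_real (gamma1 n1 n2)) * h z))"

definition apparent_at_0 ::
    "complex \<Rightarrow> nat \<Rightarrow> nat \<Rightarrow> complex \<times> complex \<times> complex \<Rightarrow> bool" where
  "apparent_at_0 \<tau> n1 n2 p \<longleftrightarrow>
     (\<forall>r>0. ball 0 r \<inter> lattice \<tau> = {0} \<longrightarrow>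
        \<not> (\<exists>y. ode_solution \<tau> n1 n2 p (slit_ball r) y \<and> log_singularity_at_0 n1 n2 r y))"


text \<open>
  The coefficients in $(\partial_z - V_z)(\partial_z + V_z - U_z)(\partial_z + U_z)
  = \partial_z^3 + W_2 \partial_z + W_3$.
\<close>

definition W2 :: "(complex \<Rightarrow> complex) \<Rightarrow> (complex \<Rightarrow> complex) \<Rightarrow> complex \<Rightarrow> complex" where
  "W2 U V z = dz (dz U) z - (dz U z)\<^sup>2 + dz (dz V) z - (dz V z)\<^sup>2 + dz U z * dz V z"

definition W3 :: "(complex \<Rightarrow> complex) \<Rightarrow> (complex \<Rightarrow> complex) \<Rightarrow> complex \<Rightarrow> complex" where
  "W3 U V z = dz (dz (dz U)) z - 2 * dz U z * dz (dz U) z + dz U z * dz (dz V) z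
     + dz V z * (dz U z)\<^sup>2 - dz U z * (dz V z)\<^sup>2"

definition is_associated_ode ::
    "complex \<Rightarrow> nat \<Rightarrow> nat \<Rightarrow> (complex \<Rightarrow> real) \<times> (complex \<Rightarrow> real) \<Rightarrow>
     complex \<times> complex \<times> complex \<Rightarrow> bool" where
  "is_associated_ode \<tau> n1 n2 = (\<lambda>(u, v) (B, D0, D).
     (let U = (\<lambda>z. of_real ((2 * u z + v z) / 3)); V = (\<lambda>z. of_real ((u z + 2 * v z) / 3)) in
      \<forall>z\<in>- lattice \<tau>.
        W2 U V z = - (of_real (ode_alpha n1 n2) * wp \<tau> z + B) \<and>
        W3 U V z = of_real (ode_beta n1 n2) * wp' \<tau> z + D0 * wp \<tau> z + D))"

definition associated_params ::
    "complex \<Rightarrow> nat \<Rightarrow> nat \<Rightarrow> (complex \<Rightarrow> real) \<times> (complex \<Rightarrow> real) \<Rightarrow>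
     complex \<times> complex \<times> complex" where
  "associated_params \<tau> n1 n2 s = (THE p. is_associated_ode \<tau> n1 n2 s p)"

end

theory Submission
  imports Defs
begin

text \<open>
  A solution is reconstructed from the linear equation by \<open>exp (- U) = \<Sum> |y\<^sub>k|\<^sup>2\<close> for a basis
  \<open>y\<^sub>k\<close> of solutions with Wronskian \<open>1/8\<close>. Conversely, the defect between the Gram matrix built
  from \<open>U, V\<close> and the one of the jets of such a basis satisfies a linear first order
  system, so it vanishes identically once it vanishes at one point. Near \<open>0\<close> the monodromy is
  therefore unitary, and the logarithmic behaviour of \<open>U, V\<close> forces power-type solutions with the
  prescribed exponents: \<open>0\<close> is apparent and the coefficients have the stated poles; evenness
  leaves only the constant \<open>B\<close>.

  For the converse, an apparent singularity makes the local monodromy the scalar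
  \<open>\<kappa> = exp (2 \<pi> i \<gamma>\<^sub>1)\<close>, which is a primitive third root of unity as \<open>n\<^sub>1\<close> and \<open>n\<^sub>2\<close> differ modulo 3. The monodromies
  \<open>M\<^sub>1, M\<^sub>2\<close> along the two periods satisfy \<open>M\<^sub>1 M\<^sub>2 = \<kappa> M\<^sub>2 M\<^sub>1\<close>, so they generate an irreducible group
  that is unitary for exactly one Hermitian form of given determinant. This form gives the
  unique solution, and its uniqueness makes that solution even.
\<close>


section \<open>Smooth functions and Wirtinger derivatives\<close>

text \<open>Solutions are multivalued on the punctured torus, but nothing is continued along paths.
  Translates of the strips \<open>S\<close> and \<open>T\<close> cover the plane off the lattice;
  both are convex and free of lattice points, so solutions are functions there, and each strip is
  invariant under one period, which gives one monodromy. The local monodromy enters at the vertex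
  \<open>1 + \<tau>\<close>, where four parallelograms meet and two opposite slit discs replace a
  loop. The constant \<open>1/8\<close> comes from factorizing the matrix of mixed derivatives of
  \<open>exp (- U)\<close>: its pivots are \<open>exp (- U)\<close>, \<open>exp (U - V) / 4\<close>
  and \<open>exp V / 16\<close>, with product \<open>1/64\<close>, and its determinant is the
  squared modulus of the Wronskian. This normalization fixes the scalar that irreducibility leaves
  open in the Hermitian form. Globally, \<open>V\<close> is defined from \<open>U\<close> by the
  first equation. Existence, uniqueness, periodicity and evenness thus all concern the one function
  \<open>exp (- U)\<close>.\<close>

lemma frechet_derivative_eqI: "(f has_derivative D) (at z) \<Longrightarrow> frechet_derivative f (at z) = D"
  using frechet_derivative_at by metis

text \<open>The last assumption is the congruence rule for \<open>Ck_on k\<close>. It is assumed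
  because the rule is first used inside the induction that proves that congruence, where the
  induction hypothesis supplies it.\<close>

lemma Ck_onI:
  fixes f :: "complex \<Rightarrow> 'a::real_normed_vector"
  assumes "\<And>z. z \<in> S \<Longrightarrow> (f has_derivative D z) (at z)"
    and "open S" "Ck_on k S (\<lambda>z. D z 1)" "Ck_on k S (\<lambda>z. D z \<i>)"
    and cong: "\<And>f g :: complex \<Rightarrow> 'a::real_normed_vector. (\<And>z. z \<in> S \<Longrightarrow> f z = g z) \<Longrightarrow> Ck_on k S f \<Longrightarrow> Ck_on k S g"
  shows "Ck_on (Suc k) S f"
proof -
  have "frechet_derivative f (at z) = D z" if "z \<in> S" for z
    using frechet_derivative_eqI[OF assms(1)[OF that]] .
  note e = this
  have "f differentiable at z" if "z \<in> S" for z
    using assms(1)[OF that] unfolding differentiable_def by blast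
  moreover have "Ck_on k S (\<lambda>z. frechet_derivative f (at z) 1)"
    by (rule cong[OF _ assms(3)]) (simp add: e)
  moreover have "Ck_on k S (\<lambda>z. frechet_derivative f (at z) \<i>)"
    by (rule cong[OF _ assms(4)]) (simp add: e)
  ultimately show ?thesis by simp
qed

lemma Ck_on_cong_imp:
  fixes f g :: "complex \<Rightarrow> 'a::real_normed_vector"
  assumes "open S" "\<And>z. z \<in> S \<Longrightarrow> f z = g z" "Ck_on k S f"
  shows "Ck_on k S g"
  using assms(2,3)
proof (induction k arbitrary: f g)
  case 0
  then show ?case by (metis Ck_on.simps(1) continuous_on_cong)
next
  case (Suc k)
  have D: "(g has_derivative frechet_derivative f (at z)) (at z)" if "z \<in> S" for z
  proof -
    have "(f has_derivative frechet_derivative f (at z)) (at z)"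
      using Suc.prems(2) that frechet_derivative_works by fastforce
    then show ?thesis
      by (rule has_derivative_transform_within_open[OF _ \<open>open S\<close> that]) (use Suc.prems in auto)
  qed
  show ?case
  proof (rule Ck_onI[OF D assms(1)])
    show "Ck_on k S (\<lambda>z. frechet_derivative f (at z) 1)" "Ck_on k S (\<lambda>z. frechet_derivative f (at z) \<i>)"
      using Suc.prems(2) by auto
  qed (use Suc.IH in blast)+
qed

lemma Ck_on_SucI:
  fixes f :: "complex \<Rightarrow> 'a::real_normed_vector"
  assumes "open S" "\<And>z. z \<in> S \<Longrightarrow> (f has_derivative D z) (at z)"
    and "Ck_on k S (\<lambda>z. D z 1)" "Ck_on k S (\<lambda>z. D z \<i>)"
  shows "Ck_on (Suc k) S f"
  by (rule Ck_onI[OF assms(2,1,3,4)]) (use Ck_on_cong_imp assms(1) in blast)+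

lemma Ck_on_SucD: "Ck_on (Suc k) S f \<Longrightarrow> Ck_on k S f"
proof (induction k arbitrary: f)
  case 0
  then have "f differentiable at z" if "z \<in> S" for z using that by simp
  then have "continuous (at z within S) f" if "z \<in> S" for z
    using that by (meson continuous_at_imp_continuous_at_within differentiable_imp_continuous_within)
  then show ?case by (simp add: continuous_on_eq_continuous_within)
next
  case (Suc k)
  have "Ck_on k S (\<lambda>z. frechet_derivative f (at z) 1)" "Ck_on k S (\<lambda>z. frechet_derivative f (at z) \<i>)"
    by (rule Suc.IH, use Suc.prems in simp)+
  moreover have "\<forall>z\<in>S. f differentiable at z" using Suc.prems by simp
  ultimately show ?case by simp
qed

lemma Ck_on_has_derivative:
  assumes "Ck_on (Suc k) S f" "z \<in> S"
  shows "(f has_derivative frechet_derivative f (at z)) (at z)"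
  using assms frechet_derivative_works by auto

text \<open>\<open>Ck_on\<close> speaks of derivatives at a point of the full plane, so only its
  base case, continuity on \<open>S\<close>, has to be localized.\<close>

lemma Ck_on_local:
  fixes f :: "complex \<Rightarrow> 'a::real_normed_vector"
  assumes "\<And>z. z \<in> S \<Longrightarrow> \<exists>N. open N \<and> z \<in> N \<and> Ck_on k N f"
  shows "Ck_on k S f"
  using assms
proof (induction k arbitrary: f)
  case 0
  show ?case unfolding Ck_on.simps continuous_on_eq_continuous_within
  proof
    fix z assume "z \<in> S"
    then obtain N where "open N" "z \<in> N" "continuous_on N f" using 0 by auto
    then show "continuous (at z within S) f"
      by (meson continuous_at_imp_continuous_at_within continuous_on_eq_continuous_at)
  qed
next
  case (Suc k)
  then show ?case unfolding Ck_on.simps by (meson)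
qed

lemma Ck_on_subset: "Ck_on k S f \<Longrightarrow> T \<subseteq> S \<Longrightarrow> Ck_on k T f"
  by (induction k arbitrary: f) (auto intro: continuous_on_subset)

lemma Ck_on_const: "open S \<Longrightarrow> Ck_on k S (\<lambda>_. c :: 'a::real_normed_vector)"
proof (induction k arbitrary: c)
  case (Suc k)
  show ?case
    by (rule Ck_on_SucI[where D = "\<lambda>_ _. 0"]) (use Suc in auto)
qed auto

lemma Ck_on_add:
  fixes f g :: "complex \<Rightarrow> 'a::real_normed_vector"
  shows "open S \<Longrightarrow> Ck_on k S f \<Longrightarrow> Ck_on k S g \<Longrightarrow> Ck_on k S (\<lambda>z. f z + g z)"
proof (induction k arbitrary: f g)
  case (Suc k)
  note d = Ck_on_has_derivative[OF Suc.prems(2)] Ck_on_has_derivative[OF Suc.prems(3)]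
  show ?case
    by (rule Ck_on_SucI[OF Suc.prems(1) has_derivative_add[OF d]]) (use Suc in auto)
qed (auto intro: continuous_intros)

lemma Ck_on_bounded_linear:
  fixes f :: "complex \<Rightarrow> 'a::real_normed_vector" and T :: "'a \<Rightarrow> 'b::real_normed_vector"
  assumes "bounded_linear T"
  shows "open S \<Longrightarrow> Ck_on k S f \<Longrightarrow> Ck_on k S (\<lambda>z. T (f z))"
proof (induction k arbitrary: f)
  case 0
  then show ?case using assms by (auto intro: bounded_linear.continuous_on)
next
  case (Suc k)
  note d = Ck_on_has_derivative[OF Suc.prems(2)]
  show ?case
    by (rule Ck_on_SucI[OF Suc.prems(1) bounded_linear.has_derivative[OF assms d]]) (use Suc in auto)
qed

lemma Ck_on_mult:
  fixes f g :: "complex \<Rightarrow> complex"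
  shows "open S \<Longrightarrow> Ck_on k S f \<Longrightarrow> Ck_on k S g \<Longrightarrow> Ck_on k S (\<lambda>z. f z * g z)"
proof (induction k arbitrary: f g)
  case (Suc k)
  note d = Ck_on_has_derivative[OF Suc.prems(2)] Ck_on_has_derivative[OF Suc.prems(3)]
  show ?case
    by (rule Ck_on_SucI[OF Suc.prems(1) has_derivative_mult[OF d]], assumption, assumption)
      (intro Ck_on_add Suc.IH Suc.prems(1) Suc.prems(2,3)[THEN Ck_on_SucD];
        use Suc.prems(2,3) in simp)+
qed (auto intro: continuous_intros)

text \<open>The induction generalizes over \<open>\<phi>\<close>, since the derivative of the
  composite contains \<open>deriv \<phi>\<close> composed with the same \<open>f\<close>.\<close>

lemma Ck_on_holomorphic_comp:
  fixes f :: "complex \<Rightarrow> complex"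
  shows "open S \<Longrightarrow> Ck_on k S f \<Longrightarrow> open T \<Longrightarrow> \<phi> holomorphic_on T \<Longrightarrow> f ` S \<subseteq> T \<Longrightarrow> Ck_on k S (\<lambda>z. \<phi> (f z))"
proof (induction k arbitrary: \<phi>)
  case 0
  then have "continuous_on S f" by simp
  then show ?case unfolding Ck_on.simps
    by (rule continuous_on_compose2[OF holomorphic_on_imp_continuous_on[OF 0(4)] _ 0(5)])
next
  case (Suc k)
  have D: "((\<lambda>z. \<phi> (f z)) has_derivative (\<lambda>h. deriv \<phi> (f z) * frechet_derivative f (at z) h)) (at z)" if "z \<in> S" for z
  proof -
    have "(\<phi> has_field_derivative deriv \<phi> (f z)) (at (f z))"
      using Suc.prems that by (meson holomorphic_derivI image_subset_iff)
    then show ?thesis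
      using has_derivative_compose[OF Ck_on_has_derivative[OF Suc.prems(2) that]]
      by (simp add: has_field_derivative_def)
  qed
  have "Ck_on k S (\<lambda>z. deriv \<phi> (f z))"
    by (rule Suc.IH[OF Suc.prems(1) Ck_on_SucD[OF Suc.prems(2)] Suc.prems(3)
          holomorphic_deriv[OF Suc.prems(4,3)] Suc.prems(5)])
  then show ?case
    by (intro Ck_on_SucI[OF Suc.prems(1) D] Ck_on_mult Suc.prems(1)) (use Suc.prems(2) in simp)+
qed

lemma smooth_on_cong: "open S \<Longrightarrow> (\<And>z. z \<in> S \<Longrightarrow> f z = g z) \<Longrightarrow> smooth_on S f \<Longrightarrow> smooth_on S g"
  unfolding smooth_on_def by (intro allI, rule Ck_on_cong_imp[of S f g]) auto

lemma smooth_on_subset: "smooth_on S f \<Longrightarrow> T \<subseteq> S \<Longrightarrow> smooth_on T f"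
  unfolding smooth_on_def by (intro allI, rule Ck_on_subset[of _ S]) auto

lemma smooth_on_local:
  assumes "\<And>z. z \<in> S \<Longrightarrow> \<exists>N. open N \<and> z \<in> N \<and> smooth_on N f"
  shows "smooth_on S f"
  unfolding smooth_on_def
proof
  fix k show "Ck_on k S f"
    by (rule Ck_on_local) (use assms smooth_on_def in blast)
qed

lemma smooth_on_has_derivative:
  "smooth_on S f \<Longrightarrow> z \<in> S \<Longrightarrow> (f has_derivative frechet_derivative f (at z)) (at z)"
  unfolding smooth_on_def by (rule Ck_on_has_derivative[of 0]) (simp_all only:)

lemma smooth_on_frechet:
  assumes "smooth_on S f"
  shows "smooth_on S (\<lambda>z. frechet_derivative f (at z) 1)" "smooth_on S (\<lambda>z. frechet_derivative f (at z) \<i>)"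
proof -
  have "Ck_on (Suc k) S f" for k using assms unfolding smooth_on_def by simp
  then show "smooth_on S (\<lambda>z. frechet_derivative f (at z) 1)" "smooth_on S (\<lambda>z. frechet_derivative f (at z) \<i>)"
    unfolding smooth_on_def Ck_on.simps by simp_all
qed

lemma smooth_on_const: "open S \<Longrightarrow> smooth_on S (\<lambda>_. c)"
  by (simp add: smooth_on_def Ck_on_const)

lemma smooth_on_add: "open S \<Longrightarrow> smooth_on S f \<Longrightarrow> smooth_on S g \<Longrightarrow> smooth_on S (\<lambda>z. f z + g z)"
  by (simp add: smooth_on_def Ck_on_add)

lemma smooth_on_bounded_linear: "bounded_linear T \<Longrightarrow> open S \<Longrightarrow> smooth_on S f \<Longrightarrow> smooth_on S (\<lambda>z. T (f z))"
  by (simp add: smooth_on_def Ck_on_bounded_linear)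

lemma smooth_on_mult:
  fixes f g :: "complex \<Rightarrow> complex"
  shows "open S \<Longrightarrow> smooth_on S f \<Longrightarrow> smooth_on S g \<Longrightarrow> smooth_on S (\<lambda>z. f z * g z)"
  by (simp add: smooth_on_def Ck_on_mult)

lemma smooth_on_holomorphic_comp:
  "open S \<Longrightarrow> smooth_on S f \<Longrightarrow> open T \<Longrightarrow> \<phi> holomorphic_on T \<Longrightarrow> f ` S \<subseteq> T \<Longrightarrow> smooth_on S (\<lambda>z. \<phi> (f z))"
  unfolding smooth_on_def by (intro allI, rule Ck_on_holomorphic_comp[of S _ f T]) auto

lemma smooth_on_ident: "open S \<Longrightarrow> smooth_on S (\<lambda>z::complex. z)"
  unfolding smooth_on_def
proof
  fix k assume S: "open S"
  show "Ck_on k S (\<lambda>z::complex. z)"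
  proof (cases k)
    case (Suc j)
    show ?thesis unfolding Suc
      by (rule Ck_on_SucI[where D = "\<lambda>_ h. h"]) (auto simp: S Ck_on_const)
  qed auto
qed

lemma holomorphic_imp_smooth_on: "open S \<Longrightarrow> f holomorphic_on S \<Longrightarrow> smooth_on S f"
  using smooth_on_holomorphic_comp[OF _ smooth_on_ident, of S S f] by auto

lemma smooth_on_cnj: "open S \<Longrightarrow> smooth_on S f \<Longrightarrow> smooth_on S (\<lambda>z. cnj (f z))"
  by (rule smooth_on_bounded_linear[OF bounded_linear_cnj])

lemma smooth_on_sum:
  fixes f :: "'i \<Rightarrow> complex \<Rightarrow> 'a::real_normed_vector"
  assumes "open S" "\<And>i. i \<in> I \<Longrightarrow> smooth_on S (f i)"
  shows "smooth_on S (\<lambda>z. \<Sum>i\<in>I. f i z)"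
  using assms(2)
  by (induction I rule: infinite_finite_induct) (auto intro!: smooth_on_const smooth_on_add assms(1))

lemma smooth_on_of_real_iff:
  fixes u :: "complex \<Rightarrow> real"
  assumes "open S"
  shows "smooth_on S (\<lambda>z. complex_of_real (u z)) \<longleftrightarrow> smooth_on S u"
  using smooth_on_bounded_linear[OF bounded_linear_Re assms, of "\<lambda>z. complex_of_real (u z)"]
    smooth_on_bounded_linear[OF bounded_linear_of_real[where 'a=complex] assms, of u] by auto

text \<open>The real differential in complex coordinates, with \<open>a\<close> and \<open>b\<close>
  the values of \<open>dz\<close> and \<open>dzbar\<close>. A relation, unlike an equation for
  \<open>dz f z\<close>, carries differentiability along, so the rules of calculus below need no
  separate side conditions for it.\<close>

definition wirt :: "(complex \<Rightarrow> complex) \<Rightarrow> complex \<Rightarrow> complex \<Rightarrow> complex \<Rightarrow> bool" where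
  "wirt f a b z \<longleftrightarrow> (f has_derivative (\<lambda>h. a * h + b * cnj h)) (at z)"

lemma wirt_dz: "wirt f a b z \<Longrightarrow> dz f z = a"
  and wirt_dzbar: "wirt f a b z \<Longrightarrow> dzbar f z = b"
  unfolding wirt_def dz_def dzbar_def by (auto simp: frechet_derivative_eqI algebra_simps)

lemma wirt_cong:
  assumes "wirt f a b z" "open S" "z \<in> S" "\<And>w. w \<in> S \<Longrightarrow> f w = g w"
  shows "wirt g a b z"
  unfolding wirt_def
  by (rule has_derivative_transform_within_open[OF assms(1)[unfolded wirt_def] assms(2,3)]) (rule assms(4))

text \<open>A real-linear map of the plane has the form \<open>a * h + b * cnj h\<close>, and
  \<open>a\<close>, \<open>b\<close> can be read off from its values at \<open>1\<close> and
  \<open>\<i>\<close>.\<close>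

lemma smooth_on_wirt:
  assumes "smooth_on S f" "z \<in> S"
  shows "wirt f (dz f z) (dzbar f z) z"
proof -
  let ?D = "frechet_derivative f (at z)"
  have d: "(f has_derivative ?D) (at z)"
    by (rule smooth_on_has_derivative[OF assms])
  have "?D h = dz f z * h + dzbar f z * cnj h" for h
  proof -
    interpret linear ?D using d has_derivative_linear by blast
    have "h = Re h *\<^sub>R 1 + Im h *\<^sub>R \<i>" by (simp add: complex_eq_iff)
    then have "?D h = Re h *\<^sub>R ?D 1 + Im h *\<^sub>R ?D \<i>" by (metis add scale)
    then show ?thesis
      unfolding dz_def dzbar_def by (simp add: complex_eq_iff field_simps)
  qed
  then show ?thesis using d unfolding wirt_def by presburger
qed

lemma has_derivative_cong_open:
  assumes "open S" "z \<in> S" "\<And>w. w \<in> S \<Longrightarrow> f w = g w"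
  shows "(f has_derivative D) (at z) \<longleftrightarrow> (g has_derivative D) (at z)"
  using has_derivative_transform_within_open[of f D z UNIV S g] has_derivative_transform_within_open[of g D z UNIV S f]
    assms by auto

lemma dz_cong:
  assumes "open S" "z \<in> S" "\<And>w. w \<in> S \<Longrightarrow> f w = g w"
  shows "dz f z = dz g z" "dzbar f z = dzbar g z"
proof -
  have "(f has_derivative D) (at z) \<longleftrightarrow> (g has_derivative D) (at z)" for D
    by (rule has_derivative_cong_open[OF assms])
  then have "frechet_derivative f (at z) = frechet_derivative g (at z)"
    unfolding frechet_derivative_def by simp
  then show "dz f z = dz g z" "dzbar f z = dzbar g z" by (auto simp: dz_def dzbar_def)
qed

lemma smooth_on_dz:
  assumes "open S" "smooth_on S f"
  shows "smooth_on S (dz f)" "smooth_on S (dzbar f)"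
proof -
  have "smooth_on S (\<lambda>z. frechet_derivative f (at z) 1)" "smooth_on S (\<lambda>z. frechet_derivative f (at z) \<i>)"
    by (rule smooth_on_frechet[OF assms(2)])+
  then have a: "smooth_on S (\<lambda>z. (1/2) * (frechet_derivative f (at z) 1 + (- \<i>) * frechet_derivative f (at z) \<i>))"
    "smooth_on S (\<lambda>z. (1/2) * (frechet_derivative f (at z) 1 + \<i> * frechet_derivative f (at z) \<i>))"
    by (intro smooth_on_mult smooth_on_add smooth_on_const assms(1); simp)+
  show "smooth_on S (dz f)" "smooth_on S (dzbar f)"
    by (rule smooth_on_cong[OF assms(1) _ a(1)], simp add: dz_def)
      (rule smooth_on_cong[OF assms(1) _ a(2)], simp add: dzbar_def)
qed

lemma wirt_const: "wirt (\<lambda>_. c) 0 0 z"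
  by (simp add: wirt_def)

lemma wirt_add: "wirt f a b z \<Longrightarrow> wirt g c d z \<Longrightarrow> wirt (\<lambda>z. f z + g z) (a + c) (b + d) z"
  unfolding wirt_def by (drule (1) has_derivative_add) (simp add: algebra_simps)

lemma wirt_diff: "wirt f a b z \<Longrightarrow> wirt g c d z \<Longrightarrow> wirt (\<lambda>z. f z - g z) (a - c) (b - d) z"
  unfolding wirt_def by (drule (1) has_derivative_diff) (simp add: algebra_simps)

lemma wirt_minus: "wirt f a b z \<Longrightarrow> wirt (\<lambda>z. - f z) (- a) (- b) z"
  unfolding wirt_def by (drule has_derivative_minus) (simp add: algebra_simps)

lemma wirt_mult: "wirt f a b z \<Longrightarrow> wirt g c d z \<Longrightarrow>
    wirt (\<lambda>z. f z * g z) (a * g z + f z * c) (b * g z + f z * d) z"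
  unfolding wirt_def by (drule (1) has_derivative_mult) (simp add: algebra_simps)

lemma wirt_power2: "wirt f a b z \<Longrightarrow> wirt (\<lambda>z. (f z)\<^sup>2) (2 * f z * a) (2 * f z * b) z"
  using wirt_mult[of f a b z f a b] by (simp add: power2_eq_square algebra_simps)

lemma wirt_cmult: "wirt f a b z \<Longrightarrow> wirt (\<lambda>z. c * f z) (c * a) (c * b) z"
  using wirt_mult[OF wirt_const, of f a b z c] by simp

lemma wirt_cnj: "wirt f a b z \<Longrightarrow> wirt (\<lambda>z. cnj (f z)) (cnj b) (cnj a) z"
  unfolding wirt_def by (drule has_derivative_cnj) (simp add: algebra_simps)

lemma wirt_holomorphic_comp:
  assumes "wirt f a b z" "(\<phi> has_field_derivative d) (at (f z))"
  shows "wirt (\<lambda>z. \<phi> (f z)) (d * a) (d * b) z"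
  using has_derivative_compose[OF assms(1)[unfolded wirt_def] assms(2)[unfolded has_field_derivative_def]]
  unfolding wirt_def by (simp add: algebra_simps)

lemma wirt_exp: "wirt f a b z \<Longrightarrow> wirt (\<lambda>z. exp (f z)) (exp (f z) * a) (exp (f z) * b) z"
  by (rule wirt_holomorphic_comp) (auto intro: derivative_eq_intros)

lemma wirt_holomorphic: "(f has_field_derivative d) (at z) \<Longrightarrow> wirt f d 0 z"
  by (simp add: wirt_def has_field_derivative_def)

lemma wirt_unique: "wirt f a b z \<Longrightarrow> wirt f c d z \<Longrightarrow> a = c \<and> b = d"
  using wirt_dz wirt_dzbar by metis

lemma wirt_sum:
  assumes "\<And>i. i \<in> I \<Longrightarrow> wirt (f i) (a i) (b i) z"
  shows "wirt (\<lambda>z. \<Sum>i\<in>I. f i z) (\<Sum>i\<in>I. a i) (\<Sum>i\<in>I. b i) z"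
  using assms
  by (induction I rule: infinite_finite_induct) (auto intro!: wirt_add wirt_const)

text \<open>The hypothesis says that the real differential is multiplication by \<open>d z\<close>,
  which is the Cauchy-Riemann condition.\<close>

lemma wirt_antiholo_zero_imp_holomorphic:
  assumes "open S" "\<And>z. z \<in> S \<Longrightarrow> wirt f (d z) 0 z"
  shows "f holomorphic_on S"
proof -
  have "(f has_field_derivative d z) (at z)" if "z \<in> S" for z
    using assms(2)[OF that] by (simp add: wirt_def has_field_derivative_def)
  then show ?thesis using assms(1) by (meson field_differentiable_def holomorphic_on_open)
qed

section \<open>Equality of mixed partial derivatives\<close>

lemma MVT_slice:
  fixes f :: "complex \<Rightarrow> real"
  assumes "0 < h" "\<And>s. 0 \<le> s \<Longrightarrow> s \<le> h \<Longrightarrow> (f has_derivative D (z + of_real s * c)) (at (z + of_real s * c))"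
  obtains \<xi> where "0 < \<xi>" "\<xi> < h" "f (z + of_real h * c) - f z = h * D (z + of_real \<xi> * c) c"
proof -
  have d: "((\<lambda>s. f (z + of_real s * c)) has_real_derivative D (z + of_real s * c) c) (at s)"
    if "0 \<le> s" "s \<le> h" for s
  proof -
    have a: "((\<lambda>s::real. z + of_real s * c) has_derivative (\<lambda>t. of_real t * c)) (at s)"
      by (auto intro!: derivative_eq_intros)
    have "linear (D (z + of_real s * c))"
      using assms(2)[OF that] has_derivative_linear by blast
    then have "D (z + of_real s * c) (of_real t * c) = D (z + of_real s * c) c * t" for t
      using linear_scale[of "D (z + of_real s * c)" t c] by (simp add: scaleR_conv_of_real)
    then show ?thesis
      using has_derivative_compose[OF a assms(2)[OF that]] by (simp add: has_field_derivative_def mult_commute_abs)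
  qed
  then obtain \<xi> where "0 < \<xi>" "\<xi> < h"
      "f (z + of_real h * c) - f (z + of_real 0 * c) = (h - 0) * D (z + of_real \<xi> * c) c"
    using MVT2[OF assms(1) d] by auto
  then show thesis using that by simp
qed

text \<open>The second difference over a small parallelogram is evaluated by two mean value
  theorems, first in direction \<open>c\<close>, then in direction \<open>e\<close>. Exchanging the
  directions leaves the second difference unchanged but produces the other mixed derivative.\<close>

lemma mixed_difference:
  fixes f :: "complex \<Rightarrow> real"
  assumes f: "\<And>w. w \<in> ball z r \<Longrightarrow> (f has_derivative D w) (at w)"
    and g: "\<And>w. w \<in> ball z r \<Longrightarrow> ((\<lambda>w. D w c) has_derivative E w) (at w)"
    and h: "0 < h" "2 * h < r" and c: "norm c = 1" "norm e = 1"
  obtains w where "dist z w < r" "dist z w \<le> 2 * h"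
    "f (z + of_real h * c + of_real h * e) - f (z + of_real h * c) - f (z + of_real h * e) + f z = h * h * E w e"
proof -
  let ?F = "\<lambda>w. f (w + of_real h * e) - f w"
  have B: "dist z (z + of_real s * c + of_real t * e) \<le> 2 * h"
    if "0 \<le> s" "s \<le> h" "0 \<le> t" "t \<le> h" for s t
  proof -
    have "norm (of_real s * c + of_real t * e) \<le> s + t"
      using norm_triangle_ineq[of "of_real s * c" "of_real t * e"] that c by (simp add: norm_mult)
    then show ?thesis using that by (simp add: dist_norm norm_minus_commute algebra_simps)
  qed
  have dF: "(?F has_derivative (\<lambda>k. D (w + of_real h * e) k - D w k)) (at w)"
    if "w = z + of_real s * c" "0 \<le> s" "s \<le> h" for w s
  proof -
    have a: "((\<lambda>w. w + of_real h * e) has_derivative (\<lambda>k. k)) (at w)"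
      by (auto intro!: derivative_eq_intros)
    have 1: "(f has_derivative D (w + of_real h * e)) (at (w + of_real h * e))"
      using f[of "w + of_real h * e"] B[of s h] that h by auto
    have 2: "(f has_derivative D w) (at w)"
      using f[of w] B[of s 0] that h by auto
    show ?thesis by (rule has_derivative_diff[OF has_derivative_compose[OF a 1] 2])
  qed
  obtain \<xi> where \<xi>: "0 < \<xi>" "\<xi> < h"
    "?F (z + of_real h * c) - ?F z = h * (D (z + of_real \<xi> * c + of_real h * e) c - D (z + of_real \<xi> * c) c)"
    by (rule MVT_slice[of h ?F "\<lambda>w k. D (w + of_real h * e) k - D w k" z c, OF h(1) dF[OF refl]])
  have dG: "((\<lambda>w. D w c) has_derivative E (z + of_real \<xi> * c + of_real s * e)) (at (z + of_real \<xi> * c + of_real s * e))"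
    if "0 \<le> s" "s \<le> h" for s
    using g[of "z + of_real \<xi> * c + of_real s * e"] B[of \<xi> s] that h \<xi> by auto
  obtain \<eta> where \<eta>: "0 < \<eta>" "\<eta> < h"
    "D (z + of_real \<xi> * c + of_real h * e) c - D (z + of_real \<xi> * c) c = h * E (z + of_real \<xi> * c + of_real \<eta> * e) e"
    by (rule MVT_slice[of h "\<lambda>w. D w c" E "z + of_real \<xi> * c" e, OF h(1) dG])
  show thesis
  proof (rule that[of "z + of_real \<xi> * c + of_real \<eta> * e"])
    show "dist z (z + of_real \<xi> * c + of_real \<eta> * e) \<le> 2 * h" using B[of \<xi> \<eta>] \<xi> \<eta> by simp
    then show "dist z (z + of_real \<xi> * c + of_real \<eta> * e) < r" using h by simp
    show "f (z + of_real h * c + of_real h * e) - f (z + of_real h * c) - f (z + of_real h * e) + f z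
        = h * h * E (z + of_real \<xi> * c + of_real \<eta> * e) e"
      using \<xi>(3) \<eta>(3) by (simp add: algebra_simps)
  qed
qed

text \<open>Schwarz's theorem: one second difference is \<open>h * h\<close> times either mixed
  derivative at some nearby point, so by continuity the two cannot differ at
  \<open>z\<close>.\<close>

lemma mixed_partials_real:
  fixes f :: "complex \<Rightarrow> real"
  assumes S: "open S" "z \<in> S" and f: "smooth_on S f"
  defines "fx \<equiv> (\<lambda>w. frechet_derivative f (at w) 1)" and "fy \<equiv> (\<lambda>w. frechet_derivative f (at w) \<i>)"
  shows "frechet_derivative fx (at z) \<i> = frechet_derivative fy (at z) 1"
proof -
  have sx: "smooth_on S fx" and sy: "smooth_on S fy"
    unfolding fx_def fy_def by (rule smooth_on_frechet[OF f])+
  have df: "(f has_derivative frechet_derivative f (at w)) (at w)"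
    and dx: "(fx has_derivative frechet_derivative fx (at w)) (at w)"
    and dy: "(fy has_derivative frechet_derivative fy (at w)) (at w)" if "w \<in> S" for w
    using that by (rule f[THEN smooth_on_has_derivative] sx[THEN smooth_on_has_derivative]
        sy[THEN smooth_on_has_derivative])+
  let ?a = "\<lambda>w. frechet_derivative fx (at w) \<i>" and ?b = "\<lambda>w. frechet_derivative fy (at w) 1"
  have ca: "continuous_on S ?a" and cb: "continuous_on S ?b"
    using sx[THEN smooth_on_frechet(2)] sy[THEN smooth_on_frechet(1)] unfolding smooth_on_def
    by (metis Ck_on.simps(1))+
  obtain r where r: "r > 0" "ball z r \<subseteq> S" using S openE by blast
  show ?thesis
  proof (rule ccontr)
    assume ne: "?a z \<noteq> ?b z"
    define \<epsilon> where "\<epsilon> = \<bar>?a z - ?b z\<bar> / 2"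
    have \<epsilon>: "\<epsilon> > 0" using ne by (simp add: \<epsilon>_def)
    obtain d1 where d1: "d1 > 0" "\<And>w. w \<in> S \<Longrightarrow> dist w z < d1 \<Longrightarrow> dist (?a w) (?a z) < \<epsilon>"
      using ca S(2) \<epsilon> unfolding continuous_on_iff by blast
    obtain d2 where d2: "d2 > 0" "\<And>w. w \<in> S \<Longrightarrow> dist w z < d2 \<Longrightarrow> dist (?b w) (?b z) < \<epsilon>"
      using cb S(2) \<epsilon> unfolding continuous_on_iff by blast
    \<comment> \<open>A third of the smallest radius, because the evaluation points may lie at
      distance \<open>2 * h\<close> from \<open>z\<close>.\<close>
    define h where "h = min r (min d1 d2) / 3"
    have h: "0 < h" "2 * h < r" "2 * h < d1" "2 * h < d2" using r d1 d2 by (auto simp: h_def)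
    obtain w1 where w1: "dist z w1 < r" "dist z w1 \<le> 2 * h"
      "f (z + of_real h * 1 + of_real h * \<i>) - f (z + of_real h * 1) - f (z + of_real h * \<i>) + f z = h * h * ?a w1"
      by (rule mixed_difference[of z r f "\<lambda>w. frechet_derivative f (at w)" 1 "\<lambda>w. frechet_derivative fx (at w)" h \<i>])
        (use r h df dx in \<open>auto simp: fx_def[symmetric] mem_ball[symmetric] simp del: mem_ball\<close>)
    obtain w2 where w2: "dist z w2 < r" "dist z w2 \<le> 2 * h"
      "f (z + of_real h * \<i> + of_real h * 1) - f (z + of_real h * \<i>) - f (z + of_real h * 1) + f z = h * h * ?b w2"
      by (rule mixed_difference[of z r f "\<lambda>w. frechet_derivative f (at w)" \<i> "\<lambda>w. frechet_derivative fy (at w)" h 1])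
        (use r h df dy in \<open>auto simp: fy_def[symmetric] mem_ball[symmetric] simp del: mem_ball\<close>)
    have "h * h * ?a w1 = h * h * ?b w2" using w1(3) w2(3) by (simp add: algebra_simps)
    then have "?a w1 = ?b w2" using h by simp
    moreover have "dist (?a w1) (?a z) < \<epsilon>" "dist (?b w2) (?b z) < \<epsilon>"
      using d1(2)[of w1] d2(2)[of w2] w1 w2 r h by (auto simp: dist_commute subset_eq)
    ultimately have "\<bar>?a z - ?b z\<bar> < 2 * \<epsilon>" by (simp add: dist_real_def)
    then show False by (simp add: \<epsilon>_def)
  qed
qed

lemma frechet_derivative_bounded_linear:
  assumes "bounded_linear T" "f differentiable at z"
  shows "frechet_derivative (\<lambda>w. T (f w)) (at z) = (\<lambda>h. T (frechet_derivative f (at z) h))"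
  by (rule frechet_derivative_eqI, rule bounded_linear.has_derivative[OF assms(1)])
    (rule assms(2)[unfolded frechet_derivative_works])

text \<open>Reduction to the real case through the bounded linear maps \<open>Re\<close> and
  \<open>Im\<close>.\<close>

lemma mixed_partials:
  fixes f :: "complex \<Rightarrow> complex"
  assumes S: "open S" "z \<in> S" and f: "smooth_on S f"
  defines "fx \<equiv> (\<lambda>w. frechet_derivative f (at w) 1)" and "fy \<equiv> (\<lambda>w. frechet_derivative f (at w) \<i>)"
  shows "frechet_derivative fx (at z) \<i> = frechet_derivative fy (at z) 1"
proof -
  have sx: "smooth_on S fx" and sy: "smooth_on S fy"
    unfolding fx_def fy_def by (rule smooth_on_frechet[OF f])+
  have diff: "f differentiable at w" "fx differentiable at w" "fy differentiable at w" if "w \<in> S" for w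
    using f[THEN smooth_on_has_derivative, OF that] sx[THEN smooth_on_has_derivative, OF that]
      sy[THEN smooth_on_has_derivative, OF that] by (auto simp only: differentiable_def)
  have *: "T (frechet_derivative fx (at z) \<i>) = T (frechet_derivative fy (at z) 1)"
    if T: "bounded_linear (T :: complex \<Rightarrow> real)" for T
  proof -
    have 1: "frechet_derivative (\<lambda>w. T (f w)) (at w) h = T (frechet_derivative f (at w) h)" if "w \<in> S" for w h
      using frechet_derivative_bounded_linear[OF T diff(1)[OF that]] by simp
    have c: "frechet_derivative g (at z) = frechet_derivative g' (at z)"
      if "\<And>w. w \<in> S \<Longrightarrow> g w = g' w" for g g' :: "complex \<Rightarrow> real"
    proof -
      have "(g has_derivative D) (at z) \<longleftrightarrow> (g' has_derivative D) (at z)" for D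
        by (rule has_derivative_cong_open[OF S that])
      then show ?thesis unfolding frechet_derivative_def by simp
    qed
    have "T (frechet_derivative fx (at z) \<i>) = frechet_derivative (\<lambda>w. T (fx w)) (at z) \<i>"
      using frechet_derivative_bounded_linear[OF T diff(2)[OF S(2)]] by simp
    also have "\<dots> = frechet_derivative (\<lambda>w. frechet_derivative (\<lambda>w. T (f w)) (at w) 1) (at z) \<i>"
      by (rule fun_cong[OF c]) (simp only: 1 fx_def)
    also have "\<dots> = frechet_derivative (\<lambda>w. frechet_derivative (\<lambda>w. T (f w)) (at w) \<i>) (at z) 1"
      by (rule mixed_partials_real[OF S smooth_on_bounded_linear[OF T S(1) f]])
    also have "\<dots> = frechet_derivative (\<lambda>w. T (fy w)) (at z) 1"
      by (rule fun_cong[OF c]) (simp only: 1 fy_def)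
    also have "\<dots> = T (frechet_derivative fy (at z) 1)"
      using frechet_derivative_bounded_linear[OF T diff(3)[OF S(2)]] by simp
    finally show ?thesis .
  qed
  show ?thesis
    using *[OF bounded_linear_Re] *[OF bounded_linear_Im] by (simp add: complex_eq_iff)
qed

lemma dz_dzbar_commute:
  assumes "open S" "smooth_on S f" "z \<in> S"
  shows "dz (dzbar f) z = dzbar (dz f) z"
proof -
  let ?fx = "\<lambda>w. frechet_derivative f (at w) 1" and ?fy = "\<lambda>w. frechet_derivative f (at w) \<i>"
  have s: "smooth_on S ?fx" "smooth_on S ?fy"
    by (rule smooth_on_frechet[OF assms(2)])+
  have d: "(?fx has_derivative frechet_derivative ?fx (at z)) (at z)"
      "(?fy has_derivative frechet_derivative ?fy (at z)) (at z)"
    by (rule s[THEN smooth_on_has_derivative, OF assms(3)])+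
  have "(dzbar f has_derivative (\<lambda>h. (frechet_derivative ?fx (at z) h + \<i> * frechet_derivative ?fy (at z) h) / 2)) (at z)"
    "(dz f has_derivative (\<lambda>h. (frechet_derivative ?fx (at z) h - \<i> * frechet_derivative ?fy (at z) h) / 2)) (at z)"
    unfolding dz_def[abs_def] dzbar_def[abs_def]
    by (auto intro!: derivative_eq_intros d)
  from this[THEN frechet_derivative_eqI] show ?thesis
    unfolding dz_def[of "dzbar f"] dzbar_def[of "dz f"]
    using mixed_partials[OF assms(1,3,2)] by (simp add: field_simps)
qed

lemma dzbar_of_real:
  assumes "smooth_on S (\<lambda>z. complex_of_real (u z))" "z \<in> S"
  shows "dzbar (\<lambda>z. complex_of_real (u z)) z = cnj (dz (\<lambda>z. complex_of_real (u z)) z)"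
  using wirt_dzbar[OF wirt_cnj[OF smooth_on_wirt[OF assms]]] by simp

section \<open>Linear equations of third order\<close>

text \<open>A maximum argument in place of Gronwall's inequality: on a disc with
  \<open>c * \<delta>\<close> at most \<open>1/2\<close>, the mean value inequality bounds the
  maximum of the sum of norms by half of itself.\<close>

lemma zero_propagation_local:
  fixes X :: "'i \<Rightarrow> complex \<Rightarrow> complex"
  assumes I: "finite I" and r: "r > 0" "K \<ge> 0"
    and der: "\<And>i w. i \<in> I \<Longrightarrow> w \<in> cball z r \<Longrightarrow> (X i has_derivative X' i w) (at w)"
    and bnd: "\<And>i w h. i \<in> I \<Longrightarrow> w \<in> cball z r \<Longrightarrow> norm (X' i w h) \<le> K * (\<Sum>j\<in>I. norm (X j w)) * norm h"
    and 0: "\<And>i. i \<in> I \<Longrightarrow> X i z = 0"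
  shows "\<exists>\<delta>>0. \<forall>w\<in>ball z \<delta>. \<forall>i\<in>I. X i w = 0"
proof -
  define c where "c = real (card I) * K + 1"
  define \<delta> where "\<delta> = min r (1 / (2 * c))"
  have c: "c \<ge> 1" using r by (simp add: c_def)
  have \<delta>: "\<delta> > 0" "\<delta> \<le> r" "c * \<delta> \<le> 1/2"
    using r c by (auto simp: \<delta>_def min_def field_simps)
  let ?S = "\<lambda>w. \<Sum>j\<in>I. norm (X j w)"
  have sub: "cball z \<delta> \<subseteq> cball z r" using \<delta> by auto
  have contX: "continuous_on (cball z \<delta>) (X i)" if "i \<in> I" for i
    using der[OF that] sub by (meson continuous_at_imp_continuous_on has_derivative_continuous subsetD)
  have "continuous_on (cball z \<delta>) ?S"
    by (intro continuous_on_sum continuous_on_norm contX)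
  then obtain w0 where w0: "w0 \<in> cball z \<delta>" "\<And>w. w \<in> cball z \<delta> \<Longrightarrow> ?S w \<le> ?S w0"
    using continuous_attains_sup[OF compact_cball, of z \<delta> ?S] \<delta> by (metis cball_eq_empty linorder_not_less less_le_not_le)
  have M: "0 \<le> ?S w0" by (simp add: sum_nonneg)
  have each: "norm (X i w0) \<le> K * ?S w0 * \<delta>" if i: "i \<in> I" for i
  proof -
    have "norm (X i w0 - X i z) \<le> (K * ?S w0) * norm (w0 - z)"
    proof (rule differentiable_bound[where S = "cball z \<delta>" and f' = "X' i"])
      fix w assume w: "w \<in> cball z \<delta>"
      then have wr: "w \<in> cball z r" using sub by blast
      show "(X i has_derivative X' i w) (at w within cball z \<delta>)"
        using der[OF i wr] has_derivative_at_withinI by blast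
      show "onorm (X' i w) \<le> K * ?S w0"
      proof (rule onorm_bound)
        show "0 \<le> K * ?S w0" using r M by simp
        fix h
        have "norm (X' i w h) \<le> K * ?S w * norm h" by (rule bnd[OF i wr])
        also have "\<dots> \<le> K * ?S w0 * norm h"
          by (intro mult_right_mono mult_left_mono w0(2)[OF w] r(2)) simp
        finally show "norm (X' i w h) \<le> K * ?S w0 * norm h" .
      qed
    qed (use w0 \<delta> in auto)
    also have "\<dots> \<le> K * ?S w0 * \<delta>"
      using w0(1) M r by (intro mult_left_mono) (auto simp: dist_norm norm_minus_commute)
    finally show ?thesis using 0[OF i] by simp
  qed
  have "?S w0 \<le> (\<Sum>j\<in>I. K * ?S w0 * \<delta>)" by (rule sum_mono) (rule each)
  also have "\<dots> = (real (card I) * K) * \<delta> * ?S w0" by simp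
  also have "\<dots> \<le> c * \<delta> * ?S w0"
    using M \<delta>(1) by (intro mult_right_mono) (auto simp: c_def)
  also have "\<dots> \<le> 1/2 * ?S w0" by (rule mult_right_mono[OF \<delta>(3) M])
  finally have S0: "?S w0 = 0" using M by simp
  have "X i w = 0" if "w \<in> ball z \<delta>" "i \<in> I" for w i
  proof -
    have "?S w \<le> 0" using w0(2)[of w] that S0 by auto
    moreover have "norm (X i w) \<le> ?S w" by (rule member_le_sum[OF that(2)]) (auto simp: I)
    ultimately show ?thesis by (metis norm_le_zero_iff order_trans)
  qed
  then show ?thesis using \<delta>(1) by blast
qed

text \<open>The common zero set is closed by continuity and open by the local lemma, with
  \<open>K\<close> bounding \<open>C\<close> on a small disc. Real derivatives are used because the
  system for \<open>defect\<close> is not holomorphic.\<close>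

lemma zero_propagation:
  fixes X :: "'i \<Rightarrow> complex \<Rightarrow> complex"
  assumes D: "open D" "connected D" and I: "finite I"
    and der: "\<And>i z. i \<in> I \<Longrightarrow> z \<in> D \<Longrightarrow> (X i has_derivative X' i z) (at z)"
    and bnd: "\<And>i z h. i \<in> I \<Longrightarrow> z \<in> D \<Longrightarrow> norm (X' i z h) \<le> C z * (\<Sum>j\<in>I. norm (X j z)) * norm h"
    and C: "continuous_on D C"
    and z0: "z0 \<in> D" "\<And>i. i \<in> I \<Longrightarrow> X i z0 = 0"
    and i: "i \<in> I" and z: "z \<in> D"
  shows "X i z = 0"
proof -
  define Z where "Z = {z \<in> D. \<forall>i\<in>I. X i z = 0}"
  have contX: "continuous_on D (X i)" if "i \<in> I" for i
    using der[OF that] by (meson continuous_at_imp_continuous_on has_derivative_continuous)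
  have "open Z"
  proof (rule openI)
    fix w assume w: "w \<in> Z"
    then obtain r where r: "r > 0" "cball w r \<subseteq> D" using D(1) open_contains_cball unfolding Z_def by blast
    have "compact (C ` cball w r)"
      by (rule compact_continuous_image[OF continuous_on_subset[OF C r(2)] compact_cball])
    then obtain K where K: "\<And>u. u \<in> cball w r \<Longrightarrow> \<bar>C u\<bar> \<le> K"
      using compact_imp_bounded bounded_iff by (metis imageI real_norm_def)
    have K0: "0 \<le> K" using K[of w] r by auto
    have "\<exists>\<delta>>0. \<forall>u\<in>ball w \<delta>. \<forall>i\<in>I. X i u = 0"
    proof (rule zero_propagation_local[OF I r(1) K0])
      fix i u assume iu: "i \<in> I" "u \<in> cball w r"
      then have u: "u \<in> D" using r by blast
      show "(X i has_derivative X' i u) (at u)" by (rule der[OF iu(1) u])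
      fix h
      have "norm (X' i u h) \<le> C u * (\<Sum>j\<in>I. norm (X j u)) * norm h" by (rule bnd[OF iu(1) u])
      also have "\<dots> \<le> K * (\<Sum>j\<in>I. norm (X j u)) * norm h"
        using K[OF iu(2)] by (intro mult_right_mono) (auto intro: sum_nonneg)
      finally show "norm (X' i u h) \<le> K * (\<Sum>j\<in>I. norm (X j u)) * norm h" .
    qed (use w in \<open>auto simp: Z_def\<close>)
    then obtain \<delta> where \<delta>: "\<delta> > 0" "\<forall>u\<in>ball w \<delta>. \<forall>i\<in>I. X i u = 0" by blast
    show "\<exists>e>0. ball w e \<subseteq> Z"
      using \<delta> r by (intro exI[of _ "min \<delta> r"]) (auto simp: Z_def subset_iff)
  qed
  then have o: "openin (top_of_set D) Z"
    by (metis (no_types, lifting) Z_def mem_Collect_eq open_subset subsetI)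
  \<comment> \<open>For empty \<open>I\<close> the intersection would be the whole plane instead of
    \<open>D\<close>, hence the case distinction.\<close>
  have eq: "Z = (if I = {} then D else (\<Inter>i\<in>I. {z \<in> D. X i z = 0}))" by (auto simp: Z_def)
  have "closedin (top_of_set D) Z"
    unfolding eq using continuous_closedin_preimage_constant[OF contX] by auto
  then have "Z = {} \<or> Z = D" using D(2) o unfolding connected_clopen by blast
  moreover have "z0 \<in> Z" using z0 by (auto simp: Z_def)
  ultimately show ?thesis using i z unfolding Z_def by blast
qed

section \<open>Third-order linear equations and the jets of their solutions\<close>

definition ode3 :: "complex set \<Rightarrow> (complex \<Rightarrow> complex) \<Rightarrow> (complex \<Rightarrow> complex) \<Rightarrow> (complex \<Rightarrow> complex) \<Rightarrow> bool" where
  "ode3 D p q y \<longleftrightarrow> y holomorphic_on D \<and>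
     (\<forall>z\<in>D. deriv (deriv (deriv y)) z + p z * deriv y z + q z * y z = 0)"

definition jet :: "(complex \<Rightarrow> complex) \<Rightarrow> complex \<Rightarrow> complex ^ 3" where
  "jet y z = vector [y z, deriv y z, deriv (deriv y) z]"

lemma jet_nth [simp]: "jet y z $ 1 = y z" "jet y z $ 2 = deriv y z" "jet y z $ 3 = deriv (deriv y) z"
  by (simp_all add: jet_def)

lemma vec3_eq_iff: "(x :: 'a ^ 3) = y \<longleftrightarrow> x $ 1 = y $ 1 \<and> x $ 2 = y $ 2 \<and> x $ 3 = y $ 3"
  by (simp add: vec_eq_iff forall_3)

lemma holomorphic_derivs:
  assumes "open D" "y holomorphic_on D" "z \<in> D"
  shows "(y has_field_derivative deriv y z) (at z)"
    "(deriv y has_field_derivative deriv (deriv y) z) (at z)"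
    "(deriv (deriv y) has_field_derivative deriv (deriv (deriv y)) z) (at z)"
  using assms by (auto intro!: holomorphic_derivI[of _ D] holomorphic_deriv)

lemma ode3_derivs:
  assumes "open D" "ode3 D p q y" "z \<in> D"
  shows "(y has_field_derivative deriv y z) (at z)"
    "(deriv y has_field_derivative deriv (deriv y) z) (at z)"
    "(deriv (deriv y) has_field_derivative - (p z * deriv y z + q z * y z)) (at z)"
proof -
  have y: "y holomorphic_on D" using assms(2) by (simp add: ode3_def)
  show "(y has_field_derivative deriv y z) (at z)"
    "(deriv y has_field_derivative deriv (deriv y) z) (at z)"
    by (rule holomorphic_derivs[OF assms(1) y assms(3)])+
  have "deriv (deriv (deriv y)) z + p z * deriv y z + q z * y z = 0"
    using assms(2,3) by (simp add: ode3_def)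
  then have "deriv (deriv (deriv y)) z = - (p z * deriv y z + q z * y z)"
    by (simp only: eq_neg_iff_add_eq_0 add.assoc)
  then show "(deriv (deriv y) has_field_derivative - (p z * deriv y z + q z * y z)) (at z)"
    using holomorphic_derivs(3)[OF assms(1) y assms(3)] by simp
qed

lemma deriv_cong_open:
  assumes "open D" "z \<in> D" "\<And>w. w \<in> D \<Longrightarrow> f w = g w"
  shows "deriv f z = deriv g z"
  by (rule deriv_cong_ev) (use assms in \<open>auto simp: eventually_nhds\<close>)

lemma jet_cong_open:
  assumes "open D" "z \<in> D" "\<And>w. w \<in> D \<Longrightarrow> f w = g w"
  shows "jet f z = jet g z"
proof -
  have 1: "deriv f w = deriv g w" if "w \<in> D" for w by (rule deriv_cong_open[OF assms(1) that assms(3)])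
  have 2: "deriv (deriv f) z = deriv (deriv g) z" by (rule deriv_cong_open[OF assms(1,2) 1])
  show ?thesis using 1[OF assms(2)] 2 assms(2,3) by (simp add: vec3_eq_iff)
qed

lemma ode3I:
  assumes "open D"
    and "\<And>z. z \<in> D \<Longrightarrow> (y has_field_derivative y1 z) (at z)"
    and "\<And>z. z \<in> D \<Longrightarrow> (y1 has_field_derivative y2 z) (at z)"
    and "\<And>z. z \<in> D \<Longrightarrow> (y2 has_field_derivative - (p z * y1 z + q z * y z)) (at z)"
  shows "ode3 D p q y" "\<And>z. z \<in> D \<Longrightarrow> jet y z = vector [y z, y1 z, y2 z]"
proof -
  have 1: "deriv y z = y1 z" if "z \<in> D" for z by (rule DERIV_imp_deriv[OF assms(2)[OF that]])
  have 2: "deriv (deriv y) z = y2 z" if "z \<in> D" for z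
    using deriv_cong_open[OF assms(1) that 1] DERIV_imp_deriv[OF assms(3)[OF that]] by simp
  have 3: "deriv (deriv (deriv y)) z = - (p z * y1 z + q z * y z)" if "z \<in> D" for z
    using deriv_cong_open[OF assms(1) that 2] DERIV_imp_deriv[OF assms(4)[OF that]] by simp
  show "ode3 D p q y"
    unfolding ode3_def using assms(1,2) 1 3
    by (auto simp: holomorphic_on_open)
  show "jet y z = vector [y z, y1 z, y2 z]" if "z \<in> D" for z
    using 1[OF that] 2[OF that] by (simp add: vec3_eq_iff)
qed

lemma ode3_sum:
  fixes Y :: "'i \<Rightarrow> complex \<Rightarrow> complex"
  assumes "open D" "\<And>i. i \<in> I \<Longrightarrow> ode3 D p q (Y i)"
  shows "ode3 D p q (\<lambda>z. \<Sum>i\<in>I. c i * Y i z)"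
    "z \<in> D \<Longrightarrow> jet (\<lambda>z. \<Sum>i\<in>I. c i * Y i z) z = (\<Sum>i\<in>I. c i *s jet (Y i) z)"
proof -
  note d = ode3_derivs[OF assms(1) assms(2)]
  have A: "((\<lambda>z. \<Sum>i\<in>I. c i * Y i z) has_field_derivative (\<Sum>i\<in>I. c i * deriv (Y i) z)) (at z)" if "z \<in> D" for z
    by (intro DERIV_sum DERIV_cmult d(1)[OF _ that])
  have B: "((\<lambda>z. \<Sum>i\<in>I. c i * deriv (Y i) z) has_field_derivative (\<Sum>i\<in>I. c i * deriv (deriv (Y i)) z)) (at z)" if "z \<in> D" for z
    by (intro DERIV_sum DERIV_cmult d(2)[OF _ that])
  have C: "((\<lambda>z. \<Sum>i\<in>I. c i * deriv (deriv (Y i)) z) has_field_derivative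
      - (p z * (\<Sum>i\<in>I. c i * deriv (Y i) z) + q z * (\<Sum>i\<in>I. c i * Y i z))) (at z)" if "z \<in> D" for z
  proof -
    have "((\<lambda>z. \<Sum>i\<in>I. c i * deriv (deriv (Y i)) z) has_field_derivative
      (\<Sum>i\<in>I. c i * - (p z * deriv (Y i) z + q z * Y i z))) (at z)"
      by (intro DERIV_sum DERIV_cmult d(3)[OF _ that])
    moreover have "(\<Sum>i\<in>I. c i * - (p z * deriv (Y i) z + q z * Y i z)) =
      - (p z * (\<Sum>i\<in>I. c i * deriv (Y i) z) + q z * (\<Sum>i\<in>I. c i * Y i z))"
      by (simp add: sum_distrib_left sum.distrib sum_subtractf sum_negf algebra_simps)
    ultimately show ?thesis by simp
  qed
  show "ode3 D p q (\<lambda>z. \<Sum>i\<in>I. c i * Y i z)" by (rule ode3I(1)[OF assms(1) A B C])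
  show "jet (\<lambda>z. \<Sum>i\<in>I. c i * Y i z) z = (\<Sum>i\<in>I. c i *s jet (Y i) z)" if "z \<in> D"
    using ode3I(2)[OF assms(1) A B C that] by (simp add: vec3_eq_iff)
qed

lemma ode3_diff:
  assumes "open D" "ode3 D p q y" "ode3 D p q w"
  shows "ode3 D p q (\<lambda>z. y z - c * w z)" "z \<in> D \<Longrightarrow> jet (\<lambda>z. y z - c * w z) z = jet y z - c *s jet w z"
proof -
  let ?Y = "\<lambda>b. if b then y else w" and ?c = "\<lambda>b. if b then 1 else - c"
  have e: "(\<lambda>z. \<Sum>b\<in>UNIV. ?c b * ?Y b z) = (\<lambda>z. y z - c * w z)" by (auto simp: UNIV_bool)
  have o: "ode3 D p q (?Y b)" for b using assms by simp
  show "ode3 D p q (\<lambda>z. y z - c * w z)"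
    using ode3_sum(1)[where Y="?Y" and I=UNIV and c="?c", OF assms(1) o] unfolding e .
  show "z \<in> D \<Longrightarrow> jet (\<lambda>z. y z - c * w z) z = jet y z - c *s jet w z"
    using ode3_sum(2)[where Y="?Y" and I=UNIV and c="?c" and z=z, OF assms(1) o] unfolding e by (simp add: UNIV_bool vec3_eq_iff)
qed

lemma ode3_subset:
  assumes "ode3 D p q y" "open E" "E \<subseteq> D"
  shows "ode3 E p q y"
  using assms unfolding ode3_def by (auto intro: holomorphic_on_subset)

lemma ode3_cong_coeff:
  assumes "\<And>z. z \<in> D \<Longrightarrow> p z = p' z" "\<And>z. z \<in> D \<Longrightarrow> q z = q' z" "ode3 D p q y"
  shows "ode3 D p' q' y"
  using assms unfolding ode3_def by auto

text \<open>The triple of \<open>y\<close> and its first two derivatives solves a linear first-order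
  system whose coefficients are bounded by \<open>1 + norm (p z) + norm (q z)\<close>, so
  \<open>zero_propagation\<close> applies.\<close>

lemma ode3_zero:
  assumes D: "open D" "connected D" and pq: "continuous_on D p" "continuous_on D q"
    and y: "ode3 D p q y" and z0: "z0 \<in> D" "jet y z0 = 0" and z: "z \<in> D"
  shows "y z = 0"
proof -
  define X where "X = (\<lambda>i::nat. if i = 0 then y else if i = 1 then deriv y else deriv (deriv y))"
  define X' where "X' = (\<lambda>(i::nat) z. if i = 0 then (*) (deriv y z) else if i = 1 then (*) (deriv (deriv y) z)
     else (*) (- (p z * deriv y z + q z * y z)))"
  note d = ode3_derivs[OF D(1) y]
  have S: "(\<Sum>j\<in>{0,1,2}. norm (X j z)) = norm (y z) + norm (deriv y z) + norm (deriv (deriv y) z)" for z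
    by (simp add: X_def)
  have "X 0 z = 0"
  proof (rule zero_propagation[OF D, where X = X and i = 0 and z = z and ?z0.0 = z0 and I = "{0,1,2}" and X' = X' and C = "\<lambda>z. 1 + norm (p z) + norm (q z)"])
    fix i :: nat and z assume i: "i \<in> {0,1,2}" and z: "z \<in> D"
    show "(X i has_derivative X' i z) (at z)"
      using i d[OF z] by (auto simp: X_def X'_def has_field_derivative_def)
    fix h
    let ?a = "norm (y z)" and ?b = "norm (deriv y z)" and ?c = "norm (deriv (deriv y) z)"
    have t: "norm (p z * deriv y z + q z * y z) \<le> norm (p z) * ?b + norm (q z) * ?a"
      by (metis norm_mult norm_triangle_ineq)
    have n: "0 \<le> norm (p z) * ?a" "0 \<le> norm (p z) * ?b" "0 \<le> norm (p z) * ?c"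
      "0 \<le> norm (q z) * ?a" "0 \<le> norm (q z) * ?b" "0 \<le> norm (q z) * ?c" by simp_all
    have e: "(1 + norm (p z) + norm (q z)) * (?a + ?b + ?c) = ?a + ?b + ?c + norm (p z) * ?a + norm (p z) * ?b
       + norm (p z) * ?c + norm (q z) * ?a + norm (q z) * ?b + norm (q z) * ?c" by (simp add: algebra_simps)
    have "norm (X' i z h) \<le> (1 + norm (p z) + norm (q z)) * (?a + ?b + ?c) * norm h"
    proof -
      have "i = 0 \<or> i = 1 \<or> i = 2" using i by auto
      then show ?thesis
      proof (elim disjE)
        assume "i = 0" then show ?thesis unfolding e X'_def norm_mult[symmetric]
          using n by (simp add: norm_mult mult_right_mono)
      next
        assume "i = 1" then show ?thesis unfolding e X'_def
          using n by (simp add: norm_mult mult_right_mono)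
      next
        assume i: "i = 2"
        have "norm (p z * deriv y z + q z * y z) \<le> (1 + norm (p z) + norm (q z)) * (?a + ?b + ?c)"
          using t n norm_ge_zero[of "y z"] norm_ge_zero[of "deriv y z"] norm_ge_zero[of "deriv (deriv y) z"]
          unfolding e by linarith
        moreover have "norm (X' i z h) = norm (p z * deriv y z + q z * y z) * norm h"
        proof -
          have "X' i z = (*) (- (p z * deriv y z + q z * y z))"
            using i by (simp add: X'_def del: minus_add_distrib)
          then show ?thesis by (simp only: norm_mult norm_minus_cancel)
        qed
        ultimately show ?thesis by (simp only: mult_right_mono norm_ge_zero)
      qed
    qed
    then show "norm (X' i z h) \<le> (1 + norm (p z) + norm (q z)) * (\<Sum>j\<in>{0,1,2}. norm (X j z)) * norm h"
      unfolding S .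
  next
    show "continuous_on D (\<lambda>z. 1 + norm (p z) + norm (q z))" by (intro continuous_intros pq)
    fix i :: nat assume "i \<in> {0,1,2}"
    then show "X i z0 = 0" using z0(2) by (auto simp: X_def vec3_eq_iff)
  qed (use z0 z in auto)
  then show ?thesis by (simp add: X_def)
qed

lemma ode3_unique:
  assumes D: "open D" "connected D" and pq: "continuous_on D p" "continuous_on D q"
    and y: "ode3 D p q y" "ode3 D p q w" and z0: "z0 \<in> D" "jet y z0 = jet w z0" and z: "z \<in> D"
  shows "y z = w z"
proof -
  have "y z - 1 * w z = 0"
    by (rule ode3_zero[OF D pq ode3_diff(1)[OF D(1) y, of 1] z0(1) _ z])
      (use ode3_diff(2)[OF D(1) y z0(1), of 1] z0(2) in simp)
  then show ?thesis by simp
qed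

section \<open>Existence of solutions on star-shaped domains by Picard iteration\<close>

definition primitive_from :: "complex \<Rightarrow> complex set \<Rightarrow> (complex \<Rightarrow> complex) \<Rightarrow> complex \<Rightarrow> complex" where
  "primitive_from a D f = (SOME F. F a = 0 \<and> (\<forall>z\<in>D. (F has_field_derivative f z) (at z)))"

lemma primitive_from:
  assumes "open D" "a \<in> D" "\<And>z. z \<in> D \<Longrightarrow> closed_segment a z \<subseteq> D" "f holomorphic_on D"
  shows "primitive_from a D f a = 0"
    "z \<in> D \<Longrightarrow> (primitive_from a D f has_field_derivative f z) (at z)"
    "primitive_from a D f holomorphic_on D"
proof -
  have "starlike D" using assms(2,3) unfolding starlike_def by blast
  then obtain g where g: "\<forall>z\<in>D. (g has_field_derivative f z) (at z)"
    using holomorphic_starlike_primitive[of D f "{}"] assms(1,4)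
    by (metis Diff_empty finite.emptyI holomorphic_on_imp_continuous_on holomorphic_on_imp_differentiable_at)
  have "\<forall>z\<in>D. ((\<lambda>z. g z - g a) has_field_derivative f z) (at z)"
    using g by (auto intro!: derivative_eq_intros)
  then have "\<exists>F. F a = 0 \<and> (\<forall>z\<in>D. (F has_field_derivative f z) (at z))"
    by (intro exI[of _ "\<lambda>z. g z - g a"]) simp
  from someI_ex[OF this] show "primitive_from a D f a = 0"
    and d: "\<And>z. z \<in> D \<Longrightarrow> (primitive_from a D f has_field_derivative f z) (at z)"
    by (auto simp: primitive_from_def)
  then show "primitive_from a D f holomorphic_on D" by (auto simp: holomorphic_on_open[OF assms(1)])
qed

text \<open>Integrating a bound of order \<open>n\<close> along the segment gains one power of the
  distance and the divisor \<open>n + 1\<close>; iteration produces the factorials behind the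
  convergence of the Picard series.\<close>

lemma segment_bound:
  assumes "\<And>w. w \<in> closed_segment a z \<Longrightarrow> (F has_field_derivative f w) (at w)" "F a = 0"
    and "\<And>w. w \<in> closed_segment a z \<Longrightarrow> norm (f w) \<le> A * norm (w - a) ^ n"
  shows "norm (F z) \<le> A * norm (z - a) ^ Suc n / real (Suc n)"
proof -
  let ?d = "norm (z - a)"
  let ?\<phi> = "\<lambda>t::real. A * ?d ^ Suc n * (t ^ Suc n / real (Suc n))"
  have seg: "a + of_real t * (z - a) \<in> closed_segment a z" if "0 \<le> t" "t \<le> 1" for t :: real
    using that unfolding closed_segment_def by (auto simp: algebra_simps scaleR_conv_of_real intro!: exI[of _ t])
  have d: "((\<lambda>t. F (a + of_real t * (z - a))) has_vector_derivative f (a + of_real t * (z - a)) * (z - a)) (at t)"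
    if "0 \<le> t" "t \<le> 1" for t :: real
  proof -
    have "((\<lambda>t::real. a + of_real t * (z - a)) has_vector_derivative (z - a)) (at t)"
      by (auto intro!: derivative_eq_intros simp: has_vector_derivative_def scaleR_conv_of_real)
    from field_vector_diff_chain_at[OF this assms(1)[OF seg[OF that]]]
    show ?thesis by (simp add: o_def mult.commute)
  qed
  have "norm (F (a + of_real 1 * (z - a)) - F (a + of_real 0 * (z - a))) \<le> ?\<phi> 1 - ?\<phi> 0"
  proof (rule differentiable_bound_general[where f' = "\<lambda>t. f (a + of_real t * (z - a)) * (z - a)" and \<phi>' = "\<lambda>t. A * ?d ^ Suc n * t ^ n"])
    show "continuous_on {0..1} (\<lambda>t. F (a + of_real t * (z - a)))"
      by (rule continuous_at_imp_continuous_on) (use d has_vector_derivative_continuous in force)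
    show "continuous_on {0..1} ?\<phi>" by (intro continuous_intros) auto
    fix t :: real assume t: "0 < t" "t < 1"
    show "((\<lambda>t. F (a + of_real t * (z - a))) has_vector_derivative f (a + of_real t * (z - a)) * (z - a)) (at t)"
      using d t by simp
    have "(?\<phi> has_real_derivative A * ?d ^ Suc n * (real (Suc n) * t ^ n / real (Suc n))) (at t)"
      by (intro DERIV_cmult DERIV_cdivide) (use DERIV_pow[of "Suc n" t] in simp)
    then show "(?\<phi> has_vector_derivative A * ?d ^ Suc n * t ^ n) (at t)"
      unfolding has_real_derivative_iff_has_vector_derivative by simp
    have "norm (f (a + of_real t * (z - a))) \<le> A * norm (a + of_real t * (z - a) - a) ^ n"
      by (rule assms(3)[OF seg]) (use t in auto)
    also have "norm (a + of_real t * (z - a) - a) = t * ?d" using t by (simp add: norm_mult)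
    finally have "norm (f (a + of_real t * (z - a))) * ?d \<le> A * (t * ?d) ^ n * ?d"
      by (rule mult_right_mono) simp
    then show "norm (f (a + of_real t * (z - a)) * (z - a)) \<le> A * ?d ^ Suc n * t ^ n"
      by (simp add: norm_mult power_mult_distrib mult_ac)
  qed simp
  then show ?thesis using assms(2) by simp
qed

text \<open>These are the successive corrections, to be summed, not the iterates themselves. The
  first term is the quadratic polynomial with jet \<open>x\<close> at \<open>a\<close>; all later
  terms are threefold primitives based at \<open>a\<close> and have zero jet there.\<close>

primrec picard :: "complex \<Rightarrow> complex set \<Rightarrow> (complex \<Rightarrow> complex) \<Rightarrow> (complex \<Rightarrow> complex) \<Rightarrow> complex ^ 3
    \<Rightarrow> nat \<Rightarrow> complex \<Rightarrow> complex" where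
  "picard a D p q x 0 = (\<lambda>z. x $ 1 + x $ 2 * (z - a) + x $ 3 * (z - a)\<^sup>2 / 2)"
| "picard a D p q x (Suc n) = primitive_from a D (primitive_from a D (primitive_from a D
     (\<lambda>z. - (p z * deriv (picard a D p q x n) z + q z * picard a D p q x n z))))"

text \<open>The series of corrections and of its first two derivatives are majorized, locally
  uniformly, by an exponential series. Termwise differentiation then gives the equation.\<close>

lemma ode3_exists_star:
  assumes D: "open D" "a \<in> D" "\<And>z. z \<in> D \<Longrightarrow> closed_segment a z \<subseteq> D"
    and pq: "p holomorphic_on D" "q holomorphic_on D"
  shows "\<exists>y. ode3 D p q y \<and> jet y a = x"
proof -
  define Y where "Y = picard a D p q x"
  define G where "G = (\<lambda>n z. - (p z * deriv (Y n) z + q z * Y n z))"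
  define P where "P = primitive_from a D"
  have Y0: "Y 0 = (\<lambda>z. x $ 1 + x $ 2 * (z - a) + x $ 3 * (z - a)\<^sup>2 / 2)" by (simp add: Y_def)
  have YS: "Y (Suc n) = P (P (P (G n)))" for n by (simp add: Y_def P_def G_def)
  have Pa: "P f a = 0" and Pd: "z \<in> D \<Longrightarrow> (P f has_field_derivative f z) (at z)" and Ph: "P f holomorphic_on D"
    if "f holomorphic_on D" for f z
    using primitive_from[OF D that] by (auto simp: P_def)
  have GI: "G n holomorphic_on D" if "Y n holomorphic_on D" for n
    unfolding G_def using that pq D(1) by (auto intro!: holomorphic_intros holomorphic_deriv)
  have Yh: "Y n holomorphic_on D" for n
  proof (induction n)
    case 0 show ?case unfolding Y0 by (auto intro!: holomorphic_intros)
  next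
    case (Suc n) show ?case unfolding YS by (rule Ph[OF Ph[OF Ph[OF GI[OF Suc]]]])
  qed
  note Gh = GI[OF Yh]
  have d1: "deriv (Y (Suc n)) z = P (P (G n)) z" if "z \<in> D" for n z
    unfolding YS by (rule DERIV_imp_deriv[OF Pd[OF Ph[OF Ph[OF Gh]] that]])
  have bound: "\<exists>e>0. cball z e \<subseteq> D \<and> (\<exists>M. summable M \<and> (\<forall>w\<in>cball z e. \<forall>n. norm (Y (Suc n) w) \<le> M n
      \<and> norm (P (P (G n)) w) \<le> M n \<and> norm (P (G n) w) \<le> M n))" if z: "z \<in> D" for z
  proof -
    obtain e where e: "e > 0" "cball z e \<subseteq> D" using D(1) z open_contains_cball by blast
    \<comment> \<open>\<open>K\<close> is the union of the segments from \<open>a\<close> to a disc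
      around \<open>z\<close>. It is compact and again star-shaped about \<open>a\<close>, so the
      inductive estimate holds at all points over which the primitives are integrated.\<close>
    define K where "K = (\<lambda>(t, w). a + of_real t * (w - a)) ` ({0..1::real} \<times> cball z e)"
    have "compact K" unfolding K_def
      by (rule compact_continuous_image) (auto intro!: continuous_intros compact_Times simp: case_prod_unfold)
    have segeq: "closed_segment a w = (\<lambda>t. a + of_real t * (w - a)) ` {0..1}" for w
      unfolding closed_segment_def by (auto simp: algebra_simps scaleR_conv_of_real image_iff)
    have KD: "K \<subseteq> D"
    proof
      fix v assume "v \<in> K"
      then obtain t w where "t \<in> {0..1}" "w \<in> cball z e" "v = a + of_real t * (w - a)" by (auto simp: K_def)
      then have "v \<in> closed_segment a w" "w \<in> D" using e(2) by (auto simp: segeq)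
      then show "v \<in> D" using D(3) by blast
    qed
    have Kstar: "closed_segment a v \<subseteq> K" if "v \<in> K" for v
    proof
      fix u assume "u \<in> closed_segment a v"
      then obtain s where s: "s \<in> {0..1}" "u = a + of_real s * (v - a)" by (auto simp: segeq)
      obtain t w where t: "t \<in> {0..1}" "w \<in> cball z e" "v = a + of_real t * (w - a)" using \<open>v \<in> K\<close> by (auto simp: K_def)
      have "u = a + of_real (s * t) * (w - a)" using s t by (simp add: algebra_simps)
      moreover have "s * t \<in> {0..1}" using s(1) t(1) by (auto intro: mult_le_one)
      ultimately show "u \<in> K" unfolding K_def using t(2) by (intro image_eqI[of _ _ "(s * t, w)"]) auto
    qed
    have zK: "cball z e \<subseteq> K"
    proof
      fix w assume "w \<in> cball z e" then show "w \<in> K"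
        unfolding K_def by (intro image_eqI[of _ _ "(1, w)"]) auto
    qed
    have bd: "\<exists>B\<ge>0. \<forall>w\<in>K. norm (f w) \<le> B" if "continuous_on D f" for f :: "complex \<Rightarrow> complex"
    proof -
      have "bounded (f ` K)" using compact_continuous_image[OF continuous_on_subset[OF that KD] \<open>compact K\<close>] compact_imp_bounded by blast
      then obtain B where "\<forall>w\<in>K. norm (f w) \<le> B" by (auto simp: bounded_iff)
      then show ?thesis by (intro exI[of _ "max B 0"]) (auto simp: le_max_iff_disj)
    qed
    obtain B1 where B1: "B1 \<ge> 0" "\<forall>w\<in>K. norm (p w) \<le> B1" using bd[OF holomorphic_on_imp_continuous_on[OF pq(1)]] by blast
    obtain B2 where B2: "B2 \<ge> 0" "\<forall>w\<in>K. norm (q w) \<le> B2" using bd[OF holomorphic_on_imp_continuous_on[OF pq(2)]] by blast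
    obtain A where A: "A \<ge> 0" "\<forall>w\<in>K. norm (G 0 w) \<le> A" using bd[OF holomorphic_on_imp_continuous_on[OF Gh]] by blast
    have "continuous_on D (\<lambda>w. w - a)" by (intro continuous_intros)
    from bd[OF this] obtain R where R: "R \<ge> 0" "\<forall>w\<in>K. norm (w - a) \<le> R" by blast
    have sb: "norm (P f w) \<le> c * norm (w - a) ^ Suc n / real (Suc n)"
      if f: "f holomorphic_on D" "\<And>v. v \<in> K \<Longrightarrow> norm (f v) \<le> c * norm (v - a) ^ n" and w: "w \<in> K" for f c n w
      by (rule segment_bound[where f = f]) (use Pd[OF f(1)] Pa[OF f(1)] f(2) Kstar[OF w] KD in blast)+
    \<comment> \<open>Of the integrations in one step, one supplies the divisor \<open>n + 1\<close>
      and the extra power of the distance. The remaining one (for the derivative) or two (for the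
      function) are estimated by \<open>R\<close>, whence the two terms.\<close>
    define C where "C = B1 * R + B2 * R\<^sup>2"
    have C: "C \<ge> 0" using B1 B2 R by (simp add: C_def)
    have Gb: "norm (G n w) \<le> A * C ^ n / fact n * norm (w - a) ^ n" if "w \<in> K" for n w
      using that
    proof (induction n arbitrary: w)
      case 0 then show ?case using A by simp
    next
      case (Suc n)
      define A1 where "A1 = A * C ^ n / fact n / real (Suc n)"
      have A1: "A1 \<ge> 0" using A C by (simp add: A1_def)
      let ?d = "norm (w - a)"
      have dR: "?d \<le> R" using R Suc.prems by blast
      have 1: "norm (P (G n) v) \<le> A1 * norm (v - a) ^ Suc n" if "v \<in> K" for v
        using sb[OF Gh Suc.IH that] by (simp add: A1_def)
      have 2: "norm (P (P (G n)) v) \<le> A1 / real (Suc (Suc n)) * norm (v - a) ^ Suc (Suc n)" if "v \<in> K" for v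
        using sb[OF Ph[OF Gh] 1 that] by simp
      have 3: "norm (P (P (P (G n))) v) \<le> A1 / real (Suc (Suc n)) / real (Suc (Suc (Suc n))) * norm (v - a) ^ Suc (Suc (Suc n))" if "v \<in> K" for v
        using sb[OF Ph[OF Ph[OF Gh]] 2 that] by simp
      have "A1 / real (Suc (Suc n)) \<le> A1" using A1 by (simp add: divide_le_eq mult_le_cancel_left1)
      moreover have "A1 / real (Suc (Suc n)) / real (Suc (Suc (Suc n))) \<le> A1 / real (Suc (Suc n))"
        using A1 by (simp add: divide_le_eq mult_le_cancel_left1)
      ultimately have c: "A1 / real (Suc (Suc n)) \<le> A1" "A1 / real (Suc (Suc n)) / real (Suc (Suc (Suc n))) \<le> A1" by linarith+
      have "norm (P (P (G n)) w) \<le> A1 * ?d ^ Suc (Suc n)"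
        using 2[OF Suc.prems] mult_right_mono[OF c(1) zero_le_power[OF norm_ge_zero], of "w - a" "Suc (Suc n)"] by linarith
      also have "\<dots> = (A1 * ?d ^ Suc n) * ?d" by simp
      also have "\<dots> \<le> (A1 * ?d ^ Suc n) * R" by (intro mult_left_mono dR) (use A1 in simp)
      finally have b1: "norm (P (P (G n)) w) \<le> (A1 * ?d ^ Suc n) * R" .
      have "norm (P (P (P (G n))) w) \<le> A1 * ?d ^ Suc (Suc (Suc n))"
        using 3[OF Suc.prems] mult_right_mono[OF c(2) zero_le_power[OF norm_ge_zero], of "w - a" "Suc (Suc (Suc n))"] by linarith
      also have "\<dots> = (A1 * ?d ^ Suc n) * ?d\<^sup>2" by (simp add: power2_eq_square)
      also have "\<dots> \<le> (A1 * ?d ^ Suc n) * R\<^sup>2" by (intro mult_left_mono power_mono dR) (use A1 in simp_all)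
      finally have b2: "norm (Y (Suc n) w) \<le> (A1 * ?d ^ Suc n) * R\<^sup>2" unfolding YS .
      have "w \<in> D" using KD Suc.prems by blast
      have "G (Suc n) w = - (p w * deriv (Y (Suc n)) w + q w * Y (Suc n) w)" by (subst G_def) (rule refl)
      also have "\<dots> = - (p w * P (P (G n)) w + q w * Y (Suc n) w)" by (simp only: d1[OF \<open>w \<in> D\<close>])
      finally have "norm (G (Suc n) w) = norm (p w * P (P (G n)) w + q w * Y (Suc n) w)" by (simp only: norm_minus_cancel)
      also have "\<dots> \<le> norm (p w) * norm (P (P (G n)) w) + norm (q w) * norm (Y (Suc n) w)"
        unfolding norm_mult[symmetric] by (rule norm_triangle_ineq)
      finally have "norm (G (Suc n) w) \<le> norm (p w) * norm (P (P (G n)) w) + norm (q w) * norm (Y (Suc n) w)" .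
      also have "\<dots> \<le> B1 * ((A1 * ?d ^ Suc n) * R) + B2 * ((A1 * ?d ^ Suc n) * R\<^sup>2)"
        by (intro add_mono mult_mono b1 b2) (use B1 B2 Suc.prems A1 in auto)
      also have "\<dots> = C * (A1 * ?d ^ Suc n)" by (simp add: C_def algebra_simps)
      also have "\<dots> = A * C ^ Suc n / fact (Suc n) * ?d ^ Suc n" by (simp add: A1_def mult_ac)
      finally show ?case .
    qed
    define b where "b = (\<lambda>n. A * ((C * R) ^ n / fact n))"
    have b0: "b n \<ge> 0" for n using A C R by (simp add: b_def)
    \<comment> \<open>The factor with exponent \<open>0\<close> brings a constant bound into the
      form that \<open>sb\<close> expects.\<close>
    have Gb': "norm (G n w) \<le> b n * norm (w - a) ^ 0" if "w \<in> K" for n w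
    proof -
      have "norm (G n w) \<le> A * C ^ n / fact n * norm (w - a) ^ n" by (rule Gb[OF that])
      also have "\<dots> \<le> A * C ^ n / fact n * R ^ n"
        by (intro mult_left_mono power_mono) (use R that A C in auto)
      finally show ?thesis by (simp add: b_def power_mult_distrib)
    qed
    have step: "norm (P f w) \<le> (c * R) * norm (w - a) ^ 0" if "f holomorphic_on D" "\<And>v. v \<in> K \<Longrightarrow> norm (f v) \<le> c * norm (v - a) ^ 0" "w \<in> K" "c \<ge> 0" for f c w
    proof -
      have "norm (P f w) \<le> c * norm (w - a)" using sb[OF that(1-3)] by simp
      also have "\<dots> \<le> c * R" by (rule mult_left_mono) (use R that in auto)
      finally show ?thesis by simp
    qed
    have s1: "norm (P (G n) w) \<le> (b n * R) * norm (w - a) ^ 0" if "w \<in> K" for n w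
      by (rule step[OF Gh Gb' that b0])
    have s2: "norm (P (P (G n)) w) \<le> (b n * R * R) * norm (w - a) ^ 0" if "w \<in> K" for n w
      by (rule step[OF Ph[OF Gh] s1 that]) (use b0 R in auto)
    have s3: "norm (P (P (P (G n))) w) \<le> (b n * R * R * R) * norm (w - a) ^ 0" if "w \<in> K" for n w
      by (rule step[OF Ph[OF Ph[OF Gh]] s2 that]) (use b0 R in auto)
    define M where "M = (\<lambda>n. b n * R + b n * R * R + b n * R * R * R)"
    have "summable (\<lambda>n. (C * R) ^ n / fact n)" using summable_exp[of "C * R"] by (simp add: divide_inverse mult.commute)
    then have "summable b" unfolding b_def by (rule summable_mult)
    then have "summable M" unfolding M_def by (intro summable_add summable_mult2)
    moreover have "norm (Y (Suc n) w) \<le> M n \<and> norm (P (P (G n)) w) \<le> M n \<and> norm (P (G n) w) \<le> M n"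
      if "w \<in> cball z e" for n w
    proof -
      have "0 \<le> b n * R" "0 \<le> b n * R * R" "0 \<le> b n * R * R * R" using b0 R by auto
      then show ?thesis using s1[of w n] s2[of w n] s3[of w n] that zK unfolding YS M_def by force
    qed
    ultimately show ?thesis using e by blast
  qed
  \<comment> \<open>The hypothesis on \<open>f\<close> says that a common majorant of the three
    series also majorizes \<open>f\<close>, so that this fact and \<open>lim\<close> below serve
    each of the series.\<close>
  have ul: "\<exists>e>0. cball z e \<subseteq> D \<and> uniform_limit (cball z e) (\<lambda>N w. \<Sum>n<N. f n w) (\<lambda>w. \<Sum>n. f n w) sequentially"
    if z: "z \<in> D" and f: "\<forall>n w M. norm (Y (Suc n) w) \<le> M n \<and> norm (P (P (G n)) w) \<le> M n \<and> norm (P (G n) w) \<le> M n \<longrightarrow> norm (f n w) \<le> M n"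
    for z and f :: "nat \<Rightarrow> complex \<Rightarrow> complex"
  proof -
    obtain e M where e: "e > 0" "cball z e \<subseteq> D" "summable M" and M: "\<forall>w\<in>cball z e. \<forall>n. norm (Y (Suc n) w) \<le> M n
      \<and> norm (P (P (G n)) w) \<le> M n \<and> norm (P (G n) w) \<le> M n" using bound[OF z] by blast
    have "uniform_limit (cball z e) (\<lambda>N w. \<Sum>n<N. f n w) (\<lambda>w. \<Sum>n. f n w) sequentially"
      by (rule Weierstrass_m_test[OF _ e(3)]) (use M f in blast)
    then show ?thesis using e by blast
  qed
  have lim: "(\<lambda>n. f n z) sums (\<Sum>n. f n z)"
    if z: "z \<in> D" and f: "\<forall>n w M. norm (Y (Suc n) w) \<le> M n \<and> norm (P (P (G n)) w) \<le> M n \<and> norm (P (G n) w) \<le> M n \<longrightarrow> norm (f n w) \<le> M n"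
    for z and f :: "nat \<Rightarrow> complex \<Rightarrow> complex"
  proof -
    obtain e where e: "e > 0" "uniform_limit (cball z e) (\<lambda>N w. \<Sum>n<N. f n w) (\<lambda>w. \<Sum>n. f n w) sequentially"
      using ul[OF z f] by blast
    have "(\<lambda>N. \<Sum>n<N. f n z) \<longlonglongrightarrow> (\<Sum>n. f n z)"
      by (rule tendsto_uniform_limitI[OF e(2)]) (use e(1) in simp)
    then show ?thesis by (simp add: sums_def)
  qed
  define S0 S1 S2 where "S0 = (\<lambda>w. \<Sum>n. Y (Suc n) w)" and "S1 = (\<lambda>w. \<Sum>n. P (P (G n)) w)" and "S2 = (\<lambda>w. \<Sum>n. P (G n) w)"
  have D0: "(S0 has_field_derivative S1 z) (at z)" if z: "z \<in> D" for z
  proof -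
    have "\<exists>g'. \<forall>x\<in>D. (S0 has_field_derivative g' x) (at x) \<and> (\<lambda>N. \<Sum>n<N. P (P (G n)) x) \<longlonglongrightarrow> g' x"
      unfolding S0_def
      by (rule has_complex_derivative_uniform_sequence[OF D(1) _ ul])
        (auto intro!: DERIV_sum simp: YS Pd Ph Gh)
    then obtain l where l: "(S0 has_field_derivative l) (at z)" "(\<lambda>N. \<Sum>n<N. P (P (G n)) z) \<longlonglongrightarrow> l" using z by blast
    moreover have "(\<lambda>N. \<Sum>n<N. P (P (G n)) z) \<longlonglongrightarrow> S1 z"
      using lim[OF z, of "\<lambda>n. P (P (G n))"] by (simp add: sums_def S1_def)
    ultimately show ?thesis using LIMSEQ_unique by blast
  qed
  have D1: "(S1 has_field_derivative S2 z) (at z)" if z: "z \<in> D" for z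
  proof -
    have "\<exists>g'. \<forall>x\<in>D. (S1 has_field_derivative g' x) (at x) \<and> (\<lambda>N. \<Sum>n<N. P (G n) x) \<longlonglongrightarrow> g' x"
      unfolding S1_def
      by (rule has_complex_derivative_uniform_sequence[OF D(1) _ ul])
        (auto intro!: DERIV_sum simp: Pd Ph Gh)
    then obtain l where l: "(S1 has_field_derivative l) (at z)" "(\<lambda>N. \<Sum>n<N. P (G n) z) \<longlonglongrightarrow> l" using z by blast
    moreover have "(\<lambda>N. \<Sum>n<N. P (G n) z) \<longlonglongrightarrow> S2 z"
      using lim[OF z, of "\<lambda>n. P (G n)"] by (simp add: sums_def S2_def)
    ultimately show ?thesis using LIMSEQ_unique by blast
  qed
  have Y0d: "deriv (Y 0) = (\<lambda>z. x $ 2 + x $ 3 * (z - a))"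
    unfolding Y0 by (rule ext, rule DERIV_imp_deriv) (auto intro!: derivative_eq_intros simp: field_simps)
  have D2: "(S2 has_field_derivative - (p z * (deriv (Y 0) z + S1 z) + q z * (Y 0 z + S0 z))) (at z)" if z: "z \<in> D" for z
  proof -
    have "\<exists>g'. \<forall>x\<in>D. (S2 has_field_derivative g' x) (at x) \<and> (\<lambda>N. \<Sum>n<N. G n x) \<longlonglongrightarrow> g' x"
      unfolding S2_def
      by (rule has_complex_derivative_uniform_sequence[OF D(1) _ ul])
        (auto intro!: DERIV_sum simp: Pd Ph Gh)
    then obtain l where l: "(S2 has_field_derivative l) (at z)" "(\<lambda>n. G n z) sums l" using z by (auto simp: sums_def)
    have s: "(\<lambda>n. deriv (Y (Suc n)) z) sums S1 z" "(\<lambda>n. Y (Suc n) z) sums S0 z"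
      using lim[OF z, of "\<lambda>n. P (P (G n))"] lim[OF z, of "\<lambda>n. Y (Suc n)"] by (simp_all add: S1_def S0_def d1[OF z])
    have "(\<lambda>n. deriv (Y n) z) sums (S1 z + deriv (Y 0) z)" "(\<lambda>n. Y n z) sums (S0 z + Y 0 z)"
      by (rule sums_Suc[where f = "\<lambda>n. deriv (Y n) z", OF s(1)], rule sums_Suc[where f = "\<lambda>n. Y n z", OF s(2)])
    then have "(\<lambda>n. - (p z * deriv (Y n) z + q z * Y n z)) sums - (p z * (S1 z + deriv (Y 0) z) + q z * (S0 z + Y 0 z))"
      by (intro sums_minus sums_add sums_mult)
    then have "l = - (p z * (S1 z + deriv (Y 0) z) + q z * (S0 z + Y 0 z))"
      using l(2) sums_unique2 unfolding G_def by blast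
    then show ?thesis using l(1) by (simp add: add.commute)
  qed
  define y y1 y2 where "y = (\<lambda>z. Y 0 z + S0 z)" and "y1 = (\<lambda>z. deriv (Y 0) z + S1 z)" and "y2 = (\<lambda>z. x $ 3 + S2 z)"
  have e: "(y has_field_derivative y1 z) (at z)" "(y1 has_field_derivative y2 z) (at z)"
    "(y2 has_field_derivative - (p z * y1 z + q z * y z)) (at z)" if "z \<in> D" for z
  proof -
    have "(Y 0 has_field_derivative deriv (Y 0) z) (at z)"
      by (rule holomorphic_derivI[OF Yh D(1) that])
    then show "(y has_field_derivative y1 z) (at z)" unfolding y_def y1_def by (rule DERIV_add[OF _ D0[OF that]])
    have "(deriv (Y 0) has_field_derivative x $ 3) (at z)" unfolding Y0d by (auto intro!: derivative_eq_intros)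
    then show "(y1 has_field_derivative y2 z) (at z)" unfolding y1_def y2_def by (rule DERIV_add[OF _ D1[OF that]])
    show "(y2 has_field_derivative - (p z * y1 z + q z * y z)) (at z)"
      using DERIV_add[OF DERIV_const D2[OF that]] unfolding y_def y1_def y2_def by simp
  qed
  have "S0 a = 0" "S1 a = 0" "S2 a = 0"
    by (simp_all add: S0_def S1_def S2_def YS Pa Ph Gh)
  then have "vector [y a, y1 a, y2 a] = x" unfolding y_def y1_def y2_def Y0d by (simp add: Y0 vec3_eq_iff)
  then show ?thesis
    using ode3I[OF D(1), of y y1 y2 p q, OF e] D(2) by metis
qed

section \<open>Wronskians and linear independence\<close>

definition jetmat :: "(3 \<Rightarrow> complex \<Rightarrow> complex) \<Rightarrow> complex \<Rightarrow> complex ^ 3 ^ 3" where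
  "jetmat Y z = (\<chi> i. jet (Y i) z)"

definition wronsk :: "(3 \<Rightarrow> complex \<Rightarrow> complex) \<Rightarrow> complex \<Rightarrow> complex" where
  "wronsk Y z = det (jetmat Y z)"

lemma det_rows_span:
  fixes J :: "complex ^ 3 ^ 3"
  assumes "det J \<noteq> 0"
  obtains c :: "complex ^ 3" where "x = (\<Sum>i\<in>UNIV. c $ i *s J $ i)"
proof -
  have "invertible (transpose J)" using assms by (simp add: invertible_det_nz)
  then obtain B where "transpose J ** B = mat 1" by (auto simp: invertible_def)
  then have "transpose J *v (B *v x) = x" by (simp add: matrix_vector_mul_assoc)
  then have "x = (\<Sum>i\<in>UNIV. (B *v x) $ i *s J $ i)"
    by (simp add: vec_eq_iff matrix_vector_mult_def transpose_def mult.commute)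
  then show thesis using that by blast
qed

lemma det_rows_indep:
  fixes J :: "complex ^ 3 ^ 3"
  assumes "det J \<noteq> 0" "(\<Sum>i\<in>UNIV. c i *s J $ i) = 0"
  shows "c i = 0"
proof -
  have "invertible (transpose J)" using assms by (simp add: invertible_det_nz)
  then obtain B where B: "B ** transpose J = mat 1" by (auto simp: invertible_def)
  have "transpose J *v (\<chi> i. c i) = (\<Sum>i\<in>UNIV. c i *s J $ i)"
    by (simp add: vec_eq_iff matrix_vector_mult_def transpose_def mult.commute)
  then have e: "transpose J *v (\<chi> i. c i) = 0" using assms(2) by simp
  have "(\<chi> i. c i) = (B ** transpose J) *v (\<chi> i. c i)" by (simp add: B)
  also have "\<dots> = B *v (transpose J *v (\<chi> i. c i))" by (simp only: matrix_vector_mul_assoc)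
  also have "\<dots> = 0" by (simp only: e matrix_vector_mult_0_right)
  finally have "(\<chi> i. c i) = 0" .
  then show ?thesis by (metis vec_lambda_beta zero_index)
qed

text \<open>Liouville's formula: the equation has no second-derivative term, so its companion matrix
  has trace zero.\<close>

lemma wronsk_constant:
  assumes D: "open D" "connected D" and Y: "\<And>i. ode3 D p q (Y i)" and z: "z \<in> D" "w \<in> D"
  shows "wronsk Y z = wronsk Y w"
proof -
  note d = ode3_derivs[OF D(1) Y]
  have "(wronsk Y has_field_derivative 0) (at z)" if "z \<in> D" for z
    unfolding wronsk_def[abs_def] jetmat_def det_3
    by (auto intro!: derivative_eq_intros d[OF that] simp: algebra_simps)
  then show ?thesis
    using has_field_derivative_zero_constant[of D] z D
    by (metis DERIV_subset DERIV_zero_connected_constant finite.emptyI continuous_at_imp_continuous_on DERIV_isCont Diff_empty subset_UNIV)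
qed

text \<open>The \<open>z\<close>-derivative treats antiholomorphic coefficients as constants.
  Differentiating the relation twice therefore gives a linear relation between the jets, which the
  nonzero Wronskian excludes.\<close>

lemma antiholomorphic_indep:
  fixes Y :: "3 \<Rightarrow> complex \<Rightarrow> complex"
  assumes D: "open D" and Y: "\<And>i. Y i holomorphic_on D" "\<And>z. z \<in> D \<Longrightarrow> wronsk Y z \<noteq> 0"
    and c: "\<And>i z. z \<in> D \<Longrightarrow> wirt (c i) 0 (c' i z) z"
    and s: "\<And>z. z \<in> D \<Longrightarrow> (\<Sum>i\<in>UNIV. c i z * Y i z) = 0"
    and z: "z \<in> D"
  shows "c i z = 0"
proof -
  have step: "(\<Sum>i\<in>UNIV. c i z * deriv (g i) z) = 0"
    if g: "\<And>i. g i holomorphic_on D" and s: "\<And>z. z \<in> D \<Longrightarrow> (\<Sum>i\<in>UNIV. c i z * g i z) = 0" and z: "z \<in> D" for g z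
  proof -
    have "wirt (\<lambda>z. \<Sum>i\<in>UNIV. c i z * g i z) (\<Sum>i\<in>UNIV. 0 * g i z + c i z * deriv (g i) z) (\<Sum>i\<in>UNIV. c' i z * g i z + c i z * 0) z"
      by (intro wirt_sum wirt_mult c z wirt_holomorphic holomorphic_derivI[OF g D])
    from wirt_dz[OF this] dz_cong(1)[OF D z, of "\<lambda>z. \<Sum>i\<in>UNIV. c i z * g i z" "\<lambda>_. 0"] s
    show ?thesis using wirt_dz[OF wirt_const] by simp
  qed
  have h1: "deriv (Y i) holomorphic_on D" for i using Y(1) D by (rule holomorphic_deriv)
  have 1: "(\<Sum>i\<in>UNIV. c i z * deriv (Y i) z) = 0" if "z \<in> D" for z by (rule step[OF Y(1) s that])
  have 2: "(\<Sum>i\<in>UNIV. c i z * deriv (deriv (Y i)) z) = 0" if "z \<in> D" for z by (rule step[OF h1 1 that])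
  have "(\<Sum>i\<in>UNIV. c i z *s jetmat Y z $ i) = 0"
    using s[OF z] 1[OF z] 2[OF z] by (simp add: vec3_eq_iff jetmat_def)
  then show ?thesis using det_rows_indep[of "jetmat Y z" "\<lambda>i. c i z"] Y(2)[OF z] by (simp add: wronsk_def)
qed

text \<open>The inner sums are antiholomorphic coefficients of the \<open>Y i\<close> and hence
  vanish; their conjugates are then relations with constant coefficients. This is how a Hermitian
  form is recovered from the function it defines.\<close>

lemma product_indep:
  fixes Y :: "3 \<Rightarrow> complex \<Rightarrow> complex"
  assumes D: "open D" "D \<noteq> {}" and Y: "\<And>i. Y i holomorphic_on D" "\<And>z. z \<in> D \<Longrightarrow> wronsk Y z \<noteq> 0"
    and s: "\<And>z. z \<in> D \<Longrightarrow> (\<Sum>i\<in>UNIV. \<Sum>j\<in>UNIV. h i j * (Y i z * cnj (Y j z))) = 0"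
  shows "h i j = 0"
proof -
  have z: "(\<Sum>j\<in>UNIV. h i j * cnj (Y j z)) = 0" if "z \<in> D" for i z
  proof (rule antiholomorphic_indep[OF D(1) Y, where c = "\<lambda>i z. \<Sum>j\<in>UNIV. h i j * cnj (Y j z)"])
    fix i z assume z: "z \<in> D"
    have "wirt (\<lambda>z. \<Sum>j\<in>UNIV. h i j * cnj (Y j z)) (\<Sum>j\<in>UNIV. h i j * cnj 0) (\<Sum>j\<in>UNIV. h i j * cnj (deriv (Y j) z)) z"
      by (intro wirt_sum wirt_cmult wirt_cnj wirt_holomorphic holomorphic_derivI[OF Y(1) D(1) z])
    then show "wirt (\<lambda>z. \<Sum>j\<in>UNIV. h i j * cnj (Y j z)) 0 (\<Sum>j\<in>UNIV. h i j * cnj (deriv (Y j) z)) z" by simp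
    show "(\<Sum>i\<in>UNIV. (\<Sum>j\<in>UNIV. h i j * cnj (Y j z)) * Y i z) = 0"
      using s[OF z] by (simp add: sum_distrib_left sum_distrib_right mult_ac)
  qed (use that in auto)
  obtain w where w: "w \<in> D" using D by blast
  have "cnj (h i j) = 0"
  proof (rule antiholomorphic_indep[OF D(1) Y, where c = "\<lambda>j z. cnj (h i j)" and z = w])
    fix z assume "z \<in> D"
    from z[OF this, of i] have "cnj (\<Sum>j\<in>UNIV. h i j * cnj (Y j z)) = 0" by simp
    then show "(\<Sum>j\<in>UNIV. cnj (h i j) * Y j z) = 0" by simp
  qed (auto intro: wirt_const w)
  then show ?thesis by simp
qed

section \<open>The Weierstrass function and continuation on the torus\<close>

locale torus =
  fixes \<tau> :: complex
  assumes Im_pos: "Im \<tau> > 0"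
begin

abbreviation "\<Lambda> \<equiv> lattice \<tau>"

definition lat :: "int \<times> int \<Rightarrow> complex" where
  "lat = (\<lambda>(m, n). of_int m + of_int n * \<tau>)"

lemma lattice_eq: "\<Lambda> = range lat"
  by (auto simp: lattice_def lat_def)

lemma inj_lat: "inj lat"
proof (rule injI)
  fix x y :: "int \<times> int" assume e: "lat x = lat y"
  have "of_int (snd x) * Im \<tau> = of_int (snd y) * Im \<tau>"
    using arg_cong[OF e, of Im] by (simp add: lat_def case_prod_unfold)
  then have "snd x = snd y" using Im_pos by simp
  then show "x = y" using e by (simp add: lat_def case_prod_unfold prod_eq_iff)
qed

lemma lattice_zero [simp]: "0 \<in> \<Lambda>"
  unfolding lattice_eq by (rule image_eqI[of _ _ "(0,0)"]) (auto simp: lat_def)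

lemma lattice_one [simp]: "1 \<in> \<Lambda>"
  unfolding lattice_eq by (rule image_eqI[of _ _ "(1,0)"]) (auto simp: lat_def)

lemma lattice_tau [simp]: "\<tau> \<in> \<Lambda>"
  unfolding lattice_eq by (rule image_eqI[of _ _ "(0,1)"]) (auto simp: lat_def)

lemma lattice_add: "x \<in> \<Lambda> \<Longrightarrow> y \<in> \<Lambda> \<Longrightarrow> x + y \<in> \<Lambda>"
proof -
  assume "x \<in> \<Lambda>" "y \<in> \<Lambda>"
  then obtain a b c d where "x = lat (a, b)" "y = lat (c, d)" unfolding lattice_eq by (metis imageE surj_pair)
  then have "x + y = lat (a + c, b + d)" by (simp add: lat_def algebra_simps)
  then show ?thesis unfolding lattice_eq by blast
qed

lemma lattice_minus: "x \<in> \<Lambda> \<Longrightarrow> - x \<in> \<Lambda>"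
proof -
  assume "x \<in> \<Lambda>"
  then obtain a b where "x = lat (a, b)" unfolding lattice_eq by (metis imageE surj_pair)
  then have "- x = lat (- a, - b)" by (simp add: lat_def)
  then show ?thesis unfolding lattice_eq by blast
qed

lemma lattice_diff: "x \<in> \<Lambda> \<Longrightarrow> y \<in> \<Lambda> \<Longrightarrow> x - y \<in> \<Lambda>"
  using lattice_add[OF _ lattice_minus] by (metis diff_conv_add_uminus)

lemma lattice_add_iff: "p \<in> \<Lambda> \<Longrightarrow> z + p \<in> \<Lambda> \<longleftrightarrow> z \<in> \<Lambda>"
  using lattice_add lattice_diff by (metis add_diff_cancel_right')

lemma lattice_minus_iff: "- z \<in> \<Lambda> \<longleftrightarrow> z \<in> \<Lambda>"
  using lattice_minus by (metis minus_minus)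

text \<open>The imaginary part of a lattice point controls the coefficient of \<open>\<tau>\<close>,
  the triangle inequality then controls the other one, and the summand 1 is absorbed because a
  nonzero lattice point stays away from 0. The two separate bounds are multiplied in
  \<open>summable_lattice_cube\<close>.\<close>

lemma lattice_bound: "\<exists>c>0. \<forall>x. x \<noteq> (0, 0) \<longrightarrow>
    c * (1 + \<bar>real_of_int (fst x)\<bar>) \<le> norm (lat x) \<and> c * (1 + \<bar>real_of_int (snd x)\<bar>) \<le> norm (lat x)"
proof -
  define k where "k = 1 / Im \<tau>"
  define l where "l = 1 + norm \<tau> * k"
  have k: "k > 0" using Im_pos by (simp add: k_def)
  have l: "l \<ge> 1" using k by (simp add: l_def)
  have main: "1 + \<bar>real_of_int (fst x)\<bar> \<le> (1 + 2 * k + l) * norm (lat x) \<and> 1 + \<bar>real_of_int (snd x)\<bar> \<le> (1 + 2 * k + l) * norm (lat x)"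
    if "x \<noteq> (0, 0)" for x
  proof -
    let ?m = "real_of_int (fst x)" and ?n = "real_of_int (snd x)" and ?w = "norm (lat x)"
    have lx: "lat x = of_int (fst x) + of_int (snd x) * \<tau>" by (simp add: lat_def case_prod_unfold)
    have "\<bar>?n\<bar> * Im \<tau> = \<bar>Im (lat x)\<bar>" using Im_pos by (simp add: lx abs_mult)
    also have "\<dots> \<le> ?w" by (rule abs_Im_le_cmod)
    finally have nI: "\<bar>?n\<bar> * Im \<tau> \<le> ?w" .
    then have n: "\<bar>?n\<bar> \<le> k * ?w" using Im_pos by (simp add: k_def field_simps)
    have "\<bar>?m\<bar> = norm (lat x - of_int (snd x) * \<tau>)" by (simp add: lx)
    also have "\<dots> \<le> ?w + \<bar>?n\<bar> * norm \<tau>" by (metis norm_triangle_ineq4 norm_mult norm_of_int)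
    also have "\<dots> \<le> ?w + k * ?w * norm \<tau>" using n by (intro add_left_mono mult_right_mono) auto
    finally have m: "\<bar>?m\<bar> \<le> l * ?w" by (simp add: l_def algebra_simps)
    have o: "1 \<le> (1 + k) * ?w"
    proof (cases "snd x = 0")
      case True
      then have "fst x \<noteq> 0" using that by (metis prod.collapse)
      then have "1 \<le> \<bar>?m\<bar>" by linarith
      moreover have "?w = \<bar>?m\<bar>" using True by (simp add: lx)
      ultimately have "1 \<le> ?w" by simp
      then show ?thesis using k by (metis add_increasing2 less_eq_real_def mult_cancel_right1 mult_le_cancel_right1 not_one_le_zero order_trans zero_le_one distrib_right mult_nonneg_nonneg norm_ge_zero)
    next
      case False
      then have "1 \<le> \<bar>?n\<bar>" by linarith
      then have "1 \<le> k * ?w" using n by linarith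
      then show ?thesis by (simp add: distrib_right add_increasing)
    qed
    have "0 \<le> k * ?w" "0 \<le> l * ?w" "0 \<le> ?w" using k l by auto
    then show ?thesis using m n o by (simp add: distrib_right)
  qed
  define c where "c = 1 / (1 + 2 * k + l)"
  have "c > 0" using k l by (simp add: c_def)
  then show ?thesis using main k l by (intro exI[of _ c]) (auto simp: c_def field_simps)
qed

lemma summable_int_powr: "(\<lambda>m::int. (1 + \<bar>real_of_int m\<bar>) powr (-3/2)) summable_on UNIV"
proof -
  let ?f = "\<lambda>m::int. (1 + \<bar>real_of_int m\<bar>) powr (-3/2)"
  have "summable (\<lambda>n. of_nat (Suc n) powr (-3/2) :: real)"
    using summable_real_powr_iff[of "-3/2"] by (subst summable_Suc_iff) simp
  then have s: "(\<lambda>n. of_nat (Suc n) powr (-3/2) :: real) summable_on UNIV"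
    by (subst summable_on_UNIV_nonneg_real_iff) auto
  have e: "?f (int n) = of_nat (Suc n) powr (-3/2)" "?f (- int n) = of_nat (Suc n) powr (-3/2)" for n
    by (simp_all add: add.commute)
  have 1: "?f summable_on range int"
    by (subst summable_on_reindex) (use s e in \<open>auto simp: o_def inj_on_def\<close>)
  have 2: "?f summable_on range (\<lambda>n. - int n)"
    by (subst summable_on_reindex) (use s e in \<open>auto simp: o_def inj_on_def\<close>)
  have "UNIV = range int \<union> range (\<lambda>n. - int n)"
    by (auto simp: image_iff) (metis int_cases2)
  then show ?thesis using summable_on_union[OF 1 2] by simp
qed

lemma lattice_min_norm: "\<exists>m>0. \<forall>w\<in>\<Lambda> - {0}. m \<le> norm w"
proof -
  obtain c where c: "c > 0" "\<forall>x. x \<noteq> (0, 0) \<longrightarrow> c * (1 + \<bar>real_of_int (fst x)\<bar>) \<le> norm (lat x) \<and> c * (1 + \<bar>real_of_int (snd x)\<bar>) \<le> norm (lat x)"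
    using lattice_bound by blast
  have "c \<le> norm w" if w: "w \<in> \<Lambda> - {0}" for w
  proof -
    obtain x where x: "w = lat x" using w by (auto simp: lattice_eq)
    then have "x \<noteq> (0, 0)" using w by (auto simp: lat_def)
    then have "c * (1 + \<bar>real_of_int (fst x)\<bar>) \<le> norm w" using c x by blast
    moreover have "c * 1 \<le> c * (1 + \<bar>real_of_int (fst x)\<bar>)" using c by (intro mult_left_mono) auto
    ultimately show ?thesis by simp
  qed
  then show ?thesis using c by blast
qed

lemma closed_lattice_subset:
  assumes "S \<subseteq> \<Lambda>" shows "closed S"
proof -
  obtain m where m: "m > 0" "\<forall>w\<in>\<Lambda> - {0}. m \<le> norm w" using lattice_min_norm by blast
  have "y = x" if "x \<in> S" "y \<in> S" "dist y x < m" for x y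
  proof (rule ccontr)
    assume "y \<noteq> x"
    then have "y - x \<in> \<Lambda> - {0}" using that assms lattice_diff by auto
    then show False using m that by (force simp: dist_norm)
  qed
  then show ?thesis using discrete_imp_closed[OF m(1)] by blast
qed

lemma open_compl_lattice [simp]: "open (- \<Lambda>)"
  using closed_lattice_subset[of \<Lambda>] by (simp add: open_Compl)

lemma open_punctured: "open (- (\<Lambda> - {0}))"
  by (rule open_Compl[OF closed_lattice_subset]) auto

text \<open>The cube is split into two factors with exponent \<open>3/2\<close>, and one coordinate
  bound is applied to each. The majorant is a product of two one-dimensional series, convergent
  because \<open>3/2\<close> exceeds 1.\<close>

lemma summable_lattice_cube: "(\<lambda>w. 1 / norm w ^ 3) summable_on (\<Lambda> - {0})"
proof -
  obtain c where c: "c > 0" "\<And>x. x \<noteq> (0, 0) \<Longrightarrow> c * (1 + \<bar>real_of_int (fst x)\<bar>) \<le> norm (lat x)"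
    "\<And>x. x \<noteq> (0, 0) \<Longrightarrow> c * (1 + \<bar>real_of_int (snd x)\<bar>) \<le> norm (lat x)"
    using lattice_bound by blast
  let ?a = "\<lambda>m::int. (1 + \<bar>real_of_int m\<bar>) powr (-3/2)"
  have "(\<lambda>(m, n). ?a m * ?a n) summable_on (UNIV \<times> UNIV)"
  proof (rule summable_on_SigmaI[where g = "\<lambda>m. ?a m * infsum ?a UNIV"])
    show "((\<lambda>n. case (m, n) of (m, n) \<Rightarrow> ?a m * ?a n) has_sum ?a m * infsum ?a UNIV) UNIV" for m
      using has_sum_cmult_right[OF has_sum_infsum[OF summable_int_powr]] by simp
    show "(\<lambda>m. ?a m * infsum ?a UNIV) summable_on UNIV"
      by (rule summable_on_cmult_left[OF summable_int_powr])
  qed auto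
  then have "(\<lambda>x. 1 / c ^ 3 * (\<lambda>(m, n). ?a m * ?a n) x) summable_on (UNIV - {(0,0)})"
    by (intro summable_on_cmult_right) (auto intro: summable_on_subset_banach)
  then have "(\<lambda>x. norm (1 / norm (lat x) ^ 3)) summable_on (UNIV - {(0,0)})"
  proof (rule Infinite_Sum.abs_summable_on_comparison_test')
    fix x assume "x \<in> UNIV - {(0::int, 0::int)}"
    then have x: "x \<noteq> (0, 0)" by simp
    let ?m = "1 + \<bar>real_of_int (fst x)\<bar>" and ?n = "1 + \<bar>real_of_int (snd x)\<bar>" and ?w = "norm (lat x)"
    have sq: "x powr (3/2) * x powr (3/2) = x ^ 3" if "x > 0" for x :: real
      using powr_add[of x "3/2" "3/2"] powr_realpow[of x 3] that by simp
    have p: "c * ?m > 0" "c * ?n > 0" using c(1) by (auto intro!: mult_pos_pos)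
    have w: "?w > 0" using p c(2)[OF x] by linarith
    have "(c * ?m) powr (3/2) * (c * ?n) powr (3/2) \<le> ?w powr (3/2) * ?w powr (3/2)"
      using p c(2,3)[OF x] by (intro mult_mono powr_mono2) auto
    also have "\<dots> = ?w ^ 3" by (rule sq[OF w])
    also have "(c * ?m) powr (3/2) * (c * ?n) powr (3/2) = c ^ 3 * (?m powr (3/2) * ?n powr (3/2))"
    proof -
      have "(c * ?m) powr (3/2) * (c * ?n) powr (3/2) = (c powr (3/2) * c powr (3/2)) * (?m powr (3/2) * ?n powr (3/2))"
        using c(1) by (simp add: powr_mult)
      then show ?thesis by (simp only: sq[OF c(1)])
    qed
    finally have "c ^ 3 * (?m powr (3/2) * ?n powr (3/2)) \<le> ?w ^ 3" .
    moreover have "0 < c ^ 3 * (?m powr (3/2) * ?n powr (3/2))" using c(1) by auto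
    ultimately have "1 / ?w ^ 3 \<le> 1 / (c ^ 3 * (?m powr (3/2) * ?n powr (3/2)))"
      by (intro divide_left_mono) (use w in auto)
    also have "\<dots> = 1 / c ^ 3 * (?a (fst x) * ?a (snd x))" by (simp add: powr_minus_divide)
    finally show "norm (1 / norm (lat x) ^ 3) \<le> 1 / c ^ 3 * (\<lambda>(m, n). ?a m * ?a n) x"
      by (simp add: case_prod_unfold)
  qed
  then have "(\<lambda>x. 1 / norm (lat x) ^ 3) summable_on (UNIV - {(0,0)})" by simp
  moreover have "bij_betw lat (UNIV - {(0,0)}) (\<Lambda> - {0})"
  proof -
    have "lat ` (UNIV - {(0,0)}) = \<Lambda> - {0}"
      using inj_lat inj_onD[OF inj_lat, of _ "(0,0)"] by (auto simp: lattice_eq lat_def)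
    then show ?thesis using inj_lat unfolding bij_betw_def by (meson inj_on_subset subset_UNIV)
  qed
  ultimately show ?thesis
    using summable_on_reindex_bij_betw[of lat "UNIV - {(0,0)}" "\<Lambda> - {0}" "\<lambda>w. 1 / norm w ^ 3"] by simp
qed

section \<open>The Weierstrass function and its periods\<close>

definition Q where "Q z = (\<Sum>\<^sub>\<infinity>w\<in>\<Lambda> - {0}. 1 / (z - w)\<^sup>2 - 1 / w\<^sup>2)"

lemma wp_eq: "wp \<tau> z = 1 / z\<^sup>2 + Q z"
  by (simp add: wp_def Q_def)

text \<open>\<open>Q\<close> is the part of \<open>wp\<close> that stays regular at 0. Subtracting
  \<open>1 / w\<^sup>2\<close> cancels the leading part of each term and leaves the order
  \<open>1 / norm w ^ 3\<close>, locally uniformly, so the sum may be differentiated term by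
  term.\<close>

lemma Q_deriv:
  assumes z: "z \<notin> \<Lambda> - {0}"
  obtains q where "(Q has_field_derivative q) (at z)" "((\<lambda>w. - 2 / (z - w) ^ 3) has_sum q) (\<Lambda> - {0})"
proof -
  have "open (- (\<Lambda> - {0}))" by (rule open_punctured)
  then obtain d where d: "d > 0" "cball z d \<subseteq> - (\<Lambda> - {0})" using z open_contains_cball by blast
  obtain m where m: "m > 0" "\<forall>w\<in>\<Lambda> - {0}. m \<le> norm w" using lattice_min_norm by blast
  define r where "r = d / 2"
  define R where "R = norm z + r"
  have r: "r > 0" "r \<le> d" using d by (auto simp: r_def)
  have R: "R > 0" "\<And>y. y \<in> cball z r \<Longrightarrow> norm y \<le> R"
  proof -
    show "R > 0" using r by (simp add: R_def add_nonneg_pos)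
    show "norm y \<le> R" if "y \<in> cball z r" for y
    proof -
      have "norm y \<le> norm z + norm (y - z)" using norm_triangle_ineq[of z "y - z"] by simp
      then show ?thesis using that by (simp add: R_def dist_norm norm_minus_commute)
    qed
  qed
  \<comment> \<open>One constant for the two regimes in \<open>far\<close>: lattice points of norm
    at most \<open>2 * R\<close>, whose distance is at least \<open>r\<close>, and larger ones,
    whose distance is at least half their norm.\<close>
  define c where "c = min (1/2) (r / (2 * R))"
  have c: "c > 0" "c \<le> 1/2" using r R by (auto simp: c_def)
  have far: "c * norm w \<le> norm (y - w)" if y: "y \<in> cball z r" and w: "w \<in> \<Lambda> - {0}" for y w
  proof (cases "norm w \<le> 2 * R")
    case True
    have "dist z w > d" using d(2) w by (meson Compl_iff mem_cball not_le_imp_less subsetD)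
    then have "r \<le> norm (y - w)" using dist_triangle[of z w y] y by (simp add: r_def dist_norm norm_minus_commute)
    moreover have "c * norm w \<le> r / (2 * R) * (2 * R)"
      using True R r by (intro mult_mono) (auto simp: c_def)
    ultimately show ?thesis using R by simp
  next
    case False
    have "norm w - norm y \<le> norm (y - w)" by (metis norm_minus_commute norm_triangle_ineq2)
    moreover have "c * norm w \<le> 1/2 * norm w" using c by (intro mult_right_mono) auto
    ultimately show ?thesis using False R(2)[OF y] by linarith
  qed
  define C where "C = R * (2 + R / m) / c\<^sup>2"
  have Cbd: "norm (1 / (y - w)\<^sup>2 - 1 / w\<^sup>2) \<le> C * (1 / norm w ^ 3)" if y: "y \<in> cball z r" and w: "w \<in> \<Lambda> - {0}" for y w
  proof -
    have w0: "norm w > 0" "m \<le> norm w" using w m by auto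
    have yw: "c * norm w \<le> norm (y - w)" by (rule far[OF y w])
    moreover have "0 < c * norm w" by (rule mult_pos_pos[OF c(1) w0(1)])
    ultimately have yw0: "norm (y - w) > 0" by linarith
    then have ne: "y - w \<noteq> 0" "w \<noteq> 0" using w0 yw0 by auto
    have "1 / (y - w)\<^sup>2 - 1 / w\<^sup>2 = (w\<^sup>2 - (y - w)\<^sup>2) / ((y - w)\<^sup>2 * w\<^sup>2)"
      using ne by (simp add: diff_frac_eq)
    also have "w\<^sup>2 - (y - w)\<^sup>2 = y * (2 * w - y)" by (simp add: power2_eq_square algebra_simps)
    finally have "1 / (y - w)\<^sup>2 - 1 / w\<^sup>2 = y * (2 * w - y) / ((y - w)\<^sup>2 * w\<^sup>2)" .
    then have "norm (1 / (y - w)\<^sup>2 - 1 / w\<^sup>2) = norm y * norm (2 * w - y) / (norm (y - w) ^ 2 * norm w ^ 2)"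
      by (simp add: norm_mult norm_divide norm_power)
    also have "\<dots> \<le> R * ((2 + R / m) * norm w) / ((c * norm w) ^ 2 * norm w ^ 2)"
    proof (intro frac_le mult_mono power_mono)
      have "norm (2 * w - y) \<le> 2 * norm w + norm y" by (metis norm_triangle_ineq4 norm_mult norm_numeral)
      also have "norm y \<le> R / m * norm w"
      proof -
        have "norm y \<le> R" using R y by blast
        also have "R \<le> R / m * norm w" using R w0 m by (simp add: field_simps)
        finally show ?thesis .
      qed
      finally show "norm (2 * w - y) \<le> (2 + R / m) * norm w" by (simp add: algebra_simps)
    qed (use R y yw yw0 w0 c m in \<open>auto intro!: mult_nonneg_nonneg add_nonneg_nonneg\<close>)
    also have "\<dots> = C * (1 / norm w ^ 3)"
      using w0 c by (simp add: C_def field_simps power2_eq_square power3_eq_cube)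
    finally show ?thesis .
  qed
  let ?F = "finite_subsets_at_top (\<Lambda> - {0})"
  have ul: "uniform_limit (cball z r) (\<lambda>X y. \<Sum>w\<in>X. 1 / (y - w)\<^sup>2 - 1 / w\<^sup>2) Q ?F"
    unfolding Q_def[abs_def]
    by (rule Weierstrass_m_test_general[OF Cbd summable_on_cmult_right[OF summable_lattice_cube]])
  have dd: "((\<lambda>y. \<Sum>w\<in>X. 1 / (y - w)\<^sup>2 - 1 / w\<^sup>2) has_field_derivative (\<Sum>w\<in>X. - 2 / (y - w) ^ 3)) (at y)"
    if "X \<subseteq> \<Lambda> - {0}" "y \<in> cball z r" for X y
  proof (rule DERIV_sum)
    fix w assume "w \<in> X"
    then have "w \<notin> cball z d" using that(1) d(2) by blast
    moreover have "y \<in> cball z d" using that(2) r(2) by auto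
    ultimately have u: "y + - w \<noteq> 0" by auto
    have "((\<lambda>u. 1 / u\<^sup>2) has_field_derivative - 2 / u ^ 3) (at u)" if "u \<noteq> 0" for u :: complex
      using that by (auto intro!: derivative_eq_intros simp: field_simps power2_eq_square power3_eq_cube)
    from this[OF u] have "((\<lambda>y. 1 / (y + - w)\<^sup>2) has_field_derivative - 2 / (y + - w) ^ 3) (at y)"
      by (simp only: DERIV_shift[of "\<lambda>u. 1 / u\<^sup>2"])
    from DERIV_diff[OF this DERIV_const[of "1 / w\<^sup>2"]]
    show "((\<lambda>y. 1 / (y - w)\<^sup>2 - 1 / w\<^sup>2) has_field_derivative - 2 / (y - w) ^ 3) (at y)"
      by simp
  qed
  have ev: "\<forall>\<^sub>F X in ?F. continuous_on (cball z r) (\<lambda>y. \<Sum>w\<in>X. 1 / (y - w)\<^sup>2 - 1 / w\<^sup>2) \<and>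
     (\<forall>y\<in>ball z r. ((\<lambda>y. \<Sum>w\<in>X. 1 / (y - w)\<^sup>2 - 1 / w\<^sup>2) has_field_derivative (\<Sum>w\<in>X. - 2 / (y - w) ^ 3)) (at y))"
  proof (rule eventually_finite_subsets_at_top_weakI)
    fix X assume "finite X" and X: "X \<subseteq> \<Lambda> - {0}"
    show "continuous_on (cball z r) (\<lambda>y. \<Sum>w\<in>X. 1 / (y - w)\<^sup>2 - 1 / w\<^sup>2) \<and>
     (\<forall>y\<in>ball z r. ((\<lambda>y. \<Sum>w\<in>X. 1 / (y - w)\<^sup>2 - 1 / w\<^sup>2) has_field_derivative (\<Sum>w\<in>X. - 2 / (y - w) ^ 3)) (at y))"
    proof (intro conjI ballI)
      show "continuous_on (cball z r) (\<lambda>y. \<Sum>w\<in>X. 1 / (y - w)\<^sup>2 - 1 / w\<^sup>2)"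
        by (rule DERIV_continuous_on, rule has_field_derivative_at_within, rule dd[OF X])
      show "((\<lambda>y. \<Sum>w\<in>X. 1 / (y - w)\<^sup>2 - 1 / w\<^sup>2) has_field_derivative (\<Sum>w\<in>X. - 2 / (y - w) ^ 3)) (at y)"
        if "y \<in> ball z r" for y
        by (rule dd[OF X]) (use that in simp)
    qed
  qed
  obtain g' where "\<And>y. y \<in> ball z r \<Longrightarrow> (Q has_field_derivative g' y) (at y) \<and> ((\<lambda>X. \<Sum>w\<in>X. - 2 / (y - w) ^ 3) \<longlongrightarrow> g' y) ?F"
    using has_complex_derivative_uniform_limit[OF ev ul finite_subsets_at_top_neq_bot r(1)] by metis
  then show thesis using that[of "g' z"] r by (simp add: has_sum_def)
qed

lemma Q_holomorphic: "Q holomorphic_on - (\<Lambda> - {0})"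
proof -
  have "open (- (\<Lambda> - {0}))" by (rule open_punctured)
  then show ?thesis using Q_deriv by (metis ComplD holomorphic_on_open)
qed

lemma wp_deriv:
  assumes z: "z \<notin> \<Lambda>"
  shows "(wp \<tau> has_field_derivative wp' \<tau> z) (at z)" "((\<lambda>w. - 2 / (z - w) ^ 3) has_sum wp' \<tau> z) \<Lambda>"
    "wp' \<tau> z = - 2 / z ^ 3 + deriv Q z"
proof -
  have z0: "z \<noteq> 0" using z by auto
  obtain q where q: "(Q has_field_derivative q) (at z)" "((\<lambda>w. - 2 / (z - w) ^ 3) has_sum q) (\<Lambda> - {0})"
    using Q_deriv[of z] z by blast
  have d: "(wp \<tau> has_field_derivative - 2 / z ^ 3 + q) (at z)"
    unfolding wp_eq[abs_def]
    by (rule DERIV_add[OF _ q(1)]) (use z0 in \<open>auto intro!: derivative_eq_intros simp: field_simps power2_eq_square power3_eq_cube\<close>)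
  then have e: "wp' \<tau> z = - 2 / z ^ 3 + q" unfolding wp'_def by (rule DERIV_imp_deriv)
  show "(wp \<tau> has_field_derivative wp' \<tau> z) (at z)" using d e by simp
  have "((\<lambda>w. - 2 / (z - w) ^ 3) has_sum (- 2 / (z - 0) ^ 3 + q)) (insert 0 (\<Lambda> - {0}))"
    by (rule has_sum_insert[OF _ q(2)]) simp
  then show "((\<lambda>w. - 2 / (z - w) ^ 3) has_sum wp' \<tau> z) \<Lambda>" using e by (simp add: insert_absorb)
  show "wp' \<tau> z = - 2 / z ^ 3 + deriv Q z" using e DERIV_imp_deriv[OF q(1)] by simp
qed

lemma wp_holomorphic: "wp \<tau> holomorphic_on - \<Lambda>"
  using wp_deriv(1) by (auto simp: holomorphic_on_open)

lemma wp'_holomorphic: "wp' \<tau> holomorphic_on - \<Lambda>"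
  unfolding wp'_def by (rule holomorphic_deriv[OF wp_holomorphic open_compl_lattice])

text \<open>The series of \<open>wp'\<close> runs over the whole lattice without correction terms,
  so a period merely permutes it. The series of \<open>wp\<close> is not permuted in this way; its
  periodicity is obtained by integration.\<close>

lemma wp'_add_period:
  assumes p: "p \<in> \<Lambda>" and z: "z \<notin> \<Lambda>"
  shows "wp' \<tau> (z + p) = wp' \<tau> z"
proof -
  have zp: "z + p \<notin> \<Lambda>" using lattice_add_iff[OF p] z by simp
  have b: "bij_betw (\<lambda>w. w - p) \<Lambda> \<Lambda>"
    by (rule bij_betw_byWitness[where f' = "\<lambda>w. w + p"]) (use p lattice_add lattice_diff in auto)
  have "((\<lambda>w. - 2 / (z - (w - p)) ^ 3) has_sum wp' \<tau> z) \<Lambda>"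
    using wp_deriv(2)[OF z] has_sum_reindex_bij_betw[OF b, of "\<lambda>w. - 2 / (z - w) ^ 3"] by simp
  then have "((\<lambda>w. - 2 / (z + p - w) ^ 3) has_sum wp' \<tau> z) \<Lambda>" by (simp add: algebra_simps)
  then show ?thesis using wp_deriv(2)[OF zp] has_sum_unique by blast
qed

lemma wp_minus: "wp \<tau> (- z) = wp \<tau> z"
proof -
  have b: "bij_betw uminus (\<Lambda> - {0}) (\<Lambda> - {0})"
    by (rule bij_betw_byWitness[where f' = uminus]) (use lattice_minus in auto)
  have e: "(- z - - w)\<^sup>2 = (z - w)\<^sup>2" for w :: complex by (simp add: power2_eq_square algebra_simps)
  have "Q (- z) = Q z" unfolding Q_def
    using infsum_reindex_bij_betw[OF b, of "\<lambda>w. 1 / (- z - w)\<^sup>2 - 1 / w\<^sup>2"] by (simp only: e power2_minus)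
  then show ?thesis by (simp add: wp_eq)
qed

lemma wp'_minus:
  assumes "z \<notin> \<Lambda>" shows "wp' \<tau> (- z) = - wp' \<tau> z"
proof -
  have "- z \<notin> \<Lambda>" using assms lattice_minus_iff by simp
  from wp_deriv(1)[OF this] have "((\<lambda>w. wp \<tau> (- w)) has_field_derivative wp' \<tau> (- z) * - 1) (at z)"
    by (intro DERIV_chain2[of "wp \<tau>"]) (auto intro!: derivative_eq_intros)
  then have "(wp \<tau> has_field_derivative - wp' \<tau> (- z)) (at z)" by (simp add: wp_minus)
  then show ?thesis using wp_deriv(1)[OF assms] DERIV_unique by fastforce
qed

lemma connected_compl_lattice: "connected (- \<Lambda>)"
proof -
  have "countable \<Lambda>" by (simp add: lattice_eq)
  then show ?thesis using path_connected_complement_countable[of \<Lambda>] path_connected_imp_connected by auto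
qed

text \<open>By periodicity of the derivative the difference is constant, and evenness makes it zero
  at \<open>- (p / 2)\<close>, a point where \<open>wp\<close> is regular because
  \<open>p / 2\<close> is off the lattice.\<close>

lemma wp_add_period_aux:
  assumes p: "p \<in> \<Lambda>" "p / 2 \<notin> \<Lambda>" and z: "z \<notin> \<Lambda>"
  shows "wp \<tau> (z + p) = wp \<tau> z"
proof -
  let ?D = "\<lambda>z. wp \<tau> (z + p) - wp \<tau> z"
  have d: "(?D has_field_derivative 0) (at z)" if "z \<notin> \<Lambda>" for z
  proof -
    have "z + p \<notin> \<Lambda>" using lattice_add_iff[OF p(1)] that by simp
    from wp_deriv(1)[OF this] have "((\<lambda>w. wp \<tau> (w + p)) has_field_derivative wp' \<tau> (z + p) * 1) (at z)"
      by (intro DERIV_chain2[of "wp \<tau>"]) (auto intro!: derivative_eq_intros)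
    from DERIV_diff[OF this wp_deriv(1)[OF that]] show ?thesis using wp'_add_period[OF p(1) that] by simp
  qed
  have "- (p / 2) \<notin> \<Lambda>" using p(2) lattice_minus_iff by blast
  have "?D z = ?D (- (p / 2))"
  proof -
    have "\<exists>c. \<forall>z\<in>- \<Lambda>. ?D z = c"
      by (rule DERIV_zero_connected_constant[where f = ?D, OF connected_compl_lattice open_compl_lattice finite.emptyI])
        (use d in \<open>auto intro: continuous_at_imp_continuous_on DERIV_isCont\<close>)
    then show ?thesis using z \<open>- (p / 2) \<notin> \<Lambda>\<close> by (metis ComplI)
  qed
  also have "\<dots> = 0" using wp_minus[of "p / 2"] by (simp add: field_simps)
  finally show ?thesis by simp
qed

lemma half_not_lattice: "1 / 2 \<notin> \<Lambda>" "\<tau> / 2 \<notin> \<Lambda>"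
proof -
  have e: "real_of_int n * 2 = 1 \<Longrightarrow> False" for n
  proof -
    assume "real_of_int n * 2 = 1" then have "real_of_int (n * 2) = of_int 1" by simp
    then have "n * 2 = 1" by (simp only: of_int_eq_iff) then show False by presburger
  qed
  show "1 / 2 \<notin> \<Lambda>"
  proof
    assume "1 / 2 \<in> \<Lambda>"
    then obtain m n :: int where e1: "1 / 2 = of_int m + of_int n * \<tau>" by (auto simp: lattice_def)
    from arg_cong[OF this, of Im] have "n = 0" using Im_pos by simp
    with arg_cong[OF e1, of Re] have "real_of_int m * 2 = 1" by simp
    then show False using e by blast
  qed
  show "\<tau> / 2 \<notin> \<Lambda>"
  proof
    assume "\<tau> / 2 \<in> \<Lambda>"
    then obtain m n :: int where e1: "\<tau> / 2 = of_int m + of_int n * \<tau>" by (auto simp: lattice_def)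
    from arg_cong[OF this, of Im] have "real_of_int n * 2 = 1" using Im_pos by (simp add: field_simps)
    then show False using e by blast
  qed
qed

lemma wp_periodic:
  assumes "z \<notin> \<Lambda>"
  shows "wp \<tau> (z + 1) = wp \<tau> z" "wp \<tau> (z + \<tau>) = wp \<tau> z"
    "wp' \<tau> (z + 1) = wp' \<tau> z" "wp' \<tau> (z + \<tau>) = wp' \<tau> z"
  using wp_add_period_aux[of 1 z] wp_add_period_aux[of \<tau> z] half_not_lattice assms wp'_add_period[of _ z] by auto

lemma Q_continuous_at_0: "isCont Q 0" "isCont (deriv Q) 0"
proof -
  have o: "open (- (\<Lambda> - {0}))" by (rule open_punctured)
  show "isCont Q 0"
    using holomorphic_on_imp_continuous_on[OF Q_holomorphic] o by (simp add: continuous_on_eq_continuous_at)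
  show "isCont (deriv Q) 0"
    using holomorphic_on_imp_continuous_on[OF holomorphic_deriv[OF Q_holomorphic o]] o
    by (simp add: continuous_on_eq_continuous_at)
qed

lemma eventually_not_lattice: "\<forall>\<^sub>F z in at 0. z \<notin> \<Lambda>"
proof -
  have "open (- (\<Lambda> - {0}))" by (rule open_punctured)
  then have "\<forall>\<^sub>F z in at 0. z \<in> - (\<Lambda> - {0})" by (rule eventually_at_in_open') auto
  then show ?thesis by (simp add: eventually_at_filter eventually_mono)
qed

lemma wp_asymp: "((\<lambda>z. z\<^sup>2 * wp \<tau> z) \<longlongrightarrow> 1) (at 0)" "((\<lambda>z. z ^ 3 * wp' \<tau> z) \<longlongrightarrow> - 2) (at 0)"
proof -
  have "((\<lambda>z. 1 + z\<^sup>2 * Q z) \<longlongrightarrow> 1 + 0\<^sup>2 * Q 0) (at 0)"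
    using Q_continuous_at_0(1) by (intro tendsto_intros) (simp add: isCont_def)
  moreover have "\<forall>\<^sub>F z in at 0. 1 + z\<^sup>2 * Q z = z\<^sup>2 * wp \<tau> z"
    by (auto simp: eventually_at_filter wp_eq field_simps)
  ultimately show "((\<lambda>z. z\<^sup>2 * wp \<tau> z) \<longlongrightarrow> 1) (at 0)" using Lim_transform_eventually by fastforce
  have "((\<lambda>z. - 2 + z ^ 3 * deriv Q z) \<longlongrightarrow> - 2 + 0 ^ 3 * deriv Q 0) (at 0)"
    using Q_continuous_at_0(2) by (intro tendsto_intros) (simp add: isCont_def)
  moreover have "\<forall>\<^sub>F z in at 0. - 2 + z ^ 3 * deriv Q z = z ^ 3 * wp' \<tau> z"
    using eventually_not_lattice
    by (rule eventually_mono) (subst wp_deriv(3), auto simp: field_simps)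
  ultimately show "((\<lambda>z. z ^ 3 * wp' \<tau> z) \<longlongrightarrow> - 2) (at 0)" using Lim_transform_eventually by fastforce
qed

lemma period_lattice:
  assumes per: "\<And>z. z \<notin> \<Lambda> \<Longrightarrow> f (z + 1) = f z" "\<And>z. z \<notin> \<Lambda> \<Longrightarrow> f (z + \<tau>) = f z"
    and p: "p \<in> \<Lambda>" and z: "z \<notin> \<Lambda>"
  shows "f (z + p) = f z"
proof -
  have int: "f (z + of_int n * q) = f z"
    if q: "q \<in> \<Lambda>" and s: "\<And>z. z \<notin> \<Lambda> \<Longrightarrow> f (z + q) = f z" and z: "z \<notin> \<Lambda>" for n :: int and q z
  proof -
    have iq: "of_int k * q \<in> \<Lambda>" for k :: int
    proof -
      obtain a b where "q = lat (a, b)" using q unfolding lattice_eq by (metis imageE surj_pair)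
      then have "of_int k * q = lat (k * a, k * b)" by (simp add: lat_def algebra_simps)
      then show ?thesis unfolding lattice_eq by blast
    qed
    show ?thesis
    proof (induction n rule: int_induct[where k = 0])
      case base show ?case by simp
    next
      case (step1 i)
      have "z + of_int i * q \<notin> \<Lambda>" using lattice_add_iff[OF iq] z by simp
      from s[OF this] step1 show ?case by (simp add: algebra_simps)
    next
      case (step2 i)
      have "z + of_int (i - 1) * q \<notin> \<Lambda>" using lattice_add_iff[OF iq] z by blast
      from s[OF this] step2 show ?case by (simp add: algebra_simps)
    qed
  qed
  obtain m n :: int where mn: "p = of_int m + of_int n * \<tau>" using p by (auto simp: lattice_def)
  have "of_int m \<in> \<Lambda>" unfolding lattice_eq by (rule image_eqI[of _ _ "(m, 0)"]) (auto simp: lat_def)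
  then have zm: "z + of_int m \<notin> \<Lambda>" using lattice_add_iff z by simp
  have "f (z + p) = f ((z + of_int m) + of_int n * \<tau>)" by (simp add: mn add.assoc)
  also have "\<dots> = f (z + of_int m)" by (rule int[OF lattice_tau per(2) zm])
  also have "\<dots> = f z" using int[OF lattice_one per(1) z, of m] by simp
  finally show ?thesis .
qed

section \<open>Real coordinates in the basis \<open>1\<close>, \<open>\<tau>\<close> and the two
  strips\<close>

definition sc :: "complex \<Rightarrow> real" where "sc z = Re z - Im z / Im \<tau> * Re \<tau>"
definition tc :: "complex \<Rightarrow> real" where "tc z = Im z / Im \<tau>"

lemma coord: "z = of_real (sc z) + of_real (tc z) * \<tau>"
  using Im_pos by (simp add: sc_def tc_def complex_eq_iff)

lemma sc_tc_simps [simp]: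
  "sc (z + w) = sc z + sc w" "tc (z + w) = tc z + tc w" "sc (z - w) = sc z - sc w" "tc (z - w) = tc z - tc w"
  "sc (- z) = - sc z" "tc (- z) = - tc z" "sc 1 = 1" "tc 1 = 0" "sc \<tau> = 0" "tc \<tau> = 1" "sc 0 = 0" "tc 0 = 0"
  "sc (of_real x * z) = x * sc z" "tc (of_real x * z) = x * tc z" "sc (of_real x) = x" "tc (of_real x) = 0"
  "sc (of_int n) = of_int n" "tc (of_int n) = 0" "sc (x *\<^sub>R z) = x * sc z" "tc (x *\<^sub>R z) = x * tc z"
  "sc (of_int n * z) = of_int n * sc z" "tc (of_int n * z) = of_int n * tc z"
  using Im_pos by (simp_all add: sc_def tc_def field_simps)

lemma continuous_sc_tc: "continuous_on A sc" "continuous_on A tc"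
  unfolding sc_def[abs_def] tc_def[abs_def] by (intro continuous_intros; use Im_pos in simp)+

lemma tc_sign: "tc z > 0 \<longleftrightarrow> Im z > 0" "tc z < 0 \<longleftrightarrow> Im z < 0"
  using Im_pos by (auto simp: tc_def zero_less_divide_iff divide_less_0_iff)

lemma lattice_coord: "z \<in> \<Lambda> \<Longrightarrow> sc z \<in> \<int>" "z \<in> \<Lambda> \<Longrightarrow> tc z \<in> \<int>"
  by (auto simp: lattice_def)

lemma lattice_coordI: "sc z \<in> \<int> \<Longrightarrow> tc z \<in> \<int> \<Longrightarrow> z \<in> \<Lambda>"
proof -
  assume "sc z \<in> \<int>" "tc z \<in> \<int>"
  then obtain m n where "sc z = of_int m" "tc z = of_int n" by (auto elim!: Ints_cases)
  then show ?thesis using coord[of z] unfolding lattice_def by auto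
qed

text \<open>An open strip between neighbouring lattice lines, invariant under translation by
  \<open>1\<close>; the strip \<open>T\<close> below is invariant under translation by
  \<open>\<tau>\<close>.\<close>

definition S where "S = {z. 0 < tc z \<and> tc z < 1}"
definition T where "T = {z. 0 < sc z \<and> sc z < 1}"

lemma open_sc_tc: "open {z. sc z < a}" "open {z. a < sc z}" "open {z. tc z < a}" "open {z. a < tc z}"
  by (intro open_Collect_less continuous_sc_tc continuous_on_const)+

lemma convex_sc_tc: "convex {z. sc z < a}" "convex {z. a < sc z}" "convex {z. tc z < a}" "convex {z. a < tc z}"
proof -
  have l: "linear sc" "linear tc" by (auto intro!: linearI)
  have e: "{z. f z < a} = f -` {..<a}" "{z. a < f z} = f -` {a<..}" for f :: "complex \<Rightarrow> real" by auto
  show "convex {z. sc z < a}" "convex {z. a < sc z}" "convex {z. tc z < a}" "convex {z. a < tc z}"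
    unfolding e by (intro convex_linear_vimage l convex_real_interval)+
qed

lemma ST_open [simp]: "open S" "open T" and ST_convex: "convex S" "convex T"
proof -
  have S: "S = {z. 0 < tc z} \<inter> {z. tc z < 1}" and T: "T = {z. 0 < sc z} \<inter> {z. sc z < 1}" by (auto simp: S_def T_def)
  show "open S" "open T" unfolding S T by (intro open_Int open_sc_tc)+
  show "convex S" "convex T" unfolding S T by (intro convex_Int convex_sc_tc)+
qed

lemma not_Ints_between: "0 < x \<Longrightarrow> x < 1 \<Longrightarrow> (x::real) \<notin> \<int>"
  by (auto elim!: Ints_cases)

lemma ST_lattice: "z \<in> S \<Longrightarrow> z \<notin> \<Lambda>" "z \<in> T \<Longrightarrow> z \<notin> \<Lambda>"
  using lattice_coord not_Ints_between by (auto simp: S_def T_def)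

lemma small_radius: "\<exists>r>0. \<forall>\<zeta>\<in>ball 0 r. \<bar>sc \<zeta>\<bar> < 1 \<and> \<bar>tc \<zeta>\<bar> < 1"
proof -
  have "open ({z. sc z < 1} \<inter> {z. - 1 < sc z} \<inter> {z. tc z < 1} \<inter> {z. - 1 < tc z})"
    by (intro open_Int open_sc_tc)
  then obtain r where "r > 0" "ball 0 r \<subseteq> {z. sc z < 1} \<inter> {z. - 1 < sc z} \<inter> {z. tc z < 1} \<inter> {z. - 1 < tc z}"
    by (rule openE[where x = 0]) auto
  moreover have "\<bar>sc z\<bar> < 1 \<and> \<bar>tc z\<bar> < 1" if "z \<in> {z. sc z < 1} \<inter> {z. - 1 < sc z} \<inter> {z. tc z < 1} \<inter> {z. - 1 < tc z}" for z
    using that by auto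
  ultimately show ?thesis by blast
qed

lemma small_ball_lattice:
  assumes "r > 0" "\<forall>\<zeta>\<in>ball 0 r. \<bar>sc \<zeta>\<bar> < 1 \<and> \<bar>tc \<zeta>\<bar> < 1"
  shows "ball 0 r \<inter> \<Lambda> = {0}"
proof -
  have "z = 0" if z: "z \<in> ball 0 r" "z \<in> \<Lambda>" for z
  proof -
    obtain m n where mn: "sc z = of_int m" "tc z = of_int n" using lattice_coord[OF z(2)] by (auto elim!: Ints_cases)
    moreover have "\<bar>sc z\<bar> < 1" "\<bar>tc z\<bar> < 1" using assms z by auto
    ultimately have "m = 0" "n = 0" by auto
    then show ?thesis using coord[of z] mn by simp
  qed
  then show ?thesis using assms(1) by auto
qed

text \<open>The signs of \<open>a\<close> and \<open>b\<close> select sides of the lattice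
  directions, and the value 0 imposes no condition. The points found show that the sectors are
  nonempty on which the identity theorem is started.\<close>

lemma quadrant_point:
  fixes a b r :: real
  assumes "r > 0"
  shows "\<exists>\<zeta>\<in>ball 0 r. (0 < a \<longrightarrow> 0 < sc \<zeta>) \<and> (a < 0 \<longrightarrow> sc \<zeta> < 0) \<and> (0 < b \<longrightarrow> 0 < tc \<zeta>) \<and> (b < 0 \<longrightarrow> tc \<zeta> < 0)"
proof -
  define w where "w = of_real a + of_real b * \<tau>"
  define e where "e = r / (2 * (1 + norm w))"
  have e: "e > 0" using assms by (auto simp: e_def intro!: divide_pos_pos add_pos_nonneg)
  have "e * norm w \<le> e * (1 + norm w)" using e by (intro mult_left_mono) auto
  also have "\<dots> = r / 2" unfolding e_def by (simp add: field_simps add_pos_nonneg[of 1 "norm w"] add_nonneg_eq_0_iff)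
  finally have "norm (of_real e * w) < r" using assms e by (simp add: norm_mult)
  then show ?thesis using e by (intro bexI[of _ "of_real e * w"]) (auto simp: w_def mult_less_0_iff)
qed

text \<open>Continuation around the lattice point \<open>1 + \<tau>\<close> through the four parallelograms meeting there:
  \<open>\<rho>\<close> continues \<open>\<lambda>\<close> from below across the cut, where it differs from \<open>\<lambda>\<close> by the local monodromy.\<close>

lemma continuation_around_vertex:
  assumes r: "r > 0" "\<forall>\<zeta>\<in>ball 0 r. \<bar>sc \<zeta>\<bar> < 1 \<and> \<bar>tc \<zeta>\<bar> < 1"
    and lam: "lam holomorphic_on slit_ball r" "\<And>\<zeta>. \<zeta> \<in> ball 0 r \<Longrightarrow> Im \<zeta> < 0 \<Longrightarrow> lam \<zeta> = fS (1 + \<tau> + \<zeta>)"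
    and rho: "rho holomorphic_on (ball 0 r - \<real>\<^sub>\<ge>\<^sub>0)" "\<And>\<zeta>. \<zeta> \<in> ball 0 r \<Longrightarrow> Im \<zeta> < 0 \<Longrightarrow> rho \<zeta> = lam \<zeta>"
      "\<And>\<zeta>. \<zeta> \<in> ball 0 r \<Longrightarrow> Im \<zeta> > 0 \<Longrightarrow> rho \<zeta> = \<kappa> * lam \<zeta> + \<delta>"
    and f: "fS holomorphic_on S" "fT holomorphic_on T" "\<And>z. z \<in> S \<Longrightarrow> z \<in> T \<Longrightarrow> fS z = fT z"
    and gT: "gT holomorphic_on {z. z - 1 \<in> T}" "\<And>z. z \<in> S \<Longrightarrow> z - 1 \<in> T \<Longrightarrow> gT z = fS z"
    and gS: "gS holomorphic_on {z. z - \<tau> \<in> S}" "\<And>z. z \<in> T \<Longrightarrow> z - \<tau> \<in> S \<Longrightarrow> gS z = fT z"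
  shows "\<And>\<zeta>. \<zeta> \<in> ball 0 r \<Longrightarrow> Im \<zeta> > 0 \<Longrightarrow> gS (1 + \<tau> + \<zeta>) = \<kappa> * lam \<zeta> + \<delta>"
    and "\<And>\<zeta>. \<zeta> \<in> ball 0 r \<Longrightarrow> sc \<zeta> > 0 \<Longrightarrow> gT (1 + \<tau> + \<zeta>) = lam \<zeta>"
proof -
  have bnd: "\<bar>sc \<zeta>\<bar> < 1" "\<bar>tc \<zeta>\<bar> < 1" if "\<zeta> \<in> ball 0 r" for \<zeta> using r that by auto
  have bnd': "sc \<zeta> < 1" "- 1 < sc \<zeta>" "tc \<zeta> < 1" "- 1 < tc \<zeta>" "0 < 1 + sc \<zeta>" "0 < 1 + tc \<zeta>" if "cmod \<zeta> < r" for \<zeta>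
    using bnd[of \<zeta>] that by auto
  have slit: "\<zeta> \<in> slit_ball r" if "\<zeta> \<in> ball 0 r" "sc \<zeta> > 0 \<or> Im \<zeta> \<noteq> 0" for \<zeta>
    using that by (auto simp: slit_ball_def complex_nonpos_Reals_iff sc_def)
  have slit': "\<zeta> \<in> ball 0 r - \<real>\<^sub>\<ge>\<^sub>0" if "\<zeta> \<in> ball 0 r" "sc \<zeta> < 0" for \<zeta>
    using that by (auto simp: complex_nonneg_Reals_iff sc_def)
  have hc: "(\<lambda>\<zeta>. f (1 + \<tau> + \<zeta>)) holomorphic_on A" if "f holomorphic_on B" "\<And>\<zeta>. \<zeta> \<in> A \<Longrightarrow> 1 + \<tau> + \<zeta> \<in> B" for f A B
    by (rule holomorphic_on_compose_gen[OF _ that(1), unfolded o_def]) (use that(2) in \<open>auto intro!: holomorphic_intros\<close>)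
  have box: "open (ball 0 r \<inter> X \<inter> Y)" "connected (ball 0 r \<inter> X)" if "open X" "convex X" "open Y" for X Y :: "complex set"
    using that by (auto intro!: convex_connected convex_Int)
  \<comment> \<open>The half disc \<open>sc > 0\<close> misses the cut of \<open>lam\<close>;
    agreement in its lower sector propagates to all of it by the identity theorem.\<close>
  show A: "gT (1 + \<tau> + \<zeta>) = lam \<zeta>" if z: "\<zeta> \<in> ball 0 r" "sc \<zeta> > 0" for \<zeta>
  proof (rule analytic_continuation_open[where s = "ball 0 r \<inter> {z. 0 < sc z} \<inter> {z. tc z < 0}" and s' = "ball 0 r \<inter> {z. 0 < sc z}"
        and f = "\<lambda>\<zeta>. gT (1 + \<tau> + \<zeta>)" and g = lam])
    show "ball 0 r \<inter> {z. 0 < sc z} \<inter> {z. tc z < 0} \<noteq> {}" using quadrant_point[OF r(1), of 1 "-1"] by auto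
    show "(\<lambda>\<zeta>. gT (1 + \<tau> + \<zeta>)) holomorphic_on ball 0 r \<inter> {z. 0 < sc z}"
      by (rule hc[OF gT(1)]) (auto simp: T_def bnd')
    show "lam holomorphic_on ball 0 r \<inter> {z. 0 < sc z}"
      by (rule holomorphic_on_subset[OF lam(1)]) (use slit in auto)
    fix \<zeta> assume z: "\<zeta> \<in> ball 0 r \<inter> {z. 0 < sc z} \<inter> {z. tc z < 0}"
    have "gT (1 + \<tau> + \<zeta>) = fS (1 + \<tau> + \<zeta>)"
      by (rule gT(2)) (use z in \<open>auto simp: S_def T_def bnd'\<close>)
    then show "gT (1 + \<tau> + \<zeta>) = lam \<zeta>" using lam(2)[of \<zeta>] z tc_sign by auto
  qed (use z in \<open>auto intro!: box open_Int open_sc_tc convex_sc_tc\<close>)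
  \<comment> \<open>The half disc \<open>sc < 0\<close> meets the cut of \<open>lam\<close> but not
    that of \<open>rho\<close>, so here \<open>rho\<close> is the continuation from below.\<close>
  have B: "fT (1 + \<tau> + \<zeta>) = rho \<zeta>" if z: "\<zeta> \<in> ball 0 r" "sc \<zeta> < 0" for \<zeta>
  proof (rule analytic_continuation_open[where s = "ball 0 r \<inter> {z. sc z < 0} \<inter> {z. tc z < 0}" and s' = "ball 0 r \<inter> {z. sc z < 0}"
        and f = "\<lambda>\<zeta>. fT (1 + \<tau> + \<zeta>)" and g = rho])
    show "ball 0 r \<inter> {z. sc z < 0} \<inter> {z. tc z < 0} \<noteq> {}" using quadrant_point[OF r(1), of "-1" "-1"] by auto
    show "(\<lambda>\<zeta>. fT (1 + \<tau> + \<zeta>)) holomorphic_on ball 0 r \<inter> {z. sc z < 0}"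
      by (rule hc[OF f(2)]) (auto simp: T_def bnd')
    show "rho holomorphic_on ball 0 r \<inter> {z. sc z < 0}"
      by (rule holomorphic_on_subset[OF rho(1)]) (use slit' in auto)
    fix \<zeta> assume z: "\<zeta> \<in> ball 0 r \<inter> {z. sc z < 0} \<inter> {z. tc z < 0}"
    have "fS (1 + \<tau> + \<zeta>) = fT (1 + \<tau> + \<zeta>)"
      by (rule f(3)) (use z in \<open>auto simp: S_def T_def bnd'\<close>)
    then show "fT (1 + \<tau> + \<zeta>) = rho \<zeta>" using lam(2)[of \<zeta>] rho(2)[of \<zeta>] z tc_sign by auto
  qed (use z in \<open>auto intro!: box open_Int open_sc_tc convex_sc_tc\<close>)
  \<comment> \<open>In the upper left sector \<open>fT\<close> equals \<open>rho\<close>, which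
    there differs from \<open>lam\<close> by the local monodromy. The upper half disc avoids the
    cut, so the relation extends to all of it.\<close>
  show "gS (1 + \<tau> + \<zeta>) = \<kappa> * lam \<zeta> + \<delta>" if z: "\<zeta> \<in> ball 0 r" "Im \<zeta> > 0" for \<zeta>
  proof (rule analytic_continuation_open[where s = "ball 0 r \<inter> {z. 0 < tc z} \<inter> {z. sc z < 0}" and s' = "ball 0 r \<inter> {z. 0 < tc z}"
        and f = "\<lambda>\<zeta>. gS (1 + \<tau> + \<zeta>)" and g = "\<lambda>\<zeta>. \<kappa> * lam \<zeta> + \<delta>"])
    show "ball 0 r \<inter> {z. 0 < tc z} \<inter> {z. sc z < 0} \<noteq> {}" using quadrant_point[OF r(1), of "-1" 1] by auto
    show "(\<lambda>\<zeta>. gS (1 + \<tau> + \<zeta>)) holomorphic_on ball 0 r \<inter> {z. 0 < tc z}"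
      by (rule hc[OF gS(1)]) (auto simp: S_def bnd')
    have "lam holomorphic_on ball 0 r \<inter> {z. 0 < tc z}"
      by (rule holomorphic_on_subset[OF lam(1)]) (use slit tc_sign in force)
    then show "(\<lambda>\<zeta>. \<kappa> * lam \<zeta> + \<delta>) holomorphic_on ball 0 r \<inter> {z. 0 < tc z}" by (intro holomorphic_intros)
    fix \<zeta> assume z: "\<zeta> \<in> ball 0 r \<inter> {z. 0 < tc z} \<inter> {z. sc z < 0}"
    have "gS (1 + \<tau> + \<zeta>) = fT (1 + \<tau> + \<zeta>)"
      by (rule gS(2)) (use z in \<open>auto simp: S_def T_def bnd'\<close>)
    then show "gS (1 + \<tau> + \<zeta>) = \<kappa> * lam \<zeta> + \<delta>" using B[of \<zeta>] rho(3)[of \<zeta>] z tc_sign by auto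
  next
    have "0 < tc \<zeta>" using z(2) tc_sign by simp
    then show "\<zeta> \<in> ball 0 r \<inter> {z. 0 < tc z}" using z(1) by simp
  qed (auto intro!: box open_Int open_sc_tc convex_sc_tc)
qed

end

section \<open>Elliptic functions with poles of low order\<close>

lemma simple_pole_decomposition:
  assumes "f holomorphic_on A - {0}" "open A" "((\<lambda>z. z * f z) \<longlongrightarrow> c) (at 0)"
  shows "\<exists>h. h holomorphic_on A \<and> (\<forall>z\<in>A - {0}. f z = c / z + h z)"
proof (cases "0 \<in> A")
  case True
  \<comment> \<open>Multiplication by \<open>z\<close> removes the singularity; the difference
    quotient of \<open>g\<close> at 0 is then the regular part of \<open>f\<close>. For
    \<open>c = 0\<close> the singularity of \<open>f\<close> itself is removable.\<close>
  define g where "g = (\<lambda>z. if z = 0 then c else z * f z)"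
  have g: "g holomorphic_on A" unfolding g_def
    by (rule removable_singularity) (use assms in \<open>auto intro!: holomorphic_intros\<close>)
  have "(g has_field_derivative deriv g 0) (at 0)" by (rule holomorphic_derivI[OF g assms(2) True])
  moreover have "g 0 = c" by (simp add: g_def)
  ultimately have l: "((\<lambda>z. (g z - c) / z) \<longlongrightarrow> deriv g 0) (at 0)" by (simp add: DERIV_def)
  have "(\<lambda>z. if z = 0 then deriv g 0 else (g z - c) / z) holomorphic_on A"
    by (rule removable_singularity[OF _ assms(2) l])
      (auto intro!: holomorphic_intros holomorphic_on_subset[OF g])
  then show ?thesis
    by (intro exI[of _ "\<lambda>z. if z = 0 then deriv g 0 else (g z - c) / z"])
      (auto simp: g_def field_simps)
next
  case False
  then have h: "f holomorphic_on A" using assms by (simp add: Diff_idemp)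
  have "(\<lambda>z. f z - c / z) holomorphic_on A" using False h by (auto intro!: holomorphic_intros)
  then show ?thesis by (intro exI[of _ "\<lambda>z. f z - c / z"]) auto
qed

context torus
begin

text \<open>The singularities at the lattice are removable, so the extension is entire, and it takes
  all its values on one compact period parallelogram; Liouville's theorem applies.\<close>

lemma elliptic_constant:
  assumes f: "f holomorphic_on - \<Lambda>"
    and per: "\<And>z. z \<notin> \<Lambda> \<Longrightarrow> f (z + 1) = f z" "\<And>z. z \<notin> \<Lambda> \<Longrightarrow> f (z + \<tau>) = f z"
    and lim: "((\<lambda>z. z * f z) \<longlongrightarrow> 0) (at 0)"
  shows "\<exists>c. \<forall>z\<in>- \<Lambda>. f z = c"
proof -
  let ?A = "- (\<Lambda> - {0})"
  have "?A - {0} = - \<Lambda>" by auto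
  then obtain h where h: "h holomorphic_on ?A" "\<forall>z\<in>- \<Lambda>. f z = h z"
    using simple_pole_decomposition[of f ?A 0] f open_punctured lim by auto
  define F where "F = (\<lambda>z. if z \<in> \<Lambda> then h 0 else f z)"
  have Fper: "F (z + p) = F z" if "p \<in> \<Lambda>" for z p
    using lattice_add_iff[OF that, of z] period_lattice[of f p z, OF per that] by (auto simp: F_def)
  have F0: "F z = h z" if "z \<in> ?A" for z using that h(2) by (auto simp: F_def)
  have F: "F holomorphic_on UNIV"
  proof -
    have "F field_differentiable at z" for z
    proof (cases "z \<in> \<Lambda>")
      case False
      then have "f field_differentiable at z" using f holomorphic_on_imp_differentiable_at open_compl_lattice by blast
      then obtain d where "(f has_field_derivative d) (at z)" by (auto simp: field_differentiable_def)
      then have "(F has_field_derivative d) (at z)"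
        by (rule has_field_derivative_transform_within_open[OF _ open_compl_lattice]) (use False in \<open>auto simp: F_def\<close>)
      then show ?thesis by (auto simp: field_differentiable_def)
    next
      case True
      have "(h has_field_derivative deriv h 0) (at 0)" by (rule holomorphic_derivI[OF h(1) open_punctured]) auto
      then have "(F has_field_derivative deriv h 0) (at 0)"
        by (rule has_field_derivative_transform_within_open[OF _ open_punctured]) (use F0 in auto)
      then have "((\<lambda>w. F (w + - z)) has_field_derivative deriv h 0) (at z)"
        using DERIV_shift[of F "deriv h 0" z "- z"] by simp
      then have "(F has_field_derivative deriv h 0) (at z)" by (simp only: Fper[OF lattice_minus[OF True]])
      then show ?thesis by (auto simp: field_differentiable_def)
    qed
    then show ?thesis by (simp add: holomorphic_on_def field_differentiable_at_within)
  qed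
  let ?K = "(\<lambda>(s, t). of_real s + of_real t * \<tau>) ` ({0..1::real} \<times> {0..1::real})"
  have "compact ?K"
    by (rule compact_continuous_image) (auto intro!: continuous_intros compact_Times simp: case_prod_unfold)
  then have b: "bounded (F ` ?K)"
    using compact_continuous_image[OF holomorphic_on_imp_continuous_on[OF holomorphic_on_subset[OF F]]] compact_imp_bounded by blast
  have "range F \<subseteq> F ` ?K"
  proof (rule image_subsetI)
    fix z
    let ?p = "of_int \<lfloor>sc z\<rfloor> + of_int \<lfloor>tc z\<rfloor> * \<tau>"
    have p: "?p \<in> \<Lambda>" unfolding lattice_def by blast
    have "z - ?p = of_real (frac (sc z)) + of_real (frac (tc z)) * \<tau>"
      by (subst (1) coord[of z]) (simp add: frac_def algebra_simps)
    then have "z - ?p \<in> ?K"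
      by (intro image_eqI[of _ _ "(frac (sc z), frac (tc z))"]) (auto simp: frac_lt_1 less_imp_le)
    moreover have "F z = F (z - ?p)" using Fper[OF p, of "z - ?p"] by simp
    ultimately show "F z \<in> F ` ?K" by blast
  qed
  then have "bounded (range F)" using b bounded_subset by blast
  then obtain c where "\<forall>z. F z = c" using Liouville_theorem[OF F] by (auto simp: constant_on_def)
  then show ?thesis by (metis ComplD F_def)
qed

lemma convex_primitive:
  assumes "convex D" "open D" "f holomorphic_on D"
  shows "\<exists>F. F holomorphic_on D \<and> (\<forall>z\<in>D. (F has_field_derivative f z) (at z))"
proof (cases "D = {}")
  case False
  then obtain a where a: "a \<in> D" by blast
  have star: "closed_segment a z \<subseteq> D" if "z \<in> D" for z
    by (rule closed_segment_subset[OF a that assms(1)])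
  have "primitive_from a D f holomorphic_on D" by (rule primitive_from(3)[OF assms(2) a star assms(3)])
  moreover have "\<forall>z\<in>D. (primitive_from a D f has_field_derivative f z) (at z)"
    using primitive_from(2)[OF assms(2) a star assms(3)] by simp
  ultimately show ?thesis by (intro exI conjI)
qed (auto simp: holomorphic_on_def)

lemma convex_primitive_unique:
  assumes "convex D" "open D" "D \<noteq> {}" "\<And>z. z \<in> D \<Longrightarrow> (F has_field_derivative f z) (at z)" "\<And>z. z \<in> D \<Longrightarrow> (G has_field_derivative f z) (at z)"
  shows "\<exists>c. \<forall>z\<in>D. F z = G z + c"
proof -
  have "((\<lambda>z. F z - G z) has_field_derivative 0) (at z within D)" if "z \<in> D" for z
    using DERIV_diff[OF assms(4,5)[OF that]] by (simp add: has_field_derivative_at_within)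
  from has_field_derivative_zero_constant[OF assms(1) this]
  obtain c where "\<And>z. z \<in> D \<Longrightarrow> F z - G z = c" by auto
  then show ?thesis by (intro exI[of _ c]) (auto simp: algebra_simps)
qed

text \<open>The residue theorem without contour integrals: primitives on \<open>S\<close> and
  \<open>T\<close> change by constants under the periods, and such additive monodromies commute.
  Continuation around the vertex, on the other hand, produces the discrepancy
  \<open>- 2 * \<i> * of_real pi * c\<close>.\<close>

lemma elliptic_residue_zero:
  assumes f: "f holomorphic_on - \<Lambda>"
    and per: "\<And>z. z \<notin> \<Lambda> \<Longrightarrow> f (z + 1) = f z" "\<And>z. z \<notin> \<Lambda> \<Longrightarrow> f (z + \<tau>) = f z"
    and lim: "((\<lambda>z. z * f z) \<longlongrightarrow> c) (at 0)"
  shows "c = 0"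
proof -
  obtain r where r: "r > 0" "\<forall>\<zeta>\<in>ball 0 r. \<bar>sc \<zeta>\<bar> < 1 \<and> \<bar>tc \<zeta>\<bar> < 1" using small_radius by blast
  note ball = small_ball_lattice[OF r]
  have "f holomorphic_on ball 0 r - {0}" by (rule holomorphic_on_subset[OF f]) (use ball in auto)
  then obtain h where h: "h holomorphic_on ball 0 r" "\<forall>z\<in>ball 0 r - {0}. f z = c / z + h z"
    using simple_pole_decomposition[OF _ open_ball lim] by blast
  obtain H where H: "H holomorphic_on ball 0 r" "\<forall>z\<in>ball 0 r. (H has_field_derivative h z) (at z)"
    using convex_primitive[OF convex_ball open_ball h(1)] by blast
  have fS: "f holomorphic_on S" and fT: "f holomorphic_on T" using f ST_lattice by (auto intro: holomorphic_on_subset)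
  obtain FS where FS: "FS holomorphic_on S" "\<forall>z\<in>S. (FS has_field_derivative f z) (at z)"
    using convex_primitive[OF ST_convex(1) ST_open(1) fS] by blast
  obtain FT0 where FT0: "FT0 holomorphic_on T" "\<forall>z\<in>T. (FT0 has_field_derivative f z) (at z)"
    using convex_primitive[OF ST_convex(2) ST_open(2) fT] by blast
  define p where "p = (1 + \<tau>) / 2"
  have p: "p \<in> S" "p \<in> T"
  proof -
    have "p = of_real (1/2) * (1 + \<tau>)" by (simp add: p_def)
    then have "sc p = 1/2" "tc p = 1/2" by (simp_all only: sc_tc_simps) auto
    then show "p \<in> S" "p \<in> T" by (auto simp: S_def T_def)
  qed
  have "\<exists>k. \<forall>z\<in>S \<inter> T. FS z = FT0 z + k"
    by (rule convex_primitive_unique[where f = f]) (use ST_convex FS FT0 p in \<open>auto intro: convex_Int\<close>)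
  then obtain k where k: "\<And>z. z \<in> S \<Longrightarrow> z \<in> T \<Longrightarrow> FS z = FT0 z + k" by blast
  \<comment> \<open>The primitive on \<open>T\<close> is normalized to agree with the one on
    \<open>S\<close> over their intersection, as the continuation around the vertex
    requires.\<close>
  define FT where "FT = (\<lambda>z. FT0 z + k)"
  have FT: "FT holomorphic_on T" "\<forall>z\<in>T. (FT has_field_derivative f z) (at z)"
    using FT0 by (auto simp: FT_def intro!: holomorphic_intros derivative_eq_intros)
  have shift: "z + 1 \<in> S \<longleftrightarrow> z \<in> S" "z + \<tau> \<in> T \<longleftrightarrow> z \<in> T" for z by (auto simp: S_def T_def)
  have dS: "((\<lambda>z. FS (z + 1)) has_field_derivative f z) (at z)" if "z \<in> S" for z
  proof -
    have "(FS has_field_derivative f (z + 1)) (at (z + 1))" using FS(2) shift(1) that by blast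
    then show ?thesis using per(1) ST_lattice(1)[OF that] by (simp add: DERIV_shift)
  qed
  have "\<exists>k. \<forall>z\<in>S. FS (z + 1) = FS z + k"
    by (rule convex_primitive_unique[where f = f]) (use ST_convex FS p dS in auto)
  then obtain a1 where a1: "\<And>z. z \<in> S \<Longrightarrow> FS (z + 1) = FS z + a1" by blast
  have dT: "((\<lambda>z. FT (z + \<tau>)) has_field_derivative f z) (at z)" if "z \<in> T" for z
  proof -
    have "(FT has_field_derivative f (z + \<tau>)) (at (z + \<tau>))" using FT(2) shift(2) that by blast
    then show ?thesis using per(2) ST_lattice(2)[OF that] by (simp add: DERIV_shift)
  qed
  have "\<exists>k. \<forall>z\<in>T. FT (z + \<tau>) = FT z + k"
    by (rule convex_primitive_unique[where f = f]) (use ST_convex FT p dT in auto)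
  then obtain a2 where a2: "\<And>z. z \<in> T \<Longrightarrow> FT (z + \<tau>) = FT z + a2" by blast
  let ?L = "ball 0 r \<inter> {z. tc z < 0}"
  have Lne: "?L \<noteq> {}" using quadrant_point[OF r(1), of 1 "-1"] by auto
  have cS: "1 + \<tau> + \<zeta> \<in> S" if "\<zeta> \<in> ?L" for \<zeta> using that r(2) by (force simp: S_def)
  have "\<exists>k. \<forall>z\<in>?L. FS (1 + \<tau> + z) = (c * Ln z + H z) + k"
  proof (rule convex_primitive_unique[where f = f])
    show "convex ?L" "open ?L" by (auto intro!: convex_Int open_Int convex_sc_tc open_sc_tc)
    fix z assume z: "z \<in> ?L"
    have z0: "z \<noteq> 0" "z \<notin> \<real>\<^sub>\<le>\<^sub>0" "z \<notin> \<Lambda>"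
    proof -
      have "z \<in> ball 0 r" "Im z < 0" using z tc_sign(2)[of z] by auto
      then show "z \<noteq> 0" "z \<notin> \<real>\<^sub>\<le>\<^sub>0" by (auto simp: complex_nonpos_Reals_iff)
      then show "z \<notin> \<Lambda>" using ball \<open>z \<in> ball 0 r\<close> by blast
    qed
    have fz: "f z = c / z + h z" using h(2) z z0 by auto
    show "((\<lambda>z. c * Ln z + H z) has_field_derivative f z) (at z)"
      unfolding fz using H(2) z z0 by (auto intro!: derivative_eq_intros simp: field_simps)
    have "f (z + (1 + \<tau>)) = f z" by (rule period_lattice[of f, OF per _ z0(3)]) (auto intro: lattice_add)
    then have "(FS has_field_derivative f z) (at (z + (1 + \<tau>)))" using FS(2) cS[OF z] by (metis add.commute)
    then show "((\<lambda>z. FS (1 + \<tau> + z)) has_field_derivative f z) (at z)" by (simp add: DERIV_shift add.commute)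
  qed (rule Lne)
  then obtain k1 where k1: "\<And>z. z \<in> ?L \<Longrightarrow> FS (1 + \<tau> + z) = (c * Ln z + H z) + k1" by blast
  define lam where "lam = (\<lambda>z. c * Ln z + H z + k1)"
  \<comment> \<open>Uses the logarithm cut along the positive reals that agrees with
    \<open>Ln\<close> below the real axis.\<close>
  define rho where "rho = (\<lambda>z. c * (Ln (- z) - \<i> * of_real pi) + H z + k1)"
  define gT where "gT = (\<lambda>z. FT (z - 1) + a1)"
  define gS where "gS = (\<lambda>z. FS (z - \<tau>) + a2)"
  have slitH: "slit_ball r \<subseteq> ball 0 r" by (auto simp: slit_ball_def)
  note geo = continuation_around_vertex[OF r, of lam FS rho 1 "- 2 * \<i> * of_real pi * c" FT gT gS]
  have 1: "lam holomorphic_on slit_ball r" unfolding lam_def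
    by (intro holomorphic_intros holomorphic_on_subset[OF H(1)] slitH) (auto simp: slit_ball_def)
  have 2: "lam \<zeta> = FS (1 + \<tau> + \<zeta>)" if "\<zeta> \<in> ball 0 r" "Im \<zeta> < 0" for \<zeta>
    using k1[of \<zeta>] that tc_sign(2) by (auto simp: lam_def)
  have 3: "rho holomorphic_on (ball 0 r - \<real>\<^sub>\<ge>\<^sub>0)" unfolding rho_def
    by (intro holomorphic_intros holomorphic_on_subset[OF H(1)]) (auto simp: complex_nonpos_Reals_iff complex_nonneg_Reals_iff)
  have 4: "rho \<zeta> = lam \<zeta>" if "\<zeta> \<in> ball 0 r" "Im \<zeta> < 0" for \<zeta>
    using that Ln_minus[of \<zeta>] by (cases "\<zeta> = 0") (auto simp: rho_def lam_def split: if_splits)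
  have 5: "rho \<zeta> = 1 * lam \<zeta> + - 2 * \<i> * of_real pi * c" if "\<zeta> \<in> ball 0 r" "Im \<zeta> > 0" for \<zeta>
  proof -
    have e: "Ln \<zeta> = Ln (- \<zeta>) + \<i> * of_real pi" using that(2) Ln_minus[of \<zeta>] by (cases "\<zeta> = 0") auto
    show ?thesis unfolding rho_def lam_def e by (simp add: algebra_simps)
  qed
  have 6: "FS z = FT z" if "z \<in> S" "z \<in> T" for z using k[OF that] by (simp add: FT_def)
  have 7: "gT holomorphic_on {z. z - 1 \<in> T}" unfolding gT_def
    by (intro holomorphic_intros holomorphic_on_compose_gen[OF _ FT(1), unfolded o_def]) auto
  have 8: "gS holomorphic_on {z. z - \<tau> \<in> S}" unfolding gS_def
    by (intro holomorphic_intros holomorphic_on_compose_gen[OF _ FS(1), unfolded o_def]) auto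
  have 9: "gT z = FS z" if "z \<in> S" "z - 1 \<in> T" for z
    using a1[of "z - 1"] 6[of "z - 1"] shift(1)[of "z - 1"] that by (simp add: gT_def)
  have 10: "gS z = FT z" if "z \<in> T" "z - \<tau> \<in> S" for z
    using a2[of "z - \<tau>"] 6[of "z - \<tau>"] shift(2)[of "z - \<tau>"] that by (simp add: gS_def)
  obtain \<zeta> where \<zeta>: "\<zeta> \<in> ball 0 r" "0 < sc \<zeta>" "0 < tc \<zeta>" using quadrant_point[OF r(1), of 1 1] by auto
  have "gS (1 + \<tau> + \<zeta>) = 1 * lam \<zeta> + - 2 * \<i> * of_real pi * c"
    by (rule geo(1)[OF 1 2 3 4 5 FS(1) FT(1) 6 7 9 8 10]) (use \<zeta> tc_sign in auto)
  moreover have "gT (1 + \<tau> + \<zeta>) = lam \<zeta>"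
    by (rule geo(2)[OF 1 2 3 4 5 FS(1) FT(1) 6 7 9 8 10]) (use \<zeta> in auto)
  moreover have "gS (1 + \<tau> + \<zeta>) = gT (1 + \<tau> + \<zeta>)"
  proof -
    have z: "\<zeta> \<in> S" "\<zeta> \<in> T" using \<zeta> bspec[OF r(2) \<zeta>(1)] by (auto simp: S_def T_def)
    then show ?thesis using a1[of \<zeta>] a2[of \<zeta>] 6[of \<zeta>] by (simp add: gS_def gT_def add_ac)
  qed
  ultimately show ?thesis by simp
qed

end

section \<open>Linear algebra in dimension three\<close>

lemma det_zero_kernel:
  fixes A :: "complex ^ 'n ^ 'n"
  assumes "det A = 0"
  obtains x where "x \<noteq> 0" "A *v x = 0"
proof -
  have "\<not> invertible A" using assms invertible_det_nz by blast
  then have "\<not> (\<exists>B. B ** A = mat 1)" using matrix_left_right_inverse by (metis invertible_def)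
  then have "\<not> (\<forall>x. A *v x = 0 \<longrightarrow> x = 0)" using matrix_left_invertible_ker by blast
  then show thesis using that by blast
qed

text \<open>The vector \<open>p(A) x\<close> by Horner's scheme, without introducing powers of the
  matrix \<open>A\<close>.\<close>

definition poly_vec :: "complex ^ 'n ^ 'n \<Rightarrow> complex poly \<Rightarrow> complex ^ 'n \<Rightarrow> complex ^ 'n" where
  "poly_vec A p x = fold_coeffs (\<lambda>c v. c *s x + A *v v) p 0"

lemma poly_vec_0 [simp]: "poly_vec A 0 x = 0"
  by (simp add: poly_vec_def)

lemma poly_vec_pCons [simp]: "poly_vec A (pCons c p) x = c *s x + A *v poly_vec A p x"
  by (cases "p = 0 \<and> c = 0") (auto simp: poly_vec_def fold_coeffs_pCons_not_0_0_eq fold_coeffs_pCons_coeff_not_0_eq)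

lemma poly_vec_add: "poly_vec A (p + q) x = poly_vec A p x + poly_vec A q x"
  by (induction p q rule: poly_induct2) (simp_all add: matrix_vector_right_distrib vec.scale_left_distrib algebra_simps)

lemma poly_vec_smult: "poly_vec A (smult c p) x = c *s poly_vec A p x"
  by (induction p) (simp_all add: vector_scalar_commute vec.scale_right_distrib)

lemma poly_vec_linear_factor: "poly_vec A ([:- a, 1:] * q) x = A *v poly_vec A q x - a *s poly_vec A q x"
proof -
  have "[:- a, 1:] * q = smult (- a) q + pCons 0 q" by simp
  then have "poly_vec A ([:- a, 1:] * q) x = (- a) *s poly_vec A q x + A *v poly_vec A q x"
    by (simp only: poly_vec_add poly_vec_smult poly_vec_pCons) simp
  then show ?thesis by (simp add: vec_eq_iff)
qed

text \<open>Four vectors in dimension three are dependent, which yields a nonzero polynomial with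
  \<open>p(A) x = 0\<close>. Linear factors are split off as long as the quotient still annihilates
  \<open>x\<close>; the first quotient \<open>q\<close> that does not gives the eigenvector
  \<open>q(A) x\<close>, which lies in \<open>W\<close>.\<close>

lemma eigenvector_in_invariant_subspace:
  fixes A :: "complex ^ 3 ^ 3"
  assumes W: "\<And>u v. u \<in> W \<Longrightarrow> v \<in> W \<Longrightarrow> u + v \<in> W" "\<And>c u. u \<in> W \<Longrightarrow> c *s u \<in> W" "\<And>u. u \<in> W \<Longrightarrow> A *v u \<in> W"
    and x: "x \<in> W" "x \<noteq> 0"
  obtains e \<mu> where "e \<in> W" "e \<noteq> 0" "A *v e = \<mu> *s e"
proof -
  have W0: "0 \<in> W" using W(2)[OF x(1), of 0] by simp
  have pW: "poly_vec A p x \<in> W" for p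
    by (induction p) (auto intro: W x W0)
  have main: "\<exists>e \<mu>. e \<in> W \<and> e \<noteq> 0 \<and> A *v e = \<mu> *s e" if "p \<noteq> 0" "poly_vec A p x = 0" for p
    using that
  proof (induction "degree p" arbitrary: p rule: less_induct)
    case less
    show ?case
    proof (cases "degree p = 0")
      case True
      then obtain c where "p = [:c:]" by (rule degree_eq_zeroE)
      then show ?thesis using less.prems x(2) by simp
    next
      case False
      then have "coeff p 0 = 0 \<or> (\<exists>i\<in>{1..degree p}. coeff p i \<noteq> 0)"
        using less.prems(1) by (intro disjI2 bexI[of _ "degree p"]) auto
      then obtain a where "(\<Sum>i\<le>degree p. coeff p i * a ^ i) = 0" by (rule fundamental_theorem_of_algebra)
      then have "poly p a = 0" by (simp add: poly_altdef)
      then obtain q where q: "p = [:- a, 1:] * q" by (metis poly_eq_0_iff_dvd dvdE)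
      have q0: "q \<noteq> 0" using q less.prems(1) by auto
      have "degree q < degree p" unfolding q using q0 by (subst degree_mult_eq) auto
      show ?thesis
      proof (cases "poly_vec A q x = 0")
        case True
        then show ?thesis using less.hyps[OF \<open>degree q < degree p\<close> q0] by blast
      next
        case False
        have "A *v poly_vec A q x = a *s poly_vec A q x"
          using less.prems(2) unfolding q poly_vec_linear_factor by simp
        then show ?thesis using False pW by blast
      qed
    qed
  qed
  define v :: "4 \<Rightarrow> complex ^ 3" where "v = (\<lambda>j. if j = 1 then x else if j = 2 then A *v x else if j = 3 then A *v (A *v x) else A *v (A *v (A *v x)))"
  \<comment> \<open>The columns are the four vectors padded by a zero. The zero row makes the
    determinant vanish, and a kernel vector is the linear dependence.\<close>
  define B :: "complex ^ 4 ^ 4" where "B = (\<chi> i j. if i = 1 then v j $ 1 else if i = 2 then v j $ 2 else if i = 3 then v j $ 3 else 0)"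
  have "row 4 B = 0" by (simp add: row_def B_def vec_eq_iff)
  then have "det B = 0" by (rule det_zero_row)
  then obtain c where c: "c \<noteq> 0" "B *v c = 0" using det_zero_kernel by blast
  have "(B *v c) $ 1 = 0" "(B *v c) $ 2 = 0" "(B *v c) $ 3 = 0" using c(2) by auto
  then have "c $ 1 *s v 1 + c $ 2 *s v 2 + c $ 3 *s v 3 + c $ 4 *s v 4 = 0"
    by (simp add: vec3_eq_iff matrix_vector_mult_def B_def sum_4 mult.commute)
  then have "poly_vec A [:c $ 1, c $ 2, c $ 3, c $ 4:] x = 0"
    by (simp add: v_def matrix_vector_right_distrib vector_scalar_commute add.assoc)
  moreover have "[:c $ 1, c $ 2, c $ 3, c $ 4:] \<noteq> 0"
    using c(1) by (auto simp: vec_eq_iff forall_4)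
  ultimately show thesis using main that by blast
qed

section \<open>The Hermitian inner product and unitary matrices\<close>

definition hin :: "complex ^ 3 \<Rightarrow> complex ^ 3 \<Rightarrow> complex" where
  "hin x y = (\<Sum>i\<in>UNIV. x $ i * cnj (y $ i))"

lemma hin_add: "hin (x + y) z = hin x z + hin y z"
  by (simp add: hin_def sum_3 algebra_simps)

lemma hin_scale: "hin (c *s x) y = c * hin x y" "hin x (c *s y) = cnj c * hin x y"
  by (simp_all add: hin_def sum_3 algebra_simps)

lemma hin_commute: "hin y x = cnj (hin x y)"
  by (simp add: hin_def sum_3 mult.commute)

lemma hin_self: "hin x x = of_real ((norm (x $ 1))\<^sup>2 + (norm (x $ 2))\<^sup>2 + (norm (x $ 3))\<^sup>2)"
  by (simp only: hin_def sum_3 of_real_add complex_norm_square)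

lemma hin_self_eq_0: "hin x x = 0 \<longleftrightarrow> x = 0"
proof
  assume "hin x x = 0"
  then have "(norm (x $ 1))\<^sup>2 + (norm (x $ 2))\<^sup>2 + (norm (x $ 3))\<^sup>2 = 0" unfolding hin_self of_real_eq_0_iff .
  then have "(norm (x $ 1))\<^sup>2 = 0 \<and> (norm (x $ 2))\<^sup>2 = 0 \<and> (norm (x $ 3))\<^sup>2 = 0"
    using zero_le_power2[of "norm (x $ 1)"] zero_le_power2[of "norm (x $ 2)"] zero_le_power2[of "norm (x $ 3)"] by linarith
  then show "x = 0" by (simp add: vec3_eq_iff)
qed (simp add: hin_def)

text \<open>The orthogonal complement of an eigenvector is invariant under a unitary matrix.
  Eigenvectors are therefore chosen successively in the complements of the earlier ones, and
  orthogonality makes the matrix of eigenvectors invertible.\<close>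

lemma unitary_eigenbasis:
  fixes A :: "complex ^ 3 ^ 3"
  assumes A: "\<And>x y. hin (A *v x) (A *v y) = hin x y"
  obtains P :: "complex ^ 3 ^ 3" and \<mu> where "det P \<noteq> 0" "\<And>i. A *v (P $ i) = \<mu> i *s (P $ i)" "\<And>i. norm (\<mu> i) = 1"
proof -
  have ev: "norm m = 1" if "A *v e = m *s e" "e \<noteq> 0" for e m
  proof -
    have "hin (m *s e) (m *s e) = hin e e" using A[of e e] unfolding that(1) .
    then have "1 * hin e e = (m * cnj m) * hin e e" unfolding hin_scale by (metis mult.assoc mult.commute mult_1)
    moreover have "hin e e \<noteq> 0" using that(2) hin_self_eq_0 by blast
    ultimately have "m * cnj m = 1" by (metis mult_right_cancel)
    then have "norm (m * cnj m) = 1" by simp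
    then have "(norm m)\<^sup>2 = 1" by (simp add: norm_mult power2_eq_square)
    then show ?thesis by (simp add: power2_eq_1_iff) (use norm_ge_zero[of m] in linarith)
  qed
  have inv: "hin (A *v x) e = 0" if "A *v e = m *s e" "e \<noteq> 0" "hin x e = 0" for e m x
  proof -
    have "m \<noteq> 0" using ev[OF that(1,2)] by auto
    have "cnj m * hin (A *v x) e = hin (A *v x) (A *v e)" by (simp add: that(1) hin_scale)
    then show ?thesis using \<open>m \<noteq> 0\<close> A that(3) by simp
  qed
  have perp: "\<exists>x. x \<noteq> 0 \<and> hin x a = 0 \<and> hin x b = 0" for a b
  proof -
    define B :: "complex ^ 3 ^ 3" where "B = (\<chi> i j. if i = 1 then cnj (a $ j) else if i = 2 then cnj (b $ j) else 0)"
    have "row 3 B = 0" by (simp add: row_def B_def vec_eq_iff)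
    then have "det B = 0" by (rule det_zero_row)
    then obtain x where x: "x \<noteq> 0" "B *v x = 0" using det_zero_kernel by blast
    have "(B *v x) $ 1 = 0" "(B *v x) $ 2 = 0" using x(2) by auto
    then show ?thesis using x(1) by (auto simp: matrix_vector_mult_def B_def hin_def mult.commute)
  qed
  obtain e1 m1 where e1: "e1 \<noteq> 0" "A *v e1 = m1 *s e1"
    by (rule eigenvector_in_invariant_subspace[of UNIV A 1]) (auto simp: vec_eq_iff)
  obtain x1 where x1: "x1 \<noteq> 0" "hin x1 e1 = 0" using perp by blast
  obtain e2 m2 where e2: "hin e2 e1 = 0" "e2 \<noteq> 0" "A *v e2 = m2 *s e2"
    by (rule eigenvector_in_invariant_subspace[of "{x. hin x e1 = 0}" A x1]) (use x1 inv[OF e1(2,1)] in \<open>auto simp: hin_add hin_scale\<close>)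
  obtain x2 where x2: "x2 \<noteq> 0" "hin x2 e1 = 0" "hin x2 e2 = 0" using perp by blast
  obtain e3 m3 where e3: "hin e3 e1 = 0" "hin e3 e2 = 0" "e3 \<noteq> 0" "A *v e3 = m3 *s e3"
    by (rule eigenvector_in_invariant_subspace[of "{x. hin x e1 = 0 \<and> hin x e2 = 0}" A x2])
      (use x2 inv[OF e1(2,1)] inv[OF e2(3,2)] in \<open>auto simp: hin_add hin_scale\<close>)
  define P :: "complex ^ 3 ^ 3" where "P = vector [e1, e2, e3]"
  define \<mu> :: "3 \<Rightarrow> complex" where "\<mu> = (\<lambda>i. if i = 1 then m1 else if i = 2 then m2 else m3)"
  have P: "P $ 1 = e1" "P $ 2 = e2" "P $ 3 = e3" by (simp_all add: P_def)
  show thesis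
  proof (rule that[of P \<mu>])
    show "A *v (P $ i) = \<mu> i *s (P $ i)" for i
      using exhaust_3[of i] e1 e2 e3 by (auto simp: P \<mu>_def)
    show "norm (\<mu> i) = 1" for i
      using exhaust_3[of i] ev[OF e1(2,1)] ev[OF e2(3,2)] ev[OF e3(4,3)] by (auto simp: \<mu>_def)
    show "det P \<noteq> 0"
    proof
      assume "det P = 0"
      then have "det (transpose P) = 0" by simp
      then obtain c where c: "c \<noteq> 0" "transpose P *v c = 0" using det_zero_kernel by blast
      have "c $ 1 *s e1 + c $ 2 *s e2 + c $ 3 *s e3 = transpose P *v c"
        by (simp add: vec3_eq_iff matrix_vector_mult_def transpose_def sum_3 P mult.commute)
      then have s: "c $ 1 *s e1 + c $ 2 *s e2 + c $ 3 *s e3 = 0" using c(2) by (simp only:)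
      have o: "hin e1 e2 = 0" "hin e1 e3 = 0" "hin e2 e3 = 0"
        using e2(1) e3(1,2) hin_commute by (metis complex_cnj_zero)+
      have "hin 0 e = 0" for e by (simp add: hin_def)
      then have "c $ 1 * hin e1 e1 = 0" "c $ 2 * hin e2 e2 = 0" "c $ 3 * hin e3 e3 = 0"
        using arg_cong[OF s, of "\<lambda>x. hin x e1"] arg_cong[OF s, of "\<lambda>x. hin x e2"] arg_cong[OF s, of "\<lambda>x. hin x e3"]
        by (simp_all add: hin_add hin_scale o e2(1) e3(1,2))
      then have "c $ 1 = 0" "c $ 2 = 0" "c $ 3 = 0" using e1(1) e2(2) e3(3) by (simp_all add: hin_self_eq_0)
      then have "c = 0" by (simp add: vec3_eq_iff)
      then show False using c by simp
    qed
  qed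
qed

section \<open>Toda potentials and their linear equation\<close>

text \<open>For a solution of the Toda system, \<open>u\<close> and \<open>v\<close> of this locale
  stand for the combinations \<open>(2 * u + v) / 3\<close> and \<open>(u + 2 * v) / 3\<close>, not
  for the solution itself; \<open>U\<close> and \<open>V\<close> are the same functions with complex
  values. In these variables each equation has a single exponential on the right.\<close>

locale toda_domain =
  fixes D :: "complex set" and U V :: "complex \<Rightarrow> complex" and u v :: "complex \<Rightarrow> real"
  assumes D: "open D"
    and U: "U = (\<lambda>z. of_real (u z))" and V: "V = (\<lambda>z. of_real (v z))"
    and smooth: "smooth_on D U" "smooth_on D V"
    and eqU: "\<And>z. z \<in> D \<Longrightarrow> dz (dzbar U) z = - exp (2 * U z - V z) / 4"
    and eqV: "\<And>z. z \<in> D \<Longrightarrow> dz (dzbar V) z = - exp (2 * V z - U z) / 4"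
begin

abbreviation "U1 \<equiv> dz U"
abbreviation "U2 \<equiv> dz U1"
abbreviation "U3 \<equiv> dz U2"
abbreviation "V1 \<equiv> dz V"
abbreviation "V2 \<equiv> dz V1"
abbreviation "V3 \<equiv> dz V2"
lemma real: "cnj (U z) = U z" "cnj (V z) = V z"
  by (simp_all add: U V)

text \<open>Right-hand sides of \<open>eqU\<close> and \<open>eqV\<close>; after exchanging the
  derivatives they are the \<open>dzbar\<close> derivatives of \<open>U1\<close> and
  \<open>V1\<close>.\<close>

definition "E z = - exp (2 * U z - V z) / 4"
definition "F z = - exp (2 * V z - U z) / 4"

text \<open>Every antiholomorphic derivative of a higher jet of \<open>U\<close> or \<open>V\<close>
  reduces to lower-order jets multiplied by \<open>E\<close> or \<open>F\<close>. Holomorphy of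
  \<open>W2\<close> and \<open>W3\<close> thereby becomes a polynomial identity.\<close>

lemma wirt_U:
  assumes z: "z \<in> D"
  shows "wirt U (U1 z) (cnj (U1 z)) z" "wirt U1 (U2 z) (E z) z"
    "wirt E ((2 * U1 z - V1 z) * E z) (cnj (2 * U1 z - V1 z) * E z) z"
    "wirt U2 (U3 z) ((2 * U1 z - V1 z) * E z) z"
    and wirt_V: "wirt V (V1 z) (cnj (V1 z)) z" "wirt V1 (V2 z) (F z) z"
    "wirt F ((2 * V1 z - U1 z) * F z) (cnj (2 * V1 z - U1 z) * F z) z"
    "wirt V2 (V3 z) ((2 * V1 z - U1 z) * F z) z"
proof -
  note sd = smooth_on_dz[OF D]
  have U_: "wirt U (U1 z) (cnj (U1 z)) z" if "z \<in> D" for z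
    using smooth_on_wirt[OF smooth(1) that] dzbar_of_real[OF smooth(1)[unfolded U] that] by (simp add: U)
  have V_: "wirt V (V1 z) (cnj (V1 z)) z" if "z \<in> D" for z
    using smooth_on_wirt[OF smooth(2) that] dzbar_of_real[OF smooth(2)[unfolded V] that] by (simp add: V)
  have U1_: "dzbar U1 z = E z" if "z \<in> D" for z
    using dz_dzbar_commute[OF D smooth(1) that] eqU[OF that] by (simp add: E_def)
  have V1_: "dzbar V1 z = F z" if "z \<in> D" for z
    using dz_dzbar_commute[OF D smooth(2) that] eqV[OF that] by (simp add: F_def)
  have E: "wirt E ((2 * U1 z - V1 z) * E z) (cnj (2 * U1 z - V1 z) * E z) z" if "z \<in> D" for z
  proof -
    have "wirt (\<lambda>z. (- 1 / 4) * exp (2 * U z - V z)) ((- 1 / 4) * (exp (2 * U z - V z) * (2 * U1 z - V1 z)))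
        ((- 1 / 4) * (exp (2 * U z - V z) * (2 * cnj (U1 z) - cnj (V1 z)))) z"
      by (intro wirt_cmult wirt_exp wirt_diff U_[OF that] V_[OF that])
    moreover have "E = (\<lambda>z. (- 1 / 4) * exp (2 * U z - V z))" by (rule ext) (simp add: E_def)
    ultimately show ?thesis by (simp add: E_def field_simps)
  qed
  have F: "wirt F ((2 * V1 z - U1 z) * F z) (cnj (2 * V1 z - U1 z) * F z) z" if "z \<in> D" for z
  proof -
    have "wirt (\<lambda>z. (- 1 / 4) * exp (2 * V z - U z)) ((- 1 / 4) * (exp (2 * V z - U z) * (2 * V1 z - U1 z)))
        ((- 1 / 4) * (exp (2 * V z - U z) * (2 * cnj (V1 z) - cnj (U1 z)))) z"
      by (intro wirt_cmult wirt_exp wirt_diff U_[OF that] V_[OF that])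
    moreover have "F = (\<lambda>z. (- 1 / 4) * exp (2 * V z - U z))" by (rule ext) (simp add: F_def)
    ultimately show ?thesis by (simp add: F_def field_simps)
  qed
  show "wirt U (U1 z) (cnj (U1 z)) z" "wirt V (V1 z) (cnj (V1 z)) z" by (rule U_[OF z], rule V_[OF z])
  show "wirt U1 (U2 z) (E z) z" using smooth_on_wirt[OF sd(1)[OF smooth(1)] z] U1_[OF z] by simp
  show "wirt V1 (V2 z) (F z) z" using smooth_on_wirt[OF sd(1)[OF smooth(2)] z] V1_[OF z] by simp
  show "wirt E ((2 * U1 z - V1 z) * E z) (cnj (2 * U1 z - V1 z) * E z) z" by (rule E[OF z])
  show "wirt F ((2 * V1 z - U1 z) * F z) (cnj (2 * V1 z - U1 z) * F z) z" by (rule F[OF z])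
  have "dzbar U2 z = dz (dzbar U1) z" using dz_dzbar_commute[OF D sd(1)[OF smooth(1)] z] by simp
  also have "\<dots> = dz E z" by (rule dz_cong(1)[OF D z U1_])
  also have "\<dots> = (2 * U1 z - V1 z) * E z" by (rule wirt_dz[OF E[OF z]])
  finally show "wirt U2 (U3 z) ((2 * U1 z - V1 z) * E z) z"
    using smooth_on_wirt[OF sd(1)[OF sd(1)[OF smooth(1)]] z] by simp
  have "dzbar V2 z = dz (dzbar V1) z" using dz_dzbar_commute[OF D sd(1)[OF smooth(2)] z] by simp
  also have "\<dots> = dz F z" by (rule dz_cong(1)[OF D z V1_])
  also have "\<dots> = (2 * V1 z - U1 z) * F z" by (rule wirt_dz[OF F[OF z]])
  finally show "wirt V2 (V3 z) ((2 * V1 z - U1 z) * F z) z"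
    using smooth_on_wirt[OF sd(1)[OF sd(1)[OF smooth(2)]] z] by simp
qed

lemma wirt_U3:
  assumes z: "z \<in> D"
  shows "\<exists>d. wirt U3 d ((2 * U2 z - V2 z) * E z + (2 * U1 z - V1 z)\<^sup>2 * E z) z"
proof -
  note sd = smooth_on_dz(1)[OF D]
  have "wirt (\<lambda>z. (2 * U1 z - V1 z) * E z)
    ((2 * U2 z - V2 z) * E z + (2 * U1 z - V1 z) * ((2 * U1 z - V1 z) * E z))
    ((2 * E z - F z) * E z + (2 * U1 z - V1 z) * (cnj (2 * U1 z - V1 z) * E z)) z"
    by (intro wirt_mult wirt_diff wirt_cmult wirt_U wirt_V z)
  then have "dz (\<lambda>z. (2 * U1 z - V1 z) * E z) z = (2 * U2 z - V2 z) * E z + (2 * U1 z - V1 z)\<^sup>2 * E z"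
    using wirt_dz by (fastforce simp: power2_eq_square mult.assoc)
  moreover have "dzbar U3 z = dz (dzbar U2) z"
    using dz_dzbar_commute[OF D sd[OF sd[OF smooth(1)]] z] by simp
  moreover have "dz (dzbar U2) z = dz (\<lambda>z. (2 * U1 z - V1 z) * E z) z"
    by (rule dz_cong(1)[OF D z]) (rule wirt_dzbar[OF wirt_U(4)])
  ultimately have "dzbar U3 z = (2 * U2 z - V2 z) * E z + (2 * U1 z - V1 z)\<^sup>2 * E z" by simp
  then show ?thesis using smooth_on_wirt[OF sd[OF sd[OF sd[OF smooth(1)]]] z] by metis
qed

lemma W2_holomorphic: "W2 U V holomorphic_on D"
proof (rule wirt_antiholo_zero_imp_holomorphic[OF D])
  fix z assume z: "z \<in> D"
  have "wirt (\<lambda>z. U2 z - (U1 z)\<^sup>2 + V2 z - (V1 z)\<^sup>2 + U1 z * V1 z)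
    (U3 z - 2 * U1 z * U2 z + V3 z - 2 * V1 z * V2 z + (U2 z * V1 z + U1 z * V2 z))
    ((2 * U1 z - V1 z) * E z - 2 * U1 z * E z + (2 * V1 z - U1 z) * F z - 2 * V1 z * F z + (E z * V1 z + U1 z * F z)) z"
    by (intro wirt_mult wirt_diff wirt_add wirt_power2 wirt_U wirt_V z)
  moreover have "(2 * U1 z - V1 z) * E z - 2 * U1 z * E z + (2 * V1 z - U1 z) * F z - 2 * V1 z * F z + (E z * V1 z + U1 z * F z) = 0"
    by (simp add: algebra_simps)
  ultimately show "wirt (W2 U V) (U3 z - 2 * U1 z * U2 z + V3 z - 2 * V1 z * V2 z + (U2 z * V1 z + U1 z * V2 z)) 0 z"
    unfolding W2_def[abs_def] by simp
qed

lemma W3_holomorphic: "W3 U V holomorphic_on D"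
proof -
  have "\<exists>d. wirt (W3 U V) d 0 z" if z: "z \<in> D" for z
  proof -
    obtain d where d: "wirt U3 d ((2 * U2 z - V2 z) * E z + (2 * U1 z - V1 z)\<^sup>2 * E z) z" using wirt_U3[OF z] by blast
    have "wirt (\<lambda>z. U3 z - 2 * U1 z * U2 z + U1 z * V2 z + V1 z * (U1 z)\<^sup>2 - U1 z * (V1 z)\<^sup>2)
      (d - (2 * U2 z * U2 z + 2 * U1 z * U3 z) + (U2 z * V2 z + U1 z * V3 z) + (V2 z * (U1 z)\<^sup>2 + V1 z * (2 * U1 z * U2 z))
        - (U2 z * (V1 z)\<^sup>2 + U1 z * (2 * V1 z * V2 z)))
      (((2 * U2 z - V2 z) * E z + (2 * U1 z - V1 z)\<^sup>2 * E z) - (2 * E z * U2 z + 2 * U1 z * ((2 * U1 z - V1 z) * E z))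
        + (E z * V2 z + U1 z * ((2 * V1 z - U1 z) * F z)) + (F z * (U1 z)\<^sup>2 + V1 z * (2 * U1 z * E z))
        - (E z * (V1 z)\<^sup>2 + U1 z * (2 * V1 z * F z))) z"
      by (intro wirt_mult wirt_diff wirt_add wirt_power2 wirt_cmult wirt_U wirt_V z d)
    moreover have "((2 * U2 z - V2 z) * E z + (2 * U1 z - V1 z)\<^sup>2 * E z) - (2 * E z * U2 z + 2 * U1 z * ((2 * U1 z - V1 z) * E z))
        + (E z * V2 z + U1 z * ((2 * V1 z - U1 z) * F z)) + (F z * (U1 z)\<^sup>2 + V1 z * (2 * U1 z * E z))
        - (E z * (V1 z)\<^sup>2 + U1 z * (2 * V1 z * F z)) = 0"
      by (simp add: algebra_simps power2_eq_square)
    ultimately show ?thesis unfolding W3_def[abs_def] by auto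
  qed
  then obtain d where "\<And>z. z \<in> D \<Longrightarrow> wirt (W3 U V) (d z) 0 z" by metis
  then show ?thesis by (rule wirt_antiholo_zero_imp_holomorphic[OF D])
qed

text \<open>The unit lower triangular factor of the matrix of derivatives of
  \<open>exp (- U)\<close>, with \<open>i - 1\<close> derivatives in \<open>z\<close> and
  \<open>j - 1\<close> in its conjugate; \<open>diag\<close> holds the pivots. The first column
  comes from differentiating \<open>exp (- U)\<close>, the others continue the elimination.\<close>

definition frame :: "3 \<Rightarrow> 3 \<Rightarrow> complex \<Rightarrow> complex" where
  "frame i k z = (if i = k then 1 else if i = 2 \<and> k = 1 then - U1 z else if i = 3 \<and> k = 1 then (U1 z)\<^sup>2 - U2 z
     else if i = 3 \<and> k = 2 then - V1 z else 0)"

text \<open>The pivots. Each is obtained from the previous one through the Toda equations, see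
  \<open>E_diag\<close>, which is the origin of the factors \<open>1/4\<close> and
  \<open>1/16\<close>.\<close>

definition diag :: "3 \<Rightarrow> complex \<Rightarrow> real" where
  "diag k z = (if k = 1 then exp (- u z) else if k = 2 then exp (u z - v z) / 4 else exp (v z) / 16)"

definition gram :: "3 \<Rightarrow> 3 \<Rightarrow> complex \<Rightarrow> complex" where
  "gram i j z = (\<Sum>k\<in>UNIV. frame i k z * cnj (frame j k z) * of_real (diag k z))"

lemma diag_pos: "diag k z > 0"
  by (simp add: diag_def)

lemma gram_cnj: "gram i j z = cnj (gram j i z)"
  by (simp add: gram_def mult_ac)

lemma diag_exp: "complex_of_real (diag 1 z) = exp (- U z)" "complex_of_real (diag 2 z) = exp (U z - V z) / 4"
    "complex_of_real (diag 3 z) = exp (V z) / 16"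
  by (simp_all add: diag_def U V exp_of_real[symmetric])

lemma E_diag: "E z * of_real (diag 1 z) = - of_real (diag 2 z)" "F z * of_real (diag 2 z) = - of_real (diag 3 z)"
  by (simp_all add: E_def F_def diag_exp exp_add[symmetric] mult.assoc[symmetric])

lemma wirt_diag:
  assumes z: "z \<in> D"
  shows "wirt (\<lambda>z. of_real (diag 1 z)) (- U1 z * of_real (diag 1 z)) (- cnj (U1 z) * of_real (diag 1 z)) z"
    "wirt (\<lambda>z. of_real (diag 2 z)) ((U1 z - V1 z) * of_real (diag 2 z)) (cnj (U1 z - V1 z) * of_real (diag 2 z)) z"
    "wirt (\<lambda>z. of_real (diag 3 z)) (V1 z * of_real (diag 3 z)) (cnj (V1 z) * of_real (diag 3 z)) z"
proof -
  have "wirt (\<lambda>z. exp (- U z)) (exp (- U z) * (- U1 z)) (exp (- U z) * (- cnj (U1 z))) z"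
    by (intro wirt_exp wirt_minus wirt_U z)
  then show "wirt (\<lambda>z. of_real (diag 1 z)) (- U1 z * of_real (diag 1 z)) (- cnj (U1 z) * of_real (diag 1 z)) z"
    by (simp add: diag_exp mult.commute)
  have "wirt (\<lambda>z. (1/4) * exp (U z - V z)) ((1/4) * (exp (U z - V z) * (U1 z - V1 z))) ((1/4) * (exp (U z - V z) * (cnj (U1 z) - cnj (V1 z)))) z"
    by (intro wirt_cmult wirt_exp wirt_diff wirt_U wirt_V z)
  then show "wirt (\<lambda>z. of_real (diag 2 z)) ((U1 z - V1 z) * of_real (diag 2 z)) (cnj (U1 z - V1 z) * of_real (diag 2 z)) z"
    by (simp add: diag_exp mult.commute)
  have "wirt (\<lambda>z. (1/16) * exp (V z)) ((1/16) * (exp (V z) * V1 z)) ((1/16) * (exp (V z) * cnj (V1 z))) z"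
    by (intro wirt_cmult wirt_exp wirt_V z)
  then show "wirt (\<lambda>z. of_real (diag 3 z)) (V1 z * of_real (diag 3 z)) (cnj (V1 z) * of_real (diag 3 z)) z"
    by (simp add: diag_exp mult.commute)
qed

lemma frame_simps [simp]: "frame 1 1 z = 1" "frame 1 2 z = 0" "frame 1 3 z = 0" "frame 2 1 z = - U1 z" "frame 2 2 z = 1"
  "frame 2 3 z = 0" "frame 3 1 z = (U1 z)\<^sup>2 - U2 z" "frame 3 2 z = - V1 z" "frame 3 3 z = 1"
  by (simp_all add: frame_def)

lemma wirt_frame:
  assumes z: "z \<in> D"
  shows "\<exists>d. wirt (frame j 1) d (- E z * frame j 2 z) z" "\<exists>d. wirt (frame j 2) d (- F z * frame j 3 z) z"
    "\<exists>d. wirt (frame j 3) d 0 z"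
proof -
  have 1: "wirt (\<lambda>z. - U1 z) (- U2 z) (- E z) z" by (intro wirt_minus wirt_U z)
  have 2: "wirt (\<lambda>z. (U1 z)\<^sup>2 - U2 z) (2 * U1 z * U2 z - U3 z) (2 * U1 z * E z - (2 * U1 z - V1 z) * E z) z"
    by (intro wirt_diff wirt_power2 wirt_U z)
  have 3: "wirt (\<lambda>z. - V1 z) (- V2 z) (- F z) z" by (intro wirt_minus wirt_V z)
  have f: "frame 2 1 = (\<lambda>z. - U1 z)" "frame 3 1 = (\<lambda>z. (U1 z)\<^sup>2 - U2 z)" "frame 3 2 = (\<lambda>z. - V1 z)"
    "frame 1 1 = (\<lambda>z. 1)" "frame 1 2 = (\<lambda>z. 0)" "frame 1 3 = (\<lambda>z. 0)" "frame 2 2 = (\<lambda>z. 1)" "frame 2 3 = (\<lambda>z. 0)" "frame 3 3 = (\<lambda>z. 1)"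
    by auto
  have j: "j = 1 \<or> j = 2 \<or> j = 3" using exhaust_3 by blast
  show "\<exists>d. wirt (frame j 1) d (- E z * frame j 2 z) z"
    using j 1 2 wirt_const[of 1 z] by (elim disjE) (auto simp: f algebra_simps)
  show "\<exists>d. wirt (frame j 2) d (- F z * frame j 3 z) z"
    using j 3 wirt_const[of 1 z] wirt_const[of 0 z] by (elim disjE) (auto simp: f)
  show "\<exists>d. wirt (frame j 3) d 0 z"
    using j wirt_const[of 1 z] wirt_const[of 0 z] by (elim disjE) (auto simp: f)
qed

text \<open>The action of the companion matrix on the row index: a shift, and in the last row the
  differential equation.\<close>

definition dgram :: "3 \<Rightarrow> 3 \<Rightarrow> complex \<Rightarrow> complex" where
  "dgram i j z = (if i = 1 then gram 2 j z else if i = 2 then gram 3 j z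
     else - (W2 U V z * gram 2 j z + W3 U V z * gram 1 j z))"

text \<open>By \<open>E_diag\<close>, the \<open>z\<close>-derivative of a conjugate factor moves
  its term from one pivot to the next. Comparing the coefficients of the conjugate factors leaves
  the companion relations for the rows of \<open>frame\<close>; in the last row these are the
  formulas for \<open>W2\<close> and \<open>W3\<close>.\<close>

lemma gram_dz:
  assumes z: "z \<in> D"
  shows "\<exists>b. wirt (gram i j) (dgram i j z) b z"
proof -
  obtain d1 d2 d3 where p: "wirt (frame j 1) d1 (- E z * frame j 2 z) z" "wirt (frame j 2) d2 (- F z * frame j 3 z) z"
    "wirt (frame j 3) d3 0 z" using wirt_frame[OF z] by metis
  have Er: "cnj (E z) = E z" "cnj (F z) = F z" by (simp_all add: E_def F_def exp_cnj real)
  let ?p1 = "cnj (frame j 1 z)" and ?p2 = "cnj (frame j 2 z)" and ?p3 = "cnj (frame j 3 z)"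
  let ?a = "complex_of_real (diag 1 z)" and ?b = "complex_of_real (diag 2 z)" and ?c = "complex_of_real (diag 3 z)"
  have q: "wirt (\<lambda>z. cnj (frame j 1 z)) (- E z * ?p2) (cnj d1) z" "wirt (\<lambda>z. cnj (frame j 2 z)) (- F z * ?p3) (cnj d2) z"
    "wirt (\<lambda>z. cnj (frame j 3 z)) 0 (cnj d3) z"
    using p[THEN wirt_cnj] by (simp_all add: Er)
  have main: "\<exists>b. wirt (gram i j) ((f1 + c1 * - U1 z) * ?p1 * ?a + (f2 + c2 * (U1 z - V1 z) + c1) * ?p2 * ?b + (f3 + c3 * V1 z + c2) * ?p3 * ?c) b z"
    if "wirt (frame i 1) f1 g1 z" "wirt (frame i 2) f2 g2 z" "wirt (frame i 3) f3 g3 z"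
      "c1 = frame i 1 z" "c2 = frame i 2 z" "c3 = frame i 3 z" for f1 f2 f3 g1 g2 g3 c1 c2 c3
  proof -
    note t = wirt_add[OF wirt_add[OF wirt_mult[OF wirt_mult[OF that(1) q(1)] wirt_diag(1)[OF z]]
            wirt_mult[OF wirt_mult[OF that(2) q(2)] wirt_diag(2)[OF z]]]
          wirt_mult[OF wirt_mult[OF that(3) q(3)] wirt_diag(3)[OF z]]]
    have w: "\<exists>b. wirt (\<lambda>z. frame i 1 z * cnj (frame j 1 z) * of_real (diag 1 z) + frame i 2 z * cnj (frame j 2 z) * of_real (diag 2 z)
        + frame i 3 z * cnj (frame j 3 z) * of_real (diag 3 z))
      (((f1 * ?p1 + c1 * (- E z * ?p2)) * ?a + (c1 * ?p1) * (- U1 z * ?a)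
       + ((f2 * ?p2 + c2 * (- F z * ?p3)) * ?b + (c2 * ?p2) * ((U1 z - V1 z) * ?b)))
       + ((f3 * ?p3 + c3 * 0) * ?c + (c3 * ?p3) * (V1 z * ?c))) b z"
      unfolding that(4-6) by (rule exI, rule t)
    have "((f1 * ?p1 + c1 * (- E z * ?p2)) * ?a + (c1 * ?p1) * (- U1 z * ?a)
       + ((f2 * ?p2 + c2 * (- F z * ?p3)) * ?b + (c2 * ?p2) * ((U1 z - V1 z) * ?b)))
       + ((f3 * ?p3 + c3 * 0) * ?c + (c3 * ?p3) * (V1 z * ?c))
       = (f1 + c1 * - U1 z) * ?p1 * ?a + (f2 + c2 * (U1 z - V1 z)) * ?p2 * ?b + (f3 + c3 * V1 z) * ?p3 * ?c
        - c1 * ?p2 * (E z * ?a) - c2 * ?p3 * (F z * ?b)"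
      by (simp add: algebra_simps)
    also have "\<dots> = (f1 + c1 * - U1 z) * ?p1 * ?a + (f2 + c2 * (U1 z - V1 z) + c1) * ?p2 * ?b + (f3 + c3 * V1 z + c2) * ?p3 * ?c"
      unfolding E_diag by (simp add: algebra_simps)
    finally have v: "((f1 * ?p1 + c1 * (- E z * ?p2)) * ?a + (c1 * ?p1) * (- U1 z * ?a)
       + ((f2 * ?p2 + c2 * (- F z * ?p3)) * ?b + (c2 * ?p2) * ((U1 z - V1 z) * ?b)))
       + ((f3 * ?p3 + c3 * 0) * ?c + (c3 * ?p3) * (V1 z * ?c))
       = (f1 + c1 * - U1 z) * ?p1 * ?a + (f2 + c2 * (U1 z - V1 z) + c1) * ?p2 * ?b + (f3 + c3 * V1 z + c2) * ?p3 * ?c" .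
    have g: "gram i j = (\<lambda>z. frame i 1 z * cnj (frame j 1 z) * of_real (diag 1 z) + frame i 2 z * cnj (frame j 2 z) * of_real (diag 2 z)
        + frame i 3 z * cnj (frame j 3 z) * of_real (diag 3 z))"
      by (rule ext) (simp add: gram_def sum_3)
    show ?thesis using w unfolding g v .
  qed
  have f: "frame 2 1 = (\<lambda>z. - U1 z)" "frame 3 1 = (\<lambda>z. (U1 z)\<^sup>2 - U2 z)" "frame 3 2 = (\<lambda>z. - V1 z)"
    "frame 1 1 = (\<lambda>z. 1)" "frame 1 2 = (\<lambda>z. 0)" "frame 1 3 = (\<lambda>z. 0)" "frame 2 2 = (\<lambda>z. 1)" "frame 2 3 = (\<lambda>z. 0)" "frame 3 3 = (\<lambda>z. 1)"
    by auto
  have f1: "wirt (frame 2 1) (- U2 z) (- E z) z" unfolding f by (intro wirt_minus wirt_U z)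
  have f2: "wirt (frame 3 1) (2 * U1 z * U2 z - U3 z) (2 * U1 z * E z - (2 * U1 z - V1 z) * E z) z"
    unfolding f by (intro wirt_diff wirt_power2 wirt_U z)
  have f3: "wirt (frame 3 2) (- V2 z) (- F z) z" unfolding f by (intro wirt_minus wirt_V z)
  have fc: "wirt (frame 1 1) 0 0 z" "wirt (frame 1 2) 0 0 z" "wirt (frame 1 3) 0 0 z" "wirt (frame 2 2) 0 0 z" "wirt (frame 2 3) 0 0 z" "wirt (frame 3 3) 0 0 z"
    unfolding f by (rule wirt_const)+
  have g: "gram k j z = frame k 1 z * ?p1 * ?a + frame k 2 z * ?p2 * ?b + frame k 3 z * ?p3 * ?c" for k
    by (simp add: gram_def sum_3)
  consider "i = 1" | "i = 2" | "i = 3" using exhaust_3 by blast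
  then show ?thesis
  proof cases
    case 1
    have "dgram 1 j z = (0 + 1 * - U1 z) * ?p1 * ?a + (0 + 0 * (U1 z - V1 z) + 1) * ?p2 * ?b + (0 + 0 * V1 z + 0) * ?p3 * ?c"
      by (simp add: dgram_def g)
    then show ?thesis using main[of 0 0 0 0 0 0 1 0 0] fc unfolding 1 by simp
  next
    case 2
    have "dgram 2 j z = (- U2 z + - U1 z * - U1 z) * ?p1 * ?a + (0 + 1 * (U1 z - V1 z) + - U1 z) * ?p2 * ?b + (0 + 0 * V1 z + 1) * ?p3 * ?c"
      by (simp add: dgram_def g power2_eq_square)
    then show ?thesis using main[of "- U2 z" "- E z" 0 0 0 0 "- U1 z" 1 0] fc f1 unfolding 2 by simp
  next
    case 3
    have "dgram 3 j z = (2 * U1 z * U2 z - U3 z + ((U1 z)\<^sup>2 - U2 z) * - U1 z) * ?p1 * ?a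
        + (- V2 z + - V1 z * (U1 z - V1 z) + ((U1 z)\<^sup>2 - U2 z)) * ?p2 * ?b + (0 + 1 * V1 z + - V1 z) * ?p3 * ?c"
      by (simp add: dgram_def g W2_def W3_def power2_eq_square algebra_simps)
    then show ?thesis
      using main[of "2 * U1 z * U2 z - U3 z" "2 * U1 z * E z - (2 * U1 z - V1 z) * E z" "- V2 z" "- F z" 0 0 "(U1 z)\<^sup>2 - U2 z" "- V1 z" 1] fc f2 f3
      unfolding 3 by simp
  qed
qed

text \<open>The antiholomorphic derivative follows from the holomorphic one by Hermitian
  symmetry.\<close>

lemma wirt_gram:
  assumes z: "z \<in> D"
  shows "wirt (gram i j) (dgram i j z) (cnj (dgram j i z)) z"
proof -
  obtain b b' where b: "wirt (gram i j) (dgram i j z) b z" "wirt (gram j i) (dgram j i z) b' z"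
    using gram_dz[OF z] by metis
  have "gram i j = (\<lambda>z. cnj (gram j i z))" using gram_cnj by blast
  then have "wirt (gram i j) (cnj b') (cnj (dgram j i z)) z" using wirt_cnj[OF b(2)] by simp
  then show ?thesis using b(1) wirt_unique by metis
qed

abbreviation "ode \<equiv> ode3 D (W2 U V) (W3 U V)"

definition djet :: "(complex \<Rightarrow> complex) \<Rightarrow> 3 \<Rightarrow> complex \<Rightarrow> complex" where
  "djet y i z = (if i = 1 then jet y z $ 2 else if i = 2 then jet y z $ 3 else - (W2 U V z * jet y z $ 2 + W3 U V z * jet y z $ 1))"

definition defect :: "(3 \<Rightarrow> complex \<Rightarrow> complex) \<Rightarrow> 3 \<Rightarrow> 3 \<Rightarrow> complex \<Rightarrow> complex" where
  "defect Y i j z = gram i j z - (\<Sum>k\<in>UNIV. jet (Y k) z $ i * cnj (jet (Y k) z $ j))"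

lemma wirt_defect:
  assumes Y: "\<And>k. ode (Y k)" and z: "z \<in> D"
  defines "d \<equiv> (\<lambda>i j. if i = 1 then defect Y 2 j z else if i = (2::3) then defect Y 3 j z
     else - (W2 U V z * defect Y 2 j z + W3 U V z * defect Y 1 j z))"
  shows "wirt (defect Y i j) (d i j) (cnj (d j i)) z"
proof -
  have j: "((\<lambda>z. jet (Y k) z $ i) has_field_derivative djet (Y k) i z) (at z)" for k i
    using exhaust_3[of i] ode3_derivs[OF D Y z, of k] by (auto simp: djet_def)
  have "wirt (\<lambda>z. gram i j z - (\<Sum>k\<in>UNIV. jet (Y k) z $ i * cnj (jet (Y k) z $ j)))
    (dgram i j z - (\<Sum>k\<in>UNIV. djet (Y k) i z * cnj (jet (Y k) z $ j) + jet (Y k) z $ i * cnj 0))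
    (cnj (dgram j i z) - (\<Sum>k\<in>UNIV. 0 * cnj (jet (Y k) z $ j) + jet (Y k) z $ i * cnj (djet (Y k) j z))) z"
    by (intro wirt_diff wirt_sum wirt_mult wirt_cnj wirt_holomorphic j wirt_gram z)
  moreover have A: "d i j = dgram i j z - (\<Sum>k\<in>UNIV. djet (Y k) i z * cnj (jet (Y k) z $ j) + jet (Y k) z $ i * cnj 0)" for i j
    using exhaust_3[of i] by (auto simp: d_def defect_def dgram_def djet_def sum_3 algebra_simps)
  moreover have "cnj (d j i) = cnj (dgram j i z) - (\<Sum>k\<in>UNIV. 0 * cnj (jet (Y k) z $ j) + jet (Y k) z $ i * cnj (djet (Y k) j z))"
    unfolding A by (simp add: sum_3 mult_ac)
  ultimately show ?thesis unfolding defect_def[abs_def] by simp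
qed

lemma defect_zero_propagates:
  assumes conn: "connected D" and Y: "\<And>k. ode (Y k)" and z0: "z0 \<in> D" "\<And>i j. defect Y i j z0 = 0" and z: "z \<in> D"
  shows "defect Y i j z = 0"
proof -
  define d where "d = (\<lambda>i j z. if i = 1 then defect Y 2 j z else if i = (2::3) then defect Y 3 j z
     else - (W2 U V z * defect Y 2 j z + W3 U V z * defect Y 1 j z))"
  define X where "X = (\<lambda>(i, j). defect Y i j)"
  define C where "C = (\<lambda>z. 2 * (1 + norm (W2 U V z) + norm (W3 U V z)))"
  have "X (i, j) z = 0"
  proof (rule zero_propagation[OF D conn, where I = UNIV and X = X and C = C and ?z0.0 = z0
        and X' = "\<lambda>(i, j) z h. d i j z * h + cnj (d j i z) * cnj h"])
    fix p :: "3 \<times> 3" and w assume w: "w \<in> D"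
    obtain a b where p: "p = (a, b)" by fastforce
    show "(X p has_derivative (case p of (i, j) \<Rightarrow> \<lambda>z h. d i j z * h + cnj (d j i z) * cnj h) w) (at w)"
      using wirt_defect[OF Y w, where i = a and j = b] unfolding p X_def d_def wirt_def by simp
    fix h
    let ?S = "\<Sum>q\<in>UNIV. norm (X q w)"
    have S: "norm (defect Y k l w) \<le> ?S" for k l
      using member_le_sum[of "(k, l)" UNIV "\<lambda>q. norm (X q w)"] by (simp add: X_def)
    have S0: "?S \<ge> 0" by (simp add: sum_nonneg)
    have dn: "norm (d k l w) \<le> (1 + norm (W2 U V w) + norm (W3 U V w)) * ?S" for k l
    proof -
      have 1: "norm (defect Y m l w) \<le> (1 + norm (W2 U V w) + norm (W3 U V w)) * ?S" for m
      proof -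
        have "1 * ?S \<le> (1 + norm (W2 U V w) + norm (W3 U V w)) * ?S" by (intro mult_right_mono S0) simp
        then show ?thesis using S[of m l] by simp
      qed
      have "norm (W2 U V w * defect Y 2 l w + W3 U V w * defect Y 1 l w) \<le> norm (W2 U V w) * ?S + norm (W3 U V w) * ?S"
        by (intro order_trans[OF norm_triangle_ineq] add_mono) (auto simp: norm_mult intro!: mult_left_mono S)
      also have "\<dots> \<le> (1 + norm (W2 U V w) + norm (W3 U V w)) * ?S" using S0 by (simp add: algebra_simps)
      finally have 2: "norm (- (W2 U V w * defect Y 2 l w + W3 U V w * defect Y 1 l w)) \<le> (1 + norm (W2 U V w) + norm (W3 U V w)) * ?S"
        by (simp only: norm_minus_cancel)
      show ?thesis unfolding d_def using 1 2 by (simp del: minus_add_distrib)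
    qed
    have "norm (d a b w * h + cnj (d b a w) * cnj h) \<le> norm (d a b w) * norm h + norm (d b a w) * norm h"
      by (rule order_trans[OF norm_triangle_ineq]) (simp add: norm_mult)
    also have "\<dots> \<le> (1 + norm (W2 U V w) + norm (W3 U V w)) * ?S * norm h + (1 + norm (W2 U V w) + norm (W3 U V w)) * ?S * norm h"
      by (intro add_mono mult_right_mono dn) auto
    also have "\<dots> = C w * ?S * norm h" by (simp add: C_def algebra_simps)
    finally show "norm ((case p of (i, j) \<Rightarrow> \<lambda>z h. d i j z * h + cnj (d j i z) * cnj h) w h) \<le> C w * ?S * norm h"
      by (simp add: p)
  next
    show "continuous_on D C" unfolding C_def
      by (intro continuous_intros holomorphic_on_imp_continuous_on W2_holomorphic W3_holomorphic)
    fix p show "X p z0 = 0" by (cases p) (simp add: X_def z0)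
  qed (use z0 z in auto)
  then show ?thesis by (simp add: X_def)
qed

lemma defect_eq_diag:
  assumes "\<And>i j. defect Y i j z = 0"
  shows "of_real (exp (- u z)) = (\<Sum>k\<in>UNIV. Y k z * cnj (Y k z))"
    "(\<Sum>k\<in>UNIV. jet (Y k) z $ i * cnj (jet (Y k) z $ j)) = gram i j z"
  using assms[of 1 1] assms[of i j] by (auto simp: defect_def gram_def sum_3 diag_def)

text \<open>The initial jets at \<open>a\<close> are the columns of \<open>frame\<close> scaled by
  the square roots of the pivots, that is, a square root of the Gram matrix. Hence the defect
  vanishes at \<open>a\<close>, and the Wronskian is the product of the three roots.\<close>

lemma exists_representation:
  assumes star: "a \<in> D" "\<And>z. z \<in> D \<Longrightarrow> closed_segment a z \<subseteq> D" and conn: "connected D"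
  obtains Y where "\<And>k. ode (Y k)" "\<And>i j z. z \<in> D \<Longrightarrow> defect Y i j z = 0" "\<And>z. z \<in> D \<Longrightarrow> wronsk Y z = 1 / 8"
proof -
  have "\<exists>y. ode y \<and> jet y a = (\<chi> i. frame i k a * of_real (sqrt (diag k a)))" for k
    by (rule ode3_exists_star[OF D star W2_holomorphic W3_holomorphic])
  then obtain Y where Y: "\<And>k. ode (Y k)" "\<And>k. jet (Y k) a = (\<chi> i. frame i k a * of_real (sqrt (diag k a)))" by metis
  have da: "defect Y i j a = 0" for i j
  proof -
    have sq: "of_real (sqrt (diag k a)) * of_real (sqrt (diag k a)) = complex_of_real (diag k a)" for k
      using diag_pos[of k a] by (simp flip: of_real_mult)
    have "jet (Y k) a $ i * cnj (jet (Y k) a $ j) = frame i k a * cnj (frame j k a) * of_real (diag k a)" for k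
      unfolding Y(2) sq[symmetric] by simp
    then show ?thesis unfolding defect_def gram_def by simp
  qed
  have d: "defect Y i j z = 0" if "z \<in> D" for i j z
    by (rule defect_zero_propagates[where Y = Y, OF conn Y(1) star(1) da that])
  have "wronsk Y a = of_real (sqrt (diag 1 a) * sqrt (diag 2 a) * sqrt (diag 3 a))"
    by (simp add: wronsk_def jetmat_def det_3 Y(2))
  also have "sqrt (diag 1 a) * sqrt (diag 2 a) * sqrt (diag 3 a) = sqrt (diag 1 a * diag 2 a * diag 3 a)"
    by (simp add: real_sqrt_mult)
  also have "diag 1 a * diag 2 a * diag 3 a = (1/8)\<^sup>2"
    by (simp add: diag_def exp_minus exp_diff field_simps power2_eq_square)
  also have "sqrt ((1/8)\<^sup>2) = (1/8::real)" by (rule real_sqrt_unique) auto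
  finally have "wronsk Y a = 1 / 8" by simp
  then have "wronsk Y z = 1 / 8" if "z \<in> D" for z
    using wronsk_constant[OF D conn Y(1) that star(1)] by simp
  then show thesis using that Y(1) d by blast
qed

lemma defect_extends:
  assumes conn: "connected D" and Y: "\<And>k. ode (Y k)" "\<And>k. ode (Y' k)"
    and d: "\<And>i j. defect Y' i j z0 = 0" and z0: "z0 \<in> D" "\<And>k. jet (Y k) z0 = jet (Y' k) z0" and z: "z \<in> D"
  shows "defect Y i j z = 0"
  by (rule defect_zero_propagates[OF conn Y(1) z0(1) _ z]) (use d in \<open>simp add: defect_def z0\<close>)

text \<open>The leading 2 by 2 minor of the Gram matrix is the product of the first two pivots; by
  the Cauchy-Binet formula it is also the sum of the squared moduli of the minors of the
  jets.\<close>

lemma minors_sum: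
  assumes "\<And>i j. defect Y i j z = 0"
  shows "of_real (exp (- v z) / 4) = (\<Sum>(i, j)\<in>{(1,2),(1,3),(2,3)}. (Y i z * deriv (Y j) z - Y j z * deriv (Y i) z) * cnj (Y i z * deriv (Y j) z - Y j z * deriv (Y i) z))"
proof -
  have g: "gram i j z = (\<Sum>k\<in>UNIV. jet (Y k) z $ i * cnj (jet (Y k) z $ j))" for i j
    using assms[of i j] by (simp add: defect_def)
  have "gram 1 1 z * gram 2 2 z - gram 1 2 z * gram 2 1 z = of_real (diag 1 z * diag 2 z)"
    by (simp add: gram_def sum_3 algebra_simps)
  also have "diag 1 z * diag 2 z = exp (- v z) / 4" by (simp add: diag_def exp_diff exp_minus field_simps)
  finally have e: "gram 1 1 z * gram 2 2 z - gram 1 2 z * gram 2 1 z = of_real (exp (- v z) / 4)" .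
  show ?thesis unfolding e[symmetric] by (simp add: g sum_3 algebra_simps)
qed

end

section \<open>Local structure at the singular point\<close>

text \<open>Unlike \<open>powr\<close>, this power is nonzero also at \<open>0\<close>, so division
  by it needs no side condition; off \<open>0\<close> the two agree.\<close>

definition cpow :: "real \<Rightarrow> complex \<Rightarrow> complex" where
  "cpow s z = exp (of_real s * Ln z)"

lemma cpow_nonzero [simp]: "cpow s z \<noteq> 0"
  by (simp add: cpow_def)

lemma cpow_add: "cpow (s + t) z = cpow s z * cpow t z"
  by (simp add: cpow_def distrib_right exp_add)

lemma cpow_of_nat: "z \<noteq> 0 \<Longrightarrow> cpow (real n) z = z ^ n"
  by (simp add: cpow_def exp_of_nat_mult)

lemma cpow_minus_1: "z \<noteq> 0 \<Longrightarrow> cpow (s - 1) z = cpow s z / z"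
  using cpow_add[of "s - 1" 1 z] cpow_of_nat[of z 1] by (simp add: field_simps)

lemma norm_cpow: "z \<noteq> 0 \<Longrightarrow> norm (cpow s z) = norm z powr s"
  by (simp add: cpow_def powr_def)

lemma cpow_powr: "z \<noteq> 0 \<Longrightarrow> cpow s z = z powr of_real s"
  by (simp add: cpow_def powr_def)

lemma cpow_derivative:
  assumes "z \<notin> \<real>\<^sub>\<le>\<^sub>0"
  shows "(cpow s has_field_derivative of_real s * cpow (s - 1) z) (at z)"
proof -
  have z: "z \<noteq> 0" using assms by auto
  have "(cpow s has_field_derivative exp (of_real s * Ln z) * (of_real s * inverse z)) (at z)"
    unfolding cpow_def[abs_def] using assms by (auto intro!: derivative_eq_intros)
  moreover have "exp (of_real s * Ln z) * (of_real s * inverse z) = of_real s * cpow (s - 1) z"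
    unfolding cpow_minus_1[OF z] by (simp add: cpow_def divide_inverse)
  ultimately show ?thesis by simp
qed

lemma slit_ball_facts:
  "open (slit_ball r)" "slit_ball r \<subseteq> ball 0 r" "z \<in> slit_ball r \<Longrightarrow> z \<noteq> 0" "z \<in> slit_ball r \<Longrightarrow> z \<notin> \<real>\<^sub>\<le>\<^sub>0"
  "z \<in> slit_ball r \<longleftrightarrow> norm z < r \<and> z \<notin> \<real>\<^sub>\<le>\<^sub>0"
  by (auto simp: slit_ball_def open_Diff)

lemma slit_ball_star:
  assumes "0 < t" "t < r"
  shows "of_real t \<in> slit_ball r" "z \<in> slit_ball r \<Longrightarrow> closed_segment (of_real t) z \<subseteq> slit_ball r"
proof -
  show "of_real t \<in> slit_ball r" using assms by (simp add: slit_ball_facts(5))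
  assume z: "z \<in> slit_ball r"
  show "closed_segment (of_real t) z \<subseteq> slit_ball r"
  proof
    fix w assume w: "w \<in> closed_segment (of_real t) z"
    then have "w \<in> ball 0 r" using z assms closed_segment_subset[of "of_real t" "ball 0 r" z] by (auto simp: slit_ball_def)
    moreover have "w \<notin> \<real>\<^sub>\<le>\<^sub>0"
    proof
      assume wn: "w \<in> \<real>\<^sub>\<le>\<^sub>0"
      obtain s where s: "0 \<le> s" "s \<le> 1" "w = (1 - s) *\<^sub>R of_real t + s *\<^sub>R z" using w by (auto simp: closed_segment_def)
      have re: "Re w = (1 - s) * t + s * Re z" "Im w = s * Im z" using s by auto
      show False
      proof (cases "s = 0")
        case True then show False using wn re assms by (auto simp: complex_nonpos_Reals_iff)
      next
        case False
        then have "Im z = 0" using wn re by (auto simp: complex_nonpos_Reals_iff)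
        then have "Re z > 0" using z by (auto simp: slit_ball_def complex_nonpos_Reals_iff not_le)
        then have "Re w > 0" using re assms False s by (auto intro!: add_nonneg_pos mult_nonneg_nonneg mult_pos_pos)
        then show False using wn by (auto simp: complex_nonpos_Reals_iff)
      qed
    qed
    ultimately show "w \<in> slit_ball r" by (simp add: slit_ball_def)
  qed
qed

lemma slit_ball_connected: "connected (slit_ball r)"
proof (cases "r > 0")
  case True
  then have "starlike (slit_ball r)"
    using slit_ball_star[of "r/2" r] unfolding starlike_def by fastforce
  then show ?thesis by (rule starlike_imp_connected)
next
  case False
  then have "ball (0::complex) r = {}" by simp
  then have "slit_ball r = {}" unfolding slit_ball_def by (simp only: empty_Diff)
  then show ?thesis by simp
qed

definition power_form :: "real \<Rightarrow> real \<Rightarrow> (complex \<Rightarrow> complex) \<Rightarrow> (complex \<Rightarrow> complex) \<Rightarrow> bool" where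
  "power_form r s h y \<longleftrightarrow> h holomorphic_on ball 0 r \<and> (\<forall>z\<in>slit_ball r. y z = cpow s z * h z)"

text \<open>The operator \<open>s + z d/dz\<close>: differentiating the product of \<open>h\<close>
  with the power of exponent \<open>s\<close> lowers the exponent by one and replaces
  \<open>h\<close> by \<open>euler s h\<close>.\<close>

definition euler :: "real \<Rightarrow> (complex \<Rightarrow> complex) \<Rightarrow> complex \<Rightarrow> complex" where
  "euler s h z = of_real s * h z + z * deriv h z"

lemma euler_holomorphic: "h holomorphic_on ball 0 r \<Longrightarrow> euler s h holomorphic_on ball 0 r"
  unfolding euler_def[abs_def] by (auto intro!: holomorphic_intros holomorphic_deriv)

lemma power_form_deriv:
  assumes "power_form r s h y"
  shows "power_form r (s - 1) (euler s h) (deriv y)"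
proof -
  have "deriv y z = cpow (s - 1) z * euler s h z" if z: "z \<in> slit_ball r" for z
  proof -
    have z': "z \<in> ball 0 r" "z \<noteq> 0" "z \<notin> \<real>\<^sub>\<le>\<^sub>0" using z slit_ball_facts by auto
    have "deriv y z = deriv (\<lambda>z. cpow s z * h z) z"
      by (rule deriv_cong_open[OF slit_ball_facts(1) z]) (use assms in \<open>auto simp: power_form_def\<close>)
    also have "\<dots> = of_real s * cpow (s - 1) z * h z + deriv h z * cpow s z"
      by (rule DERIV_imp_deriv, rule DERIV_mult[OF cpow_derivative[OF z'(3)] holomorphic_derivI[of h "ball 0 r"]])
        (use assms z' in \<open>auto simp: power_form_def\<close>)
    also have "\<dots> = cpow (s - 1) z * euler s h z" using z'(2) by (simp add: euler_def cpow_minus_1 field_simps)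
    finally show ?thesis .
  qed
  then show ?thesis using assms euler_holomorphic by (auto simp: power_form_def)
qed

text \<open>Away from 0 the cofactor is the quotient \<open>g z / z ^ n\<close>, which extends the
  local factorization to the whole ball. The bound \<open>n \<ge> 1\<close> records the progress
  made by one elimination in \<open>echelon\<close>.\<close>

lemma order_factorization:
  assumes g: "g holomorphic_on ball 0 r" and r: "r > 0" and nz: "\<exists>z\<in>ball 0 r. g z \<noteq> 0"
  shows "\<exists>n h. h holomorphic_on ball 0 r \<and> h 0 \<noteq> 0 \<and> (\<forall>z\<in>ball 0 r. g z = z ^ n * h z) \<and> (g 0 = 0 \<longrightarrow> n \<ge> 1)"
proof (cases "g 0 = 0")
  case False
  then show ?thesis using g by (intro exI[of _ 0] exI[of _ g]) auto
next
  case True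
  have nc: "\<not> g constant_on ball 0 r" using nz True r unfolding constant_on_def by (metis centre_in_ball)
  obtain k d n where n: "0 < n" "0 < d" "ball (0::complex) d \<subseteq> ball 0 r" "k holomorphic_on ball 0 d"
    "\<And>w. w \<in> ball 0 d \<Longrightarrow> g w = (w - 0) ^ n * k w" "\<And>w. w \<in> ball 0 d \<Longrightarrow> k w \<noteq> 0"
    by (rule holomorphic_factor_zero_nonconstant[OF g open_ball connected_ball centre_in_ball[THEN iffD2, OF r] True nc]) (rule that, assumption+)
  define h where "h = (\<lambda>z. if z \<in> ball 0 d then k z else g z / z ^ n)"
  have eq: "h z = g z / z ^ n" if "z \<noteq> 0" for z using that n(5)[of z] by (auto simp: h_def)
  have "h holomorphic_on ball 0 d \<union> (ball 0 r - {0})"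
  proof (rule holomorphic_on_Un)
    show "h holomorphic_on ball 0 d" by (rule holomorphic_transform[OF n(4)]) (simp add: h_def)
    have "(\<lambda>z. g z / z ^ n) holomorphic_on ball 0 r - {0}"
      by (auto intro!: holomorphic_intros holomorphic_on_subset[OF g])
    then show "h holomorphic_on ball 0 r - {0}" by (rule holomorphic_transform) (use eq in auto)
  qed auto
  moreover have "ball 0 d \<union> (ball 0 r - {0}) = ball (0::complex) r"
  proof -
    have "(0::complex) \<in> ball 0 d" using n(2) by simp
    then show ?thesis using n(3) by blast
  qed
  ultimately have "h holomorphic_on ball 0 r" by simp
  moreover have "h 0 \<noteq> 0" using n(6)[of 0] n(2) by (simp add: h_def)
  moreover have "g z = z ^ n * h z" for z using eq[of z] True n(1) by (cases "z = 0") auto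
  ultimately show ?thesis using n(1) by (intro exI[of _ n] exI[of _ h]) auto
qed

lemma Ln_minus_cases: "Im z < 0 \<Longrightarrow> Ln z = Ln (- z) - \<i> * of_real pi" "Im z > 0 \<Longrightarrow> Ln z = Ln (- z) + \<i> * of_real pi"
  using Ln_minus[of z] by (cases "z = 0"; auto)+

text \<open>The branch cut along the positive reals that continues \<open>cpow s\<close> from the
  lower half plane; in the upper half plane it carries the monodromy factor.\<close>

definition lower_branch :: "real \<Rightarrow> complex \<Rightarrow> complex" where
  "lower_branch s z = exp (of_real s * (Ln (- z) - \<i> * of_real pi))"

lemma lower_branch_eq: "Im z < 0 \<Longrightarrow> lower_branch s z = cpow s z"
  "Im z > 0 \<Longrightarrow> lower_branch s z = exp (- (2 * \<i> * of_real pi * of_real s)) * cpow s z"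
proof -
  show "lower_branch s z = cpow s z" if "Im z < 0"
    unfolding lower_branch_def cpow_def Ln_minus_cases(1)[OF that] by simp
  show "lower_branch s z = exp (- (2 * \<i> * of_real pi * of_real s)) * cpow s z" if "Im z > 0"
    unfolding lower_branch_def cpow_def Ln_minus_cases(2)[OF that] exp_add[symmetric] by (simp add: algebra_simps)
qed

lemma lower_branch_nonzero [simp]: "lower_branch s z \<noteq> 0"
  by (simp add: lower_branch_def)

lemma lower_branch_holomorphic: "lower_branch s holomorphic_on - \<real>\<^sub>\<ge>\<^sub>0"
  unfolding lower_branch_def[abs_def]
  by (auto intro!: holomorphic_intros simp: complex_nonpos_Reals_iff complex_nonneg_Reals_iff)

lemma norm_lower_branch: "z \<noteq> 0 \<Longrightarrow> norm (lower_branch s z) = norm z powr s"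
  by (simp add: lower_branch_def powr_def)

lemma unit_exp: "norm \<mu> = 1 \<Longrightarrow> \<exists>\<theta>. \<mu> = exp (- (2 * \<i> * of_real pi * of_real \<theta>))"
proof -
  assume "norm \<mu> = 1"
  then have "\<mu> = exp (\<i> * of_real (Arg \<mu>))" using Arg_eq[of \<mu>] by (metis mult_1 norm_zero of_real_1 zero_neq_one)
  then show ?thesis by (intro exI[of _ "- Arg \<mu> / (2 * pi)"]) simp
qed

text \<open>Dividing by a power whose monodromy factor is \<open>\<mu>\<close> merges the two
  branches into one function on the punctured disc. The growth bound leaves at most a pole, and its
  order, or the order of vanishing, completes the exponent.\<close>

lemma monodromy_eigenfunction_power_form:
  assumes r: "r > 0"
    and y: "y holomorphic_on slit_ball r" and y': "y' holomorphic_on (ball 0 r - \<real>\<^sub>\<ge>\<^sub>0)"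
    and low: "\<And>z. z \<in> ball 0 r \<Longrightarrow> Im z < 0 \<Longrightarrow> y' z = y z"
    and up: "\<And>z. z \<in> ball 0 r \<Longrightarrow> Im z > 0 \<Longrightarrow> y' z = \<mu> * y z" and \<mu>: "norm \<mu> = 1"
    and growth: "\<delta> > 0" "\<And>z. z \<in> slit_ball r \<Longrightarrow> norm z < \<delta> \<Longrightarrow> norm (y z) \<le> C * norm z powr s"
      "\<And>z. z \<in> ball 0 r - \<real>\<^sub>\<ge>\<^sub>0 \<Longrightarrow> norm z < \<delta> \<Longrightarrow> norm (y' z) \<le> C * norm z powr s"
    and nz: "\<exists>z\<in>slit_ball r. y z \<noteq> 0"
  shows "\<exists>\<rho> h. power_form r \<rho> h y \<and> h 0 \<noteq> 0"
proof -
  obtain \<theta> where \<theta>: "\<mu> = exp (- (2 * \<i> * of_real pi * of_real \<theta>))" using unit_exp[OF \<mu>] by blast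
  define H where "H = (\<lambda>z. if z \<in> slit_ball r then y z / cpow \<theta> z else y' z / lower_branch \<theta> z)"
  have H1: "H z = y z / cpow \<theta> z" if "z \<in> slit_ball r" for z using that by (simp add: H_def)
  have H2: "H z = y' z / lower_branch \<theta> z" if z: "z \<in> ball 0 r - \<real>\<^sub>\<ge>\<^sub>0" for z
  proof (cases "z \<in> slit_ball r")
    case True
    then have "Im z \<noteq> 0" using z by (auto simp: slit_ball_def complex_nonpos_Reals_iff complex_nonneg_Reals_iff)
    then consider "Im z < 0" | "Im z > 0" by linarith
    then show ?thesis
    proof cases
      case 1 then show ?thesis using low[of z] z True by (simp add: H_def lower_branch_eq)
    next
      case 2 then show ?thesis using up[of z] z True by (simp add: H_def lower_branch_eq \<theta>)
    qed
  qed (simp add: H_def)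
  have un: "ball 0 r - {0} = slit_ball r \<union> (ball 0 r - \<real>\<^sub>\<ge>\<^sub>0)"
    by (auto simp: slit_ball_def complex_nonpos_Reals_iff complex_nonneg_Reals_iff complex_eq_iff)
  have "H holomorphic_on ball 0 r - {0}" unfolding un
  proof (rule holomorphic_on_Un)
    have "cpow \<theta> holomorphic_on slit_ball r"
      unfolding holomorphic_on_open[OF slit_ball_facts(1)] using cpow_derivative slit_ball_facts(4) by blast
    then have "(\<lambda>z. y z / cpow \<theta> z) holomorphic_on slit_ball r" using y by (intro holomorphic_intros) auto
    then show "H holomorphic_on slit_ball r" by (rule holomorphic_transform) (simp add: H1)
    have "(\<lambda>z. y' z / lower_branch \<theta> z) holomorphic_on (ball 0 r - \<real>\<^sub>\<ge>\<^sub>0)"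
      using y' by (intro holomorphic_intros holomorphic_on_subset[OF lower_branch_holomorphic]) auto
    then show "H holomorphic_on (ball 0 r - \<real>\<^sub>\<ge>\<^sub>0)" by (rule holomorphic_transform) (simp add: H2)
  qed (auto simp: slit_ball_facts open_Diff)
  note Hh = this
  \<comment> \<open>\<open>k\<close> clears the pole; the further factor \<open>z\<close> in
    \<open>g\<close> below makes the product tend to 0, so that the singularity is removed with a
    known value.\<close>
  obtain k :: nat where k: "\<theta> - s \<le> real k" using real_arch_simple by blast
  have Hb: "norm (H z) \<le> C * norm z powr (s - \<theta>)" if z: "z \<in> ball 0 r - {0}" "norm z < \<delta>" for z
  proof -
    have z0: "z \<noteq> 0" using z by simp
    have *: "norm (a / b) \<le> C * norm z powr (s - \<theta>)" if "norm a \<le> C * norm z powr s" "norm b = norm z powr \<theta>" for a b :: complex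
      using that z0 by (simp add: norm_divide powr_diff divide_right_mono)
    show ?thesis
    proof (cases "z \<in> slit_ball r")
      case True
      show ?thesis unfolding H1[OF True] by (rule *[OF growth(2)[OF True z(2)] norm_cpow[OF z0]])
    next
      case False
      then have z': "z \<in> ball 0 r - \<real>\<^sub>\<ge>\<^sub>0" using un z by blast
      show ?thesis unfolding H2[OF z'] by (rule *[OF growth(3)[OF z' z(2)] norm_lower_branch[OF z0]])
    qed
  qed
  define g where "g = (\<lambda>z. z ^ (k + 1) * H z)"
  have "(g \<longlongrightarrow> 0) (at 0)"
  proof (rule Lim_null_comparison)
    show "\<forall>\<^sub>F z in at 0. norm (g z) \<le> \<bar>C\<bar> * norm z"
      unfolding eventually_at
    proof (intro exI conjI ballI impI)
      show "0 < min 1 (min r \<delta>)" using r growth(1) by simp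
      fix z :: complex assume "z \<noteq> 0 \<and> dist z 0 < min 1 (min r \<delta>)"
      then have z: "z \<in> ball 0 r - {0}" "norm z < \<delta>" "norm z < 1" "norm z > 0" by auto
      have "norm (g z) \<le> norm z ^ (k + 1) * (C * norm z powr (s - \<theta>))"
        unfolding g_def norm_mult norm_power by (intro mult_left_mono Hb z) simp
      also have "\<dots> \<le> norm z ^ (k + 1) * (\<bar>C\<bar> * norm z powr (s - \<theta>))" by (intro mult_left_mono mult_right_mono) auto
      also have "\<dots> = \<bar>C\<bar> * norm z * (norm z powr real k * norm z powr (s - \<theta>))" using z by (simp add: powr_realpow)
      also have "norm z powr real k * norm z powr (s - \<theta>) = norm z powr (real k + (s - \<theta>))" by (simp add: powr_add)
      also have "\<bar>C\<bar> * norm z * norm z powr (real k + (s - \<theta>)) \<le> \<bar>C\<bar> * norm z * 1"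
        by (intro mult_left_mono powr_le1) (use k z in auto)
      finally show "norm (g z) \<le> \<bar>C\<bar> * norm z" by simp
    qed
    show "((\<lambda>z. \<bar>C\<bar> * norm z) \<longlongrightarrow> 0) (at (0::complex))" by (auto intro!: tendsto_eq_intros)
  qed
  then have gh: "(\<lambda>z. if z = 0 then 0 else g z) holomorphic_on ball 0 r"
    by (intro removable_singularity) (auto simp: g_def intro!: holomorphic_intros Hh)
  obtain z0 where z0: "z0 \<in> slit_ball r" "y z0 \<noteq> 0" using nz by blast
  have z0': "z0 \<in> ball 0 r" "z0 \<noteq> 0" using z0 slit_ball_facts by auto
  have "\<exists>z\<in>ball 0 r. (if z = 0 then 0 else g z) \<noteq> 0"
    by (rule bexI[OF _ z0'(1)]) (use z0 z0' in \<open>simp add: g_def H1\<close>)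
  from order_factorization[OF gh r this] obtain n h where h: "h holomorphic_on ball 0 r" "h 0 \<noteq> 0"
    "\<forall>z\<in>ball 0 r. (if z = 0 then 0 else g z) = z ^ n * h z" by blast
  have "y z = cpow (\<theta> + real n - real (k + 1)) z * h z" if z: "z \<in> slit_ball r" for z
  proof -
    have z': "z \<in> ball 0 r" "z \<noteq> 0" using z slit_ball_facts by auto
    have e: "z ^ (k + 1) * (y z / cpow \<theta> z) = z ^ n * h z" using bspec[OF h(3) z'(1)] z'(2) unfolding H1[OF z, symmetric] g_def by simp
    have "cpow \<theta> z * cpow (real n) z = cpow (\<theta> + real n - real (k + 1)) z * cpow (real (k + 1)) z"
      by (simp flip: cpow_add)
    then have e2: "cpow \<theta> z * z ^ n = cpow (\<theta> + real n - real (k + 1)) z * z ^ (k + 1)"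
      unfolding cpow_of_nat[OF z'(2)] .
    have "z ^ (k + 1) * y z = (cpow \<theta> z * z ^ n) * h z"
    proof -
      have "z ^ (k + 1) * y z = cpow \<theta> z * (z ^ (k + 1) * (y z / cpow \<theta> z))" by simp
      then show ?thesis unfolding e by simp
    qed
    then have "z ^ (k + 1) * y z = z ^ (k + 1) * (cpow (\<theta> + real n - real (k + 1)) z * h z)"
      unfolding e2 by (simp only: mult_ac)
    then show ?thesis using z'(2) by simp
  qed
  then show ?thesis using h by (auto simp: power_form_def)
qed

section \<open>Orders of growth at 0\<close>

definition asy :: "real \<Rightarrow> (complex \<Rightarrow> real) \<Rightarrow> real \<Rightarrow> bool" where
  "asy r S m \<longleftrightarrow> (\<exists>c1>0. \<exists>c2>0. \<exists>\<delta>>0. \<forall>z\<in>slit_ball r. norm z < \<delta> \<longrightarrow>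
     c1 * norm z powr m \<le> S z \<and> S z \<le> c2 * norm z powr m)"

lemma asy_le:
  assumes r: "r > 0" and S: "asy r S m" "asy r S m'"
  shows "m \<le> m'"
proof (rule ccontr)
  assume lt: "\<not> m \<le> m'"
  obtain c2 d2 where 2: "c2 > 0" "d2 > 0" "\<And>z. z \<in> slit_ball r \<Longrightarrow> norm z < d2 \<Longrightarrow> S z \<le> c2 * norm z powr m"
    using S(1) unfolding asy_def by blast
  obtain c1 d1 where 1: "c1 > 0" "d1 > 0" "\<And>z. z \<in> slit_ball r \<Longrightarrow> norm z < d1 \<Longrightarrow> c1 * norm z powr m' \<le> S z"
    using S(2) unfolding asy_def by blast
  have "((\<lambda>t. t powr (m - m')) \<longlongrightarrow> 0) (at_right (0::real))"
    using lt tendsto_powr'[of "\<lambda>t::real. t" 0 "at_right 0" "\<lambda>_. m - m'" "m - m'"]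
    by (auto simp: eventually_at_filter intro!: tendsto_eq_intros)
  then have "\<forall>\<^sub>F t in at_right (0::real). t powr (m - m') < c1 / c2"
    by (rule order_tendstoD(2)) (use 1 2 in simp)
  moreover have "\<forall>\<^sub>F t in at_right (0::real). t < min r (min d1 d2)"
    using r 1(2) 2(2) by (intro order_tendstoD(2)[OF tendsto_ident_at]) simp
  moreover have "\<forall>\<^sub>F t in at_right (0::real). 0 < t" by (simp add: eventually_at_filter)
  ultimately have "\<forall>\<^sub>F t in at_right (0::real). False"
  proof eventually_elim
    case (elim t)
    have z: "of_real t \<in> slit_ball r" using elim by (intro slit_ball_star(1)) auto
    have "c1 * t powr m' \<le> c2 * t powr m"
      using 1(3)[OF z] 2(3)[OF z] elim by auto
    also have "t powr m = t powr (m - m') * t powr m'" by (simp flip: powr_add)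
    finally have "c1 \<le> c2 * t powr (m - m')" using elim by simp
    then show False using elim 2(1) by (simp add: field_simps)
  qed
  then show False by (simp add: trivial_limit_def[symmetric])
qed

lemma asy_unique: "r > 0 \<Longrightarrow> asy r S m \<Longrightarrow> asy r S m' \<Longrightarrow> m = m'"
  using asy_le by (metis order_antisym)

lemma asy_compare:
  assumes "asy r S m" "\<And>z. z \<in> slit_ball r \<Longrightarrow> S z \<le> K * S' z" "\<And>z. z \<in> slit_ball r \<Longrightarrow> S' z \<le> K' * S z" "K > 0" "K' > 0"
  shows "asy r S' m"
proof -
  obtain c1 c2 d where c: "c1 > 0" "c2 > 0" "d > 0" "\<And>z. z \<in> slit_ball r \<Longrightarrow> norm z < d \<Longrightarrow> c1 * norm z powr m \<le> S z \<and> S z \<le> c2 * norm z powr m"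
    using assms(1) unfolding asy_def by blast
  have "c1 / K * norm z powr m \<le> S' z \<and> S' z \<le> (K' * c2) * norm z powr m" if z: "z \<in> slit_ball r" "norm z < d" for z
  proof
    have "c1 * norm z powr m \<le> K * S' z" using c(4)[OF z] assms(2)[OF z(1)] by linarith
    then show "c1 / K * norm z powr m \<le> S' z" using assms(4) by (simp add: field_simps)
    have "S' z \<le> K' * (c2 * norm z powr m)"
      using assms(3)[OF z(1)] mult_left_mono[OF conjunct2[OF c(4)[OF z]], of K'] assms(5) by linarith
    then show "S' z \<le> (K' * c2) * norm z powr m" by simp
  qed
  moreover have "c1 / K > 0" "K' * c2 > 0" using c assms by auto
  ultimately show ?thesis unfolding asy_def using c(3) by blast
qed

text \<open>Squares of moduli cannot cancel, so the term with the smallest exponent fixes the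
  order.\<close>

lemma asy_sum_squares:
  fixes \<phi> :: "'i \<Rightarrow> complex \<Rightarrow> complex"
  assumes r: "r > 0" and I: "finite I" "I \<noteq> {}"
    and \<phi>: "\<And>i. i \<in> I \<Longrightarrow> power_form r (s i) (k i) (\<phi> i)" "\<And>i. i \<in> I \<Longrightarrow> k i 0 \<noteq> 0"
  shows "asy r (\<lambda>z. \<Sum>i\<in>I. (norm (\<phi> i z))\<^sup>2) (2 * Min (s ` I))"
proof -
  let ?m = "Min (s ` I)"
  have m: "?m \<in> s ` I" "\<And>i. i \<in> I \<Longrightarrow> ?m \<le> s i" using I by auto
  have "\<exists>d>0. \<forall>z. norm z < d \<longrightarrow> norm (k i 0) / 2 \<le> norm (k i z) \<and> norm (k i z) \<le> 2 * norm (k i 0)" if i: "i \<in> I" for i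
  proof -
    have "isCont (k i) 0"
      using \<phi>(1)[OF i] r unfolding power_form_def
      by (metis centre_in_ball continuous_on_eq_continuous_at holomorphic_on_imp_continuous_on open_ball)
    then have "((\<lambda>z. norm (k i z)) \<longlongrightarrow> norm (k i 0)) (at 0)" by (simp add: isCont_def tendsto_norm)
    moreover have "0 < norm (k i 0) / 2" using \<phi>(2)[OF i] by simp
    ultimately obtain d where d: "d > 0" "\<And>z. z \<noteq> 0 \<Longrightarrow> norm z < d \<Longrightarrow> \<bar>norm (k i z) - norm (k i 0)\<bar> < norm (k i 0) / 2"
      unfolding tendsto_iff eventually_at by (metis UNIV_I dist_0_norm dist_commute dist_real_def)
    have "norm (k i 0) / 2 \<le> norm (k i z) \<and> norm (k i z) \<le> 2 * norm (k i 0)" if "norm z < d" for z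
    proof (cases "z = 0")
      case False
      then show ?thesis using d(2)[OF False that] by linarith
    qed (use norm_ge_zero[of "k i 0"] in simp)
    then show ?thesis using d(1) by blast
  qed
  then obtain d where d: "\<And>i. i \<in> I \<Longrightarrow> d i > 0" "\<And>i z. i \<in> I \<Longrightarrow> norm z < d i \<Longrightarrow> norm (k i 0) / 2 \<le> norm (k i z) \<and> norm (k i z) \<le> 2 * norm (k i 0)"
    by metis
  define \<delta> where "\<delta> = min 1 (Min (d ` I))"
  have \<delta>: "\<delta> > 0" "\<delta> \<le> 1" "\<And>i. i \<in> I \<Longrightarrow> \<delta> \<le> d i" using I d by (auto simp: \<delta>_def min_le_iff_disj)
  obtain i0 where i0: "i0 \<in> I" "s i0 = ?m" using m(1) by force
  have nf: "(norm (\<phi> i z))\<^sup>2 = norm z powr (2 * s i) * (norm (k i z))\<^sup>2" if "i \<in> I" "z \<in> slit_ball r" for i z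
  proof -
    have "z \<noteq> 0" using slit_ball_facts that by blast
    have "norm (\<phi> i z) = norm z powr s i * norm (k i z)"
      using \<phi>(1)[OF that(1)] that(2) \<open>z \<noteq> 0\<close> by (simp add: power_form_def norm_mult norm_cpow)
    moreover have "(norm z powr s i)\<^sup>2 = norm z powr (2 * s i)" by (simp add: power2_eq_square powr_add[symmetric])
    ultimately show ?thesis by (simp add: power_mult_distrib)
  qed
  define c1 where "c1 = (norm (k i0 0) / 2)\<^sup>2"
  define c2 where "c2 = (\<Sum>i\<in>I. (2 * norm (k i 0))\<^sup>2)"
  have "c1 > 0" using \<phi>(2)[OF i0(1)] by (simp add: c1_def)
  moreover have "c2 > 0" unfolding c2_def by (rule sum_pos) (use I \<phi>(2) in auto)
  moreover have "c1 * norm z powr (2 * ?m) \<le> (\<Sum>i\<in>I. (norm (\<phi> i z))\<^sup>2) \<and> (\<Sum>i\<in>I. (norm (\<phi> i z))\<^sup>2) \<le> c2 * norm z powr (2 * ?m)"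
    if z: "z \<in> slit_ball r" "norm z < \<delta>" for z
  proof
    have zd: "norm z < d i" if "i \<in> I" for i using z(2) \<delta>(3)[OF that] by linarith
    have "c1 * norm z powr (2 * ?m) \<le> (norm (k i0 z))\<^sup>2 * norm z powr (2 * ?m)"
      unfolding c1_def by (intro mult_right_mono power_mono) (use d(2)[OF i0(1) zd[OF i0(1)]] in auto)
    also have "\<dots> = (norm (\<phi> i0 z))\<^sup>2" by (simp add: nf[OF i0(1) z(1)] i0(2) mult.commute)
    also have "\<dots> \<le> (\<Sum>i\<in>I. (norm (\<phi> i z))\<^sup>2)" by (rule member_le_sum[OF i0(1)]) (use I in auto)
    finally show "c1 * norm z powr (2 * ?m) \<le> (\<Sum>i\<in>I. (norm (\<phi> i z))\<^sup>2)" .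
    have "(\<Sum>i\<in>I. (norm (\<phi> i z))\<^sup>2) \<le> (\<Sum>i\<in>I. norm z powr (2 * ?m) * (2 * norm (k i 0))\<^sup>2)"
    proof (rule sum_mono)
      fix i assume i: "i \<in> I"
      show "(norm (\<phi> i z))\<^sup>2 \<le> norm z powr (2 * ?m) * (2 * norm (k i 0))\<^sup>2"
        unfolding nf[OF i z(1)]
      proof (intro mult_mono power_mono)
        show "norm z powr (2 * s i) \<le> norm z powr (2 * ?m)"
          by (rule powr_mono') (use m(2)[OF i] z \<delta> in auto)
      qed (use d(2)[OF i zd[OF i]] in auto)
    qed
    also have "\<dots> = c2 * norm z powr (2 * ?m)" by (simp add: c2_def sum_distrib_left[symmetric] mult.commute)
    finally show "(\<Sum>i\<in>I. (norm (\<phi> i z))\<^sup>2) \<le> c2 * norm z powr (2 * ?m)" .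
  qed
  ultimately show ?thesis unfolding asy_def using \<delta>(1) by blast
qed

section \<open>Squared norms of a basis and of its 2 by 2 minors\<close>

definition sq :: "(3 \<Rightarrow> complex \<Rightarrow> complex) \<Rightarrow> complex \<Rightarrow> real" where
  "sq Y z = (\<Sum>i\<in>UNIV. (norm (Y i z))\<^sup>2)"

definition wr2 :: "(3 \<Rightarrow> complex \<Rightarrow> complex) \<Rightarrow> 3 \<times> 3 \<Rightarrow> complex \<Rightarrow> complex" where
  "wr2 Y = (\<lambda>(i, j) z. Y i z * deriv (Y j) z - Y j z * deriv (Y i) z)"

abbreviation "pairs3 \<equiv> {(1::3, 2::3), (1, 3), (2, 3)}"

definition wsq :: "(3 \<Rightarrow> complex \<Rightarrow> complex) \<Rightarrow> complex \<Rightarrow> real" where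
  "wsq Y z = (\<Sum>p\<in>pairs3. (norm (wr2 Y p z))\<^sup>2)"

lemma cauchy_schwarz_3:
  fixes a b c x y z :: complex
  shows "(norm (a * x + b * y + c * z))\<^sup>2 \<le> ((norm a)\<^sup>2 + (norm b)\<^sup>2 + (norm c)\<^sup>2) * ((norm x)\<^sup>2 + (norm y)\<^sup>2 + (norm z)\<^sup>2)"
proof -
  have "norm (a * x + b * y + c * z) \<le> norm a * norm x + norm b * norm y + norm c * norm z"
    using norm_triangle_ineq[of "a * x + b * y" "c * z"] norm_triangle_ineq[of "a * x" "b * y"] by (simp add: norm_mult)
  then have "(norm (a * x + b * y + c * z))\<^sup>2 \<le> (norm a * norm x + norm b * norm y + norm c * norm z)\<^sup>2"
    by (rule power_mono) simp
  also have "\<dots> \<le> ((norm a)\<^sup>2 + (norm b)\<^sup>2 + (norm c)\<^sup>2) * ((norm x)\<^sup>2 + (norm y)\<^sup>2 + (norm z)\<^sup>2)"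
  proof -
    have "((norm a)\<^sup>2 + (norm b)\<^sup>2 + (norm c)\<^sup>2) * ((norm x)\<^sup>2 + (norm y)\<^sup>2 + (norm z)\<^sup>2) - (norm a * norm x + norm b * norm y + norm c * norm z)\<^sup>2
      = (norm a * norm y - norm b * norm x)\<^sup>2 + (norm a * norm z - norm c * norm x)\<^sup>2 + (norm b * norm z - norm c * norm y)\<^sup>2"
      by (simp add: power2_eq_square algebra_simps)
    moreover have "\<dots> \<ge> 0" by simp
    ultimately show ?thesis by linarith
  qed
  finally show ?thesis .
qed

text \<open>Functions are combined by \<open>A\<close> and minors by its second compound matrix; the
  Cauchy-Schwarz inequality gives a constant that depends on \<open>A\<close> alone.\<close>

lemma sq_combination_bound:
  fixes A :: "complex ^ 3 ^ 3"
  shows "\<exists>K>0. \<forall>Y Z z. (\<forall>i. Z i z = (\<Sum>j\<in>UNIV. A $ i $ j * Y j z)) \<longrightarrow> sq Z z \<le> K * sq Y z \<and>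
     ((\<forall>i. deriv (Z i) z = (\<Sum>j\<in>UNIV. A $ i $ j * deriv (Y j) z)) \<longrightarrow> wsq Z z \<le> K * wsq Y z)"
proof -
  define N where "N = (\<lambda>i. (norm (A $ i $ 1))\<^sup>2 + (norm (A $ i $ 2))\<^sup>2 + (norm (A $ i $ 3))\<^sup>2)"
  define m where "m = (\<lambda>i j k l. A $ i $ k * A $ j $ l - A $ i $ l * A $ j $ k)"
  define M where "M = (\<lambda>(i, j). (norm (m i j 1 2))\<^sup>2 + (norm (m i j 1 3))\<^sup>2 + (norm (m i j 2 3))\<^sup>2)"
  define K where "K = 1 + (\<Sum>i\<in>UNIV. N i) + (\<Sum>p\<in>pairs3. M p)"
  have N0: "0 \<le> (\<Sum>i\<in>UNIV. N i)" and M0: "0 \<le> (\<Sum>p\<in>pairs3. M p)" by (auto intro!: sum_nonneg simp: N_def M_def)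
  have K0: "K > 0" using N0 M0 by (simp add: K_def)
  have "sq Z z \<le> K * sq Y z \<and> ((\<forall>i. deriv (Z i) z = (\<Sum>j\<in>UNIV. A $ i $ j * deriv (Y j) z)) \<longrightarrow> wsq Z z \<le> K * wsq Y z)"
    if Z: "\<forall>i. Z i z = (\<Sum>j\<in>UNIV. A $ i $ j * Y j z)" for Y Z z
  proof (intro conjI impI)
    have sY: "sq Y z \<ge> 0" by (simp add: sq_def sum_nonneg)
    have "sq Z z \<le> (\<Sum>i\<in>UNIV. N i * sq Y z)"
      unfolding sq_def[of Z]
    proof (rule sum_mono)
      fix i
      show "(norm (Z i z))\<^sup>2 \<le> N i * sq Y z"
        using Z cauchy_schwarz_3[of "A $ i $ 1" "Y 1 z" "A $ i $ 2" "Y 2 z" "A $ i $ 3" "Y 3 z"]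
        by (simp add: sq_def sum_3 N_def)
    qed
    also have "\<dots> = (\<Sum>i\<in>UNIV. N i) * sq Y z" by (simp add: sum_distrib_right)
    also have "\<dots> \<le> K * sq Y z" by (rule mult_right_mono[OF _ sY]) (use M0 in \<open>simp add: K_def\<close>)
    finally show "sq Z z \<le> K * sq Y z" .
    assume Z': "\<forall>i. deriv (Z i) z = (\<Sum>j\<in>UNIV. A $ i $ j * deriv (Y j) z)"
    have wY: "wsq Y z \<ge> 0" unfolding wsq_def by (rule sum_nonneg) simp
    have "wsq Z z \<le> (\<Sum>p\<in>pairs3. M p * wsq Y z)"
      unfolding wsq_def[of Z]
    proof (rule sum_mono)
      fix p :: "3 \<times> 3"
      obtain i j where p: "p = (i, j)" by fastforce
      have "wr2 Z p z = m i j 1 2 * wr2 Y (1,2) z + m i j 1 3 * wr2 Y (1,3) z + m i j 2 3 * wr2 Y (2,3) z"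
        using Z Z' by (simp add: p wr2_def m_def sum_3 algebra_simps)
      then show "(norm (wr2 Z p z))\<^sup>2 \<le> M p * wsq Y z"
        using cauchy_schwarz_3[of "m i j 1 2" "wr2 Y (1,2) z" "m i j 1 3" "wr2 Y (1,3) z" "m i j 2 3" "wr2 Y (2,3) z"]
        by (simp add: wsq_def M_def p add.assoc)
    qed
    also have "\<dots> = (\<Sum>p\<in>pairs3. M p) * wsq Y z" by (simp only: sum_distrib_right)
    also have "\<dots> \<le> K * wsq Y z" by (rule mult_right_mono[OF _ wY]) (use N0 in \<open>simp add: K_def\<close>)
    finally show "wsq Z z \<le> K * wsq Y z" .
  qed
  then show ?thesis using K0 by blast
qed

text \<open>At 0 the rows of coefficients become \<open>1\<close>, \<open>s\<close>,
  \<open>s * (s - 1)\<close> times \<open>h i 0\<close>, so the leading coefficient contains the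
  Vandermonde determinant of the exponents.\<close>

lemma wronsk_power_form:
  assumes Y: "\<And>i. power_form r (s i) (h i) (Y i)"
  obtains w where "power_form r (s 1 + s 2 + s 3 - 3) w (wronsk Y)"
    "w 0 = h 1 0 * h 2 0 * h 3 0 * of_real ((s 2 - s 1) * (s 3 - s 1) * (s 3 - s 2))"
proof -
  define w where "w = (\<lambda>z. det (\<chi> i. vector [h i z, euler (s i) (h i) z, euler (s i - 1) (euler (s i) (h i)) z] :: complex ^ 3 ^ 3))"
  have hol: "h i holomorphic_on ball 0 r" for i using Y by (simp add: power_form_def)
  have "w holomorphic_on ball 0 r"
    unfolding w_def det_3 by (simp, intro holomorphic_intros hol euler_holomorphic)
  moreover have "wronsk Y z = cpow (s 1 + s 2 + s 3 - 3) z * w z" if z: "z \<in> slit_ball r" for z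
  proof -
    have z0: "z \<noteq> 0" using slit_ball_facts(3)[OF z] .
    define x where "x = inverse z"
    have m: "cpow (t - 1) z = cpow t z * x" for t using cpow_minus_1[OF z0] by (simp add: x_def divide_inverse)
    have m2: "cpow (t - 2) z = cpow t z * x * x" for t using m[of "t - 1"] m[of t] by simp
    have j: "Y i z = cpow (s i) z * h i z" "deriv (Y i) z = cpow (s i) z * x * euler (s i) (h i) z"
      "deriv (deriv (Y i)) z = cpow (s i) z * x * x * euler (s i - 1) (euler (s i) (h i)) z" for i
      using Y[of i] power_form_deriv[OF Y, of i] power_form_deriv[OF power_form_deriv[OF Y], of i] z
      by (auto simp: power_form_def m m2)
    have "cpow (s 1 + s 2 + s 3 - 3) z = cpow (s 1 + s 2 + s 3 - 1 - 1 - 1) z"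
      by (rule arg_cong[where f = "\<lambda>t. cpow t z"]) simp
    also have "\<dots> = cpow (s 1) z * cpow (s 2) z * cpow (s 3) z * x * x * x" by (simp only: m cpow_add)
    finally show ?thesis
      unfolding wronsk_def jetmat_def w_def det_3 by (simp add: j algebra_simps)
  qed
  moreover have "w 0 = h 1 0 * h 2 0 * h 3 0 * of_real ((s 2 - s 1) * (s 3 - s 1) * (s 3 - s 2))"
    unfolding w_def det_3 by (simp add: euler_def algebra_simps power2_eq_square)
  ultimately show thesis using that by (auto simp: power_form_def)
qed

text \<open>A constant Wronskian has order 0, and this order is \<open>s 1 + s 2 + s 3 - 3\<close>
  plus the order of vanishing of its coefficient at 0. For distinct exponents the Vandermonde factor
  is nonzero, so the coefficient does not vanish there.\<close>

lemma exponent_sum: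
  assumes r: "r > 0" and Y: "\<And>i. power_form r (s i) (h i) (Y i)" "\<And>i. h i 0 \<noteq> 0"
    and c: "c \<noteq> 0" "\<And>z. z \<in> slit_ball r \<Longrightarrow> wronsk Y z = c"
  shows "s 1 + s 2 + s 3 \<le> 3" "inj s \<Longrightarrow> s 1 + s 2 + s 3 = 3"
proof -
  obtain w where w: "power_form r (s 1 + s 2 + s 3 - 3) w (wronsk Y)"
    "w 0 = h 1 0 * h 2 0 * h 3 0 * of_real ((s 2 - s 1) * (s 3 - s 1) * (s 3 - s 2))"
    by (rule wronsk_power_form[OF Y(1)])
  have z1: "complex_of_real (r / 2) \<in> slit_ball r" using slit_ball_star(1)[of "r/2" r] r by simp
  have "w (of_real (r / 2)) \<noteq> 0" using w(1) c(2)[OF z1] c(1) z1 by (auto simp: power_form_def)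
  then have nz: "\<exists>z\<in>ball 0 r. w z \<noteq> 0" using z1 slit_ball_facts(2) by blast
  have wh: "w holomorphic_on ball 0 r" using w(1) by (simp add: power_form_def)
  obtain n k where k: "k holomorphic_on ball 0 r" "k 0 \<noteq> 0" "\<forall>z\<in>ball 0 r. w z = z ^ n * k z"
    using order_factorization[OF wh r nz] by blast
  have pf: "power_form r (s 1 + s 2 + s 3 - 3 + real n) k (wronsk Y)"
    using w(1) k slit_ball_facts by (auto simp: power_form_def cpow_add cpow_of_nat)
  \<comment> \<open>Sums over a one-element set, so that \<open>asy_sum_squares\<close> also
    measures a single function.\<close>
  have a1: "asy r (\<lambda>z. \<Sum>i\<in>{()}. (norm (wronsk Y z))\<^sup>2) (2 * Min ((\<lambda>_. s 1 + s 2 + s 3 - 3 + real n) ` {()}))"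
    by (rule asy_sum_squares[OF r]) (use pf k in auto)
  have "power_form r 0 (\<lambda>_. c) (wronsk Y)" using c(2) by (auto simp: power_form_def cpow_def)
  then have a2: "asy r (\<lambda>z. \<Sum>i\<in>{()}. (norm (wronsk Y z))\<^sup>2) (2 * Min ((\<lambda>_. 0) ` {()}))"
    by (intro asy_sum_squares[OF r]) (use c in auto)
  have e: "s 1 + s 2 + s 3 - 3 + real n = 0" using asy_unique[OF r a1 a2] by simp
  then show "s 1 + s 2 + s 3 \<le> 3" by simp
  show "s 1 + s 2 + s 3 = 3" if "inj s"
  proof -
    have "s 2 \<noteq> s 1" "s 3 \<noteq> s 1" "s 3 \<noteq> s 2" using that by (auto simp: inj_eq)
    then have "w 0 \<noteq> 0" using w(2) Y(2) by simp
    then have "n = 0" using k(3) r by (cases n) auto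
    then show ?thesis using e by simp
  qed
qed

section \<open>Change of basis\<close>

definition lincomb :: "complex ^ 3 ^ 3 \<Rightarrow> (3 \<Rightarrow> complex \<Rightarrow> complex) \<Rightarrow> 3 \<Rightarrow> complex \<Rightarrow> complex" where
  "lincomb A Y i z = (\<Sum>j\<in>UNIV. A $ i $ j * Y j z)"

lemma lincomb_ode3:
  assumes "open D" "\<And>i. ode3 D p q (Y i)"
  shows "ode3 D p q (lincomb A Y i)" "z \<in> D \<Longrightarrow> jet (lincomb A Y i) z = (\<Sum>j\<in>UNIV. A $ i $ j *s jet (Y j) z)"
    "z \<in> D \<Longrightarrow> wronsk (lincomb A Y) z = det A * wronsk Y z"
proof -
  show "ode3 D p q (lincomb A Y i)"
    unfolding lincomb_def[abs_def] by (rule ode3_sum(1)[OF assms(1)]) (rule assms(2))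
  have j: "jet (lincomb A Y i) z = (\<Sum>j\<in>UNIV. A $ i $ j *s jet (Y j) z)" if "z \<in> D" for i z
    unfolding lincomb_def[abs_def] by (rule ode3_sum(2)[OF assms(1) _ that]) (rule assms(2))
  then show "z \<in> D \<Longrightarrow> jet (lincomb A Y i) z = (\<Sum>j\<in>UNIV. A $ i $ j *s jet (Y j) z)" .
  assume z: "z \<in> D"
  have "jetmat (lincomb A Y) z = A ** jetmat Y z"
    by (simp add: vec_eq_iff jetmat_def j[OF z] matrix_matrix_mult_def)
  then show "wronsk (lincomb A Y) z = det A * wronsk Y z" by (simp add: wronsk_def det_mul)
qed

lemma lincomb_inverse:
  assumes "det A \<noteq> 0"
  obtains B where "\<And>Y. lincomb B (lincomb A Y) = Y"
proof -
  obtain B where B: "B ** A = mat 1" using assms invertible_det_nz[of A] by (auto simp: invertible_def)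
  have "lincomb B (lincomb A Y) i z = Y i z" for Y i z
  proof -
    have "lincomb B (lincomb A Y) i z = (\<Sum>j\<in>UNIV. (B ** A) $ i $ j * Y j z)"
      by (simp add: lincomb_def matrix_matrix_mult_def sum_3 algebra_simps)
    also have "\<dots> = Y i z" using exhaust_3[of i] by (auto simp: B mat_def sum_3)
    finally show ?thesis .
  qed
  then show thesis using that by blast
qed

lemma lincomb_asy:
  assumes "det A \<noteq> 0" and Y: "\<And>i. ode3 (slit_ball r) p q (Y i)"
  shows "asy r (sq Y) m \<longleftrightarrow> asy r (sq (lincomb A Y)) m" "asy r (wsq Y) m \<longleftrightarrow> asy r (wsq (lincomb A Y)) m"
proof -
  have main: "\<exists>K>0. \<forall>z\<in>slit_ball r. sq (lincomb A Y) z \<le> K * sq Y z \<and> wsq (lincomb A Y) z \<le> K * wsq Y z"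
    if Y: "\<And>i. ode3 (slit_ball r) p q (Y i)" for A Y
  proof -
    obtain K where K: "K > 0" "\<forall>Y Z z. (\<forall>i. Z i z = (\<Sum>j\<in>UNIV. A $ i $ j * Y j z)) \<longrightarrow> sq Z z \<le> K * sq Y z \<and>
     ((\<forall>i. deriv (Z i) z = (\<Sum>j\<in>UNIV. A $ i $ j * deriv (Y j) z)) \<longrightarrow> wsq Z z \<le> K * wsq Y z)"
      using sq_combination_bound by blast
    have "sq (lincomb A Y) z \<le> K * sq Y z \<and> wsq (lincomb A Y) z \<le> K * wsq Y z" if z: "z \<in> slit_ball r" for z
    proof -
      have "deriv (lincomb A Y i) z = (\<Sum>j\<in>UNIV. A $ i $ j * deriv (Y j) z)" for i
        using arg_cong[OF lincomb_ode3(2)[OF slit_ball_facts(1) Y z], of "\<lambda>x :: complex ^ 3. x $ 2"] by simp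
      moreover have "lincomb A Y i z = (\<Sum>j\<in>UNIV. A $ i $ j * Y j z)" for i by (simp add: lincomb_def)
      ultimately show ?thesis using K(2)[THEN spec[of _ Y], THEN spec[of _ "lincomb A Y"], THEN spec[of _ z]] by blast
    qed
    then show ?thesis using K(1) by blast
  qed
  obtain B where B: "lincomb B (lincomb A Y) = Y" using lincomb_inverse[OF assms(1)] by metis
  obtain K where K: "K > 0" "\<forall>z\<in>slit_ball r. sq (lincomb A Y) z \<le> K * sq Y z \<and> wsq (lincomb A Y) z \<le> K * wsq Y z"
    using main[where Y = Y and A = A, OF Y] by blast
  have Z: "ode3 (slit_ball r) p q (lincomb A Y i)" for i by (rule lincomb_ode3(1)[OF slit_ball_facts(1) Y])
  obtain K' where K': "K' > 0" "\<forall>z\<in>slit_ball r. sq Y z \<le> K' * sq (lincomb A Y) z \<and> wsq Y z \<le> K' * wsq (lincomb A Y) z"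
    using main[where Y = "lincomb A Y" and A = B, OF Z] unfolding B by blast
  have s: "asy r (sq (lincomb A Y)) m" if "asy r (sq Y) m"
    by (rule asy_compare[OF that _ _ K'(1) K(1)]) (use K(2) K'(2) in auto)
  have s': "asy r (sq Y) m" if "asy r (sq (lincomb A Y)) m"
    by (rule asy_compare[OF that _ _ K(1) K'(1)]) (use K(2) K'(2) in auto)
  have w: "asy r (wsq (lincomb A Y)) m" if "asy r (wsq Y) m"
    by (rule asy_compare[OF that _ _ K'(1) K(1)]) (use K(2) K'(2) in auto)
  have w': "asy r (wsq Y) m" if "asy r (wsq (lincomb A Y)) m"
    by (rule asy_compare[OF that _ _ K(1) K'(1)]) (use K(2) K'(2) in auto)
  show "asy r (sq Y) m \<longleftrightarrow> asy r (sq (lincomb A Y)) m" using s s' by (rule iffI)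
  show "asy r (wsq Y) m \<longleftrightarrow> asy r (wsq (lincomb A Y)) m" using w w' by (rule iffI)
qed

text \<open>If two exponents coincide, a combination of the two solutions cancels their leading
  terms and raises one exponent by a positive integer. The sum of the exponents never exceeds 3 by
  \<open>exponent_sum\<close>, so the process ends with distinct exponents.\<close>

lemma echelon:
  assumes r: "r > 0" and Y: "\<And>i. ode3 (slit_ball r) p q (Y i)"
    and c: "c \<noteq> 0" "\<And>z. z \<in> slit_ball r \<Longrightarrow> wronsk Y z = c"
    and f: "\<And>i. power_form r (s i) (h i) (Y i)" "\<And>i. h i 0 \<noteq> 0"
  obtains A \<sigma> k where "det A \<noteq> 0" "inj \<sigma>" "\<And>i. power_form r (\<sigma> i) (k i) (lincomb A Y i)" "\<And>i. k i 0 \<noteq> 0"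
proof -
  define good where "good = (\<lambda>A \<sigma> k. det A \<noteq> 0 \<and> (\<forall>i. power_form r (\<sigma> i) (k i) (lincomb A Y i) \<and> k i 0 \<noteq> 0))"
  note o = slit_ball_facts(1)
  have z1: "complex_of_real (r / 2) \<in> slit_ball r" using slit_ball_star(1)[of "r/2" r] r by simp
  \<comment> \<open>Induction on an integer above the distance of the exponent sum from 3; each
    elimination lowers that distance by at least 1, and for \<open>m = 0\<close> the sum would
    exceed 3.\<close>
  have main: "\<exists>A \<sigma> k. good A \<sigma> k \<and> inj \<sigma>" if "good A \<sigma> k" "3 - (\<sigma> 1 + \<sigma> 2 + \<sigma> 3) < real m" for A \<sigma> k m
    using that
  proof (induction m arbitrary: A \<sigma> k)
    case 0
    have w: "wronsk (lincomb A Y) z = det A * c" if "z \<in> slit_ball r" for z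
      using lincomb_ode3(3)[OF o Y that] c(2)[OF that] by simp
    have "\<sigma> 1 + \<sigma> 2 + \<sigma> 3 \<le> 3"
      by (rule exponent_sum(1)[OF r _ _ _ w, of \<sigma> k]) (use 0 c(1) in \<open>auto simp: good_def\<close>)
    then show ?case using 0 by simp
  next
    case (Suc m)
    show ?case
    proof (cases "inj \<sigma>")
      case True then show ?thesis using Suc.prems by blast
    next
      case False
      then obtain a b where ab: "a \<noteq> b" "\<sigma> a = \<sigma> b" by (auto simp: inj_def)
      have dA: "det A \<noteq> 0" and pf: "\<And>i. power_form r (\<sigma> i) (k i) (lincomb A Y i)" and k0: "\<And>i. k i 0 \<noteq> 0"
        using Suc.prems(1) by (auto simp: good_def)
      define t where "t = - (k b 0 / k a 0)"
      define A' where "A' = (\<chi> i. if i = b then row b A + t *s row a A else row i A)"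
      have dA': "det A' = det A" unfolding A'_def using ab(1) by (intro det_row_operation) auto
      have Ab: "lincomb A' Y b z = lincomb A Y b z + t * lincomb A Y a z" for z
        by (simp add: lincomb_def A'_def row_def sum_3 algebra_simps)
      have Ai: "lincomb A' Y i z = lincomb A Y i z" if "i \<noteq> b" for i z
        using that by (simp add: lincomb_def A'_def row_def)
      define g where "g = (\<lambda>z. k b z + t * k a z)"
      have kh: "k i holomorphic_on ball 0 r" for i using pf by (simp add: power_form_def)
      have gh: "g holomorphic_on ball 0 r" unfolding g_def by (intro holomorphic_intros kh)
      have g0: "g 0 = 0" using k0[of a] by (simp add: g_def t_def)
      have pg: "lincomb A' Y b z = cpow (\<sigma> b) z * g z" if "z \<in> slit_ball r" for z
        using pf[of a] pf[of b] that ab(2) by (simp add: Ab g_def power_form_def algebra_simps)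
      \<comment> \<open>If the combination vanished identically, so would a row of the jet matrix
        and hence the Wronskian.\<close>
      have nz: "\<exists>z\<in>ball 0 r. g z \<noteq> 0"
      proof (rule ccontr)
        assume n: "\<not> ?thesis"
        have "lincomb A' Y b z = 0" if "z \<in> slit_ball r" for z
          using pg[OF that] n slit_ball_facts(2) that by (metis mult_zero_right subsetD)
        then have "jet (lincomb A' Y b) (of_real (r/2)) = jet (\<lambda>_. 0) (of_real (r/2))"
          by (intro jet_cong_open[OF o z1]) simp
        then have "row b (jetmat (lincomb A' Y) (of_real (r/2))) = 0"
          by (simp add: row_def jetmat_def vec3_eq_iff)
        then have "wronsk (lincomb A' Y) (of_real (r/2)) = 0" unfolding wronsk_def by (rule det_zero_row)
        then show False using lincomb_ode3(3)[OF o Y z1, of A'] c dA dA' c(2)[OF z1] by simp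
      qed
      obtain n k' where n: "k' holomorphic_on ball 0 r" "k' 0 \<noteq> 0" "\<forall>z\<in>ball 0 r. g z = z ^ n * k' z" "n \<ge> 1"
        using order_factorization[OF gh r nz] g0 by blast
      define \<sigma>' where "\<sigma>' = \<sigma>(b := \<sigma> b + real n)"
      define kk where "kk = k(b := k')"
      have "power_form r (\<sigma>' i) (kk i) (lincomb A' Y i)" for i
      proof (cases "i = b")
        case True
        have "cpow (\<sigma> b) z * g z = cpow (\<sigma> b + real n) z * k' z" if "z \<in> slit_ball r" for z
          using n(3) slit_ball_facts(2,3) that by (auto simp: cpow_add cpow_of_nat)
        then show ?thesis using True n(1) pg by (simp add: power_form_def \<sigma>'_def kk_def)
      next
        case False then show ?thesis using pf[of i] Ai[OF False] by (simp add: power_form_def \<sigma>'_def kk_def)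
      qed
      then have "good A' \<sigma>' kk" using dA dA' k0 n(2) by (auto simp: good_def kk_def)
      moreover have "\<sigma>' 1 + \<sigma>' 2 + \<sigma>' 3 = \<sigma> 1 + \<sigma> 2 + \<sigma> 3 + real n"
        using exhaust_3[of b] by (auto simp: \<sigma>'_def)
      moreover have "real n \<ge> 1" using n(4) by simp
      ultimately show ?thesis using Suc.IH[of A' \<sigma>' kk] Suc.prems(2) by simp
    qed
  qed
  have "lincomb (mat 1) Y i z = Y i z" for i z using exhaust_3[of i] by (auto simp: lincomb_def mat_def sum_3)
  then have "good (mat 1) s h" using f by (simp add: good_def power_form_def)
  moreover obtain m :: nat where "3 - (s 1 + s 2 + s 3) < real m" using reals_Archimedean2 by blast
  ultimately obtain A \<sigma> k where "good A \<sigma> k" "inj \<sigma>" using main by blast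
  then show thesis using that by (auto simp: good_def)
qed

lemma asy_sq:
  assumes "r > 0" "\<And>i. power_form r (\<sigma> i) (k i) (Z i)" "\<And>i. k i 0 \<noteq> 0"
  shows "asy r (sq Z) (2 * min (\<sigma> 1) (min (\<sigma> 2) (\<sigma> 3)))"
proof -
  have "asy r (\<lambda>z. \<Sum>i\<in>UNIV. (norm (Z i z))\<^sup>2) (2 * Min (\<sigma> ` UNIV))"
    by (rule asy_sum_squares) (use assms in auto)
  moreover have "Min (\<sigma> ` UNIV) = min (\<sigma> 1) (min (\<sigma> 2) (\<sigma> 3))" by (simp add: UNIV_3)
  ultimately show ?thesis by (simp add: sq_def[abs_def])
qed

text \<open>The leading coefficient of the minor with indices \<open>i\<close>, \<open>j\<close>
  contains the factor \<open>\<sigma> j - \<sigma> i\<close>, so distinct exponents keep every minor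
  at its expected order.\<close>

lemma asy_wsq:
  assumes r: "r > 0" and Z: "\<And>i. power_form r (\<sigma> i) (k i) (Z i)" "\<And>i. k i 0 \<noteq> 0" and inj: "inj \<sigma>"
  shows "asy r (wsq Z) (2 * (min (\<sigma> 1 + \<sigma> 2) (min (\<sigma> 1 + \<sigma> 3) (\<sigma> 2 + \<sigma> 3)) - 1))"
proof -
  define S where "S = (\<lambda>(i, j). \<sigma> i + \<sigma> j - 1)"
  define K where "K = (\<lambda>(i, j) z. k i z * euler (\<sigma> j) (k j) z - k j z * euler (\<sigma> i) (k i) z)"
  have kh: "k i holomorphic_on ball 0 r" for i using Z(1) by (simp add: power_form_def)
  have pf: "power_form r (S p) (K p) (wr2 Z p)" for p
  proof -
    obtain i j where p: "p = (i, j)" by fastforce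
    have "wr2 Z (i, j) z = cpow (\<sigma> i + \<sigma> j - 1) z * (k i z * euler (\<sigma> j) (k j) z - k j z * euler (\<sigma> i) (k i) z)"
      if z: "z \<in> slit_ball r" for z
    proof -
      have z0: "z \<noteq> 0" using slit_ball_facts(3)[OF z] .
      have y: "Z l z = cpow (\<sigma> l) z * k l z" "deriv (Z l) z = cpow (\<sigma> l) z / z * euler (\<sigma> l) (k l) z" for l
        using Z(1)[of l] power_form_deriv[OF Z(1), of l] z by (auto simp: power_form_def cpow_minus_1[OF z0])
      show ?thesis unfolding cpow_minus_1[OF z0] cpow_add by (simp add: wr2_def y field_simps z0)
    qed
    moreover have "K (i, j) holomorphic_on ball 0 r"
      unfolding K_def by (simp, intro holomorphic_intros kh euler_holomorphic)
    ultimately show ?thesis by (simp add: p power_form_def S_def K_def)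
  qed
  have nz: "K p 0 \<noteq> 0" if "p \<in> pairs3" for p
  proof -
    obtain i j where p: "p = (i, j)" by fastforce
    have "i \<noteq> j" using that p by auto
    then have ne: "\<sigma> j - \<sigma> i \<noteq> 0" using inj by (auto simp: inj_eq)
    have "K p 0 = of_real (\<sigma> j - \<sigma> i) * k i 0 * k j 0" by (simp add: p K_def euler_def algebra_simps)
    then show ?thesis using ne Z(2) by simp
  qed
  have "asy r (\<lambda>z. \<Sum>p\<in>pairs3. (norm (wr2 Z p z))\<^sup>2) (2 * Min (S ` pairs3))"
    by (rule asy_sum_squares[OF r, where s = S and k = K and \<phi> = "wr2 Z" and I = pairs3]) (use pf nz in blast)+
  moreover have "Min (S ` pairs3) = min (\<sigma> 1 + \<sigma> 2) (min (\<sigma> 1 + \<sigma> 3) (\<sigma> 2 + \<sigma> 3)) - 1"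
    by (simp add: S_def min_def)
  ultimately show ?thesis by (simp add: wsq_def[abs_def])
qed

text \<open>The equation multiplied by the power of exponent \<open>3 - s\<close>: the powers
  cancel, and only functions defined without a choice of branch remain next to the
  coefficients.\<close>

lemma power_form_ode:
  assumes f: "power_form r s h y" and y: "ode3 (slit_ball r) p q y" and z: "z \<in> slit_ball r"
  defines "e1 \<equiv> euler s h" and "e3 \<equiv> euler (s - 2) (euler (s - 1) (euler s h))"
  shows "e3 z + z\<^sup>2 * p z * e1 z + z ^ 3 * q z * h z = 0"
proof -
  have z0: "z \<noteq> 0" using slit_ball_facts(3)[OF z] .
  have f3: "power_form r (s - 1 - 1 - 1) (euler (s - 1 - 1) (euler (s - 1) (euler s h))) (deriv (deriv (deriv y)))"
    by (rule power_form_deriv[OF power_form_deriv[OF power_form_deriv[OF f]]])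
  have m3: "cpow (s - 3) z = cpow s z / z / z / z"
    using cpow_minus_1[OF z0, of "s - 2"] cpow_minus_1[OF z0, of "s - 1"] cpow_minus_1[OF z0, of s] by simp
  have Y: "y z = cpow s z * h z" "deriv y z = cpow s z / z * e1 z" "deriv (deriv (deriv y)) z = cpow s z / z / z / z * e3 z"
    using f power_form_deriv[OF f] f3 z by (auto simp: power_form_def cpow_minus_1[OF z0] m3 e1_def e3_def)
  have "z ^ 3 * (deriv (deriv (deriv y)) z + p z * deriv y z + q z * y z)
      = cpow s z * (e3 z + z\<^sup>2 * p z * e1 z + z ^ 3 * q z * h z)"
    unfolding Y using z0 by (simp add: field_simps power2_eq_square power3_eq_cube)
  moreover have "deriv (deriv (deriv y)) z + p z * deriv y z + q z * y z = 0" using y z by (simp add: ode3_def)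
  ultimately have "cpow s z * (e3 z + z\<^sup>2 * p z * e1 z + z ^ 3 * q z * h z) = 0" by simp
  then show ?thesis by simp
qed

lemma euler_at_0: "euler s h 0 = of_real s * h 0"
  by (simp add: euler_def)

lemma isCont_ball_0: "r > 0 \<Longrightarrow> h holomorphic_on ball 0 r \<Longrightarrow> (h \<longlongrightarrow> h 0) (at 0)"
  using holomorphic_on_imp_continuous_on[of h "ball 0 r"] by (simp add: continuous_on_eq_continuous_at isCont_def)

text \<open>Two solutions with different exponents give two linear equations for
  \<open>z\<^sup>2 * p z\<close> and \<open>z ^ 3 * q z\<close>. Their determinant tends to a
  nonzero multiple of \<open>s a - s b\<close>, so both limits exist, and the common cubic equation
  of the exponents identifies them.\<close>

lemma coefficient_limits:
  assumes r: "r > 0" and pq: "p holomorphic_on ball 0 r - {0}" "q holomorphic_on ball 0 r - {0}"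
    and y: "\<And>i. ode3 (slit_ball r) p q (y i)" and f: "\<And>i. power_form r (s i) (h i) (y i)" "\<And>i. h i 0 \<noteq> 0"
    and ab: "s a \<noteq> s b"
    and root: "\<And>i. s i * (s i - 1) * (s i - 2) - \<alpha> * s i - 2 * \<beta> = 0"
  shows "((\<lambda>z. z\<^sup>2 * p z) \<longlongrightarrow> - of_real \<alpha>) (at 0)" "((\<lambda>z. z ^ 3 * q z) \<longlongrightarrow> - of_real (2 * \<beta>)) (at 0)"
proof -
  define e1 where "e1 = (\<lambda>i. euler (s i) (h i))"
  define e3 where "e3 = (\<lambda>i. euler (s i - 2) (euler (s i - 1) (euler (s i) (h i))))"
  have hh: "h i holomorphic_on ball 0 r" for i using f(1) by (simp add: power_form_def)
  have eh: "e1 i holomorphic_on ball 0 r" "e3 i holomorphic_on ball 0 r" for i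
    unfolding e1_def e3_def by (intro euler_holomorphic hh)+
  have eq: "e3 i z + z\<^sup>2 * p z * e1 i z + z ^ 3 * q z * h i z = 0" if "z \<in> slit_ball r" for i z
    unfolding e1_def e3_def by (rule power_form_ode[OF f(1) y that])
  \<comment> \<open>All functions involved are single-valued, so the relation extends from the slit
    disc to the punctured disc, where limits at 0 are taken.\<close>
  have eq': "e3 i z + z\<^sup>2 * p z * e1 i z + z ^ 3 * q z * h i z = 0" if "z \<in> ball 0 r - {0}" for i z
  proof (rule analytic_continuation_open[where s = "slit_ball r" and s' = "ball 0 r - {0}" and g = "\<lambda>_. 0"
        and f = "\<lambda>z. e3 i z + z\<^sup>2 * p z * e1 i z + z ^ 3 * q z * h i z"])
    show "slit_ball r \<noteq> {}" using slit_ball_star(1)[of "r/2" r] r by force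
    show "connected (ball 0 r - {0::complex})" by (intro connected_open_delete) auto
    show "slit_ball r \<subseteq> ball 0 r - {0}" using slit_ball_facts by auto
    show "(\<lambda>z. e3 i z + z\<^sup>2 * p z * e1 i z + z ^ 3 * q z * h i z) holomorphic_on ball 0 r - {0}"
      by (intro holomorphic_intros pq holomorphic_on_subset[OF eh(1)] holomorphic_on_subset[OF eh(2)] holomorphic_on_subset[OF hh]) auto
  qed (use that eq in \<open>auto simp: slit_ball_facts(1)\<close>)
  define dd where "dd = (\<lambda>z. e1 a z * h b z - e1 b z * h a z)"
  define nn where "nn = (\<lambda>z. e3 a z * h b z - e3 b z * h a z)"
  have lim: "(h i \<longlongrightarrow> h i 0) (at 0)" "(e1 i \<longlongrightarrow> of_real (s i) * h i 0) (at 0)"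
    "(e3 i \<longlongrightarrow> of_real (s i * (s i - 1) * (s i - 2)) * h i 0) (at 0)" for i
    using isCont_ball_0[OF r hh, of i] isCont_ball_0[OF r eh(1), of i] isCont_ball_0[OF r eh(2), of i]
    by (simp_all add: e1_def e3_def euler_at_0 mult_ac)
  have ddl: "(dd \<longlongrightarrow> of_real (s a - s b) * h a 0 * h b 0) (at 0)"
  proof -
    have "(dd \<longlongrightarrow> of_real (s a) * h a 0 * h b 0 - of_real (s b) * h b 0 * h a 0) (at 0)"
      unfolding dd_def by (intro tendsto_intros lim)
    then show ?thesis by (simp add: algebra_simps)
  qed
  have chi: "s i * (s i - 1) * (s i - 2) = \<alpha> * s i + 2 * \<beta>" for i using root[of i] by simp
  have nnl: "(nn \<longlongrightarrow> of_real (\<alpha> * (s a - s b)) * h a 0 * h b 0) (at 0)"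
  proof -
    have "(nn \<longlongrightarrow> of_real (\<alpha> * s a + 2 * \<beta>) * h a 0 * h b 0 - of_real (\<alpha> * s b + 2 * \<beta>) * h b 0 * h a 0) (at 0)"
      unfolding nn_def using lim(3) unfolding chi by (intro tendsto_intros lim)
    then show ?thesis by (simp add: algebra_simps)
  qed
  have d0: "of_real (s a - s b) * h a 0 * h b 0 \<noteq> 0" using ab f(2) by simp
  have near: "\<forall>\<^sub>F z in at 0. z \<in> ball 0 r - {0}"
    using r by (auto simp: eventually_at dist_commute intro!: exI[of _ r])
  have "((\<lambda>z. - (nn z / dd z)) \<longlongrightarrow> - (of_real (\<alpha> * (s a - s b)) * h a 0 * h b 0 / (of_real (s a - s b) * h a 0 * h b 0))) (at 0)"
    by (intro tendsto_intros nnl ddl d0)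
  moreover have "of_real (\<alpha> * (s a - s b)) * h a 0 * h b 0 / (of_real (s a - s b) * h a 0 * h b 0) = complex_of_real \<alpha>"
    using d0 by (simp add: field_simps)
  moreover have "\<forall>\<^sub>F z in at 0. - (nn z / dd z) = z\<^sup>2 * p z"
    using near tendsto_imp_eventually_ne[OF ddl d0]
  proof eventually_elim
    case (elim z)
    have "nn z + z\<^sup>2 * p z * dd z = (e3 a z + z\<^sup>2 * p z * e1 a z + z ^ 3 * q z * h a z) * h b z
       - (e3 b z + z\<^sup>2 * p z * e1 b z + z ^ 3 * q z * h b z) * h a z"
      by (simp add: nn_def dd_def algebra_simps)
    then have "nn z + z\<^sup>2 * p z * dd z = 0" using eq'[OF elim(1)] by simp
    then have "nn z = - (z\<^sup>2 * p z) * dd z" by (simp add: eq_neg_iff_add_eq_0)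
    then show ?case using elim(2) by simp
  qed
  ultimately show P: "((\<lambda>z. z\<^sup>2 * p z) \<longlongrightarrow> - of_real \<alpha>) (at 0)"
    using Lim_transform_eventually by fastforce
  have "((\<lambda>z. - ((e3 a z + z\<^sup>2 * p z * e1 a z) / h a z)) \<longlongrightarrow>
      - ((of_real (\<alpha> * s a + 2 * \<beta>) * h a 0 + - of_real \<alpha> * (of_real (s a) * h a 0)) / h a 0)) (at 0)"
    using lim(3)[of a] unfolding chi by (intro tendsto_intros lim P f(2))
  moreover have "(of_real (\<alpha> * s a + 2 * \<beta>) * h a 0 + - of_real \<alpha> * (of_real (s a) * h a 0)) / h a 0 = complex_of_real (2 * \<beta>)"
    using f(2)[of a] by (simp add: field_simps)
  moreover have "\<forall>\<^sub>F z in at 0. - ((e3 a z + z\<^sup>2 * p z * e1 a z) / h a z) = z ^ 3 * q z"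
    using near tendsto_imp_eventually_ne[OF lim(1) f(2), of a]
  proof eventually_elim
    case (elim z)
    have "e3 a z + z\<^sup>2 * p z * e1 a z = - (z ^ 3 * q z) * h a z"
      using eq'[OF elim(1), of a] by (simp add: eq_neg_iff_add_eq_0)
    then show ?case using elim(2) by simp
  qed
  ultimately show "((\<lambda>z. z ^ 3 * q z) \<longlongrightarrow> - of_real (2 * \<beta>)) (at 0)"
    using Lim_transform_eventually by fastforce
qed

text \<open>The indicial equation, obtained as the limit of \<open>power_form_ode\<close> along the
  positive reals.\<close>

lemma exponent_root:
  assumes r: "r > 0" and y: "ode3 (slit_ball r) p q y" and f: "power_form r s h y" "h 0 \<noteq> 0"
    and lim: "((\<lambda>z. z\<^sup>2 * p z) \<longlongrightarrow> - of_real \<alpha>) (at 0)" "((\<lambda>z. z ^ 3 * q z) \<longlongrightarrow> - of_real (2 * \<beta>)) (at 0)"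
  shows "s * (s - 1) * (s - 2) - \<alpha> * s - 2 * \<beta> = 0"
proof -
  define e1 where "e1 = euler s h"
  define e3 where "e3 = euler (s - 2) (euler (s - 1) (euler s h))"
  have hh: "h holomorphic_on ball 0 r" using f(1) by (simp add: power_form_def)
  have eh: "e1 holomorphic_on ball 0 r" "e3 holomorphic_on ball 0 r"
    unfolding e1_def e3_def by (intro euler_holomorphic hh)+
  have "((\<lambda>z. e3 z + z\<^sup>2 * p z * e1 z + z ^ 3 * q z * h z) \<longlongrightarrow> e3 0 + - of_real \<alpha> * e1 0 + - of_real (2 * \<beta>) * h 0) (at 0)"
    by (intro tendsto_intros isCont_ball_0[OF r] eh hh lim)
  moreover have "filterlim complex_of_real (at 0) (at_right 0)"
    unfolding filterlim_at by (auto simp: eventually_at_filter intro!: tendsto_eq_intros)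
  ultimately have "((\<lambda>t. e3 (complex_of_real t) + (of_real t)\<^sup>2 * p (of_real t) * e1 (of_real t) + (of_real t) ^ 3 * q (of_real t) * h (of_real t))
    \<longlongrightarrow> e3 0 + - of_real \<alpha> * e1 0 + - of_real (2 * \<beta>) * h 0) (at_right 0)"
    by (rule filterlim_compose)
  moreover have "\<forall>\<^sub>F t in at_right 0. e3 (complex_of_real t) + (of_real t)\<^sup>2 * p (of_real t) * e1 (of_real t) + (of_real t) ^ 3 * q (of_real t) * h (of_real t) = 0"
    unfolding eventually_at_right_field e1_def e3_def
    using r power_form_ode[OF f(1) y slit_ball_star(1)] by (intro exI[of _ r]) auto
  ultimately have "((\<lambda>t::real. 0) \<longlongrightarrow> e3 0 + - of_real \<alpha> * e1 0 + - of_real (2 * \<beta>) * h 0) (at_right 0)"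
    by (rule Lim_transform_eventually)
  then have "e3 0 + - of_real \<alpha> * e1 0 + - of_real (2 * \<beta>) * h 0 = 0"
    by (simp add: tendsto_const_iff)
  then have "of_real (s * (s - 1) * (s - 2) - \<alpha> * s - 2 * \<beta>) * h 0 = 0"
    by (simp add: e1_def e3_def euler_at_0 algebra_simps)
  then show ?thesis using f(2) by (metis mult_eq_0_iff of_real_eq_0_iff)
qed

text \<open>\<open>ode3_exists_star\<close> prescribes the jet at the centre of the star; the
  constant nonzero Wronskian of a basis built there moves the initial point anywhere in
  \<open>D\<close>.\<close>

lemma ode3_exists_at:
  assumes D: "open D" "a \<in> D" "\<And>z. z \<in> D \<Longrightarrow> closed_segment a z \<subseteq> D" "connected D"
    and pq: "p holomorphic_on D" "q holomorphic_on D" and z1: "z1 \<in> D"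
  shows "\<exists>y. ode3 D p q y \<and> jet y z1 = x"
proof -
  have "\<exists>y. ode3 D p q y \<and> jet y a = (mat 1 :: complex ^ 3 ^ 3) $ i" for i
    by (rule ode3_exists_star[OF D(1-3) pq])
  then obtain Y where Y: "\<And>i. ode3 D p q (Y i)" "\<And>i. jet (Y i) a = (mat 1 :: complex ^ 3 ^ 3) $ i" by metis
  have "jetmat Y a = mat 1" by (simp add: vec_eq_iff jetmat_def Y(2))
  then have "wronsk Y a = 1" by (simp add: wronsk_def)
  then have "det (jetmat Y z1) \<noteq> 0"
    using wronsk_constant[OF D(1,4) Y(1) z1 D(2)] by (simp add: wronsk_def)
  then obtain c :: "complex ^ 3" where c: "x = (\<Sum>i\<in>UNIV. c $ i *s jetmat Y z1 $ i)" by (rule det_rows_span)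
  have "jet (\<lambda>z. \<Sum>i\<in>UNIV. c $ i * Y i z) z1 = x"
    using ode3_sum(2)[OF D(1) Y(1) z1, where I = UNIV and c = "\<lambda>i. c $ i"] c by (simp add: jetmat_def)
  moreover have "ode3 D p q (\<lambda>z. \<Sum>i\<in>UNIV. c $ i * Y i z)"
    by (rule ode3_sum(1)[OF D(1) Y(1), where I = UNIV and c = "\<lambda>i. c $ i"])
  ultimately show ?thesis by (intro exI[of _ "\<lambda>z. \<Sum>i\<in>UNIV. c $ i * Y i z"] conjI)
qed

lemma ode3_basis_span:
  assumes D: "open D" "connected D" and pq: "continuous_on D p" "continuous_on D q"
    and Y: "\<And>i. ode3 D p q (Y i)" and w: "z0 \<in> D" "wronsk Y z0 \<noteq> 0" and y: "ode3 D p q y"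
  obtains c :: "complex ^ 3" where "\<And>z. z \<in> D \<Longrightarrow> y z = (\<Sum>i\<in>UNIV. c $ i * Y i z)"
proof -
  obtain c :: "complex ^ 3" where c: "jet y z0 = (\<Sum>i\<in>UNIV. c $ i *s jetmat Y z0 $ i)"
    by (rule det_rows_span[of "jetmat Y z0"]) (use w(2) in \<open>simp_all add: wronsk_def\<close>)
  have o: "ode3 D p q (\<lambda>z. \<Sum>i\<in>UNIV. c $ i * Y i z)"
    by (rule ode3_sum(1)[OF D(1) Y, where I = UNIV and c = "\<lambda>i. c $ i"])
  have "jet y z0 = jet (\<lambda>z. \<Sum>i\<in>UNIV. c $ i * Y i z) z0"
    using ode3_sum(2)[OF D(1) Y w(1), where I = UNIV and c = "\<lambda>i. c $ i"] c by (simp add: jetmat_def)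
  then have "y z = (\<Sum>i\<in>UNIV. c $ i * Y i z)" if "z \<in> D" for z
    by (rule ode3_unique[OF D pq y o w(1) _ that])
  then show thesis using that by blast
qed

section \<open>The opposite slit disc and the local monodromy of Toda potentials\<close>

lemma slit_ball_uminus: "z \<in> ball 0 r - \<real>\<^sub>\<ge>\<^sub>0 \<longleftrightarrow> - z \<in> slit_ball r"
  by (auto simp: slit_ball_def complex_nonpos_Reals_iff complex_nonneg_Reals_iff)

lemma opposite_slit_star:
  assumes "0 < t" "t < r"
  shows "- complex_of_real t \<in> ball 0 r - \<real>\<^sub>\<ge>\<^sub>0"
    "z \<in> ball 0 r - \<real>\<^sub>\<ge>\<^sub>0 \<Longrightarrow> closed_segment (- complex_of_real t) z \<subseteq> ball 0 r - \<real>\<^sub>\<ge>\<^sub>0"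
proof -
  show "- complex_of_real t \<in> ball 0 r - \<real>\<^sub>\<ge>\<^sub>0" unfolding slit_ball_uminus using slit_ball_star(1)[OF assms] by simp
  assume z: "z \<in> ball 0 r - \<real>\<^sub>\<ge>\<^sub>0"
  show "closed_segment (- complex_of_real t) z \<subseteq> ball 0 r - \<real>\<^sub>\<ge>\<^sub>0"
  proof
    fix w assume "w \<in> closed_segment (- of_real t) z"
    then obtain s where s: "0 \<le> s" "s \<le> 1" "w = (1 - s) *\<^sub>R (- of_real t) + s *\<^sub>R z" by (auto simp: closed_segment_def)
    have "- w \<in> closed_segment (of_real t) (- z)"
      unfolding closed_segment_def using s by (auto intro!: exI[of _ s])
    then show "w \<in> ball 0 r - \<real>\<^sub>\<ge>\<^sub>0"
      unfolding slit_ball_uminus using slit_ball_star(2)[OF assms] z unfolding slit_ball_uminus by blast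
  qed
qed

lemma opposite_slit_facts: "open (ball (0::complex) r - \<real>\<^sub>\<ge>\<^sub>0)" "r > 0 \<Longrightarrow> connected (ball (0::complex) r - \<real>\<^sub>\<ge>\<^sub>0)"
proof -
  show "open (ball (0::complex) r - \<real>\<^sub>\<ge>\<^sub>0)" by (auto intro: open_Diff)
  assume "r > 0"
  then have "starlike (ball (0::complex) r - \<real>\<^sub>\<ge>\<^sub>0)"
    using opposite_slit_star[of "r/2" r] unfolding starlike_def by (metis field_sum_of_halves half_gt_zero less_add_same_cancel2)
  then show "connected (ball (0::complex) r - \<real>\<^sub>\<ge>\<^sub>0)" by (rule starlike_imp_connected)
qed

lemma toda_domain_subset:
  assumes "toda_domain D U V u v" "open D'" "D' \<subseteq> D"
  shows "toda_domain D' U V u v"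
  using assms unfolding toda_domain_def by (auto intro: smooth_on_subset)

lemma asy_exp:
  assumes d: "\<delta> > 0" and b: "\<And>z. 0 < norm z \<Longrightarrow> norm z < \<delta> \<Longrightarrow> \<bar>u z - 2 * g * ln (norm z)\<bar> \<le> C"
  shows "asy r (\<lambda>z. exp (- u z)) (- 2 * g)"
proof -
  have "exp (- C) * norm z powr (- 2 * g) \<le> exp (- u z) \<and> exp (- u z) \<le> exp C * norm z powr (- 2 * g)"
    if z: "z \<in> slit_ball r" "norm z < \<delta>" for z
  proof -
    have z0: "0 < norm z" using slit_ball_facts(3)[OF z(1)] by simp
    have e: "norm z powr (- 2 * g) = exp (- 2 * g * ln (norm z))" using z0 by (simp add: powr_def)
    have "- C + - 2 * g * ln (norm z) \<le> - u z" "- u z \<le> C + - 2 * g * ln (norm z)" using b[OF z0 z(2)] by (auto simp: abs_le_iff)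
    then show ?thesis unfolding e exp_add[symmetric] by simp
  qed
  then show ?thesis unfolding asy_def using d by (metis exp_gt_zero)
qed

lemma asy_cong: "asy r S m \<Longrightarrow> (\<And>z. z \<in> slit_ball r \<Longrightarrow> S' z = S z) \<Longrightarrow> asy r S' m"
  by (rule asy_compare[of r S m 1 S' 1]) auto

text \<open>The smallest exponent, the sum of the two smallest and the total determine all three.
  The total comes from the constant Wronskian, the other two data from the growth of the sum of
  squares and of the minors.\<close>

lemma exponents_determined:
  fixes \<sigma> :: "3 \<Rightarrow> real"
  assumes "\<sigma> 1 + \<sigma> 2 + \<sigma> 3 = 3" "min (\<sigma> 1) (min (\<sigma> 2) (\<sigma> 3)) = - g1"
    "min (\<sigma> 1 + \<sigma> 2) (min (\<sigma> 1 + \<sigma> 3) (\<sigma> 2 + \<sigma> 3)) - 1 = - g2"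
  shows "\<sigma> i = - g1 \<or> \<sigma> i = 1 + g1 - g2 \<or> \<sigma> i = 2 + g2"
  using assms exhaust_3[of i] unfolding min_def by (auto split: if_splits)

text \<open>The monodromy at \<open>0\<close> preserves the Hermitian form \<open>exp (- u)\<close>, hence is unitary; this is what
  excludes logarithms.\<close>

lemma toda_local_structure:
  assumes r: "r > 0" and T: "toda_domain (ball 0 r - {0}) U V u v"
    and b: "\<delta> > 0" "\<And>z. 0 < norm z \<Longrightarrow> norm z < \<delta> \<Longrightarrow> \<bar>u z - 2 * g1 * ln (norm z)\<bar> \<le> C"
      "\<And>z. 0 < norm z \<Longrightarrow> norm z < \<delta> \<Longrightarrow> \<bar>v z - 2 * g2 * ln (norm z)\<bar> \<le> C"
  obtains Z \<sigma> k where "\<And>i. ode3 (slit_ball r) (W2 U V) (W3 U V) (Z i)" "\<And>i. power_form r (\<sigma> i) (k i) (Z i)"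
    "\<And>i. k i 0 \<noteq> 0" "inj \<sigma>" "\<And>z. z \<in> slit_ball r \<Longrightarrow> wronsk Z z \<noteq> 0"
    "\<And>i. \<sigma> i = - g1 \<or> \<sigma> i = 1 + g1 - g2 \<or> \<sigma> i = 2 + g2"
proof -
  let ?S = "slit_ball r" and ?S' = "ball 0 r - \<real>\<^sub>\<ge>\<^sub>0 :: complex set"
  have r2: "0 < r / 2" "r / 2 < r" using r by auto
  note So = slit_ball_facts(1)[of r] and Sc = slit_ball_connected[of r]
    and So' = opposite_slit_facts(1)[of r] and Sc' = opposite_slit_facts(2)[OF r]
  have "?S \<subseteq> ball 0 r - {0}" using slit_ball_facts by auto
  then have T1: "toda_domain ?S U V u v" by (rule toda_domain_subset[OF T So])
  have T2: "toda_domain ?S' U V u v" by (rule toda_domain_subset[OF T So']) auto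
  note hol1 = toda_domain.W2_holomorphic[OF T1] toda_domain.W3_holomorphic[OF T1]
  note hol2 = toda_domain.W2_holomorphic[OF T2] toda_domain.W3_holomorphic[OF T2]
  note con1 = hol1[THEN holomorphic_on_imp_continuous_on] and con2 = hol2[THEN holomorphic_on_imp_continuous_on]
  obtain Y where Y: "\<And>k. ode3 ?S (W2 U V) (W3 U V) (Y k)"
    "\<And>i j z. z \<in> ?S \<Longrightarrow> toda_domain.defect U V u v Y i j z = 0" "\<And>z. z \<in> ?S \<Longrightarrow> wronsk Y z = 1 / 8"
    by (rule toda_domain.exists_representation[OF T1 slit_ball_star[OF r2] Sc], assumption) (rule that; (assumption | simp))
  have wne: "wronsk Y z \<noteq> 0" if "z \<in> ?S" for z unfolding Y(3)[OF that] by simp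
  define L where "L = ball 0 r \<inter> {z. Im z < 0}"
  define H where "H = ball 0 r \<inter> {z. 0 < Im z}"
  have LH: "open L" "open H" "connected L" "connected H" "L \<subseteq> ?S" "L \<subseteq> ?S'" "H \<subseteq> ?S" "H \<subseteq> ?S'"
    unfolding L_def H_def slit_ball_def
    by (auto simp: complex_nonpos_Reals_iff complex_nonneg_Reals_iff intro!: open_Int open_halfspace_Im_lt open_halfspace_Im_gt
        convex_connected convex_Int convex_halfspace_Im_lt convex_halfspace_Im_gt)
  define z1 where "z1 = - \<i> * of_real (r / 2)"
  define z2 where "z2 = \<i> * of_real (r / 2)"
  have z1: "z1 \<in> L" and z2: "z2 \<in> H" using r by (auto simp: z1_def z2_def L_def H_def norm_mult)
  have z1': "z1 \<in> ?S" "z1 \<in> ?S'" "z2 \<in> ?S" "z2 \<in> ?S'" using z1 z2 LH by auto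
  \<comment> \<open>\<open>Y'\<close> will be the continuation of \<open>Y\<close> from the lower
    half disc across the negative real axis; in the upper half disc it is a matrix \<open>M\<close>
    applied to \<open>Y\<close>.\<close>
  have "\<exists>y. ode3 ?S' (W2 U V) (W3 U V) y \<and> jet y z1 = jet (Y k) z1" for k
    by (rule ode3_exists_at[OF So' opposite_slit_star[OF r2] Sc' hol2 z1'(2)])
  then obtain Y' where Y': "\<And>k. ode3 ?S' (W2 U V) (W3 U V) (Y' k)" "\<And>k. jet (Y' k) z1 = jet (Y k) z1" by metis
  have low: "Y' k z = Y k z" if "z \<in> L" for k z
    by (rule ode3_unique[OF LH(1,3) continuous_on_subset[OF con1(1) LH(5)] continuous_on_subset[OF con1(2) LH(5)]
          ode3_subset[OF Y'(1) LH(1,6)] ode3_subset[OF Y(1) LH(1,5)] z1 Y'(2) that])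
  have def': "toda_domain.defect U V u v Y' i j z = 0" if "z \<in> ?S'" for i j z
    by (rule toda_domain.defect_extends[OF T2 Sc' Y'(1) Y'(1) _ z1'(2) refl that])
      (use Y(2)[OF z1'(1)] in \<open>simp add: toda_domain.defect_def[OF T1] toda_domain.defect_def[OF T2] Y'(2)\<close>)
  have "\<exists>c :: complex ^ 3. \<forall>z\<in>H. Y' k z = (\<Sum>i\<in>UNIV. c $ i * Y i z)" for k
  proof -
    note w0 = wne[OF z1'(3)]
    obtain c :: "complex ^ 3" where "\<And>z. z \<in> H \<Longrightarrow> Y' k z = (\<Sum>i\<in>UNIV. c $ i * Y i z)"
      by (rule ode3_basis_span[OF LH(2,4) continuous_on_subset[OF con1(1) LH(7)] continuous_on_subset[OF con1(2) LH(7)]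
        ode3_subset[OF Y(1) LH(2,7)] z2 w0 ode3_subset[OF Y'(1)[of k] LH(2,8)]]) (rule that, assumption)
    then show ?thesis by blast
  qed
  then obtain m :: "3 \<Rightarrow> complex ^ 3" where m: "\<And>k z. z \<in> H \<Longrightarrow> Y' k z = (\<Sum>i\<in>UNIV. m k $ i * Y i z)" by metis
  define M :: "complex ^ 3 ^ 3" where "M = (\<chi> k. m k)"
  have up: "Y' k z = (\<Sum>i\<in>UNIV. M $ k $ i * Y i z)" if "z \<in> H" for k z using m[OF that] by (simp add: M_def)
  have rep: "(\<Sum>k\<in>UNIV. Y k z * cnj (Y k z)) = of_real (exp (- u z))" if "z \<in> ?S" for z
    using toda_domain.defect_eq_diag(1)[OF T1 Y(2)[OF that]] by simp
  have rep': "(\<Sum>k\<in>UNIV. Y' k z * cnj (Y' k z)) = of_real (exp (- u z))" if "z \<in> ?S'" for z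
    using toda_domain.defect_eq_diag(1)[OF T2 def'[OF that]] by simp
  have Yh: "Y k holomorphic_on ?S" for k using Y(1) by (simp add: ode3_def)
  have Yh': "Y' k holomorphic_on ?S'" for k using Y'(1) by (simp add: ode3_def)
  \<comment> \<open>Both bases represent the same \<open>exp (- u)\<close> in the upper half disc;
    independence of the products turns this into unitarity of \<open>M\<close>.\<close>
  have orth: "(\<Sum>k\<in>UNIV. M $ k $ i * cnj (M $ k $ j)) - (if i = j then 1 else 0) = 0" for i j
  proof (rule product_indep[where Y = Y and D = H and h = "\<lambda>i j. (\<Sum>k\<in>UNIV. M $ k $ i * cnj (M $ k $ j)) - (if i = j then 1 else 0)"])
    show "H \<noteq> {}" using z2 by blast
    show "Y i holomorphic_on H" for i by (rule holomorphic_on_subset[OF Yh LH(7)])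
    show "wronsk Y z \<noteq> 0" if "z \<in> H" for z by (rule wne) (use that LH(7) in blast)
    fix z assume z: "z \<in> H"
    have zS: "z \<in> ?S" "z \<in> ?S'" using z LH(7,8) by blast+
    have "(\<Sum>k\<in>UNIV. Y' k z * cnj (Y' k z)) = (\<Sum>k\<in>UNIV. Y k z * cnj (Y k z))"
      by (simp only: rep[OF zS(1)] rep'[OF zS(2)])
    then show "(\<Sum>i\<in>UNIV. \<Sum>j\<in>UNIV. ((\<Sum>k\<in>UNIV. M $ k $ i * cnj (M $ k $ j)) - (if i = j then 1 else 0)) * (Y i z * cnj (Y j z))) = 0"
      unfolding up[OF z] by (simp add: sum_3 algebra_simps)
  qed (rule LH(2))
  define N :: "complex ^ 3 ^ 3" where "N = (\<chi> i j. cnj (M $ j $ i))"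
  have "N ** M = mat 1"
  proof -
    have "(\<Sum>k\<in>UNIV. N $ i $ k * M $ k $ j) = (if i = j then 1 else 0)" for i j
      using orth[of j i] by (auto simp: N_def mult.commute)
    then show ?thesis by (simp add: vec_eq_iff matrix_matrix_mult_def mat_def)
  qed
  then have MN: "M ** N = mat 1" using matrix_left_right_inverse by blast
  have rows: "(\<Sum>k\<in>UNIV. M $ i $ k * cnj (M $ j $ k)) = (if i = j then 1 else 0)" for i j
  proof -
    have "(M ** N) $ i $ j = (if i = j then 1 else 0)" unfolding MN by (simp add: mat_def)
    then show ?thesis by (simp add: matrix_matrix_mult_def N_def)
  qed
  \<comment> \<open>Coefficient vectors of combinations of the \<open>Y k\<close> are transformed by
    the transpose of \<open>M\<close>, so eigenvectors of \<open>A\<close> give solutions whose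
    continuation is a scalar multiple.\<close>
  define A where "A = transpose M"
  have unit: "hin (A *v x) (A *v y) = hin x y" for x y
  proof -
    have "hin (A *v x) (A *v y) = (\<Sum>i\<in>UNIV. \<Sum>j\<in>UNIV. x $ i * cnj (y $ j) * (\<Sum>k\<in>UNIV. M $ i $ k * cnj (M $ j $ k)))"
      by (simp add: hin_def A_def matrix_vector_mult_def transpose_def sum_3 algebra_simps del: transpose_matrix_vector)
    also have "\<dots> = hin x y" unfolding rows by (simp add: hin_def sum_3)
    finally show ?thesis .
  qed
  obtain P :: "complex ^ 3 ^ 3" and \<mu> where P: "det P \<noteq> 0" "\<And>i. A *v (P $ i) = \<mu> i *s (P $ i)" "\<And>i. norm (\<mu> i) = 1"
    by (rule unitary_eigenbasis[OF unit]) (rule that, assumption+)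
  define X where "X = lincomb P Y"
  define X' where "X' = lincomb P Y'"
  have upX: "X' i z = \<mu> i * X i z" if "z \<in> H" for i z
  proof -
    have "X' i z = (\<Sum>j\<in>UNIV. (A *v (P $ i)) $ j * Y j z)"
      by (simp add: X'_def lincomb_def up[OF that] A_def matrix_vector_mult_def transpose_def sum_3 algebra_simps del: transpose_matrix_vector)
    also have "\<dots> = \<mu> i * X i z" unfolding P(2) by (simp add: X_def lincomb_def sum_distrib_left mult.assoc)
    finally show ?thesis .
  qed
  have Xode: "ode3 ?S (W2 U V) (W3 U V) (X i)" for i unfolding X_def by (rule lincomb_ode3(1)[OF So Y(1)])
  have Xode': "ode3 ?S' (W2 U V) (W3 U V) (X' i)" for i unfolding X'_def by (rule lincomb_ode3(1)[OF So' Y'(1)])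
  have Xw: "wronsk X z = det P / 8" if "z \<in> ?S" for z
    using lincomb_ode3(3)[OF So Y(1) that, of P] Y(3)[OF that] by (simp add: X_def)
  \<comment> \<open>One function is bounded by the whole sum of squares, hence by
    \<open>exp (- u z / 2)\<close>; this gives the growth bound for the eigenfunctions on both slit
    discs.\<close>
  have grow1: "norm (w k) \<le> exp (C / 2) * norm z powr (- g1)"
    if "(\<Sum>k\<in>UNIV. w k * cnj (w k)) = of_real (exp (- u z))" "z \<noteq> 0" "norm z < \<delta>" for w :: "3 \<Rightarrow> complex" and k z
  proof -
    have "complex_of_real (\<Sum>k\<in>UNIV. (norm (w k))\<^sup>2) = of_real (exp (- u z))"
      unfolding of_real_sum complex_norm_square by (rule that(1))
    then have "(\<Sum>k\<in>UNIV. (norm (w k))\<^sup>2) = exp (- u z)" using of_real_eq_iff by blast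
    then have "(norm (w k))\<^sup>2 \<le> exp (- u z)" using member_le_sum[of k UNIV "\<lambda>k. (norm (w k))\<^sup>2"] by simp
    also have "\<dots> \<le> exp (2 * (C / 2 + - g1 * ln (norm z)))" using b(2)[of z] that by (simp add: abs_le_iff algebra_simps)
    also have "\<dots> = (exp (C / 2 + - g1 * ln (norm z)))\<^sup>2" by (rule exp_double)
    also have "exp (C / 2 + - g1 * ln (norm z)) = exp (C / 2) * norm z powr (- g1)"
      using that(2) by (simp add: powr_def exp_add[symmetric])
    finally show ?thesis by (rule power2_le_imp_le) simp
  qed
  define Bd where "Bd = (\<lambda>i. (\<Sum>j\<in>UNIV. norm (P $ i $ j)) * exp (C / 2))"
  have grow2: "norm (lincomb P W i z) \<le> Bd i * norm z powr (- g1)"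
    if "(\<Sum>k\<in>UNIV. W k z * cnj (W k z)) = of_real (exp (- u z))" "z \<noteq> 0" "norm z < \<delta>" for W i z
  proof -
    have "norm (lincomb P W i z) \<le> (\<Sum>j\<in>UNIV. norm (P $ i $ j) * (exp (C / 2) * norm z powr (- g1)))"
      unfolding lincomb_def by (rule sum_norm_le) (auto simp: norm_mult intro!: mult_left_mono grow1[of "\<lambda>k. W k z"] that)
    also have "\<dots> = Bd i * norm z powr (- g1)" by (simp add: Bd_def sum_3 algebra_simps)
    finally show ?thesis .
  qed
  have "\<exists>\<rho> h. power_form r \<rho> h (X i) \<and> h 0 \<noteq> 0" for i
  proof (rule monodromy_eigenfunction_power_form[OF r, where y' = "X' i" and \<mu> = "\<mu> i" and \<delta> = \<delta> and C = "Bd i" and s = "- g1"])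
    show "X i holomorphic_on ?S" using Xode by (simp add: ode3_def)
    show "X' i holomorphic_on ?S'" using Xode' by (simp add: ode3_def)
    show "X' i z = X i z" if "z \<in> ball 0 r" "Im z < 0" for z
      using low[of z] that by (simp add: X_def X'_def lincomb_def L_def)
    show "X' i z = \<mu> i * X i z" if "z \<in> ball 0 r" "Im z > 0" for z
      using upX[of z i] that by (simp add: H_def)
    show "norm (X i z) \<le> Bd i * norm z powr (- g1)" if "z \<in> ?S" "norm z < \<delta>" for z
      unfolding X_def by (rule grow2[where W = Y, OF rep[OF that(1)] slit_ball_facts(3)[OF that(1)] that(2)])
    show "norm (X' i z) \<le> Bd i * norm z powr (- g1)" if "z \<in> ?S'" "norm z < \<delta>" for z
      unfolding X'_def by (rule grow2[where W = Y', OF rep'[OF that(1)] _ that(2)]) (use that(1) in auto)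
    show "\<exists>z\<in>?S. X i z \<noteq> 0"
    proof (rule ccontr)
      assume "\<not> ?thesis"
      then have "jet (X i) z1 = jet (\<lambda>_. 0) z1" by (intro jet_cong_open[OF So z1'(1)]) auto
      then have "row i (jetmat X z1) = 0" by (simp add: row_def jetmat_def vec3_eq_iff)
      then have "wronsk X z1 = 0" unfolding wronsk_def by (rule det_zero_row)
      then show False using Xw[OF z1'(1)] P(1) by simp
    qed
  qed (use P(3) b(1) in auto)
  then obtain \<rho> h where f: "\<And>i. power_form r (\<rho> i) (h i) (X i)" "\<And>i. h i 0 \<noteq> 0" by metis
  have c0: "det P / 8 \<noteq> 0" using P(1) by simp
  obtain B \<sigma> k where B: "det B \<noteq> 0" "inj \<sigma>" "\<And>i. power_form r (\<sigma> i) (k i) (lincomb B X i)" "\<And>i. k i 0 \<noteq> 0"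
    by (rule echelon[OF r Xode c0 Xw f], assumption) (rule that, assumption+)
  have Zode: "ode3 ?S (W2 U V) (W3 U V) (lincomb B X i)" for i by (rule lincomb_ode3(1)[OF So Xode])
  have Zw: "wronsk (lincomb B X) z = det B * (det P / 8)" if "z \<in> ?S" for z
    using lincomb_ode3(3)[OF So Xode that, of B] Xw[OF that] by simp
  have c1: "det B * (det P / 8) \<noteq> 0" using B(1) c0 by simp
  have sum3: "\<sigma> 1 + \<sigma> 2 + \<sigma> 3 = 3" by (rule exponent_sum(2)[OF r B(3,4) c1 Zw B(2)])
  have "asy r (sq Y) (- 2 * g1)"
  proof (rule asy_cong[OF asy_exp[OF b(1,2)]])
    fix z assume "z \<in> ?S"
    have "complex_of_real (sq Y z) = of_real (exp (- u z))"
      unfolding sq_def of_real_sum complex_norm_square by (rule rep[OF \<open>z \<in> ?S\<close>])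
    then show "sq Y z = exp (- u z)" using of_real_eq_iff by blast
  qed
  then have "asy r (sq (lincomb B X)) (- 2 * g1)"
    using lincomb_asy(1)[OF P(1) Y(1)] lincomb_asy(1)[OF B(1) Xode] by (simp add: X_def)
  from asy_unique[OF r this asy_sq[OF r B(3,4)]] have m1: "min (\<sigma> 1) (min (\<sigma> 2) (\<sigma> 3)) = - g1" by simp
  have "asy r (\<lambda>z. exp (- v z) / 4) (- 2 * g2)"
    by (rule asy_compare[OF asy_exp[OF b(1,3)], where K = 4 and K' = 1]) auto
  then have "asy r (wsq Y) (- 2 * g2)"
  proof (rule asy_cong)
    fix z assume "z \<in> ?S"
    have "complex_of_real (wsq Y z) = of_real (exp (- v z) / 4)"
      unfolding wsq_def of_real_sum complex_norm_square toda_domain.minors_sum[OF T1 Y(2)[OF \<open>z \<in> ?S\<close>]]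
      by (simp add: wr2_def)
    then show "wsq Y z = exp (- v z) / 4" using of_real_eq_iff by blast
  qed
  then have "asy r (wsq (lincomb B X)) (- 2 * g2)"
    using lincomb_asy(2)[OF P(1) Y(1)] lincomb_asy(2)[OF B(1) Xode] by (simp add: X_def)
  from asy_unique[OF r this asy_wsq[OF r B(3,4,2)]]
  have m2: "min (\<sigma> 1 + \<sigma> 2) (min (\<sigma> 1 + \<sigma> 3) (\<sigma> 2 + \<sigma> 3)) - 1 = - g2" by simp
  have Zne: "wronsk (lincomb B X) z \<noteq> 0" if "z \<in> ?S" for z
    unfolding Zw[OF that] by (rule c1)
  show thesis
    by (rule that[OF Zode B(3,4,2) Zne exponents_determined[OF sum3 m1 m2]])
qed

section \<open>From even solutions to linear equations\<close>

lemma wirt_affine: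
  assumes "wirt f a b (e * z + p)"
  shows "wirt (\<lambda>w. f (e * w + p)) (a * e) (b * cnj e) z"
proof -
  have "((\<lambda>w. e * w + p) has_derivative (\<lambda>h. e * h)) (at z)" by (auto intro!: derivative_eq_intros)
  from has_derivative_compose[OF this assms[unfolded wirt_def]] show ?thesis
    unfolding wirt_def by (simp add: mult_ac)
qed

lemma dz_affine:
  assumes D: "open D" and f: "smooth_on D f" and z: "z \<in> D" "e * z + p \<in> D"
    and s: "\<And>w. w \<in> D \<Longrightarrow> f (e * w + p) = s * f w"
  shows "e * dz f (e * z + p) = s * dz f z" "cnj e * dzbar f (e * z + p) = s * dzbar f z"
proof -
  have "wirt (\<lambda>w. f (e * w + p)) (dz f (e * z + p) * e) (dzbar f (e * z + p) * cnj e) z"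
    by (rule wirt_affine[OF smooth_on_wirt[OF f z(2)]])
  then have "wirt (\<lambda>w. s * f w) (dz f (e * z + p) * e) (dzbar f (e * z + p) * cnj e) z"
    by (rule wirt_cong[OF _ D z(1)]) (rule s)
  from wirt_unique[OF this wirt_cmult[OF smooth_on_wirt[OF f z(1)]]]
  show "e * dz f (e * z + p) = s * dz f z" "cnj e * dzbar f (e * z + p) = s * dzbar f z" by (auto simp: mult.commute)
qed

lemma dz_lincomb:
  assumes D: "open D" "z \<in> D" and f: "smooth_on D f" "smooth_on D g"
  shows "dz (\<lambda>z. a * f z + b * g z) z = a * dz f z + b * dz g z"
    "dzbar (\<lambda>z. a * f z + b * g z) z = a * dzbar f z + b * dzbar g z"
    "dz (dzbar (\<lambda>z. a * f z + b * g z)) z = a * dz (dzbar f) z + b * dz (dzbar g) z"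
proof -
  have w: "wirt (\<lambda>z. a * f z + b * g z) (a * dz f w + b * dz g w) (a * dzbar f w + b * dzbar g w) w"
    if "smooth_on D f" "smooth_on D g" "w \<in> D" for f g w
    by (rule wirt_add[OF wirt_cmult[OF smooth_on_wirt[OF that(1,3)]] wirt_cmult[OF smooth_on_wirt[OF that(2,3)]]])
  show "dz (\<lambda>z. a * f z + b * g z) z = a * dz f z + b * dz g z" by (rule wirt_dz[OF w[OF f D(2)]])
  show "dzbar (\<lambda>z. a * f z + b * g z) z = a * dzbar f z + b * dzbar g z" by (rule wirt_dzbar[OF w[OF f D(2)]])
  have "dz (dzbar (\<lambda>z. a * f z + b * g z)) z = dz (\<lambda>z. a * dzbar f z + b * dzbar g z) z"
    by (rule dz_cong(1)[OF D]) (rule wirt_dzbar[OF w[OF f]])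
  also have "\<dots> = a * dz (dzbar f) z + b * dz (dzbar g) z"
    by (rule wirt_dz[OF w[OF smooth_on_dz(2)[OF D(1) f(1)] smooth_on_dz(2)[OF D(1) f(2)] D(2)]])
  finally show "dz (dzbar (\<lambda>z. a * f z + b * g z)) z = a * dz (dzbar f) z + b * dz (dzbar g) z" .
qed

text \<open>The left side is the indicial polynomial; \<open>wp'\<close> has leading term
  \<open>- 2 / z ^ 3\<close>, whence the factor in \<open>2 * ode_beta\<close>. The roots are the
  three local exponents, see \<open>gamma_differences\<close>.\<close>

lemma exponent_polynomial:
  fixes s :: real
  shows "s * (s - 1) * (s - 2) - ode_alpha n1 n2 * s - 2 * ode_beta n1 n2
    = (s + gamma1 n1 n2) * (s - (1 + gamma1 n1 n2 - gamma2 n1 n2)) * (s - (2 + gamma2 n1 n2))"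
  by (simp add: ode_alpha_def ode_beta_def Let_def algebra_simps)

lemma gamma_differences: "2 * gamma1 n1 n2 - gamma2 n1 n2 = real n1" "2 * gamma2 n1 n2 - gamma1 n1 n2 = real n2"
  "1 + gamma1 n1 n2 - gamma2 n1 n2 = - gamma1 n1 n2 + real (n1 + 1)"
  "2 + gamma2 n1 n2 = - gamma1 n1 n2 + real (n1 + n2 + 2)"
  by (simp_all add: gamma1_def gamma2_def field_simps)

text \<open>All exponents lie in \<open>- g\<close> plus the natural numbers, so one common power
  can be taken out of every combination of the basis.\<close>

lemma power_form_solution_no_log:
  assumes r: "r > 0" and pq: "continuous_on (slit_ball r) p" "continuous_on (slit_ball r) q"
    and Z: "\<And>i. ode3 (slit_ball r) p q (Z i)" "\<And>i. power_form r (\<sigma> i) (k i) (Z i)"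
      "\<And>z. z \<in> slit_ball r \<Longrightarrow> wronsk Z z \<noteq> 0"
    and \<sigma>: "\<And>i. \<exists>n::nat. \<sigma> i = - g + real n" and y: "ode3 (slit_ball r) p q y"
  shows "\<exists>h. h holomorphic_on ball 0 r \<and> (\<forall>z\<in>slit_ball r. y z = z powr (- of_real g) * h z)"
proof -
  have z1: "complex_of_real (r / 2) \<in> slit_ball r" using slit_ball_star(1)[of "r/2" r] r by simp
  obtain c :: "complex ^ 3" where c: "\<And>z. z \<in> slit_ball r \<Longrightarrow> y z = (\<Sum>i\<in>UNIV. c $ i * Z i z)"
    by (rule ode3_basis_span[OF slit_ball_facts(1) slit_ball_connected pq Z(1) z1 Z(3)[OF z1] y]) (rule that, assumption)
  obtain n :: "3 \<Rightarrow> nat" where n: "\<And>i. \<sigma> i = - g + real (n i)" using \<sigma> by metis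
  have "(\<lambda>z. \<Sum>i\<in>UNIV. c $ i * (z ^ n i * k i z)) holomorphic_on ball 0 r"
    using Z(2) unfolding power_form_def by (intro holomorphic_intros) auto
  moreover have "y z = z powr (- of_real g) * (\<Sum>i\<in>UNIV. c $ i * (z ^ n i * k i z))" if z: "z \<in> slit_ball r" for z
  proof -
    have z0: "z \<noteq> 0" using slit_ball_facts(3)[OF z] .
    have "Z i z = cpow (- g) z * (z ^ n i * k i z)" for i
    proof -
      have "cpow (\<sigma> i) z = cpow (- g) z * z ^ n i" unfolding n cpow_add cpow_of_nat[OF z0] ..
      then show ?thesis using Z(2)[of i] z by (simp add: power_form_def mult.assoc)
    qed
    then show ?thesis using c[OF z] cpow_powr[OF z0, of "- g"] by (simp add: sum_distrib_left mult_ac)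
  qed
  ultimately show ?thesis by (intro exI[of _ "\<lambda>z. \<Sum>i\<in>UNIV. c $ i * (z ^ n i * k i z)"]) simp
qed

lemma ode_solution_iff_ode3:
  "ode_solution \<tau> n1 n2 (B, D0, D) S y \<longleftrightarrow>
    ode3 S (\<lambda>z. - (of_real (ode_alpha n1 n2) * wp \<tau> z + B)) (\<lambda>z. of_real (ode_beta n1 n2) * wp' \<tau> z + D0 * wp \<tau> z + D) y"
  by (simp add: ode_solution_def ode3_def eval_nat_numeral algebra_simps)

context torus
begin

lemma solution_toda_domain:
  assumes s: "toda_solution \<tau> n1 n2 (u, v)"
  defines "uu \<equiv> (\<lambda>z. (2 * u z + v z) / 3)" and "vv \<equiv> (\<lambda>z. (u z + 2 * v z) / 3)"
  shows "toda_domain (- \<Lambda>) (\<lambda>z. of_real (uu z)) (\<lambda>z. of_real (vv z)) uu vv"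
proof -
  let ?u = "\<lambda>z. complex_of_real (u z)" and ?v = "\<lambda>z. complex_of_real (v z)"
  have sm: "smooth_on (- \<Lambda>) ?u" "smooth_on (- \<Lambda>) ?v"
    using s by (auto simp: toda_solution_def smooth_on_of_real_iff)
  have eU: "(\<lambda>z. complex_of_real (uu z)) = (\<lambda>z. (2/3) * ?u z + (1/3) * ?v z)"
    and eV: "(\<lambda>z. complex_of_real (vv z)) = (\<lambda>z. (1/3) * ?u z + (2/3) * ?v z)"
    by (auto simp: uu_def vv_def field_simps)
  have uv: "2 * uu z - vv z = u z" "2 * vv z - uu z = v z" for z by (simp_all add: uu_def vv_def field_simps)
  have e: "exp (2 * complex_of_real (uu z) - of_real (vv z)) = of_real (exp (u z))"
    "exp (2 * complex_of_real (vv z) - of_real (uu z)) = of_real (exp (v z))" for z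
    by (simp_all flip: uv exp_of_real)
  show ?thesis
  proof (unfold_locales)
    show "smooth_on (- \<Lambda>) (\<lambda>z. complex_of_real (uu z))" "smooth_on (- \<Lambda>) (\<lambda>z. complex_of_real (vv z))"
      unfolding eU eV by (intro smooth_on_add smooth_on_mult smooth_on_const open_compl_lattice sm)+
    fix z assume z: "z \<in> - \<Lambda>"
    have L: "4 * dz (dzbar ?u) z + 2 * of_real (exp (u z)) - of_real (exp (v z)) = 0"
      "4 * dz (dzbar ?v) z + 2 * of_real (exp (v z)) - of_real (exp (u z)) = 0"
      using s z by (auto simp: toda_solution_def laplacian_def)
    have L': "dz (dzbar ?u) z = (of_real (exp (v z)) - 2 * of_real (exp (u z))) / 4"
      "dz (dzbar ?v) z = (of_real (exp (u z)) - 2 * of_real (exp (v z))) / 4"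
      using L by (simp_all add: field_simps eq_neg_iff_add_eq_0 add_eq_0_iff)
    show "dz (dzbar (\<lambda>z. complex_of_real (uu z))) z = - exp (2 * complex_of_real (uu z) - complex_of_real (vv z)) / 4"
      unfolding eU dz_lincomb(3)[OF open_compl_lattice z sm] L' e[of z] by (simp add: field_simps)
    show "dz (dzbar (\<lambda>z. complex_of_real (vv z))) z = - exp (2 * complex_of_real (vv z) - complex_of_real (uu z)) / 4"
      unfolding eV dz_lincomb(3)[OF open_compl_lattice z sm] L' e[of z] by (simp add: field_simps)
  qed auto
qed

lemma bigo_1_bound:
  assumes "f \<in> O[at 0](\<lambda>_. 1 :: real)"
  obtains C \<delta> where "\<delta> > 0" "\<And>z::complex. 0 < norm z \<Longrightarrow> norm z < \<delta> \<Longrightarrow> \<bar>f z\<bar> \<le> C"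
proof -
  obtain c where c: "\<forall>\<^sub>F z in at (0::complex). norm (f z) \<le> c * norm (1 :: real)"
    using landau_o.bigE[OF assms] by blast
  then obtain d where "d > 0" "\<forall>z. z \<noteq> 0 \<and> dist z 0 < d \<longrightarrow> norm (f z) \<le> c"
    unfolding eventually_at by auto
  then show thesis using that[of d c] by auto
qed

lemma solution_bounds:
  assumes s: "toda_solution \<tau> n1 n2 (u, v)"
  obtains C \<delta> where "\<delta> > 0"
    "\<And>z. 0 < norm z \<Longrightarrow> norm z < \<delta> \<Longrightarrow> \<bar>(2 * u z + v z) / 3 - 2 * gamma1 n1 n2 * ln (norm z)\<bar> \<le> C"
    "\<And>z. 0 < norm z \<Longrightarrow> norm z < \<delta> \<Longrightarrow> \<bar>(u z + 2 * v z) / 3 - 2 * gamma2 n1 n2 * ln (norm z)\<bar> \<le> C"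
proof -
  have o: "(\<lambda>z. u z - 2 * real n1 * ln (norm z)) \<in> O[at 0](\<lambda>_. 1)" "(\<lambda>z. v z - 2 * real n2 * ln (norm z)) \<in> O[at 0](\<lambda>_. 1)"
    using s by (auto simp: toda_solution_def)
  obtain C1 d1 where 1: "d1 > 0" "\<And>z. 0 < norm z \<Longrightarrow> norm z < d1 \<Longrightarrow> \<bar>u z - 2 * real n1 * ln (norm z)\<bar> \<le> C1"
    by (rule bigo_1_bound[OF o(1)]) (rule that, assumption+)
  obtain C2 d2 where 2: "d2 > 0" "\<And>z. 0 < norm z \<Longrightarrow> norm z < d2 \<Longrightarrow> \<bar>v z - 2 * real n2 * ln (norm z)\<bar> \<le> C2"
    by (rule bigo_1_bound[OF o(2)]) (rule that, assumption+)
  have e: "(2 * u z + v z) / 3 - 2 * gamma1 n1 n2 * l = (2 * (u z - 2 * real n1 * l) + (v z - 2 * real n2 * l)) / 3"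
    "(u z + 2 * v z) / 3 - 2 * gamma2 n1 n2 * l = ((u z - 2 * real n1 * l) + 2 * (v z - 2 * real n2 * l)) / 3" for z l
    by (simp_all add: gamma1_def gamma2_def field_simps)
  show thesis
  proof (rule that[of "min d1 d2" "2 * C1 + 2 * C2"])
    show "0 < min d1 d2" using 1 2 by simp
    fix z :: complex assume z: "0 < norm z" "norm z < min d1 d2"
    have "\<bar>u z - 2 * real n1 * ln (norm z)\<bar> \<le> C1" "\<bar>v z - 2 * real n2 * ln (norm z)\<bar> \<le> C2"
      using 1(2)[of z] 2(2)[of z] z by auto
    moreover have "\<bar>(2 * a + b) / 3\<bar> \<le> 2 * C1 + 2 * C2" "\<bar>(a + 2 * b) / 3\<bar> \<le> 2 * C1 + 2 * C2"
      if "\<bar>a\<bar> \<le> C1" "\<bar>b\<bar> \<le> C2" for a b :: real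
      using that by (simp_all add: abs_le_iff)
    ultimately show "\<bar>(2 * u z + v z) / 3 - 2 * gamma1 n1 n2 * ln (norm z)\<bar> \<le> 2 * C1 + 2 * C2"
      "\<bar>(u z + 2 * v z) / 3 - 2 * gamma2 n1 n2 * ln (norm z)\<bar> \<le> 2 * C1 + 2 * C2"
      unfolding e by simp_all
  qed
qed

text \<open>For \<open>e = 1\<close> this concerns translations, for \<open>e = -1\<close>
  reflections. Each \<open>z\<close>-derivative contributes a factor \<open>e\<close>, and the terms
  of \<open>W2\<close> contain two of them, those of \<open>W3\<close> three.\<close>

lemma W_affine:
  assumes sm: "smooth_on (- \<Lambda>) U" "smooth_on (- \<Lambda>) V" and e: "e = 1 \<or> e = -1"
    and p: "\<And>z. z \<in> - \<Lambda> \<Longrightarrow> e * z + p \<in> - \<Lambda>"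
    and inv: "\<And>z. z \<in> - \<Lambda> \<Longrightarrow> U (e * z + p) = U z" "\<And>z. z \<in> - \<Lambda> \<Longrightarrow> V (e * z + p) = V z" and z: "z \<in> - \<Lambda>"
  shows "W2 U V (e * z + p) = W2 U V z" "W3 U V (e * z + p) = e * W3 U V z"
    "dz (dzbar U) (e * z + p) = dz (dzbar U) z"
proof -
  have ee: "e * e = 1" "cnj e = e" using e by auto
  have step: "dz f (e * w + p) = (e * s) * dz f w" "dzbar f (e * w + p) = (e * s) * dzbar f w"
    if "smooth_on (- \<Lambda>) f" "\<And>w. w \<in> - \<Lambda> \<Longrightarrow> f (e * w + p) = s * f w" "w \<in> - \<Lambda>" for f s w
  proof -
    have 1: "e * dz f (e * w + p) = s * dz f w" "cnj e * dzbar f (e * w + p) = s * dzbar f w"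
      using dz_affine[OF open_compl_lattice that(1,3) p[OF that(3)] that(2)] by auto
    have "dz f (e * w + p) = (e * e) * dz f (e * w + p)" "dzbar f (e * w + p) = (e * e) * dzbar f (e * w + p)" by (simp_all add: ee)
    then show "dz f (e * w + p) = (e * s) * dz f w" "dzbar f (e * w + p) = (e * s) * dzbar f w"
      using 1 unfolding ee(2) by (simp_all only: mult.assoc)
  qed
  note sd = smooth_on_dz[OF open_compl_lattice]
  have U1: "dz U (e * w + p) = e * dz U w" "dzbar U (e * w + p) = e * dzbar U w" if "w \<in> - \<Lambda>" for w
    using step[of U 1 w] sm(1) inv(1) that by auto
  have V1: "dz V (e * w + p) = e * dz V w" if "w \<in> - \<Lambda>" for w using step(1)[of V 1 w] sm(2) inv(2) that by auto
  have U2: "dz (dz U) (e * w + p) = 1 * dz (dz U) w" if "w \<in> - \<Lambda>" for w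
    using step(1)[OF sd(1)[OF sm(1)] U1(1) that] ee by simp
  have V2: "dz (dz V) (e * w + p) = 1 * dz (dz V) w" if "w \<in> - \<Lambda>" for w
    using step(1)[OF sd(1)[OF sm(2)] V1 that] ee by simp
  have U3: "dz (dz (dz U)) (e * w + p) = e * dz (dz (dz U)) w" if "w \<in> - \<Lambda>" for w
    using step(1)[OF sd(1)[OF sd(1)[OF sm(1)]] U2 that] by simp
  show "dz (dzbar U) (e * z + p) = dz (dzbar U) z"
    using step(1)[OF sd(2)[OF sm(1)] U1(2) z] ee by simp
  show "W2 U V (e * z + p) = W2 U V z" "W3 U V (e * z + p) = e * W3 U V z"
    unfolding W2_def W3_def U1[OF z] V1[OF z] U2[OF z] V2[OF z] U3[OF z] using e by (auto simp: power2_eq_square algebra_simps)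
qed

text \<open>The limit makes \<open>z * f z\<close> regular at 0, and an odd regular function
  vanishes there.\<close>

lemma pole_lowering:
  assumes f: "f holomorphic_on - \<Lambda>" and lim: "((\<lambda>z. z * (z * f z)) \<longlongrightarrow> 0) (at 0)"
    and odd: "\<And>z. z \<notin> \<Lambda> \<Longrightarrow> (- z) * f (- z) = - (z * f z)"
  shows "((\<lambda>z. z * f z) \<longlongrightarrow> 0) (at 0)"
proof -
  have A: "- (\<Lambda> - {0}) - {0} = - \<Lambda>" by auto
  have "(\<lambda>z. z * f z) holomorphic_on - (\<Lambda> - {0}) - {0}" unfolding A by (intro holomorphic_intros f)
  then obtain h where h: "h holomorphic_on - (\<Lambda> - {0})" "\<forall>z\<in>- (\<Lambda> - {0}) - {0}. z * f z = 0 / z + h z"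
    using simple_pole_decomposition[OF _ open_punctured lim] by blast
  have hz: "z * f z = h z" if "z \<notin> \<Lambda>" for z using h(2) that unfolding A by simp
  have "isCont h 0"
    using holomorphic_on_imp_continuous_on[OF h(1)] open_punctured by (simp add: continuous_on_eq_continuous_at)
  then have hl: "(h \<longlongrightarrow> h 0) (at 0)" by (simp add: isCont_def)
  have "((\<lambda>z. h (- z)) \<longlongrightarrow> h 0) (at 0)"
  proof -
    have "isCont (\<lambda>z. h (- z)) 0"
      by (rule isCont_o2[where g = h]) (use \<open>isCont h 0\<close> in \<open>auto intro: continuous_intros\<close>)
    then show ?thesis by (simp add: isCont_def)
  qed
  moreover have "\<forall>\<^sub>F z in at 0. h (- z) = - h z"
    using eventually_not_lattice
  proof eventually_elim
    case (elim z) then show ?case using hz[of z] hz[of "- z"] odd[of z] lattice_minus_iff by metis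
  qed
  ultimately have "((\<lambda>z. - h z) \<longlongrightarrow> h 0) (at 0)" by (rule Lim_transform_eventually)
  moreover have "((\<lambda>z. - h z) \<longlongrightarrow> - h 0) (at 0)" by (intro tendsto_intros hl)
  ultimately have "h 0 = - h 0" using tendsto_unique by (metis at_neq_bot)
  then have "h 0 = 0" by (simp add: eq_neg_iff_add_eq_0)
  have "\<forall>\<^sub>F z in at 0. h z = z * f z" using eventually_not_lattice by (rule eventually_mono) (simp add: hz)
  then show ?thesis using Lim_transform_eventually[OF hl] \<open>h 0 = 0\<close> by simp
qed

lemma even_solution_params:
  assumes s: "(u, v) \<in> even_toda_solutions \<tau> n1 n2"
  shows "\<exists>B. is_associated_ode \<tau> n1 n2 (u, v) (B, 0, 0) \<and> apparent_at_0 \<tau> n1 n2 (B, 0, 0)"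
proof -
  define uu where "uu = (\<lambda>z. (2 * u z + v z) / 3)"
  define vv where "vv = (\<lambda>z. (u z + 2 * v z) / 3)"
  define U where "U = (\<lambda>z. complex_of_real (uu z))"
  define V where "V = (\<lambda>z. complex_of_real (vv z))"
  define g1 where "g1 = gamma1 n1 n2"
  define g2 where "g2 = gamma2 n1 n2"
  let ?al = "ode_alpha n1 n2" and ?be = "ode_beta n1 n2"
  have ts: "toda_solution \<tau> n1 n2 (u, v)" and ev: "\<And>z. u (- z) = u z" "\<And>z. v (- z) = v z"
    using s by (auto simp: even_toda_solutions_def)
  have per: "u (z + 1) = u z" "u (z + \<tau>) = u z" "v (z + 1) = v z" "v (z + \<tau>) = v z" for z
    using ts by (auto simp: toda_solution_def torus_function_def)
  have T: "toda_domain (- \<Lambda>) U V uu vv"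
    unfolding U_def V_def uu_def vv_def by (rule solution_toda_domain[OF ts])
  have sm: "smooth_on (- \<Lambda>) U" "smooth_on (- \<Lambda>) V" using T by (auto simp: toda_domain_def)
  note W2h = toda_domain.W2_holomorphic[OF T] and W3h = toda_domain.W3_holomorphic[OF T]
  obtain C \<delta> where b0: "\<delta> > 0"
    "\<And>z. 0 < norm z \<Longrightarrow> norm z < \<delta> \<Longrightarrow> \<bar>(2 * u z + v z) / 3 - 2 * gamma1 n1 n2 * ln (norm z)\<bar> \<le> C"
    "\<And>z. 0 < norm z \<Longrightarrow> norm z < \<delta> \<Longrightarrow> \<bar>(u z + 2 * v z) / 3 - 2 * gamma2 n1 n2 * ln (norm z)\<bar> \<le> C"
    by (rule solution_bounds[OF ts]) (rule that, assumption+)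
  have b: "\<delta> > 0" "\<And>z. 0 < norm z \<Longrightarrow> norm z < \<delta> \<Longrightarrow> \<bar>uu z - 2 * g1 * ln (norm z)\<bar> \<le> C"
    "\<And>z. 0 < norm z \<Longrightarrow> norm z < \<delta> \<Longrightarrow> \<bar>vv z - 2 * g2 * ln (norm z)\<bar> \<le> C"
    unfolding uu_def vv_def g1_def g2_def by (rule b0; assumption)+
  have local: "\<exists>Z \<sigma> k. (\<forall>i. ode3 (slit_ball r) (W2 U V) (W3 U V) (Z i)) \<and> (\<forall>i. power_form r (\<sigma> i) (k i) (Z i)) \<and> (\<forall>i. k i 0 \<noteq> 0) \<and> inj \<sigma>
     \<and> (\<forall>z\<in>slit_ball r. wronsk Z z \<noteq> 0) \<and> (\<forall>i. \<sigma> i = - g1 \<or> \<sigma> i = 1 + g1 - g2 \<or> \<sigma> i = 2 + g2)"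
    and sub: "ball 0 r - {0} \<subseteq> - \<Lambda>" if r: "r > 0" "ball 0 r \<inter> \<Lambda> = {0}" for r
  proof -
    show sub: "ball 0 r - {0} \<subseteq> - \<Lambda>" using r(2) by auto
    have T': "toda_domain (ball 0 r - {0}) U V uu vv" by (rule toda_domain_subset[OF T _ sub]) auto
    obtain Z \<sigma> k where zz: "\<And>i. ode3 (slit_ball r) (W2 U V) (W3 U V) (Z i)" "\<And>i. power_form r (\<sigma> i) (k i) (Z i)" "\<And>i. k i 0 \<noteq> 0" "inj \<sigma>"
      "\<And>z. z \<in> slit_ball r \<Longrightarrow> wronsk Z z \<noteq> 0" "\<And>i. \<sigma> i = - g1 \<or> \<sigma> i = 1 + g1 - g2 \<or> \<sigma> i = 2 + g2"
      by (rule toda_local_structure[OF r(1) T' b]; (assumption | (rule that; assumption)))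
    show "\<exists>Z \<sigma> k. (\<forall>i. ode3 (slit_ball r) (W2 U V) (W3 U V) (Z i)) \<and> (\<forall>i. power_form r (\<sigma> i) (k i) (Z i)) \<and> (\<forall>i. k i 0 \<noteq> 0) \<and> inj \<sigma>
     \<and> (\<forall>z\<in>slit_ball r. wronsk Z z \<noteq> 0) \<and> (\<forall>i. \<sigma> i = - g1 \<or> \<sigma> i = 1 + g1 - g2 \<or> \<sigma> i = 2 + g2)"
      by (intro exI[of _ Z] exI[of _ \<sigma>] exI[of _ k] conjI allI ballI zz)
  qed
  obtain r where "r > 0" "\<forall>\<zeta>\<in>ball 0 r. \<bar>sc \<zeta>\<bar> < 1 \<and> \<bar>tc \<zeta>\<bar> < 1" using small_radius by blast
  then have r: "r > 0" "ball 0 r \<inter> \<Lambda> = {0}" using small_ball_lattice by auto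
  obtain Z \<sigma> k where zz: "(\<forall>i. ode3 (slit_ball r) (W2 U V) (W3 U V) (Z i)) \<and> (\<forall>i. power_form r (\<sigma> i) (k i) (Z i)) \<and> (\<forall>i. k i 0 \<noteq> 0) \<and> inj \<sigma>
     \<and> (\<forall>z\<in>slit_ball r. wronsk Z z \<noteq> 0) \<and> (\<forall>i. \<sigma> i = - g1 \<or> \<sigma> i = 1 + g1 - g2 \<or> \<sigma> i = 2 + g2)"
    using local[OF r] by (elim exE) (rule that)
  have Z: "\<And>i. ode3 (slit_ball r) (W2 U V) (W3 U V) (Z i)" "\<And>i. power_form r (\<sigma> i) (k i) (Z i)" "\<And>i. k i 0 \<noteq> 0" "inj \<sigma>"
    "\<And>i. \<sigma> i = - g1 \<or> \<sigma> i = 1 + g1 - g2 \<or> \<sigma> i = 2 + g2"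
    using zz by simp_all
  have root: "\<sigma> i * (\<sigma> i - 1) * (\<sigma> i - 2) - ?al * \<sigma> i - 2 * ?be = 0" for i
    unfolding exponent_polynomial using Z(5)[of i] by (auto simp: g1_def g2_def)
  have ne: "\<sigma> 1 \<noteq> \<sigma> 2" using Z(4) by (simp add: inj_eq)
  have l2: "((\<lambda>z. z\<^sup>2 * W2 U V z) \<longlongrightarrow> - of_real ?al) (at 0)" and l3: "((\<lambda>z. z ^ 3 * W3 U V z) \<longlongrightarrow> - of_real (2 * ?be)) (at 0)"
    by (rule coefficient_limits[OF r(1) holomorphic_on_subset[OF W2h sub[OF r]] holomorphic_on_subset[OF W3h sub[OF r]] Z(1,2,3) ne root])+
  \<comment> \<open>Subtracting the principal parts found in \<open>l2\<close> and \<open>l3\<close>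
    leaves elliptic functions with poles of lower order, to be reduced to constants by parity and
    the residue theorem.\<close>
  define f2 where "f2 = (\<lambda>z. W2 U V z + of_real ?al * wp \<tau> z)"
  define f3 where "f3 = (\<lambda>z. W3 U V z - of_real ?be * wp' \<tau> z)"
  have f2h: "f2 holomorphic_on - \<Lambda>" unfolding f2_def by (intro holomorphic_intros W2h wp_holomorphic)
  have f3h: "f3 holomorphic_on - \<Lambda>" unfolding f3_def by (intro holomorphic_intros W3h wp'_holomorphic)
  have Wp: "W2 U V (z + q) = W2 U V z" "W3 U V (z + q) = W3 U V z" if "q = 1 \<or> q = \<tau>" "z \<notin> \<Lambda>" for q z
  proof -
    have "z + q \<notin> \<Lambda>" if "z \<notin> \<Lambda>" for z using lattice_add_iff[of q z] \<open>q = 1 \<or> q = \<tau>\<close> that by auto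
    then show "W2 U V (z + q) = W2 U V z" "W3 U V (z + q) = W3 U V z"
      using W_affine[OF sm, of 1 q z] that per by (auto simp: U_def V_def uu_def vv_def)
  qed
  have Wm: "W2 U V (- z) = W2 U V z" "W3 U V (- z) = - W3 U V z" if "z \<notin> \<Lambda>" for z
    using W_affine[OF sm, of "-1" 0 z] that ev lattice_minus_iff by (auto simp: U_def V_def uu_def vv_def)
  have f2p: "f2 (z + 1) = f2 z" "f2 (z + \<tau>) = f2 z" "f3 (z + 1) = f3 z" "f3 (z + \<tau>) = f3 z" if "z \<notin> \<Lambda>" for z
    using that Wp wp_periodic by (auto simp: f2_def f3_def)
  have f2m: "f2 (- z) = f2 z" "f3 (- z) = - f3 z" if "z \<notin> \<Lambda>" for z
    using that Wm wp_minus wp'_minus by (auto simp: f2_def f3_def)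
  have "((\<lambda>z. z\<^sup>2 * W2 U V z + of_real ?al * (z\<^sup>2 * wp \<tau> z)) \<longlongrightarrow> - of_real ?al + of_real ?al * 1) (at 0)"
    by (intro tendsto_intros l2 wp_asymp)
  then have "((\<lambda>z. z * (z * f2 z)) \<longlongrightarrow> 0) (at 0)" by (simp add: f2_def power2_eq_square algebra_simps)
  then have "((\<lambda>z. z * f2 z) \<longlongrightarrow> 0) (at 0)" by (rule pole_lowering[OF f2h]) (simp add: f2m)
  then obtain c where c: "\<And>z. z \<notin> \<Lambda> \<Longrightarrow> f2 z = c" using elliptic_constant[OF f2h f2p(1,2)] by (metis ComplI)
  have "((\<lambda>z. z ^ 3 * W3 U V z - of_real ?be * (z ^ 3 * wp' \<tau> z)) \<longlongrightarrow> - of_real (2 * ?be) - of_real ?be * - 2) (at 0)"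
    by (intro tendsto_intros l3 wp_asymp)
  then have "((\<lambda>z. z * (z * (z * f3 z))) \<longlongrightarrow> 0) (at 0)" by (simp add: f3_def power3_eq_cube algebra_simps)
  \<comment> \<open>Applied to the even function \<open>z * f3 z\<close>, which leaves at most a
    simple pole of the odd function \<open>f3\<close>.\<close>
  then have l4: "((\<lambda>z. z * (z * f3 z)) \<longlongrightarrow> 0) (at 0)"
    by (rule pole_lowering[where f = "\<lambda>z. z * f3 z", rotated]) (auto simp: f2m intro!: holomorphic_intros f3h)
  have A: "- (\<Lambda> - {0}) - {0} = - \<Lambda>" by auto
  have "(\<lambda>z. z * f3 z) holomorphic_on - (\<Lambda> - {0}) - {0}" unfolding A by (intro holomorphic_intros f3h)
  then obtain h where h: "h holomorphic_on - (\<Lambda> - {0})" "\<forall>z\<in>- (\<Lambda> - {0}) - {0}. z * f3 z = 0 / z + h z"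
    using simple_pole_decomposition[OF _ open_punctured l4] by blast
  have "isCont h 0"
    using holomorphic_on_imp_continuous_on[OF h(1)] open_punctured by (simp add: continuous_on_eq_continuous_at)
  then have "(h \<longlongrightarrow> h 0) (at 0)" by (simp add: isCont_def)
  moreover have "\<forall>\<^sub>F z in at 0. h z = z * f3 z"
    using eventually_not_lattice by (rule eventually_mono) (use h(2) in \<open>auto simp: A\<close>)
  ultimately have l5: "((\<lambda>z. z * f3 z) \<longlongrightarrow> h 0) (at 0)" by (rule Lim_transform_eventually)
  \<comment> \<open>Parity cannot exclude a simple pole of an odd function; the vanishing of the
    residue does.\<close>
  have "h 0 = 0" by (rule elliptic_residue_zero[OF f3h f2p(3,4) l5])
  then obtain c3 where c3: "\<And>z. z \<notin> \<Lambda> \<Longrightarrow> f3 z = c3" using elliptic_constant[OF f3h f2p(3,4)] l5 by (metis ComplI)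
  have "c3 = - c3" using c3[of "1/2"] c3[of "- (1/2)"] f2m(2)[of "1/2"] half_not_lattice(1) lattice_minus_iff by metis
  then have "c3 = 0" by (simp add: eq_neg_iff_add_eq_0)
  have W: "W2 U V z = - (of_real ?al * wp \<tau> z + - c)" "W3 U V z = of_real ?be * wp' \<tau> z + 0 * wp \<tau> z + 0" if "z \<notin> \<Lambda>" for z
    using c[OF that] c3[OF that] \<open>c3 = 0\<close> by (auto simp: f2_def f3_def algebra_simps)
  have "is_associated_ode \<tau> n1 n2 (u, v) (- c, 0, 0)"
    using W unfolding is_associated_ode_def by (auto simp: Let_def U_def V_def uu_def vv_def)
  moreover have "apparent_at_0 \<tau> n1 n2 (- c, 0, 0)"
    unfolding apparent_at_0_def log_singularity_at_0_def
  proof (intro allI impI notI, elim exE conjE)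
    fix R y assume R: "R > 0" "ball 0 R \<inter> \<Lambda> = {0}" and y: "ode_solution \<tau> n1 n2 (- c, 0, 0) (slit_ball R) y"
      and nl: "\<not> (\<exists>h. h holomorphic_on ball 0 R \<and> (\<forall>z\<in>slit_ball R. y z = z powr (- of_real (gamma1 n1 n2)) * h z))"
    have sl: "slit_ball R \<subseteq> - \<Lambda>" using sub[OF R] slit_ball_facts by blast
    have y3: "ode3 (slit_ball R) (W2 U V) (W3 U V) y"
      by (rule ode3_cong_coeff[OF _ _ y[unfolded ode_solution_iff_ode3]]) (use W sl in auto)
    \<comment> \<open>\<open>apparent_at_0\<close> quantifies over all admissible radii, so the
      local basis is produced anew on the disc of radius \<open>R\<close>.\<close>
    obtain Z \<sigma> k where zz: "(\<forall>i. ode3 (slit_ball R) (W2 U V) (W3 U V) (Z i)) \<and> (\<forall>i. power_form R (\<sigma> i) (k i) (Z i)) \<and> (\<forall>i. k i 0 \<noteq> 0) \<and> inj \<sigma>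
     \<and> (\<forall>z\<in>slit_ball R. wronsk Z z \<noteq> 0) \<and> (\<forall>i. \<sigma> i = - g1 \<or> \<sigma> i = 1 + g1 - g2 \<or> \<sigma> i = 2 + g2)"
      using local[OF R] by (elim exE) (rule that)
    have Z: "\<And>i. ode3 (slit_ball R) (W2 U V) (W3 U V) (Z i)" "\<And>i. power_form R (\<sigma> i) (k i) (Z i)"
      "\<And>z. z \<in> slit_ball R \<Longrightarrow> wronsk Z z \<noteq> 0" "\<And>i. \<sigma> i = - g1 \<or> \<sigma> i = 1 + g1 - g2 \<or> \<sigma> i = 2 + g2"
      using zz by simp_all
    have "\<exists>n::nat. \<sigma> i = - gamma1 n1 n2 + real n" for i
      using Z(4)[of i] unfolding g1_def g2_def gamma_differences(3,4) by (metis add.right_neutral of_nat_0)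
    from power_form_solution_no_log[OF R(1) _ _ Z(1-3) this y3] nl
    show False using holomorphic_on_imp_continuous_on[OF holomorphic_on_subset[OF W2h sl]]
        holomorphic_on_imp_continuous_on[OF holomorphic_on_subset[OF W3h sl]] by blast
  qed
  ultimately show ?thesis by blast
qed

text \<open>Since \<open>wp\<close> has a double pole, no multiple of it other than 0 is constant:
  multiplying by \<open>z\<^sup>2\<close> and letting \<open>z\<close> tend to 0 isolates
  \<open>D0\<close>. The result makes the definite description in \<open>associated_params\<close>
  meaningful.\<close>

lemma associated_unique:
  assumes "is_associated_ode \<tau> n1 n2 s p" "is_associated_ode \<tau> n1 n2 s p'"
  shows "p = p'"
proof -
  obtain u v B D0 D B' D0' D' where e: "s = (u, v)" "p = (B, D0, D)" "p' = (B', D0', D')" by (metis surj_pair)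
  have 2: "of_real (ode_alpha n1 n2) * wp \<tau> z + B = of_real (ode_alpha n1 n2) * wp \<tau> z + B'"
    and 3: "of_real (ode_beta n1 n2) * wp' \<tau> z + D0 * wp \<tau> z + D = of_real (ode_beta n1 n2) * wp' \<tau> z + D0' * wp \<tau> z + D'" if "z \<notin> \<Lambda>" for z
    using assms that unfolding e is_associated_ode_def Let_def by (auto simp: neg_equal_iff_equal)
  have B: "B = B'" using 2[OF half_not_lattice(1)] by simp
  have lin: "(D0 - D0') * wp \<tau> z = D' - D" if "z \<notin> \<Lambda>" for z using 3[OF that] by (simp add: algebra_simps)
  have "((\<lambda>z. (D0 - D0') * (z\<^sup>2 * wp \<tau> z)) \<longlongrightarrow> (D0 - D0') * 1) (at 0)" by (intro tendsto_intros wp_asymp)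
  moreover have "\<forall>\<^sub>F z in at 0. (D0 - D0') * (z\<^sup>2 * wp \<tau> z) = (D' - D) * z\<^sup>2"
    using eventually_not_lattice by (rule eventually_mono) (simp flip: lin)
  ultimately have "((\<lambda>z. (D' - D) * z\<^sup>2) \<longlongrightarrow> (D0 - D0') * 1) (at 0)" by (rule Lim_transform_eventually)
  moreover have "((\<lambda>z. (D' - D) * z\<^sup>2) \<longlongrightarrow> (D' - D) * 0\<^sup>2) (at 0)" by (intro tendsto_intros)
  ultimately have "(D0 - D0') * 1 = (D' - D) * 0\<^sup>2" using tendsto_unique by (metis at_neq_bot)
  then have "D0 = D0'" by simp
  then show ?thesis using B lin[OF half_not_lattice(1)] e by simp
qed

end

section \<open>Toda potentials from a basis of solutions\<close>

lemma log_sum_squares_laplacian: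
  fixes a :: "3 \<Rightarrow> complex \<Rightarrow> complex"
  assumes N: "open N" and a: "\<And>k. a k holomorphic_on N" and pos: "\<And>z. z \<in> N \<Longrightarrow> sq a z > 0"
  defines "L \<equiv> (\<lambda>z. complex_of_real (ln (sq a z)))"
  shows "smooth_on N L" "z \<in> N \<Longrightarrow> dz (dzbar L) z = of_real (wsq a z / (sq a z)\<^sup>2)"
proof -
  define f where "f = (\<lambda>z. \<Sum>k\<in>UNIV. a k z * cnj (a k z))"
  define fb where "fb = (\<lambda>z. \<Sum>k\<in>UNIV. a k z * cnj (deriv (a k) z))"
  define fz where "fz = (\<lambda>z. \<Sum>k\<in>UNIV. deriv (a k) z * cnj (a k z))"
  have sqf: "f z = of_real (sq a z)" for z unfolding f_def sq_def of_real_sum complex_norm_square ..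
  have d: "(a k has_field_derivative deriv (a k) z) (at z)" if "z \<in> N" for k z
    by (rule holomorphic_derivI[OF a N that])
  have d2: "(deriv (a k) has_field_derivative deriv (deriv (a k)) z) (at z)" if "z \<in> N" for k z
    by (rule holomorphic_derivI[OF holomorphic_deriv[OF a N] N that])
  have wf: "wirt f (fz z) (fb z) z" if "z \<in> N" for z
  proof -
    have "wirt f (\<Sum>k\<in>UNIV. deriv (a k) z * cnj (a k z) + a k z * cnj 0) (\<Sum>k\<in>UNIV. 0 * cnj (a k z) + a k z * cnj (deriv (a k) z)) z"
      unfolding f_def by (intro wirt_sum wirt_mult wirt_cnj wirt_holomorphic d that)
    then show ?thesis by (simp add: fz_def fb_def)
  qed
  have wfb: "\<exists>c. wirt fb (\<Sum>k\<in>UNIV. deriv (a k) z * cnj (deriv (a k) z)) c z" if "z \<in> N" for z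
  proof -
    have "wirt fb (\<Sum>k\<in>UNIV. deriv (a k) z * cnj (deriv (a k) z) + a k z * cnj 0)
       (\<Sum>k\<in>UNIV. 0 * cnj (deriv (a k) z) + a k z * cnj (deriv (deriv (a k)) z)) z"
      unfolding fb_def by (intro wirt_sum wirt_mult wirt_cnj wirt_holomorphic d d2 that)
    then show ?thesis by auto
  qed
  have fsm: "smooth_on N f" unfolding f_def
    by (intro smooth_on_sum smooth_on_mult smooth_on_cnj holomorphic_imp_smooth_on N a)
  have fpos: "f z \<notin> \<real>\<^sub>\<le>\<^sub>0" "f z \<noteq> 0" if "z \<in> N" for z using pos[OF that] by (auto simp: sqf complex_nonpos_Reals_iff)
  have LLn: "L z = Ln (f z)" if "z \<in> N" for z using pos[OF that] by (simp add: L_def sqf Ln_of_real)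
  have "smooth_on N (\<lambda>z. Ln (f z))"
    by (rule smooth_on_holomorphic_comp[OF N fsm, of "- \<real>\<^sub>\<le>\<^sub>0"]) (use fpos in \<open>auto intro!: holomorphic_intros simp: open_Compl\<close>)
  then show "smooth_on N L" by (rule smooth_on_cong[OF N, rotated]) (simp add: LLn)
  have dL: "dzbar L w = inverse (f w) * fb w" if w: "w \<in> N" for w
  proof -
    have "wirt (\<lambda>z. Ln (f z)) (inverse (f w) * fz w) (inverse (f w) * fb w) w"
      by (rule wirt_holomorphic_comp[OF wf[OF w]]) (use fpos[OF w] in \<open>auto intro!: derivative_eq_intros\<close>)
    then have "wirt L (inverse (f w) * fz w) (inverse (f w) * fb w) w"
      by (rule wirt_cong[OF _ N w]) (simp add: LLn)
    then show ?thesis by (rule wirt_dzbar)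
  qed
  assume z: "z \<in> N"
  let ?s = "\<Sum>k\<in>UNIV. deriv (a k) z * cnj (deriv (a k) z)"
  obtain c where c: "wirt fb ?s c z" using wfb[OF z] by blast
  have "wirt (\<lambda>z. inverse (f z)) (- (inverse (f z))\<^sup>2 * fz z) (- (inverse (f z))\<^sup>2 * fb z) z"
    by (rule wirt_holomorphic_comp[OF wf[OF z], of inverse]) (use fpos[OF z] in \<open>auto intro!: derivative_eq_intros simp: power2_eq_square\<close>)
  from wirt_dz[OF wirt_mult[OF this c]]
  have "dz (\<lambda>z. inverse (f z) * fb z) z = - (inverse (f z))\<^sup>2 * fz z * fb z + inverse (f z) * ?s" .
  moreover have "dz (dzbar L) z = dz (\<lambda>z. inverse (f z) * fb z) z" by (rule dz_cong(1)[OF N z dL])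
  ultimately have "dz (dzbar L) z = (f z * ?s - fz z * fb z) / (f z)\<^sup>2"
    using fpos[OF z] by (simp add: field_simps power2_eq_square)
  \<comment> \<open>Lagrange's identity for two vectors in dimension three.\<close>
  also have "f z * ?s - fz z * fb z = of_real (wsq a z)"
    unfolding wsq_def of_real_sum complex_norm_square by (simp add: f_def fz_def fb_def wr2_def sum_3 algebra_simps)
  finally show "dz (dzbar L) z = of_real (wsq a z / (sq a z)\<^sup>2)" by (simp add: sqf)
qed

text \<open>A converse of \<open>exists_representation\<close>; the factor 4 in \<open>v\<close>
  matches \<open>minors_sum\<close>. The minors of the minors are the Wronskian times the original
  functions, which closes the second equation and produces the constant \<open>64\<close>.\<close>

lemma local_toda_from_basis:
  assumes N: "open N" and Y: "\<And>k. ode3 N p q (Y k)" and pq: "p holomorphic_on N" "q holomorphic_on N"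
    and w: "\<And>z. z \<in> N \<Longrightarrow> norm (wronsk Y z) = 1 / 8"
  defines "u \<equiv> (\<lambda>z. - ln (sq Y z))" and "v \<equiv> (\<lambda>z. - ln (4 * wsq Y z))"
  shows "\<And>z. z \<in> N \<Longrightarrow> sq Y z > 0" "\<And>z. z \<in> N \<Longrightarrow> wsq Y z > 0"
    "toda_domain N (\<lambda>z. of_real (u z)) (\<lambda>z. of_real (v z)) u v"
    "\<And>z. z \<in> N \<Longrightarrow> W2 (\<lambda>z. of_real (u z)) (\<lambda>z. of_real (v z)) z = p z"
    "\<And>z. z \<in> N \<Longrightarrow> W3 (\<lambda>z. of_real (u z)) (\<lambda>z. of_real (v z)) z = q z"
proof -
  define A :: "3 \<Rightarrow> complex \<Rightarrow> complex" where "A = (\<lambda>k. if k = 1 then wr2 Y (1,2) else if k = 2 then wr2 Y (1,3) else wr2 Y (2,3))"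
  have As: "sq A z = wsq Y z" for z by (simp add: sq_def wsq_def sum_3 A_def add.assoc)
  have d: "(Y k has_field_derivative deriv (Y k) z) (at z)" "(deriv (Y k) has_field_derivative deriv (deriv (Y k)) z) (at z)" if "z \<in> N" for k z
    using ode3_derivs[OF N Y that] by auto
  have Yh: "Y k holomorphic_on N" for k using Y by (simp add: ode3_def)
  have dw: "(wr2 Y (i, j) has_field_derivative (Y i z * deriv (deriv (Y j)) z - Y j z * deriv (deriv (Y i)) z)) (at z)" if "z \<in> N" for i j z
    unfolding wr2_def by (auto intro!: derivative_eq_intros d[OF that])
  have Ah: "A k holomorphic_on N" for k
    unfolding A_def using dw by (auto simp: holomorphic_on_open[OF N] intro!: exI)
  have wr: "wronsk Y z = Y 1 z * (deriv (Y 2) z * deriv (deriv (Y 3)) z - deriv (Y 3) z * deriv (deriv (Y 2)) z)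
     - Y 2 z * (deriv (Y 1) z * deriv (deriv (Y 3)) z - deriv (Y 3) z * deriv (deriv (Y 1)) z)
     + Y 3 z * (deriv (Y 1) z * deriv (deriv (Y 2)) z - deriv (Y 2) z * deriv (deriv (Y 1)) z)" for z
    unfolding wronsk_def jetmat_def det_3 by (simp add: algebra_simps)
  have wr': "wronsk Y z = deriv (deriv (Y 3)) z * wr2 Y (1,2) z - deriv (deriv (Y 2)) z * wr2 Y (1,3) z + deriv (deriv (Y 1)) z * wr2 Y (2,3) z" for z
    unfolding wr by (simp add: wr2_def algebra_simps)
  have w0: "wronsk Y z \<noteq> 0" if "z \<in> N" for z using w[OF that] by auto
  show sqp: "sq Y z > 0" if z: "z \<in> N" for z
  proof (rule ccontr)
    assume "\<not> ?thesis"
    then have "sq Y z = 0" unfolding sq_def using sum_nonneg[of UNIV "\<lambda>i. (norm (Y i z))\<^sup>2"] by force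
    then have "Y i z = 0" for i unfolding sq_def by (subst (asm) sum_nonneg_eq_0_iff) auto
    then show False using w0[OF z] by (simp add: wr)
  qed
  show wsp: "wsq Y z > 0" if z: "z \<in> N" for z
  proof (rule ccontr)
    assume n: "\<not> ?thesis"
    have "wsq Y z \<ge> 0" unfolding wsq_def by (rule sum_nonneg) simp
    then have "wsq Y z = 0" using n by simp
    then have "\<forall>p\<in>pairs3. (norm (wr2 Y p z))\<^sup>2 = 0" unfolding wsq_def by (subst (asm) sum_nonneg_eq_0_iff) auto
    then show False using w0[OF z] by (simp add: wr')
  qed
  let ?U = "\<lambda>z. complex_of_real (u z)" and ?V = "\<lambda>z. complex_of_real (v z)"
  let ?L1 = "\<lambda>z. complex_of_real (ln (sq Y z))" and ?L2 = "\<lambda>z. complex_of_real (ln (sq A z))"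
  have Apos: "sq A z > 0" if "z \<in> N" for z using wsp[OF that] As by simp
  have lap1: "smooth_on N ?L1" "\<And>z. z \<in> N \<Longrightarrow> dz (dzbar ?L1) z = of_real (wsq Y z / (sq Y z)\<^sup>2)"
    by (rule log_sum_squares_laplacian[OF N Yh sqp], assumption+)+
  have lap2: "smooth_on N ?L2" "\<And>z. z \<in> N \<Longrightarrow> dz (dzbar ?L2) z = of_real (wsq A z / (sq A z)\<^sup>2)"
    by (rule log_sum_squares_laplacian[OF N Ah Apos], assumption+)+
  have U: "?U = (\<lambda>z. (-1) * ?L1 z + 0 * ?L1 z)" by (simp add: u_def)
  have cs: "smooth_on N (\<lambda>_. 1 :: complex)" by (rule smooth_on_const[OF N])
  have V: "?V z = (-1) * ?L2 z + (- complex_of_real (ln 4)) * 1" if "z \<in> N" for z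
    using wsp[OF that] by (simp add: v_def As ln_mult)
  have Vs: "smooth_on N (\<lambda>z. (-1) * ?L2 z + (- complex_of_real (ln 4)) * 1)"
    by (intro smooth_on_add smooth_on_mult smooth_on_const lap2(1) N)
  have smU: "smooth_on N ?U" unfolding U by (intro smooth_on_add smooth_on_mult smooth_on_const lap1(1) N)
  have smV: "smooth_on N ?V" by (rule smooth_on_cong[OF N _ Vs]) (simp add: V)
  have lU: "dz (dzbar ?U) z = - of_real (wsq Y z / (sq Y z)\<^sup>2)" if "z \<in> N" for z
    unfolding U dz_lincomb(3)[OF N that lap1(1) lap1(1)] lap1(2)[OF that] by simp
  have wsqA: "wsq A z = sq Y z / 64" if z: "z \<in> N" for z
  proof -
    have A123: "A 1 = wr2 Y (1,2)" "A 2 = wr2 Y (1,3)" "A 3 = wr2 Y (2,3)" by (simp_all add: A_def)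
    have dA: "deriv (A 1) z = Y 1 z * deriv (deriv (Y 2)) z - Y 2 z * deriv (deriv (Y 1)) z"
      "deriv (A 2) z = Y 1 z * deriv (deriv (Y 3)) z - Y 3 z * deriv (deriv (Y 1)) z"
      "deriv (A 3) z = Y 2 z * deriv (deriv (Y 3)) z - Y 3 z * deriv (deriv (Y 2)) z"
      unfolding A123 by (rule DERIV_imp_deriv[OF dw[OF z]])+
    have "wr2 A (1,2) z = Y 1 z * wronsk Y z" "wr2 A (1,3) z = Y 2 z * wronsk Y z" "wr2 A (2,3) z = Y 3 z * wronsk Y z"
      unfolding wr2_def[of A] fst_conv snd_conv prod.case dA unfolding A123 wr by (simp_all add: wr2_def algebra_simps)
    then show ?thesis by (simp add: wsq_def sq_def sum_3 norm_mult power_mult_distrib w[OF z] power2_eq_square)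
  qed
  have lV: "dz (dzbar ?V) z = - of_real (sq Y z / (64 * (wsq Y z)\<^sup>2))" if z: "z \<in> N" for z
  proof -
    have b: "dzbar ?V w = dzbar (\<lambda>z. (-1) * ?L2 z + (- complex_of_real (ln 4)) * 1) w" if "w \<in> N" for w
      by (rule dz_cong(2)[OF N that V])
    have "dz (dzbar ?V) z = dz (dzbar (\<lambda>z. (-1) * ?L2 z + (- complex_of_real (ln 4)) * 1)) z"
      by (rule dz_cong(1)[OF N z b])
    also have "\<dots> = (-1) * dz (dzbar ?L2) z + (- complex_of_real (ln 4)) * dz (dzbar (\<lambda>_. 1)) z"
      by (rule dz_lincomb(3)[OF N z lap2(1) cs])
    also have "dzbar (\<lambda>_. 1) = (\<lambda>_. 0)" using wirt_dzbar[OF wirt_const] by blast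
    also have "dz (\<lambda>_. 0) z = 0" by (rule wirt_dz[OF wirt_const])
    finally show ?thesis using lap2(2)[OF z] by (simp add: As wsqA[OF z])
  qed
  show T: "toda_domain N ?U ?V u v"
  proof (unfold_locales)
    fix z assume z: "z \<in> N"
    have eu: "exp (u z) = 1 / sq Y z" "exp (v z) = 1 / (4 * wsq Y z)"
      using sqp[OF z] wsp[OF z] by (simp_all add: u_def v_def exp_minus inverse_eq_divide)
    have e2: "exp (2 * u z - v z) / 4 = wsq Y z / (sq Y z)\<^sup>2"
      unfolding exp_diff exp_double eu using sqp[OF z] wsp[OF z] by (simp add: field_simps power2_eq_square)
    have e3: "exp (2 * v z - u z) / 4 = sq Y z / (64 * (wsq Y z)\<^sup>2)"
      unfolding exp_diff exp_double eu using sqp[OF z] wsp[OF z] by (simp add: field_simps power2_eq_square)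
    have c: "- exp (2 * complex_of_real x - of_real y) / 4 = - of_real (exp (2 * x - y) / 4)" for x y
      by (simp flip: exp_of_real)
    show "dz (dzbar ?U) z = - exp (2 * ?U z - ?V z) / 4" unfolding c e2 by (rule lU[OF z])
    show "dz (dzbar ?V) z = - exp (2 * ?V z - ?U z) / 4" unfolding c e3 by (rule lV[OF z])
  qed (use N smU smV in auto)
  let ?g = "toda_domain.gram ?U ?V u v"
  define G where "G = (\<lambda>i j z. \<Sum>k\<in>UNIV. jet (Y k) z $ i * cnj (jet (Y k) z $ j))"
  define dj where "dj = (\<lambda>k i z. if i = (1::3) then jet (Y k) z $ 2 else if i = 2 then jet (Y k) z $ 3 else - (p z * jet (Y k) z $ 2 + q z * jet (Y k) z $ 1))"
  have j: "((\<lambda>z. jet (Y k) z $ i) has_field_derivative dj k i z) (at z)" if "z \<in> N" for k i z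
    using exhaust_3[of i] ode3_derivs[OF N Y that, of k] by (auto simp: dj_def)
  have wG: "wirt (G i j) (\<Sum>k\<in>UNIV. dj k i z * cnj (jet (Y k) z $ j)) (\<Sum>k\<in>UNIV. jet (Y k) z $ i * cnj (dj k j z)) z" if "z \<in> N" for i j z
  proof -
    have "wirt (G i j) (\<Sum>k\<in>UNIV. dj k i z * cnj (jet (Y k) z $ j) + jet (Y k) z $ i * cnj 0)
       (\<Sum>k\<in>UNIV. 0 * cnj (jet (Y k) z $ j) + jet (Y k) z $ i * cnj (dj k j z)) z"
      unfolding G_def by (intro wirt_sum wirt_mult wirt_cnj wirt_holomorphic j that)
    then show ?thesis by simp
  qed
  note wg = toda_domain.wirt_gram[OF T]
  \<comment> \<open>Where an entry of the Gram matrix agrees with that of the jets, so do its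
    derivatives. Starting from the entry \<open>1 1\<close>, this and Hermitian symmetry yield the
    first two columns entry by entry.\<close>
  have step: "toda_domain.dgram ?U ?V u v i j z = (\<Sum>k\<in>UNIV. dj k i z * cnj (jet (Y k) z $ j))"
    "cnj (toda_domain.dgram ?U ?V u v j i z) = (\<Sum>k\<in>UNIV. jet (Y k) z $ i * cnj (dj k j z))"
    if e: "\<And>z. z \<in> N \<Longrightarrow> ?g i j z = G i j z" and z: "z \<in> N" for i j z
    using wirt_unique[OF wirt_cong[OF wg[OF z, of i j] N z e] wG[OF z, of i j]] by auto
  have dg: "toda_domain.dgram ?U ?V u v 1 j z = ?g 2 j z" "toda_domain.dgram ?U ?V u v 2 j z = ?g 3 j z"
    "toda_domain.dgram ?U ?V u v 3 j z = - (W2 ?U ?V z * ?g 2 j z + W3 ?U ?V z * ?g 1 j z)" for j z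
    by (simp_all add: toda_domain.dgram_def[OF T])
  have e11: "?g 1 1 z = G 1 1 z" if "z \<in> N" for z
  proof -
    have "?g 1 1 z = of_real (exp (- u z))"
      by (simp add: toda_domain.gram_def[OF T] sum_3 toda_domain.frame_simps[OF T] toda_domain.diag_def[OF T])
    also have "exp (- u z) = sq Y z" using sqp[OF that] by (simp add: u_def)
    also have "complex_of_real (sq Y z) = G 1 1 z" unfolding G_def sq_def of_real_sum complex_norm_square by simp
    finally show ?thesis .
  qed
  have e21: "?g 2 1 z = G 2 1 z" if "z \<in> N" for z using step(1)[OF e11 that] by (simp add: dg G_def dj_def)
  have e31: "?g 3 1 z = G 3 1 z" if "z \<in> N" for z using step(1)[OF e21 that] by (simp add: dg G_def dj_def)
  have gc: "?g i j z = cnj (?g j i z)" for i j z by (rule toda_domain.gram_cnj[OF T])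
  have e12: "?g 1 2 z = G 1 2 z" if "z \<in> N" for z
    using e21[OF that] gc[of 1 2 z] by (simp add: G_def mult.commute)
  have e22: "?g 2 2 z = G 2 2 z" if "z \<in> N" for z using step(1)[OF e12 that] by (simp add: dg G_def dj_def)
  have e32: "?g 3 2 z = G 3 2 z" if "z \<in> N" for z using step(1)[OF e22 that] by (simp add: dg G_def dj_def)
  have fin: "(W2 ?U ?V z - p z) * ?g 2 1 z + (W3 ?U ?V z - q z) * ?g 1 1 z = 0"
    "(W2 ?U ?V z - p z) * ?g 2 2 z + (W3 ?U ?V z - q z) * ?g 1 2 z = 0" if z: "z \<in> N" for z
  proof -
    have "- (W2 ?U ?V z * ?g 2 1 z + W3 ?U ?V z * ?g 1 1 z) = - (p z * G 2 1 z + q z * G 1 1 z)"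
      using step(1)[OF e31 z] unfolding dg by (simp add: dj_def G_def sum_3 algebra_simps)
    then show "(W2 ?U ?V z - p z) * ?g 2 1 z + (W3 ?U ?V z - q z) * ?g 1 1 z = 0"
      unfolding neg_equal_iff_equal e21[OF z, symmetric] e11[OF z, symmetric] by (simp add: algebra_simps)
    have "- (W2 ?U ?V z * ?g 2 2 z + W3 ?U ?V z * ?g 1 2 z) = - (p z * G 2 2 z + q z * G 1 2 z)"
      using step(1)[OF e32 z] unfolding dg by (simp add: dj_def G_def sum_3 algebra_simps)
    then show "(W2 ?U ?V z - p z) * ?g 2 2 z + (W3 ?U ?V z - q z) * ?g 1 2 z = 0"
      unfolding neg_equal_iff_equal e22[OF z, symmetric] e12[OF z, symmetric] by (simp add: algebra_simps)
  qed
  \<comment> \<open>The relations \<open>fin\<close> are linear in the errors of \<open>W2\<close>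
    and \<open>W3\<close>, and this determinant is the product of two positive pivots, so both
    errors vanish.\<close>
  have dt: "?g 1 1 z * ?g 2 2 z - ?g 1 2 z * ?g 2 1 z \<noteq> 0" for z
  proof -
    have "?g 1 1 z * ?g 2 2 z - ?g 1 2 z * ?g 2 1 z = of_real (toda_domain.diag u v 1 z * toda_domain.diag u v 2 z)"
      by (simp add: toda_domain.gram_def[OF T] sum_3 toda_domain.frame_simps[OF T] algebra_simps)
    then show ?thesis using toda_domain.diag_pos[OF T, of 1 z] toda_domain.diag_pos[OF T, of 2 z] by simp
  qed
  have cramer: "a = 0 \<and> b = 0" if "a * m21 + b * m11 = 0" "a * m22 + b * m12 = 0" "m11 * m22 - m12 * m21 \<noteq> 0" for a b m11 m12 m21 m22 :: complex
  proof -
    have "a * (m11 * m22 - m12 * m21) = m11 * (a * m22 + b * m12) - m12 * (a * m21 + b * m11)"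
      "b * (m11 * m22 - m12 * m21) = m22 * (a * m21 + b * m11) - m21 * (a * m22 + b * m12)" by (simp_all add: algebra_simps)
    then show ?thesis using that by simp
  qed
  show "W2 ?U ?V z = p z" "W3 ?U ?V z = q z" if z: "z \<in> N" for z
    using cramer[OF fin[OF z] dt] by auto
qed

section \<open>Monodromy of an equation with apparent singularity\<close>

text \<open>Under a reflection the first and third derivatives change sign, so the coefficient of
  \<open>y\<close> must be odd while that of the first derivative is even; \<open>e = 1\<close>
  covers translations.\<close>

lemma ode3_affine:
  assumes D: "open D" "open E" and y: "ode3 D p q y" and e: "e = 1 \<or> e = -1"
    and m: "\<And>z. z \<in> E \<Longrightarrow> e * z + c \<in> D"
    and pq: "\<And>z. z \<in> E \<Longrightarrow> p' z = p (e * z + c)" "\<And>z. z \<in> E \<Longrightarrow> q' z = e * q (e * z + c)"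
  shows "ode3 E p' q' (\<lambda>z. y (e * z + c))"
    "\<And>z. z \<in> E \<Longrightarrow> jet (\<lambda>z. y (e * z + c)) z = vector [y (e * z + c), e * deriv y (e * z + c), deriv (deriv y) (e * z + c)]"
proof -
  have ee: "e * (w * e) = w" for w using e by auto
  have l: "((\<lambda>z. e * z + c) has_field_derivative e) (at z)" for z by (auto intro!: derivative_eq_intros)
  note d = ode3_derivs[OF D(1) y m]
  have 1: "((\<lambda>z. y (e * z + c)) has_field_derivative e * deriv y (e * z + c)) (at z)" if "z \<in> E" for z
    using DERIV_chain2[OF d(1)[OF that] l] by (simp add: mult.commute)
  have 2: "((\<lambda>z. e * deriv y (e * z + c)) has_field_derivative deriv (deriv y) (e * z + c)) (at z)" if "z \<in> E" for z
    using DERIV_cmult[OF DERIV_chain2[OF d(2)[OF that] l], of e] unfolding ee .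
  have 3: "((\<lambda>z. deriv (deriv y) (e * z + c)) has_field_derivative - (p' z * (e * deriv y (e * z + c)) + q' z * y (e * z + c))) (at z)" if "z \<in> E" for z
    using DERIV_chain2[OF d(3)[OF that] l] by (simp add: pq[OF that] algebra_simps)
  note I = ode3I[OF D(2) 1 2 3]
  show "ode3 E p' q' (\<lambda>z. y (e * z + c))" by (rule I(1))
  show "jet (\<lambda>z. y (e * z + c)) z = vector [y (e * z + c), e * deriv y (e * z + c), deriv (deriv y) (e * z + c)]" if "z \<in> E" for z
    by (rule I(2)[OF _ _ _ that])
qed

lemma jet_eq_vector: "jet y z = vector [y z, deriv y z, deriv (deriv y) z]"
  by (simp add: jet_def)

section \<open>Solution spaces on the two strips and their monodromy\<close>

locale even_lame = torus +
  fixes n1 n2 :: nat and B :: complex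
  assumes mod3: "n1 mod 3 \<noteq> n2 mod 3" and apparent: "apparent_at_0 \<tau> n1 n2 (B, 0, 0)"
begin

definition cp :: "complex \<Rightarrow> complex" where "cp z = - (of_real (ode_alpha n1 n2) * wp \<tau> z + B)"
definition cq :: "complex \<Rightarrow> complex" where "cq z = of_real (ode_beta n1 n2) * wp' \<tau> z"

lemma cp_cq_holomorphic: "cp holomorphic_on - \<Lambda>" "cq holomorphic_on - \<Lambda>"
  unfolding cp_def[abs_def] cq_def[abs_def] by (intro holomorphic_intros wp_holomorphic wp'_holomorphic)+

lemma cp_cq_period: "z \<notin> \<Lambda> \<Longrightarrow> w \<in> \<Lambda> \<Longrightarrow> cp (z + w) = cp z" "z \<notin> \<Lambda> \<Longrightarrow> w \<in> \<Lambda> \<Longrightarrow> cq (z + w) = cq z"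
  using period_lattice[of "wp \<tau>" w z] period_lattice[of "wp' \<tau>" w z] wp_periodic by (auto simp: cp_def cq_def)

lemma cp_cq_minus: "z \<notin> \<Lambda> \<Longrightarrow> cp (- z) = cp z" "z \<notin> \<Lambda> \<Longrightarrow> cq (- z) = - cq z"
  by (auto simp: cp_def cq_def wp_minus wp'_minus)

text \<open>The common base point of both strips, and the fixed point of the reflection that sends
  \<open>w\<close> to \<open>1 + \<tau> - w\<close>, used for evenness.\<close>

definition z0 :: complex where "z0 = (1 + \<tau>) / 2"

lemma z0_coord: "sc z0 = 1 / 2" "tc z0 = 1 / 2"
proof -
  have "z0 = of_real (1/2) * (1 + \<tau>)" by (simp add: z0_def)
  then show "sc z0 = 1 / 2" "tc z0 = 1 / 2" by (simp_all only: sc_tc_simps) simp_all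
qed

definition cell :: "complex set \<Rightarrow> bool" where
  "cell D \<longleftrightarrow> open D \<and> convex D \<and> z0 \<in> D \<and> D \<subseteq> - \<Lambda>"

lemma cell_ST: "cell S" "cell T" "cell (S \<inter> T)"
  unfolding cell_def using ST_lattice by (auto intro: ST_convex convex_Int simp: S_def[THEN eqset_imp_iff] T_def[THEN eqset_imp_iff] z0_coord)

lemma cellD: "cell D \<Longrightarrow> open D" "cell D \<Longrightarrow> connected D" "cell D \<Longrightarrow> z0 \<in> D" "cell D \<Longrightarrow> D \<subseteq> - \<Lambda>"
    "cell D \<Longrightarrow> cp holomorphic_on D" "cell D \<Longrightarrow> cq holomorphic_on D"
    "cell D \<Longrightarrow> continuous_on D cp" "cell D \<Longrightarrow> continuous_on D cq"
    "cell D \<Longrightarrow> z \<in> D \<Longrightarrow> closed_segment z0 z \<subseteq> D"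
proof -
  assume D: "cell D"
  then show "open D" "connected D" "z0 \<in> D" "D \<subseteq> - \<Lambda>" by (auto simp: cell_def convex_connected)
  then show h: "cp holomorphic_on D" "cq holomorphic_on D" using cp_cq_holomorphic holomorphic_on_subset by blast+
  show "continuous_on D cp" "continuous_on D cq" using h holomorphic_on_imp_continuous_on by blast+
  show "closed_segment z0 z \<subseteq> D" if "z \<in> D"
    using D that by (intro closed_segment_subset) (auto simp: cell_def)
qed

text \<open>Solutions are labelled by their jet at \<open>z0\<close>, so that solutions on different
  domains can be compared and all monodromies act on the same space of vectors.\<close>

definition sol :: "complex set \<Rightarrow> complex ^ 3 \<Rightarrow> complex \<Rightarrow> complex" where
  "sol D x = (SOME y. ode3 D cp cq y \<and> jet y z0 = x)"

lemma sol: assumes "cell D" shows "ode3 D cp cq (sol D x)" "jet (sol D x) z0 = x"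
proof -
  have "\<exists>y. ode3 D cp cq y \<and> jet y z0 = x"
    by (rule ode3_exists_star[OF cellD(1,3)[OF assms] cellD(9)[OF assms] cellD(5,6)[OF assms]])
  from someI_ex[OF this] show "ode3 D cp cq (sol D x)" "jet (sol D x) z0 = x" unfolding sol_def by auto
qed

lemma sol_unique: "cell D \<Longrightarrow> ode3 D cp cq y \<Longrightarrow> jet y z0 = x \<Longrightarrow> z \<in> D \<Longrightarrow> y z = sol D x z"
  by (rule ode3_unique[OF cellD(1,2,7,8) _ sol(1) cellD(3)]) (auto simp: sol)

lemma sol_restrict: "cell D \<Longrightarrow> cell E \<Longrightarrow> E \<subseteq> D \<Longrightarrow> z \<in> E \<Longrightarrow> sol D x z = sol E x z"
  by (rule sol_unique) (auto intro: ode3_subset[OF sol(1)] cellD(1) simp: sol)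

lemma sol_ST: "z \<in> S \<Longrightarrow> z \<in> T \<Longrightarrow> sol S x z = sol T x z"
  using sol_restrict[OF cell_ST(1,3)] sol_restrict[OF cell_ST(2,3)] by auto

lemma sol_sum:
  assumes "cell D" "z \<in> D"
  shows "sol D (\<Sum>i\<in>I. c i *s X i) z = (\<Sum>i\<in>I. c i * sol D (X i) z)"
proof (rule sol_unique[OF assms(1), symmetric])
  show "ode3 D cp cq (\<lambda>z. \<Sum>i\<in>I. c i * sol D (X i) z)"
    by (rule ode3_sum(1)[OF cellD(1)[OF assms(1)]]) (rule sol(1)[OF assms(1)])
  have "jet (\<lambda>z. \<Sum>i\<in>I. c i * sol D (X i) z) z0 = (\<Sum>i\<in>I. c i *s jet (sol D (X i)) z0)"
    by (rule ode3_sum(2)[OF cellD(1)[OF assms(1)] _ cellD(3)[OF assms(1)]]) (rule sol(1)[OF assms(1)])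
  then show "jet (\<lambda>z. \<Sum>i\<in>I. c i * sol D (X i) z) z0 = (\<Sum>i\<in>I. c i *s X i)" by (simp add: sol(2)[OF assms(1)])
qed (rule assms(2))

lemma sol_scale: "cell D \<Longrightarrow> z \<in> D \<Longrightarrow> sol D (c *s x) z = c * sol D x z"
  using sol_sum[of D z "\<lambda>_. c" "\<lambda>_. x" "{()}"] by simp

lemma sol_inj:
  assumes D: "cell D" and E: "open E" "E \<noteq> {}" "E \<subseteq> D" "\<And>z. z \<in> E \<Longrightarrow> sol D x z = sol D y z"
  shows "x = y"
proof -
  obtain w where w: "w \<in> E" using E(2) by blast
  have "jet (sol D x) w = jet (sol D y) w" by (rule jet_cong_open[OF E(1) w E(4)])
  then have "sol D x z = sol D y z" if "z \<in> D" for z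
    using ode3_unique[OF cellD(1,2,7,8)[OF D] sol(1)[OF D] sol(1)[OF D]] w E(3) that by blast
  then have "jet (sol D x) z0 = jet (sol D y) z0" by (rule jet_cong_open[OF cellD(1,3)[OF D]])
  then show ?thesis by (simp add: sol(2)[OF D])
qed

definition shift_cell :: "complex set \<Rightarrow> complex \<Rightarrow> bool" where
  "shift_cell D q \<longleftrightarrow> cell D \<and> q \<in> \<Lambda> \<and> (\<forall>z. z + q \<in> D \<longleftrightarrow> z \<in> D)"

lemma shift_cell_ST: "shift_cell S 1" "shift_cell T \<tau>"
  using cell_ST by (auto simp: shift_cell_def S_def T_def)

text \<open>The label of the translated solution: by \<open>sol_shift\<close> this is the jet at
  \<open>z0\<close> of the function sending \<open>z\<close> to
  \<open>sol D x (z + q)\<close>.\<close>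

definition mon :: "complex set \<Rightarrow> complex \<Rightarrow> complex ^ 3 \<Rightarrow> complex ^ 3" where
  "mon D q x = jet (sol D x) (z0 + q)"

lemma sol_shift:
  assumes D: "shift_cell D q" and z: "z \<in> D"
  shows "sol D x (z + q) = sol D (mon D q x) z"
proof -
  have c: "cell D" and q: "q \<in> \<Lambda>" and s: "\<And>z. z + q \<in> D \<longleftrightarrow> z \<in> D" using D by (auto simp: shift_cell_def)
  have nl: "z \<notin> \<Lambda>" if "z \<in> D" for z using cellD(4)[OF c] that by auto
  note a = ode3_affine[OF cellD(1)[OF c] cellD(1)[OF c] sol(1)[OF c, of x], where e = 1 and c = q and p' = cp and q' = cq]
  have "sol D x (1 * z + q) = sol D (mon D q x) z"
  proof (rule sol_unique[OF c _ _ z])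
    show "ode3 D cp cq (\<lambda>z. sol D x (1 * z + q))" by (rule a(1)) (auto simp: s cp_cq_period nl q)
    have "jet (\<lambda>z. sol D x (1 * z + q)) z0 = vector [sol D x (1 * z0 + q), 1 * deriv (sol D x) (1 * z0 + q), deriv (deriv (sol D x)) (1 * z0 + q)]"
      by (rule a(2)) (auto simp: s cp_cq_period nl q cellD(3)[OF c])
    then show "jet (\<lambda>z. sol D x (1 * z + q)) z0 = mon D q x" by (simp add: mon_def jet_eq_vector)
  qed
  then show ?thesis by simp
qed

lemma mon_sum:
  assumes D: "shift_cell D q"
  shows "mon D q (\<Sum>i\<in>I. c i *s X i) = (\<Sum>i\<in>I. c i *s mon D q (X i))"
proof -
  have c: "cell D" and q: "z0 + q \<in> D" using D cellD(3) by (auto simp: shift_cell_def)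
  have "mon D q (\<Sum>i\<in>I. c i *s X i) = jet (\<lambda>z. \<Sum>i\<in>I. c i * sol D (X i) z) (z0 + q)"
    unfolding mon_def by (rule jet_cong_open[OF cellD(1)[OF c] q sol_sum[OF c]])
  also have "\<dots> = (\<Sum>i\<in>I. c i *s jet (sol D (X i)) (z0 + q))"
    by (rule ode3_sum(2)[OF cellD(1)[OF c] _ q]) (rule sol(1)[OF c])
  finally show ?thesis by (simp add: mon_def)
qed

lemma mon_scale: "shift_cell D q \<Longrightarrow> mon D q (c *s x) = c *s mon D q x"
  using mon_sum[of D q "\<lambda>_. c" "\<lambda>_. x" "{()}"] by simp

lemma mon_inj:
  assumes D: "shift_cell D q" and x: "mon D q x = 0"
  shows "x = 0"
proof (rule sol_inj)
  have c: "cell D" and s: "\<And>z. z + q \<in> D \<longleftrightarrow> z \<in> D" using D by (auto simp: shift_cell_def)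
  show "cell D" "open D" "D \<subseteq> D" "D \<noteq> {}" using c cellD[OF c] by auto
  fix z assume "z \<in> D"
  then have z: "z - q \<in> D" using s[of "z - q"] by simp
  have z': "z \<in> D" by fact
  have "sol D x (z - q + q) = sol D (mon D q x) (z - q)" by (rule sol_shift[OF D z])
  also have "\<dots> = 0" unfolding x using sol_scale[OF c z, of 0 0] by simp
  also have "0 = sol D 0 z" using sol_scale[OF c z', of 0 0] by simp
  finally show "sol D x z = sol D 0 z" by simp
qed

lemma wronsk_sol:
  assumes D: "cell D" and z: "z \<in> D"
  shows "wronsk (\<lambda>k. sol D (X k)) z = det (\<chi> k. X k)"
proof -
  have "wronsk (\<lambda>k. sol D (X k)) z = wronsk (\<lambda>k. sol D (X k)) z0"
    by (rule wronsk_constant[OF cellD(1,2)[OF D] sol(1)[OF D] z cellD(3)[OF D]])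
  then show ?thesis by (simp add: wronsk_def jetmat_def sol(2)[OF D])
qed

lemma det_mon:
  assumes D: "shift_cell D q"
  shows "det (\<chi> k. mon D q (X k)) = det (\<chi> k. X k)"
proof -
  have c: "cell D" and q: "z0 + q \<in> D" using D cellD(3) by (auto simp: shift_cell_def)
  show ?thesis using wronsk_sol[OF c q, of X] by (simp add: wronsk_def jetmat_def mon_def)
qed

text \<open>The factor between the principal power of exponent \<open>- gamma1 n1 n2\<close> and its
  \<open>lower_branch\<close> in the upper half plane.\<close>

definition \<kappa> :: complex where "\<kappa> = exp (2 * \<i> * of_real pi * of_real (gamma1 n1 n2))"

text \<open>Three times \<open>gamma1 n1 n2\<close> is the integer \<open>2 * n1 + n2\<close>,
  congruent to \<open>n2 - n1\<close> modulo 3 and hence not divisible by 3.\<close>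

lemma kappa: "norm \<kappa> = 1" "\<kappa> ^ 3 = 1" "\<kappa> \<noteq> 1" "\<kappa>\<^sup>2 \<noteq> 1"
proof -
  have k: "\<kappa> ^ n = exp (2 * \<i> * of_real pi * of_real (of_nat n * gamma1 n1 n2))" for n
    unfolding \<kappa>_def by (simp flip: exp_of_nat_mult add: mult_ac)
  have iff: "exp (2 * \<i> * of_real pi * of_real x) = 1 \<longleftrightarrow> (\<exists>m::int. x = of_int m)" for x
    unfolding exp_eq_1 by (auto simp: algebra_simps)
  have int: "\<not> (\<exists>m::int. real n * gamma1 n1 n2 = of_int m)" if "n = 1 \<or> n = 2" for n
  proof
    assume "\<exists>m::int. real n * gamma1 n1 n2 = of_int m"
    then obtain m :: int where "real n * gamma1 n1 n2 = of_int m" by blast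
    then have "real_of_int (int n * (2 * int n1 + int n2)) = real_of_int (3 * m)" by (simp add: gamma1_def field_simps)
    then have "int n * (2 * int n1 + int n2) = 3 * m" using of_int_eq_iff by blast
    with that have "2 * int n1 + int n2 = 3 * m \<or> 2 * (2 * int n1 + int n2) = 3 * m" by auto
    then show False using mod3 by presburger
  qed
  show "norm \<kappa> = 1" unfolding \<kappa>_def by simp
  show "\<kappa> ^ 3 = 1" unfolding k iff by (intro exI[of _ "2 * int n1 + int n2"]) (simp add: gamma1_def)
  show "\<kappa> \<noteq> 1" using int[of 1] k[of 1] iff by auto
  show "\<kappa>\<^sup>2 \<noteq> 1" using int[of 2] unfolding k iff by auto
qed

text \<open>Apparentness enters here: every solution near the vertex is a power times a holomorphic
  function, so continuation across the cut multiplies it by \<open>\<kappa>\<close>. The last three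
  facts are values of one local solution in the strips around the vertex, two of them translated
  back into \<open>S\<close> and \<open>T\<close>.\<close>

lemma continuation:
  assumes r: "r > 0" "\<forall>\<zeta>\<in>ball 0 r. \<bar>sc \<zeta>\<bar> < 1 \<and> \<bar>tc \<zeta>\<bar> < 1"
  obtains lam h where "ode3 (slit_ball r) cp cq lam" "power_form r (- gamma1 n1 n2) h lam"
    "\<And>\<zeta>. \<zeta> \<in> ball 0 r \<Longrightarrow> Im \<zeta> < 0 \<Longrightarrow> sol S x (1 + \<tau> + \<zeta>) = lam \<zeta>"
    "\<And>\<zeta>. \<zeta> \<in> ball 0 r \<Longrightarrow> Im \<zeta> > 0 \<Longrightarrow> sol S (mon T \<tau> x) (1 + \<zeta>) = \<kappa> * lam \<zeta>"
    "\<And>\<zeta>. \<zeta> \<in> ball 0 r \<Longrightarrow> sc \<zeta> > 0 \<Longrightarrow> sol T (mon S 1 x) (\<tau> + \<zeta>) = lam \<zeta>"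
proof -
  note b0 = small_ball_lattice[OF r]
  have sub: "slit_ball r \<subseteq> - \<Lambda>"
  proof
    fix z assume z: "z \<in> slit_ball r"
    have "z \<in> ball 0 r" "z \<noteq> 0" using slit_ball_facts(2)[of r] slit_ball_facts(3)[OF z] z by auto
    then show "z \<in> - \<Lambda>" using b0 by blast
  qed
  have hol: "cp holomorphic_on slit_ball r" "cq holomorphic_on slit_ball r"
    using cp_cq_holomorphic sub holomorphic_on_subset by blast+
  define L where "L = ball 0 r \<inter> {\<zeta>. Im \<zeta> < 0}"
  have L: "open L" "connected L"
    unfolding L_def by (auto intro!: open_Int open_halfspace_Im_lt convex_connected convex_Int convex_halfspace_Im_lt)
  have Ls: "L \<subseteq> slit_ball r" by (auto simp: L_def slit_ball_facts(5) complex_nonpos_Reals_iff)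
  define \<zeta>1 where "\<zeta>1 = - \<i> * of_real (r / 2)"
  have z1: "\<zeta>1 \<in> L" using r by (simp add: L_def \<zeta>1_def norm_mult)
  have LS: "1 * \<zeta> + (1 + \<tau>) \<in> S" if "\<zeta> \<in> L" for \<zeta>
    using that r(2) tc_sign(2)[of \<zeta>] by (force simp: L_def S_def)
  have l1: "1 + \<tau> \<in> \<Lambda>" by (simp add: lattice_add)
  have yL: "ode3 L cp cq (\<lambda>z. sol S x (1 * z + (1 + \<tau>)))"
  proof (rule ode3_affine(1)[OF ST_open(1) L(1) sol(1)[OF cell_ST(1)] _ LS])
    fix z assume "z \<in> L"
    then have "z \<notin> \<Lambda>" using Ls sub by auto
    then show "cp z = cp (1 * z + (1 + \<tau>))" "cq z = 1 * cq (1 * z + (1 + \<tau>))" by (simp_all add: cp_cq_period l1)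
  qed auto
  have "\<exists>y. ode3 (slit_ball r) cp cq y \<and> jet y \<zeta>1 = jet (\<lambda>z. sol S x (1 * z + (1 + \<tau>))) \<zeta>1"
  proof (rule ode3_exists_at[OF slit_ball_facts(1) _ _ slit_ball_connected hol])
    show "of_real (r/2) \<in> slit_ball r" "\<And>z. z \<in> slit_ball r \<Longrightarrow> closed_segment (of_real (r/2)) z \<subseteq> slit_ball r"
      using slit_ball_star[of "r/2" r] r(1) by auto
    show "\<zeta>1 \<in> slit_ball r" using z1 Ls by auto
  qed
  then obtain lam where lam: "ode3 (slit_ball r) cp cq lam" and j: "jet lam \<zeta>1 = jet (\<lambda>z. sol S x (1 * z + (1 + \<tau>))) \<zeta>1" by blast
  have lamL: "lam \<zeta> = sol S x (1 + \<tau> + \<zeta>)" if "\<zeta> \<in> ball 0 r" "Im \<zeta> < 0" for \<zeta>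
  proof -
    have z: "\<zeta> \<in> L" using that by (simp add: L_def)
    have "lam \<zeta> = sol S x (1 * \<zeta> + (1 + \<tau>))"
      by (rule ode3_unique[OF L _ _ ode3_subset[OF lam L(1) Ls] yL z1 j z])
        (use hol Ls in \<open>blast intro: holomorphic_on_imp_continuous_on continuous_on_subset\<close>)+
    then show ?thesis by (simp add: add_ac)
  qed
  have "ode_solution \<tau> n1 n2 (B, 0, 0) (slit_ball r) lam"
    unfolding ode_solution_iff_ode3 by (rule ode3_cong_coeff[OF _ _ lam]) (simp_all add: cp_def cq_def)
  then have "\<not> log_singularity_at_0 n1 n2 r lam" using apparent r(1) b0 unfolding apparent_at_0_def by blast
  then obtain h where h: "h holomorphic_on ball 0 r" "\<forall>z\<in>slit_ball r. lam z = z powr (- of_real (gamma1 n1 n2)) * h z"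
    unfolding log_singularity_at_0_def by blast
  have pf: "power_form r (- gamma1 n1 n2) h lam"
    unfolding power_form_def using h slit_ball_facts(3) by (auto simp: cpow_powr)
  define rho where "rho = (\<lambda>z. lower_branch (- gamma1 n1 n2) z * h z)"
  have rho: "rho holomorphic_on (ball 0 r - \<real>\<^sub>\<ge>\<^sub>0)" unfolding rho_def
    by (intro holomorphic_on_mult holomorphic_on_subset[OF lower_branch_holomorphic] holomorphic_on_subset[OF h(1)]) auto
  have sl: "\<zeta> \<in> slit_ball r" if "\<zeta> \<in> ball 0 r" "Im \<zeta> \<noteq> 0" for \<zeta>
    using that by (auto simp: slit_ball_facts(5) complex_nonpos_Reals_iff)
  have rhoL: "rho \<zeta> = lam \<zeta>" if "\<zeta> \<in> ball 0 r" "Im \<zeta> < 0" for \<zeta>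
    using pf sl[OF that(1)] that by (auto simp: rho_def lower_branch_eq power_form_def)
  have rhoH: "rho \<zeta> = \<kappa> * lam \<zeta> + 0" if "\<zeta> \<in> ball 0 r" "Im \<zeta> > 0" for \<zeta>
    using pf sl[OF that(1)] that by (auto simp: rho_def lower_branch_eq power_form_def \<kappa>_def)
  have lamh: "lam holomorphic_on slit_ball r" using lam by (simp add: ode3_def)
  have solh: "sol S x holomorphic_on S" "sol T x holomorphic_on T" for x
    using sol(1)[OF cell_ST(1)] sol(1)[OF cell_ST(2)] by (auto simp: ode3_def)
  have gTh: "(\<lambda>z. sol T (mon S 1 x) (z - 1)) holomorphic_on {z. z - 1 \<in> T}"
    by (rule holomorphic_on_compose_gen[OF _ solh(2), unfolded o_def]) (auto intro!: holomorphic_intros)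
  have gSh: "(\<lambda>z. sol S (mon T \<tau> x) (z - \<tau>)) holomorphic_on {z. z - \<tau> \<in> S}"
    by (rule holomorphic_on_compose_gen[OF _ solh(1), unfolded o_def]) (auto intro!: holomorphic_intros)
  have gT: "sol T (mon S 1 x) (z - 1) = sol S x z" if "z \<in> S" "z - 1 \<in> T" for z
  proof -
    have z: "z - 1 \<in> S" using that(1) by (simp add: S_def)
    show ?thesis using sol_shift[OF shift_cell_ST(1) z, of x] sol_ST[OF z that(2)] by simp
  qed
  have gS: "sol S (mon T \<tau> x) (z - \<tau>) = sol T x z" if "z \<in> T" "z - \<tau> \<in> S" for z
  proof -
    have z: "z - \<tau> \<in> T" using that(1) by (simp add: T_def)
    show ?thesis using sol_shift[OF shift_cell_ST(2) z, of x] sol_ST[OF that(2) z] by simp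
  qed
  have C: "sol S (mon T \<tau> x) (1 + \<tau> + \<zeta> - \<tau>) = \<kappa> * lam \<zeta> + 0" if "\<zeta> \<in> ball 0 r" "Im \<zeta> > 0" for \<zeta>
    by (rule continuation_around_vertex(1)[OF r lamh lamL rho rhoL rhoH solh(1)[of x] solh(2)[of x] sol_ST gTh gT gSh gS that]; assumption)
  have C': "sol T (mon S 1 x) (1 + \<tau> + \<zeta> - 1) = lam \<zeta>" if "\<zeta> \<in> ball 0 r" "sc \<zeta> > 0" for \<zeta>
    by (rule continuation_around_vertex(2)[OF r lamh lamL rho rhoL rhoH solh(1)[of x] solh(2)[of x] sol_ST gTh gT gSh gS that]; assumption)
  show thesis
  proof (rule that[OF lam pf])
    fix \<zeta> :: complex assume z: "\<zeta> \<in> ball 0 r"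
    show "Im \<zeta> < 0 \<Longrightarrow> sol S x (1 + \<tau> + \<zeta>) = lam \<zeta>" using lamL[OF z] by simp
    have e: "1 + \<tau> + \<zeta> - \<tau> = 1 + \<zeta>" "1 + \<tau> + \<zeta> - 1 = \<tau> + \<zeta>" by simp_all
    show "Im \<zeta> > 0 \<Longrightarrow> sol S (mon T \<tau> x) (1 + \<zeta>) = \<kappa> * lam \<zeta>"
      using C[OF z] by (simp add: e)
    show "sc \<zeta> > 0 \<Longrightarrow> sol T (mon S 1 x) (\<tau> + \<zeta>) = lam \<zeta>"
      using C'[OF z] by (simp add: e)
  qed
qed

text \<open>In the sector \<open>sc > 0\<close>, \<open>tc > 0\<close> both continuations around the
  vertex are available, one through \<open>T\<close> first, the other through \<open>S\<close>
  first. They enclose the vertex, whence the factor.\<close>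

lemma monodromy_commutator: "mon S 1 (mon T \<tau> x) = \<kappa> *s mon T \<tau> (mon S 1 x)"
proof -
  obtain r where r: "r > 0" "\<forall>\<zeta>\<in>ball 0 r. \<bar>sc \<zeta>\<bar> < 1 \<and> \<bar>tc \<zeta>\<bar> < 1" using small_radius by blast
  obtain lam where lam: "\<And>\<zeta>. \<zeta> \<in> ball 0 r \<Longrightarrow> Im \<zeta> > 0 \<Longrightarrow> sol S (mon T \<tau> x) (1 + \<zeta>) = \<kappa> * lam \<zeta>"
    "\<And>\<zeta>. \<zeta> \<in> ball 0 r \<Longrightarrow> sc \<zeta> > 0 \<Longrightarrow> sol T (mon S 1 x) (\<tau> + \<zeta>) = lam \<zeta>"
    by (rule continuation[OF r]) (rule that, assumption+)
  define E where "E = ball 0 r \<inter> ({z. 0 < sc z} \<inter> {z. 0 < tc z})"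
  show ?thesis
  proof (rule sol_inj[OF cell_ST(1), of E])
    show "open E" unfolding E_def by (intro open_Int open_ball open_sc_tc)
    show "E \<noteq> {}" using quadrant_point[OF r(1), of 1 1] by (auto simp: E_def)
    have E: "z \<in> ball 0 r" "z \<in> S" "z \<in> T" "Im z > 0" "sc z > 0" if "z \<in> E" for z
      using that r(2) tc_sign(1)[of z] by (auto simp: E_def S_def T_def) force+
    then show "E \<subseteq> S" by blast
    fix z assume z: "z \<in> E"
    have "sol S (mon S 1 (mon T \<tau> x)) z = \<kappa> * lam z"
      using sol_shift[OF shift_cell_ST(1) E(2)[OF z]] lam(1)[OF E(1,4)[OF z]] by (simp add: add.commute)
    also have "lam z = sol T (mon T \<tau> (mon S 1 x)) z"
      using sol_shift[OF shift_cell_ST(2) E(3)[OF z]] lam(2)[OF E(1,5)[OF z]] by (simp add: add.commute)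
    also have "\<dots> = sol S (mon T \<tau> (mon S 1 x)) z" by (rule sol_ST[OF E(2,3)[OF z], symmetric])
    also have "\<kappa> * \<dots> = sol S (\<kappa> *s mon T \<tau> (mon S 1 x)) z" by (rule sol_scale[OF cell_ST(1) E(2)[OF z], symmetric])
    finally show "sol S (mon S 1 (mon T \<tau> x)) z = sol S (\<kappa> *s mon T \<tau> (mon S 1 x)) z" .
  qed
qed

end

lemma eigenvectors_independent:
  fixes a :: "3 \<Rightarrow> complex ^ 3"
  assumes a: "\<And>i. a i \<noteq> 0" and l: "inj l" and A: "\<And>i. A *v a i = l i *s a i"
  shows "det (\<chi> i. a i) \<noteq> 0"
proof
  assume "det (\<chi> i. a i) = 0"
  then have "det (transpose (\<chi> i. a i)) = 0" by (simp add: det_transpose)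
  then obtain c where c: "c \<noteq> 0" "transpose (\<chi> i. a i) *v c = 0" by (rule det_zero_kernel)
  have s0: "c $ 1 *s a 1 + c $ 2 *s a 2 + c $ 3 *s a 3 = 0"
    using c(2) by (simp add: vec_eq_iff matrix_vector_mult_def transpose_def sum_3 mult.commute)
  have step: "(x * l 1) *s a 1 + (y * l 2) *s a 2 + (z * l 3) *s a 3 = 0"
    if "x *s a 1 + y *s a 2 + z *s a 3 = 0" for x y z
  proof -
    have "A *v (x *s a 1 + y *s a 2 + z *s a 3) = 0" unfolding that by simp
    then show ?thesis by (simp add: matrix_vector_right_distrib vector_scalar_commute A)
  qed
  have e: "c $ 1 * a 1 $ j + c $ 2 * a 2 $ j + c $ 3 * a 3 $ j = 0"
    "c $ 1 * l 1 * a 1 $ j + c $ 2 * l 2 * a 2 $ j + c $ 3 * l 3 * a 3 $ j = 0"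
    "c $ 1 * l 1 * l 1 * a 1 $ j + c $ 2 * l 2 * l 2 * a 2 $ j + c $ 3 * l 3 * l 3 * a 3 $ j = 0" for j
    using arg_cong[OF s0, of "\<lambda>v. v $ j"] arg_cong[OF step[OF s0], of "\<lambda>v. v $ j"] arg_cong[OF step[OF step[OF s0]], of "\<lambda>v. v $ j"]
    by (simp_all add: mult.assoc)
  have d: "l 1 \<noteq> l 2" "l 1 \<noteq> l 3" "l 2 \<noteq> l 3" using l by (simp_all add: inj_eq)
  \<comment> \<open>Lagrange interpolation on the distinct eigenvalues isolates each term of the
    relation from its first two images under \<open>A\<close>.\<close>
  have "(l 1 - l 2) * (l 1 - l 3) * (c $ 1 * a 1 $ j) = 0" "(l 2 - l 1) * (l 2 - l 3) * (c $ 2 * a 2 $ j) = 0"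
    "(l 3 - l 1) * (l 3 - l 2) * (c $ 3 * a 3 $ j) = 0" for j
    using e[of j] by algebra+
  then have "c $ i * a i $ j = 0" for i j using d exhaust_3[of i] by auto
  moreover have "\<exists>j. a i $ j \<noteq> 0" for i using a[of i] by (simp add: vec_eq_iff)
  ultimately have "c $ i = 0" for i by (metis mult_eq_0_iff)
  then show False using c(1) by (simp add: vec_eq_iff)
qed

lemma det_scale_rows:
  fixes a :: "3 \<Rightarrow> complex ^ 3"
  shows "det (\<chi> i. l i *s a i) = l 1 * l 2 * l 3 * det (\<chi> i. a i)"
  by (simp add: det_3 algebra_simps)

lemma Gram_expansion:
  fixes C :: "3 \<Rightarrow> complex ^ 3" and w :: "3 \<Rightarrow> complex"
  shows "complex_of_real (\<Sum>k\<in>UNIV. (norm (\<Sum>i\<in>UNIV. C k $ i * w i))\<^sup>2)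
    = (\<Sum>i\<in>UNIV. \<Sum>j\<in>UNIV. (\<Sum>k\<in>UNIV. C k $ i * cnj (C k $ j)) * (w i * cnj (w j)))"
  unfolding of_real_sum complex_norm_square by (simp add: sum_3 algebra_simps)

lemma int_period:
  fixes f :: "complex \<Rightarrow> 'a"
  assumes per: "\<And>z. z \<in> D \<Longrightarrow> f (z + q) = f z" and mem: "\<And>z n. z \<in> D \<Longrightarrow> z + of_int n * q \<in> D" and z: "z \<in> D"
  shows "f (z + of_int n * q) = f z"
proof -
  have nat: "f (z + of_nat n * q) = f z" if "z \<in> D" for n z
  proof (induction n)
    case (Suc n)
    have "f (z + of_nat n * q + q) = f (z + of_nat n * q)" using per mem[OF that, of "int n"] by simp
    then show ?case using Suc by (simp add: algebra_simps)
  qed simp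
  show ?thesis
  proof (cases "n \<ge> 0")
    case True
    then show ?thesis using nat[OF z, of "nat n"] by simp
  next
    case False
    then show ?thesis using nat[OF mem[OF z, of n], of "nat (- n)"] by (simp add: algebra_simps)
  qed
qed

context even_lame
begin

lemma mon_matrix: assumes D: "shift_cell D q" obtains A where "\<And>x. A *v x = mon D q x"
proof
  fix x
  have "(\<chi> i j. mon D q (axis j 1) $ i) *v x = (\<Sum>j\<in>UNIV. x $ j *s mon D q (axis j 1))"
    by (simp add: vec_eq_iff matrix_vector_mult_def mult.commute)
  also have "\<dots> = mon D q (\<Sum>j\<in>UNIV. x $ j *s axis j 1)" by (rule mon_sum[OF D, symmetric])
  finally show "(\<chi> i j. mon D q (axis j 1) $ i) *v x = mon D q x" by (simp add: basis_expansion)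
qed

text \<open>An eigenvector of the first monodromy with eigenvalue \<open>\<mu>\<close> has images
  under the second one with eigenvalues \<open>\<kappa> * \<mu>\<close> and
  \<open>\<kappa>\<^sup>2 * \<mu>\<close>, all distinct. The constant Wronskian gives both
  monodromies determinant 1, which forces the moduli.\<close>

lemma monodromy_eigenbasis:
  obtains a :: "3 \<Rightarrow> complex ^ 3" and l c where "norm (det (\<chi> i. a i)) = 1 / 8" "\<And>i. mon S 1 (a i) = l i *s a i"
    "\<And>i. norm (l i) = 1" "inj l" "mon T \<tau> (a 1) = a 2" "mon T \<tau> (a 2) = a 3" "mon T \<tau> (a 3) = c *s a 1" "norm c = 1"
proof -
  note m1 = shift_cell_ST(1) and m2 = shift_cell_ST(2)
  obtain A where A: "\<And>x. A *v x = mon S 1 x" by (rule mon_matrix[OF m1]) (rule that, assumption)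
  obtain b1 \<mu> where b1: "b1 \<noteq> 0" "A *v b1 = \<mu> *s b1"
    by (rule eigenvector_in_invariant_subspace[where W = UNIV and A = A and x = "axis 1 1"]) (auto simp: axis_eq_0_iff intro: that)
  define b2 where "b2 = mon T \<tau> b1"
  define b3 where "b3 = mon T \<tau> b2"
  have e1: "mon S 1 b1 = \<mu> *s b1" using b1(2) A by simp
  have e2: "mon S 1 b2 = (\<kappa> * \<mu>) *s b2" unfolding b2_def monodromy_commutator e1 mon_scale[OF m2] by simp
  have e3: "mon S 1 b3 = (\<kappa>\<^sup>2 * \<mu>) *s b3" unfolding b3_def monodromy_commutator e2 mon_scale[OF m2] by (simp add: power2_eq_square mult_ac)
  have \<mu>0: "\<mu> \<noteq> 0" using mon_inj[OF m1, of b1] b1(1) e1 by auto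
  have n0: "b2 \<noteq> 0" "b3 \<noteq> 0" using mon_inj[OF m2] b1(1) unfolding b3_def b2_def by metis+
  define b where "b = (\<lambda>i::3. if i = 1 then b1 else if i = 2 then b2 else b3)"
  define l where "l = (\<lambda>i::3. if i = 1 then \<mu> else if i = 2 then \<kappa> * \<mu> else \<kappa>\<^sup>2 * \<mu>)"
  have b_simps: "b 1 = b1" "b 2 = b2" "b 3 = b3" by (simp_all add: b_def)
  have l_simps: "l 1 = \<mu>" "l 2 = \<kappa> * \<mu>" "l 3 = \<kappa>\<^sup>2 * \<mu>" by (simp_all add: l_def)
  have eb: "mon S 1 (b i) = l i *s b i" for i using e1 e2 e3 by (simp add: b_def l_def)
  have k0: "\<kappa> \<noteq> 0" using kappa(1) by auto
  have "\<kappa>\<^sup>2 \<noteq> \<kappa>" using kappa(3) k0 by (auto simp: power2_eq_square)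
  then have ld: "l 1 \<noteq> l 2" "l 1 \<noteq> l 3" "l 2 \<noteq> l 3" using \<mu>0 kappa(3,4) by (simp_all add: l_simps)
  have il: "inj l"
  proof (rule injI)
    fix i j assume "l i = l j"
    then show "i = j" using exhaust_3[of i] exhaust_3[of j] ld by auto
  qed
  have db: "det (\<chi> i. b i) \<noteq> 0"
    by (rule eigenvectors_independent[OF _ il, of _ A]) (use b1(1) n0 A eb in \<open>auto simp: b_def\<close>)
  have "det (\<chi> k. mon S 1 (b k)) = l 1 * l 2 * l 3 * det (\<chi> i. b i)" unfolding eb by (rule det_scale_rows)
  then have "l 1 * l 2 * l 3 = 1" using det_mon[OF m1, of b] db by simp
  then have "\<kappa> ^ 3 * \<mu> ^ 3 = 1" by (simp add: l_simps power2_eq_square power3_eq_cube mult_ac)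
  then have "norm \<mu> ^ 3 = 1" using kappa(2) by (metis mult_1 norm_one norm_power)
  then have nm: "norm \<mu> = 1" using power_eq_imp_eq_base[of "norm \<mu>" 3 1] by simp
  have nl: "norm (l i) = 1" for i using nm kappa(1) by (simp add: l_def norm_mult norm_power)
  obtain c :: "complex ^ 3" where c: "mon T \<tau> b3 = (\<Sum>i\<in>UNIV. c $ i *s (\<chi> i. b i) $ i)"
    by (rule det_rows_span[OF db, of "mon T \<tau> b3"]) (rule that, assumption)
  have k3: "\<kappa> * (\<kappa>\<^sup>2 * \<mu>) = \<mu>" using kappa(2) by (simp add: power2_eq_square power3_eq_cube mult.assoc)
  \<comment> \<open>The third image has the eigenvalue \<open>\<mu>\<close> again, so it lies on the
    line of \<open>b1\<close>.\<close>
  have "mon S 1 (mon T \<tau> b3) = \<mu> *s mon T \<tau> b3"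
    unfolding monodromy_commutator e3 mon_scale[OF m2] vector_smult_assoc k3 ..
  moreover have "mon S 1 (mon T \<tau> b3) = (\<Sum>i\<in>UNIV. c $ i *s (l i *s b i))"
    unfolding c mon_sum[OF m1] by (simp add: eb)
  ultimately have "(\<Sum>i\<in>UNIV. c $ i *s (l i *s b i)) = \<mu> *s (\<Sum>i\<in>UNIV. c $ i *s b i)" using c by simp
  then have "(\<Sum>i\<in>UNIV. (c $ i * (l i - \<mu>)) *s (\<chi> i. b i) $ i) = 0"
    by (simp add: sum_3 vec_eq_iff algebra_simps)
  from det_rows_indep[OF db this] have "c $ i * (l i - \<mu>) = 0" for i .
  then have "c $ 2 * (\<kappa> * \<mu> - \<mu>) = 0" "c $ 3 * (\<kappa>\<^sup>2 * \<mu> - \<mu>) = 0" using l_simps by metis+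
  then have "c $ 2 = 0" "c $ 3 = 0" using \<mu>0 kappa(3,4) by auto
  then have t3: "mon T \<tau> b3 = c $ 1 *s b1" using c by (simp add: sum_3 b_simps)
  have "det (\<chi> k. mon T \<tau> (b k)) = c $ 1 * det (\<chi> k. b k)"
    unfolding det_3 vec_lambda_beta b_simps t3 b2_def[symmetric] b3_def[symmetric] by (simp add: algebra_simps)
  then have c1: "c $ 1 = 1" using det_mon[OF m2, of b] db by simp
  \<comment> \<open>Scaling all three vectors by this cube root gives their determinant the modulus
    \<open>1/8\<close>.\<close>
  define t where "t = root 3 (1 / (8 * norm (det (\<chi> i. b i))))"
  have t: "t ^ 3 = 1 / (8 * norm (det (\<chi> i. b i)))" "t \<ge> 0" using db by (simp_all add: t_def)
  define a where "a = (\<lambda>i. complex_of_real t *s b i)"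
  have "det (\<chi> i. a i) = of_real t * of_real t * of_real t * det (\<chi> i. b i)"
    unfolding a_def by (rule det_scale_rows)
  then have "norm (det (\<chi> i. a i)) = t ^ 3 * norm (det (\<chi> i. b i))" using t(2) by (simp add: norm_mult power3_eq_cube)
  then have "norm (det (\<chi> i. a i)) = 1 / 8" unfolding t(1) using db by simp
  then show thesis
  proof (rule that[where a = a and l = l and c = 1])
    show "mon S 1 (a i) = l i *s a i" for i unfolding a_def mon_scale[OF m1] eb by (simp add: mult.commute)
    show "mon T \<tau> (a 1) = a 2" "mon T \<tau> (a 2) = a 3" "mon T \<tau> (a 3) = 1 *s a 1"
      unfolding a_def mon_scale[OF m2] b_simps t3 c1 by (simp_all add: b2_def b3_def)
  qed (use nl il in auto)
qed

definition Fsq :: "complex set \<Rightarrow> (3 \<Rightarrow> complex ^ 3) \<Rightarrow> complex \<Rightarrow> real" where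
  "Fsq D x z = sq (\<lambda>k. sol D (x k)) z"

text \<open>The sum of squares of such a basis descends to the torus, and its determinant has the
  normalization of a Toda potential. A representing basis of any solution has these
  properties.\<close>

definition unitary_data :: "(3 \<Rightarrow> complex ^ 3) \<Rightarrow> bool" where
  "unitary_data x \<longleftrightarrow> norm (det (\<chi> k. x k)) = 1 / 8 \<and>
     (\<forall>z\<in>S. Fsq S x (z + 1) = Fsq S x z) \<and> (\<forall>z\<in>T. Fsq T x (z + \<tau>) = Fsq T x z)"

end

section \<open>The invariant Hermitian form and its function on the torus\<close>

locale lame_basis = even_lame +
  fixes a :: "3 \<Rightarrow> complex ^ 3" and l :: "3 \<Rightarrow> complex" and c :: complex
  assumes det_a: "norm (det (\<chi> i. a i)) = 1 / 8" and mon_S: "\<And>i. mon S 1 (a i) = l i *s a i"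
    and l: "\<And>i. norm (l i) = 1" "inj l"
    and mon_T: "mon T \<tau> (a 1) = a 2" "mon T \<tau> (a 2) = a 3" "mon T \<tau> (a 3) = c *s a 1" and c: "norm c = 1"
begin

lemma shift_S: "z \<in> S \<Longrightarrow> sol S (a i) (z + 1) = l i * sol S (a i) z"
  using sol_shift[OF shift_cell_ST(1)] sol_scale[OF cell_ST(1)] by (simp add: mon_S)

lemma shift_T: "z \<in> T \<Longrightarrow> sol T (a 1) (z + \<tau>) = sol T (a 2) z" "z \<in> T \<Longrightarrow> sol T (a 2) (z + \<tau>) = sol T (a 3) z"
  "z \<in> T \<Longrightarrow> sol T (a 3) (z + \<tau>) = c * sol T (a 1) z"
  using sol_shift[OF shift_cell_ST(2)] sol_scale[OF cell_ST(2)] by (simp_all add: mon_T)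

lemma Fsq_mon:
  "cell D \<Longrightarrow> z \<in> D \<Longrightarrow> Fsq D (\<lambda>k. mon S 1 (a k)) z = Fsq D a z"
  "cell D \<Longrightarrow> z \<in> D \<Longrightarrow> Fsq D (\<lambda>k. mon T \<tau> (a k)) z = Fsq D a z"
  by (simp_all add: Fsq_def sq_def mon_S sum_3 mon_T sol_scale norm_mult l c)

lemma Fsq_period: "z \<in> S \<Longrightarrow> Fsq S a (z + 1) = Fsq S a z" "z \<in> T \<Longrightarrow> Fsq T a (z + \<tau>) = Fsq T a z"
  by (simp_all add: Fsq_def sq_def sum_3 shift_S shift_T norm_mult l c)

lemma det_a_nonzero: "det (\<chi> i. a i) \<noteq> 0" using det_a by auto

text \<open>The eigenvalues of the first period are distinct and the second period permutes the eigenlines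
  cyclically, so an invariant hermitian form is a multiple of the diagonal one.\<close>

lemma unitary_data_unique:
  assumes x: "unitary_data x"
  shows "z \<in> S \<Longrightarrow> Fsq S x z = Fsq S a z" "z \<in> T \<Longrightarrow> Fsq T x z = Fsq T a z"
proof -
  have "\<exists>C :: complex ^ 3. x k = (\<Sum>i\<in>UNIV. C $ i *s a i)" for k
  proof -
    obtain C :: "complex ^ 3" where "x k = (\<Sum>i\<in>UNIV. C $ i *s (\<chi> i. a i) $ i)"
      by (rule det_rows_span[OF det_a_nonzero, of "x k"]) (rule that, assumption)
    then show ?thesis by auto
  qed
  then obtain C :: "3 \<Rightarrow> complex ^ 3" where C: "\<And>k. x k = (\<Sum>i\<in>UNIV. C k $ i *s a i)" by metis
  \<comment> \<open>The Hermitian form of \<open>x\<close> written in the basis \<open>a\<close>;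
    \<open>product_indep\<close> will make its coefficients accessible.\<close>
  define G where "G = (\<lambda>i j. \<Sum>k\<in>UNIV. C k $ i * cnj (C k $ j))"
  have FG: "complex_of_real (Fsq D x z) = (\<Sum>i\<in>UNIV. \<Sum>j\<in>UNIV. G i j * (sol D (a i) z * cnj (sol D (a j) z)))"
    if "cell D" "z \<in> D" for D z
    unfolding Fsq_def sq_def C sol_sum[OF that] G_def by (rule Gram_expansion)
  have w: "wronsk (\<lambda>k. sol D (a k)) z \<noteq> 0" if "cell D" "z \<in> D" for D z
    unfolding wronsk_sol[OF that] by (rule det_a_nonzero)
  have hol: "sol D (a k) holomorphic_on D" if "cell D" for D k using sol(1)[OF that] by (simp add: ode3_def)
  have ne: "S \<noteq> {}" "T \<noteq> {}" using cellD(3) cell_ST by blast+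
  have "G i j * (l i * cnj (l j) - 1) = 0" for i j
  proof (rule product_indep[OF ST_open(1) ne(1) hol[OF cell_ST(1)] w[OF cell_ST(1)], where h = "\<lambda>i j. G i j * (l i * cnj (l j) - 1)"])
    fix z assume z: "z \<in> S"
    then have z1: "z + 1 \<in> S" by (simp add: S_def)
    have "complex_of_real (Fsq S x (z + 1)) = of_real (Fsq S x z)" using x z by (simp add: unitary_data_def)
    then have "0 = (\<Sum>i\<in>UNIV. \<Sum>j\<in>UNIV. G i j * (l i * sol S (a i) z * cnj (l j * sol S (a j) z)))
        - (\<Sum>i\<in>UNIV. \<Sum>j\<in>UNIV. G i j * (sol S (a i) z * cnj (sol S (a j) z)))"
      unfolding FG[OF cell_ST(1) z1] FG[OF cell_ST(1) z] shift_S[OF z] by simp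
    also have "\<dots> = (\<Sum>i\<in>UNIV. \<Sum>j\<in>UNIV. G i j * (l i * cnj (l j) - 1) * (sol S (a i) z * cnj (sol S (a j) z)))"
      unfolding sum_subtractf[symmetric] by (intro sum.cong refl) (simp add: algebra_simps)
    finally show "(\<Sum>i\<in>UNIV. \<Sum>j\<in>UNIV. G i j * (l i * cnj (l j) - 1) * (sol S (a i) z * cnj (sol S (a j) z))) = 0" by simp
  qed auto
  moreover have "l i * cnj (l j) \<noteq> 1" if "i \<noteq> j" for i j
  proof
    assume e: "l i * cnj (l j) = 1"
    have "l j * cnj (l j) = 1" using complex_norm_square[of "l j"] l(1)[of j] by simp
    then have "l i = l j" using e by (metis mult_cancel_right zero_neq_one mult_zero_right)
    then show False using l(2) that by (simp add: inj_eq)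
  qed
  ultimately have G0: "G i j = 0" if "i \<noteq> j" for i j using that by (metis eq_iff_diff_eq_0 mult_eq_0_iff)
  \<comment> \<open>The diagonal coefficients of the form after the cyclic shift minus those before
    it, so its vanishing says that all three agree.\<close>
  define h where "h = (\<lambda>i j::3. if i \<noteq> j then 0 else if i = 1 then G 3 3 - G 1 1 else if i = 2 then G 1 1 - G 2 2 else G 2 2 - G 3 3)"
  have diag: "(\<Sum>i\<in>UNIV. \<Sum>j\<in>UNIV. G i j * (w i * cnj (w j)))
      = G 1 1 * (w 1 * cnj (w 1)) + G 2 2 * (w 2 * cnj (w 2)) + G 3 3 * (w 3 * cnj (w 3))" for w :: "3 \<Rightarrow> complex"
    by (simp add: sum_3 G0)
  have cc: "c * cnj c = 1" using complex_norm_square[of c] c by simp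
  have "h i j = 0" for i j
  proof (rule product_indep[OF ST_open(2) ne(2) hol[OF cell_ST(2)] w[OF cell_ST(2)], where h = h])
    fix z assume z: "z \<in> T"
    then have z1: "z + \<tau> \<in> T" by (simp add: T_def)
    have "complex_of_real (Fsq T x (z + \<tau>)) = of_real (Fsq T x z)" using x z by (simp add: unitary_data_def)
    then have "0 = (G 1 1 * (sol T (a 2) z * cnj (sol T (a 2) z)) + G 2 2 * (sol T (a 3) z * cnj (sol T (a 3) z))
        + G 3 3 * (c * sol T (a 1) z * cnj (c * sol T (a 1) z)))
      - (G 1 1 * (sol T (a 1) z * cnj (sol T (a 1) z)) + G 2 2 * (sol T (a 2) z * cnj (sol T (a 2) z)) + G 3 3 * (sol T (a 3) z * cnj (sol T (a 3) z)))"
      unfolding FG[OF cell_ST(2) z1] FG[OF cell_ST(2) z] diag[of "\<lambda>i. sol T (a i) (z + \<tau>)"] diag[of "\<lambda>i. sol T (a i) z"] shift_T[OF z] by simp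
    also have "c * sol T (a 1) z * cnj (c * sol T (a 1) z) = (c * cnj c) * (sol T (a 1) z * cnj (sol T (a 1) z))" by simp
    finally have "0 = (G 1 1 * (sol T (a 2) z * cnj (sol T (a 2) z)) + G 2 2 * (sol T (a 3) z * cnj (sol T (a 3) z))
        + G 3 3 * (1 * (sol T (a 1) z * cnj (sol T (a 1) z))))
      - (G 1 1 * (sol T (a 1) z * cnj (sol T (a 1) z)) + G 2 2 * (sol T (a 2) z * cnj (sol T (a 2) z)) + G 3 3 * (sol T (a 3) z * cnj (sol T (a 3) z)))"
      unfolding cc .
    also have "\<dots> = (\<Sum>i\<in>UNIV. \<Sum>j\<in>UNIV. h i j * (sol T (a i) z * cnj (sol T (a j) z)))"
      by (simp add: sum_3 h_def algebra_simps)
    finally show "(\<Sum>i\<in>UNIV. \<Sum>j\<in>UNIV. h i j * (sol T (a i) z * cnj (sol T (a j) z))) = 0" by simp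
  qed auto
  from this[of 1 1] this[of 2 2] have "G 1 1 = G 3 3" "G 2 2 = G 1 1" by (simp_all add: h_def)
  then have Gd: "G i j = (if i = j then G 1 1 else 0)" for i j using exhaust_3[of i] G0 by auto
  define g where "g = (\<Sum>k\<in>UNIV. (norm (C k $ 1))\<^sup>2)"
  have g: "G 1 1 = of_real g" "g \<ge> 0"
    unfolding g_def G_def of_real_sum complex_norm_square by (simp_all add: sum_nonneg)
  let ?C = "\<chi> k i. C k $ i" and ?C' = "\<chi> k i. cnj (C k $ i)"
  have "(\<chi> k. x k) = ?C ** (\<chi> i. a i)"
    by (simp add: vec_eq_iff C matrix_matrix_mult_def)
  then have "norm (det (\<chi> k. x k)) = norm (det ?C) * (1 / 8)" using det_a by (simp add: det_mul norm_mult)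
  then have nC: "norm (det ?C) = 1" using x by (simp add: unitary_data_def)
  have "(\<chi> i j. G i j) = transpose ?C ** ?C'"
    by (simp add: vec_eq_iff G_def matrix_matrix_mult_def transpose_def)
  then have "det (\<chi> i j. G i j) = det ?C * det ?C'" by (simp add: det_mul det_transpose)
  also have "det ?C' = cnj (det ?C)" by (simp add: det_3)
  also have "det ?C * cnj (det ?C) = 1" using complex_norm_square[of "det ?C"] nC by simp
  \<comment> \<open>The common normalization of the determinants leaves a nonnegative scalar whose
    cube is 1.\<close>
  finally have "G 1 1 * G 1 1 * G 1 1 = 1" by (simp add: det_3 G0 Gd[of 2 2] Gd[of 3 3])
  then have "complex_of_real (g ^ 3) = of_real 1" by (simp add: g(1) power3_eq_cube)
  then have "g ^ 3 = 1 ^ 3" using of_real_eq_iff by (metis power_one)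
  then have "g = 1" using power_eq_imp_eq_base[of g 3 1] g(2) by simp
  then have G1: "G 1 1 = 1" "G 2 2 = 1" "G 3 3 = 1" using Gd[of 2 2] Gd[of 3 3] g(1) by simp_all
  have F: "Fsq D x z = Fsq D a z" if "cell D" "z \<in> D" for D z
  proof -
    have "complex_of_real (Fsq D x z) = of_real (Fsq D a z)"
      unfolding FG[OF that] diag[of "\<lambda>i. sol D (a i) z"] G1
      unfolding Fsq_def sq_def sum_3 of_real_add complex_norm_square by simp
    then show ?thesis using of_real_eq_iff by blast
  qed
  show "z \<in> S \<Longrightarrow> Fsq S x z = Fsq S a z" "z \<in> T \<Longrightarrow> Fsq T x z = Fsq T a z"
    using F cell_ST by auto
qed

text \<open>The candidate for \<open>exp (- U)\<close> on the torus. A point is moved into the strip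
  \<open>S\<close>, or into \<open>T\<close> if it lies on a lattice line in direction
  \<open>1\<close>; the values at lattice points themselves are meaningless.\<close>

definition FF :: "complex \<Rightarrow> real" where
  "FF z = (if tc z \<notin> \<int> then Fsq S a (z - of_int \<lfloor>tc z\<rfloor> * \<tau>) else Fsq T a (z - of_int \<lfloor>sc z\<rfloor>))"

lemma floor_between: "x \<notin> \<int> \<Longrightarrow> 0 < x - of_int \<lfloor>x\<rfloor> \<and> x - of_int \<lfloor>x\<rfloor> < (1 :: real)"
proof -
  assume "x \<notin> \<int>"
  then have "x \<noteq> of_int \<lfloor>x\<rfloor>" using Ints_of_int by metis
  then show ?thesis using of_int_floor_le[of x] real_of_int_floor_add_one_gt[of x] by linarith
qed

lemma reduce_S: "tc z \<notin> \<int> \<Longrightarrow> z - of_int \<lfloor>tc z\<rfloor> * \<tau> \<in> S"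
  using floor_between[of "tc z"] by (simp add: S_def)

lemma reduce_T: "sc z \<notin> \<int> \<Longrightarrow> z - of_int \<lfloor>sc z\<rfloor> \<in> T"
  using floor_between[of "sc z"] by (simp add: T_def)

lemma FF_period: "FF (z + 1) = FF z" "z \<notin> \<Lambda> \<Longrightarrow> FF (z + \<tau>) = FF z"
proof -
  have i: "x + 1 \<in> \<int> \<longleftrightarrow> x \<in> \<int>" for x :: real using Ints_add[of x 1] Ints_diff[of "x + 1" 1] by auto
  show "FF (z + 1) = FF z"
  proof (cases "tc z \<in> \<int>")
    case False
    then show ?thesis using Fsq_period(1)[OF reduce_S[OF False]] by (simp add: FF_def algebra_simps)
  qed (simp add: FF_def)
  assume z: "z \<notin> \<Lambda>"
  show "FF (z + \<tau>) = FF z"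
  proof (cases "tc z \<in> \<int>")
    case True
    then have "sc z \<notin> \<int>" using z lattice_coordI by blast
    then have "Fsq T a (z - of_int \<lfloor>sc z\<rfloor> + \<tau>) = Fsq T a (z - of_int \<lfloor>sc z\<rfloor>)" by (intro Fsq_period(2) reduce_T)
    moreover have "z - of_int \<lfloor>sc z\<rfloor> + \<tau> = z + \<tau> - of_int \<lfloor>sc z\<rfloor>" by simp
    ultimately show ?thesis using True by (simp add: FF_def i)
  qed (simp add: FF_def i algebra_simps)
qed

lemma FF_S: "z \<in> S \<Longrightarrow> FF z = Fsq S a z"
proof -
  assume z: "z \<in> S"
  then have "tc z \<notin> \<int>" "\<lfloor>tc z\<rfloor> = 0" using not_Ints_between by (auto simp: S_def floor_eq_iff)
  then show ?thesis by (simp add: FF_def)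
qed

lemma FF_T: assumes z: "z \<in> T" shows "FF z = Fsq T a z"
proof (cases "tc z \<in> \<int>")
  case True
  moreover have "\<lfloor>sc z\<rfloor> = 0" using z by (auto simp: T_def floor_eq_iff)
  ultimately show ?thesis by (simp add: FF_def)
next
  case False
  let ?w = "z - of_int \<lfloor>tc z\<rfloor> * \<tau>"
  have w: "?w \<in> S" "?w \<in> T" using reduce_S[OF False] z by (auto simp: T_def)
  have "Fsq T a (?w + of_int \<lfloor>tc z\<rfloor> * \<tau>) = Fsq T a ?w"
    by (rule int_period[where D = T and f = "Fsq T a" and q = \<tau>]) (use Fsq_period(2) w(2) in \<open>auto simp: T_def\<close>)
  moreover have "Fsq S a ?w = Fsq T a ?w" using sol_ST[OF w] by (simp add: Fsq_def sq_def)
  ultimately show ?thesis using False by (simp add: FF_def)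
qed

lemma FF_lattice: "z \<notin> \<Lambda> \<Longrightarrow> p \<in> \<Lambda> \<Longrightarrow> FF (z + p) = FF z"
  by (rule period_lattice) (auto simp: FF_period)

lemma cell_cover:
  assumes "z \<notin> \<Lambda>" obtains p where "p \<in> \<Lambda>" "z + p \<in> S \<or> z + p \<in> T"
proof (cases "tc z \<in> \<int>")
  case False
  have "- (of_int \<lfloor>tc z\<rfloor> * \<tau>) \<in> \<Lambda>" by (rule lattice_coordI) (simp_all add: Ints_of_int)
  then show thesis using that[of "- (of_int \<lfloor>tc z\<rfloor> * \<tau>)"] reduce_S[OF False] by simp
next
  case True
  then have "sc z \<notin> \<int>" using assms lattice_coordI by blast
  moreover have "- of_int \<lfloor>sc z\<rfloor> \<in> \<Lambda>" by (rule lattice_coordI) (simp_all add: Ints_of_int)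
  ultimately show thesis using that[of "- of_int \<lfloor>sc z\<rfloor>"] reduce_T by simp
qed

lemma FF_local:
  assumes z: "z \<notin> \<Lambda>"
  obtains N Y where "open N" "z \<in> N" "N \<subseteq> - \<Lambda>" "\<And>k. ode3 N cp cq (Y k)"
    "\<And>w. w \<in> N \<Longrightarrow> norm (wronsk Y w) = 1 / 8" "\<And>w. w \<in> N \<Longrightarrow> FF w = sq Y w"
proof -
  obtain p where p: "p \<in> \<Lambda>" "z + p \<in> S \<or> z + p \<in> T" by (rule cell_cover[OF z])
  then obtain D where D: "D = S \<or> D = T" "z + p \<in> D" by blast
  have cD: "cell D" using D(1) cell_ST by auto
  have FD: "FF w = Fsq D a w" if "w \<in> D" for w using that D(1) FF_S FF_T by auto
  define N where "N = (\<lambda>w. w + p) -` D"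
  have N: "open N" unfolding N_def by (rule open_vimage[OF cellD(1)[OF cD]]) (intro continuous_intros)
  have Np: "1 * w + p \<in> D" if "w \<in> N" for w using that by (simp add: N_def)
  have nl: "w \<notin> \<Lambda>" if "w \<in> N" for w
    using Np[OF that] cellD(4)[OF cD] lattice_add_iff[OF p(1), of w] by auto
  define Y where "Y = (\<lambda>k w. sol D (a k) (1 * w + p))"
  have cc: "cp w = cp (1 * w + p)" "cq w = 1 * cq (1 * w + p)" if "w \<in> N" for w
    using cp_cq_period[OF nl[OF that] p(1)] by simp_all
  have Yo: "ode3 N cp cq (Y k)" for k unfolding Y_def
    by (rule ode3_affine(1)[OF cellD(1)[OF cD] N sol(1)[OF cD] _ Np cc]) auto
  have Yj: "jet (Y k) w = jet (sol D (a k)) (w + p)" if "w \<in> N" for k w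
  proof -
    have "jet (\<lambda>w. sol D (a k) (1 * w + p)) w = vector [sol D (a k) (1 * w + p), 1 * deriv (sol D (a k)) (1 * w + p), deriv (deriv (sol D (a k))) (1 * w + p)]"
      by (rule ode3_affine(2)[OF cellD(1)[OF cD] N sol(1)[OF cD] _ Np cc that]) auto
    then show ?thesis by (simp add: Y_def jet_eq_vector)
  qed
  show thesis
  proof (rule that[OF N _ _ Yo])
    show "z \<in> N" "N \<subseteq> - \<Lambda>" using D(2) nl by (auto simp: N_def)
    fix w assume w: "w \<in> N"
    have "wronsk Y w = wronsk (\<lambda>k. sol D (a k)) (w + p)" by (simp add: wronsk_def jetmat_def Yj[OF w])
    also have "\<dots> = det (\<chi> k. a k)" using wronsk_sol[OF cD] Np[OF w] by simp
    finally show "norm (wronsk Y w) = 1 / 8" using det_a by simp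
    have "FF w = FF (w + p)" by (rule FF_lattice[OF nl[OF w] p(1), symmetric])
    also have "\<dots> = sq Y w" using FD[of "w + p"] Np[OF w] by (simp add: Fsq_def sq_def Y_def)
    finally show "FF w = sq Y w" .
  qed
qed

text \<open>The reflection about \<open>z0\<close> preserves both strips and acts on jets at
  \<open>z0\<close> by changing the sign of the first derivative. The reflected basis is again
  \<open>unitary_data\<close>, so uniqueness of the invariant form gives the same function.\<close>

lemma FF_minus: assumes z: "z \<notin> \<Lambda>" shows "FF (- z) = FF z"
proof -
  define R :: "complex ^ 3 \<Rightarrow> complex ^ 3" where "R = (\<lambda>x. vector [x $ 1, - x $ 2, x $ 3])"
  have refl: "sol D (R x) w = sol D x (1 + \<tau> - w)" if D: "cell D" "\<And>w. w \<in> D \<Longrightarrow> 1 + \<tau> - w \<in> D" and w: "w \<in> D" for D x w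
  proof -
    have D': "(-1) * w + (1 + \<tau>) \<in> D" if "w \<in> D" for w using D(2)[OF that] by simp
    have nl: "w \<notin> \<Lambda>" if "w \<in> D" for w using cellD(4)[OF D(1)] that by auto
    have cc: "cp w = cp ((-1) * w + (1 + \<tau>))" "cq w = (-1) * cq ((-1) * w + (1 + \<tau>))" if "w \<in> D" for w
      using cp_cq_period[of "- w" "1 + \<tau>"] cp_cq_minus[OF nl[OF that]] nl[OF that] lattice_minus_iff[of w] by (simp_all add: lattice_add)
    note aff = ode3_affine[OF cellD(1)[OF D(1)] cellD(1)[OF D(1)] sol(1)[OF D(1), of x] _ D', where p' = cp and q' = cq]
    have e: "- 1 * z0 + (1 + \<tau>) = z0" by (simp add: z0_def field_simps)
    have "sol D x ((-1) * w + (1 + \<tau>)) = sol D (R x) w"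
    proof (rule sol_unique[OF D(1) _ _ w])
      show "ode3 D cp cq (\<lambda>w. sol D x ((-1) * w + (1 + \<tau>)))" by (rule aff(1)) (use cc in auto)
      have "jet (\<lambda>w. sol D x ((-1) * w + (1 + \<tau>))) z0 = vector [sol D x z0, (-1) * deriv (sol D x) z0, deriv (deriv (sol D x)) z0]"
        using aff(2)[OF _ _ _ _ cellD(3)[OF D(1)]] cc unfolding e by auto
      then show "jet (\<lambda>w. sol D x ((-1) * w + (1 + \<tau>))) z0 = R x"
        by (simp add: R_def jet_nth[of "sol D x" z0, unfolded sol(2)[OF D(1)]])
    qed
    then show ?thesis by (simp add: algebra_simps)
  qed
  have mS: "1 + \<tau> - w \<in> S" if "w \<in> S" for w using that by (simp add: S_def)
  have mT: "1 + \<tau> - w \<in> T" if "w \<in> T" for w using that by (simp add: T_def)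
  have FR: "Fsq S (\<lambda>k. R (a k)) w = Fsq S a (1 + \<tau> - w)" if "w \<in> S" for w
    using refl[OF cell_ST(1) mS that] by (simp add: Fsq_def sq_def)
  have FR': "Fsq T (\<lambda>k. R (a k)) w = Fsq T a (1 + \<tau> - w)" if "w \<in> T" for w
    using refl[OF cell_ST(2) mT that] by (simp add: Fsq_def sq_def)
  have "unitary_data (\<lambda>k. R (a k))"
    unfolding unitary_data_def
  proof (intro conjI ballI)
    have "det (\<chi> k. R (a k)) = - det (\<chi> k. a k)" by (simp add: det_3 R_def algebra_simps)
    then show "norm (det (\<chi> k. R (a k))) = 1 / 8" using det_a by simp
    fix w
    show "Fsq S (\<lambda>k. R (a k)) (w + 1) = Fsq S (\<lambda>k. R (a k)) w" if w: "w \<in> S"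
    proof -
      have w': "w + 1 \<in> S" "\<tau> - w \<in> S" using w by (simp_all add: S_def)
      have e: "1 + \<tau> - (w + 1) = \<tau> - w" "1 + \<tau> - w = \<tau> - w + 1" by simp_all
      show ?thesis unfolding FR[OF w] FR[OF w'(1)] e Fsq_period(1)[OF w'(2)] ..
    qed
    show "Fsq T (\<lambda>k. R (a k)) (w + \<tau>) = Fsq T (\<lambda>k. R (a k)) w" if w: "w \<in> T"
    proof -
      have w': "w + \<tau> \<in> T" "1 - w \<in> T" using w by (simp_all add: T_def)
      have e: "1 + \<tau> - (w + \<tau>) = 1 - w" "1 + \<tau> - w = 1 - w + \<tau>" by simp_all
      show ?thesis unfolding FR'[OF w] FR'[OF w'(1)] e Fsq_period(2)[OF w'(2)] ..
    qed
  qed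
  note U = unitary_data_unique[OF this]
  have cell_minus: "FF (1 + \<tau> - w) = FF w" if "w \<in> S \<or> w \<in> T" for w
    using that
  proof
    assume w: "w \<in> S"
    then show ?thesis using U(1)[OF w] FR[OF w] FF_S[OF w] FF_S[OF mS[OF w]] by simp
  next
    assume w: "w \<in> T"
    then show ?thesis using U(2)[OF w] FR'[OF w] FF_T[OF w] FF_T[OF mT[OF w]] by simp
  qed
  obtain p where p: "p \<in> \<Lambda>" "z + p \<in> S \<or> z + p \<in> T" by (rule cell_cover[OF z])
  have z': "- z \<notin> \<Lambda>" using z lattice_minus_iff by simp
  have "FF (- z) = FF (- z + (1 + \<tau> - p))"
    by (rule FF_lattice[OF z', symmetric]) (simp add: lattice_add lattice_diff p(1))
  also have "\<dots> = FF (1 + \<tau> - (z + p))" by (simp add: algebra_simps)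
  also have "\<dots> = FF (z + p)" by (rule cell_minus[OF p(2)])
  also have "\<dots> = FF z" by (rule FF_lattice[OF z p(1)])
  finally show ?thesis .
qed

end

section \<open>Solutions from linear equations\<close>

lemma dz_dzbar_cong:
  assumes "open N" "z \<in> N" "\<And>w. w \<in> N \<Longrightarrow> f w = g w"
  shows "dz (dzbar f) z = dz (dzbar g) z"
  by (rule dz_cong(1)[OF assms(1,2) dz_cong(2)[OF assms(1) _ assms(3)]])

lemma W_cong:
  assumes N: "open N" and e: "\<And>w. w \<in> N \<Longrightarrow> U w = U' w" "\<And>w. w \<in> N \<Longrightarrow> V w = V' w" and z: "z \<in> N"
  shows "W2 U V z = W2 U' V' z" "W3 U V z = W3 U' V' z"
proof -
  have U1: "dz U w = dz U' w" and V1: "dz V w = dz V' w" if "w \<in> N" for w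
    using dz_cong(1)[OF N that e(1)] dz_cong(1)[OF N that e(2)] by auto
  have U2: "dz (dz U) w = dz (dz U') w" and V2: "dz (dz V) w = dz (dz V') w" if "w \<in> N" for w
    using dz_cong(1)[OF N that U1] dz_cong(1)[OF N that V1] by auto
  have U3: "dz (dz (dz U)) z = dz (dz (dz U')) z" by (rule dz_cong(1)[OF N z U2])
  show "W2 U V z = W2 U' V' z" "W3 U V z = W3 U' V' z"
    unfolding W2_def W3_def U1[OF z] V1[OF z] U2[OF z] V2[OF z] U3 by simp_all
qed

text \<open>The first Toda equation solved for the second potential. The formula serves both as the
  definition of \<open>vv\<close> and for the uniqueness of the second component.\<close>

lemma toda_domain_second_component:
  assumes T: "toda_domain D (\<lambda>z. of_real (u z)) (\<lambda>z. of_real (v z)) u v" and z: "z \<in> D"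
  shows "v z = 2 * u z - ln (- 4 * Re (dz (dzbar (\<lambda>z. complex_of_real (u z))) z))"
proof -
  have "dz (dzbar (\<lambda>z. complex_of_real (u z))) z = - exp (2 * complex_of_real (u z) - of_real (v z)) / 4"
    by (rule toda_domain.eqU[OF T z])
  also have "\<dots> = of_real (- exp (2 * u z - v z) / 4)" by (simp flip: exp_of_real)
  finally have "- 4 * Re (dz (dzbar (\<lambda>z. complex_of_real (u z))) z) = exp (2 * u z - v z)" by simp
  then show ?thesis by simp
qed

lemma asy_ln:
  assumes "asy r F m" and r: "r > 0"
  obtains C \<delta> where "\<delta> > 0" "\<And>z. z \<in> slit_ball r \<Longrightarrow> norm z < \<delta> \<Longrightarrow> \<bar>ln (F z) - m * ln (norm z)\<bar> \<le> C"
proof -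
  obtain c1 c2 \<delta> where c: "c1 > 0" "c2 > 0" "\<delta> > 0"
    "\<forall>z\<in>slit_ball r. norm z < \<delta> \<longrightarrow> c1 * norm z powr m \<le> F z \<and> F z \<le> c2 * norm z powr m"
    using assms(1) unfolding asy_def by blast
  show thesis
  proof (rule that[of \<delta> "\<bar>ln c1\<bar> + \<bar>ln c2\<bar>"])
    fix z assume z: "z \<in> slit_ball r" "norm z < \<delta>"
    have n: "norm z > 0" using slit_ball_facts(3)[OF z(1)] by simp
    have b: "c1 * norm z powr m \<le> F z" "F z \<le> c2 * norm z powr m" using c(4) z by auto
    have p: "0 < c1 * norm z powr m" using c(1) n by simp
    have "ln (c1 * norm z powr m) \<le> ln (F z)" "ln (F z) \<le> ln (c2 * norm z powr m)"
      using b p by auto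
    moreover have "ln (c1 * norm z powr m) = ln c1 + m * ln (norm z)" "ln (c2 * norm z powr m) = ln c2 + m * ln (norm z)"
      using c(1,2) n by (simp_all add: ln_mult ln_powr)
    ultimately show "\<bar>ln (F z) - m * ln (norm z)\<bar> \<le> \<bar>ln c1\<bar> + \<bar>ln c2\<bar>" by linarith
  qed (rule c(3))
qed

lemma ordered_exponents:
  fixes \<sigma> :: "3 \<Rightarrow> real"
  assumes "\<And>i. \<sigma> i = r1 \<or> \<sigma> i = r2 \<or> \<sigma> i = r3" "inj \<sigma>" "r1 < r2" "r2 < r3"
  shows "min (\<sigma> 1) (min (\<sigma> 2) (\<sigma> 3)) = r1" "min (\<sigma> 1 + \<sigma> 2) (min (\<sigma> 1 + \<sigma> 3) (\<sigma> 2 + \<sigma> 3)) = r1 + r2"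
proof -
  have d: "\<sigma> 1 \<noteq> \<sigma> 2" "\<sigma> 1 \<noteq> \<sigma> 3" "\<sigma> 2 \<noteq> \<sigma> 3" using assms(2) by (simp_all add: inj_eq)
  show "min (\<sigma> 1) (min (\<sigma> 2) (\<sigma> 3)) = r1" "min (\<sigma> 1 + \<sigma> 2) (min (\<sigma> 1 + \<sigma> 3) (\<sigma> 2 + \<sigma> 3)) = r1 + r2"
    using assms(1)[of 1] assms(1)[of 2] assms(1)[of 3] d assms(3,4) by (elim disjE; simp add: min_def)+
qed

section \<open>Asymptotics, symmetry and uniqueness of the constructed solution\<close>

context lame_basis
begin

text \<open>The slit disc is treated in three pieces, below the real axis, above it and on the
  positive reals, each translated into a strip by a different period. The monodromies met on the way
  do not change the sum of squares, by \<open>Fsq_mon\<close> and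
  \<open>norm \<kappa> = 1\<close>.\<close>

lemma slit_basis:
  obtains r lam h where "r > 0" "ball 0 r \<inter> \<Lambda> = {0}" "\<And>k. ode3 (slit_ball r) cp cq (lam k)"
    "\<And>k. power_form r (- gamma1 n1 n2) (h k) (lam k)" "\<And>z. z \<in> slit_ball r \<Longrightarrow> FF z = sq lam z"
    "\<And>z. z \<in> slit_ball r \<Longrightarrow> wronsk lam z = det (\<chi> k. a k)"
proof -
  obtain r where r: "r > 0" "\<forall>\<zeta>\<in>ball 0 r. \<bar>sc \<zeta>\<bar> < 1 \<and> \<bar>tc \<zeta>\<bar> < 1" using small_radius by blast
  note b0 = small_ball_lattice[OF r]
  have sub: "z \<notin> \<Lambda>" "z \<in> ball 0 r" if "z \<in> slit_ball r" for z
    using b0 slit_ball_facts(2)[of r] slit_ball_facts(3)[OF that] that by blast+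
  define P where "P = (\<lambda>k lam h. ode3 (slit_ball r) cp cq lam \<and> power_form r (- gamma1 n1 n2) h lam \<and>
    (\<forall>\<zeta>\<in>ball 0 r. (Im \<zeta> < 0 \<longrightarrow> sol S (a k) (1 + \<tau> + \<zeta>) = lam \<zeta>) \<and>
       (Im \<zeta> > 0 \<longrightarrow> sol S (mon T \<tau> (a k)) (1 + \<zeta>) = \<kappa> * lam \<zeta>) \<and> (sc \<zeta> > 0 \<longrightarrow> sol T (mon S 1 (a k)) (\<tau> + \<zeta>) = lam \<zeta>)))"
  have "\<exists>lam h. P k lam h" for k
  proof -
    obtain lam h where "ode3 (slit_ball r) cp cq lam" "power_form r (- gamma1 n1 n2) h lam"
      "\<And>\<zeta>. \<zeta> \<in> ball 0 r \<Longrightarrow> Im \<zeta> < 0 \<Longrightarrow> sol S (a k) (1 + \<tau> + \<zeta>) = lam \<zeta>"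
      "\<And>\<zeta>. \<zeta> \<in> ball 0 r \<Longrightarrow> Im \<zeta> > 0 \<Longrightarrow> sol S (mon T \<tau> (a k)) (1 + \<zeta>) = \<kappa> * lam \<zeta>"
      "\<And>\<zeta>. \<zeta> \<in> ball 0 r \<Longrightarrow> sc \<zeta> > 0 \<Longrightarrow> sol T (mon S 1 (a k)) (\<tau> + \<zeta>) = lam \<zeta>"
      by (rule continuation[OF r]) (rule that, assumption+)
    then show ?thesis unfolding P_def by (intro exI[of _ lam] exI[of _ h]) simp
  qed
  then obtain lam h where lh: "\<And>k. P k (lam k) (h k)" by metis
  have lam: "ode3 (slit_ball r) cp cq (lam k)" "power_form r (- gamma1 n1 n2) (h k) (lam k)" for k
    using lh[of k] by (simp_all add: P_def)
  have val: "\<zeta> \<in> ball 0 r \<Longrightarrow> Im \<zeta> < 0 \<Longrightarrow> lam k \<zeta> = sol S (a k) (1 + \<tau> + \<zeta>)"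
    "\<zeta> \<in> ball 0 r \<Longrightarrow> Im \<zeta> > 0 \<Longrightarrow> sol S (mon T \<tau> (a k)) (1 + \<zeta>) = \<kappa> * lam k \<zeta>"
    "\<zeta> \<in> ball 0 r \<Longrightarrow> sc \<zeta> > 0 \<Longrightarrow> lam k \<zeta> = sol T (mon S 1 (a k)) (\<tau> + \<zeta>)" for k \<zeta>
    using lh[of k] by (simp_all add: P_def)
  have l1: "1 + \<tau> \<in> \<Lambda>" by (simp add: lattice_add)
  have F: "FF z = sq lam z" if z: "z \<in> slit_ball r" for z
  proof -
    note nl = sub[OF z]
    have st: "\<bar>sc z\<bar> < 1" "\<bar>tc z\<bar> < 1" using r(2) nl(2) by auto
    consider "Im z < 0" | "Im z > 0" | "Im z = 0" by linarith
    then show ?thesis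
    proof cases
      case 1
      then have "1 + \<tau> + z \<in> S" using st tc_sign(2)[of z] by (simp add: S_def)
      then show ?thesis using FF_lattice[OF nl(1) l1] FF_S val(1)[OF nl(2) 1] by (simp add: Fsq_def sq_def add_ac)
    next
      case 2
      then have s: "1 + z \<in> S" using st tc_sign(1)[of z] by (simp add: S_def)
      have "FF z = Fsq S a (1 + z)" using FF_lattice[OF nl(1) lattice_one] FF_S[OF s] by (simp add: add.commute)
      also have "\<dots> = Fsq S (\<lambda>k. mon T \<tau> (a k)) (1 + z)" using Fsq_mon(2)[OF cell_ST(1) s] by simp
      also have "\<dots> = sq lam z" using kappa(1) by (simp add: Fsq_def sq_def val(2)[OF nl(2) 2] norm_mult)
      finally show ?thesis .
    next
      case 3
      then have "z = of_real (Re z)" by (simp add: complex_eq_iff)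
      then have "sc z > 0" using slit_ball_facts(4)[OF z] 3 by (auto simp: complex_nonpos_Reals_iff sc_def)
      then have t: "\<tau> + z \<in> T" and p: "sc z > 0" using st by (simp_all add: T_def)
      have "FF z = Fsq T a (\<tau> + z)" using FF_lattice[OF nl(1) lattice_tau] FF_T[OF t] by (simp add: add.commute)
      also have "\<dots> = Fsq T (\<lambda>k. mon S 1 (a k)) (\<tau> + z)" using Fsq_mon(1)[OF cell_ST(2) t] by simp
      also have "\<dots> = sq lam z" by (simp add: Fsq_def sq_def val(3)[OF nl(2) p])
      finally show ?thesis .
    qed
  qed
  define L where "L = ball 0 r \<inter> {\<zeta>. Im \<zeta> < 0}"
  have L: "open L" unfolding L_def by (auto intro!: open_Int open_halfspace_Im_lt)
  have Ls: "L \<subseteq> slit_ball r" by (auto simp: L_def slit_ball_facts(5) complex_nonpos_Reals_iff)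
  define \<zeta>1 where "\<zeta>1 = - \<i> * of_real (r / 2)"
  have z1: "\<zeta>1 \<in> L" using r by (simp add: L_def \<zeta>1_def norm_mult)
  have LS: "1 * \<zeta> + (1 + \<tau>) \<in> S" if "\<zeta> \<in> L" for \<zeta>
    using that r(2) tc_sign(2)[of \<zeta>] by (force simp: L_def S_def)
  have cc: "cp z = cp (1 * z + (1 + \<tau>))" "cq z = 1 * cq (1 * z + (1 + \<tau>))" if "z \<in> L" for z
    using sub(1) Ls that by (auto simp: cp_cq_period l1)
  have j: "jet (lam k) \<zeta>1 = jet (sol S (a k)) (1 * \<zeta>1 + (1 + \<tau>))" for k
  proof -
    have "jet (lam k) \<zeta>1 = jet (\<lambda>z. sol S (a k) (1 * z + (1 + \<tau>))) \<zeta>1"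
      by (rule jet_cong_open[OF L z1]) (simp add: L_def val(1) add_ac)
    also have "\<dots> = vector [sol S (a k) (1 * \<zeta>1 + (1 + \<tau>)), 1 * deriv (sol S (a k)) (1 * \<zeta>1 + (1 + \<tau>)), deriv (deriv (sol S (a k))) (1 * \<zeta>1 + (1 + \<tau>))]"
      by (rule ode3_affine(2)[OF ST_open(1) L sol(1)[OF cell_ST(1)] _ LS cc z1]) auto
    finally show ?thesis by (simp add: jet_eq_vector)
  qed
  have "wronsk lam \<zeta>1 = wronsk (\<lambda>k. sol S (a k)) (1 * \<zeta>1 + (1 + \<tau>))" by (simp add: wronsk_def jetmat_def j)
  also have "\<dots> = det (\<chi> k. a k)" by (rule wronsk_sol[OF cell_ST(1) LS[OF z1]])
  finally have w1: "wronsk lam \<zeta>1 = det (\<chi> k. a k)" .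
  have w: "wronsk lam z = det (\<chi> k. a k)" if "z \<in> slit_ball r" for z
    using wronsk_constant[OF slit_ball_facts(1) slit_ball_connected lam(1) that] z1 Ls w1 by auto
  show thesis by (rule that[OF r(1) b0 lam F w])
qed

text \<open>Elimination gives distinct exponents; being roots of the indicial polynomial, they are
  its three distinct roots. The two smallest then determine the orders of the sum of squares and of
  the minors.\<close>

lemma slit_asymptotics:
  obtains r lam where "r > 0" "ball 0 r \<inter> \<Lambda> = {0}" "\<And>k. ode3 (slit_ball r) cp cq (lam k)"
    "\<And>z. z \<in> slit_ball r \<Longrightarrow> FF z = sq lam z" "\<And>z. z \<in> slit_ball r \<Longrightarrow> norm (wronsk lam z) = 1 / 8"
    "asy r (sq lam) (- 2 * gamma1 n1 n2)" "asy r (wsq lam) (- 2 * gamma2 n1 n2)"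
proof -
  define g1 where "g1 = gamma1 n1 n2"
  define g2 where "g2 = gamma2 n1 n2"
  let ?al = "ode_alpha n1 n2" and ?be = "ode_beta n1 n2"
  obtain r lam h where r: "r > 0" "ball 0 r \<inter> \<Lambda> = {0}" and lam: "\<And>k. ode3 (slit_ball r) cp cq (lam k)"
    and pf: "\<And>k. power_form r (- gamma1 n1 n2) (h k) (lam k)" and F: "\<And>z. z \<in> slit_ball r \<Longrightarrow> FF z = sq lam z"
    and w: "\<And>z. z \<in> slit_ball r \<Longrightarrow> wronsk lam z = det (\<chi> k. a k)"
    by (rule slit_basis) (rule that, assumption+)
  have z1: "complex_of_real (r / 2) \<in> slit_ball r" using slit_ball_star(1)[of "r/2" r] r by simp
  have ex: "\<exists>n k'. power_form r (- g1 + real n) k' (lam k) \<and> k' 0 \<noteq> 0" for k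
  proof -
    have hk: "h k holomorphic_on ball 0 r" "\<And>z. z \<in> slit_ball r \<Longrightarrow> lam k z = cpow (- g1) z * h k z"
      using pf[of k] by (auto simp: power_form_def g1_def)
    have nz: "\<exists>z\<in>ball 0 r. h k z \<noteq> 0"
    proof (rule ccontr)
      assume "\<not> ?thesis"
      then have "lam k z = 0" if "z \<in> slit_ball r" for z using hk(2)[OF that] slit_ball_facts(2)[of r] that by auto
      then have "jet (lam k) (of_real (r / 2)) = jet (\<lambda>_. 0) (of_real (r / 2))"
        by (intro jet_cong_open[OF slit_ball_facts(1) z1]) auto
      then have j0: "jetmat lam (of_real (r / 2)) $ k = 0" by (simp add: jetmat_def vec3_eq_iff)
      have "(\<Sum>i\<in>UNIV. (if i = k then 1 else 0) *s jetmat lam (of_real (r / 2)) $ i) = 0"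
        using exhaust_3[of k] j0 by (auto simp: sum_3)
      from det_rows_indep[OF _ this, of k] w[OF z1] det_a_nonzero show False by (simp add: wronsk_def)
    qed
    obtain n k' where k': "k' holomorphic_on ball 0 r" "k' 0 \<noteq> 0" "\<forall>z\<in>ball 0 r. h k z = z ^ n * k' z"
      using order_factorization[OF hk(1) r(1) nz] by blast
    have "lam k z = cpow (- g1 + real n) z * k' z" if z: "z \<in> slit_ball r" for z
      using k'(3) hk(2)[OF z] slit_ball_facts(2)[of r] z unfolding cpow_add cpow_of_nat[OF slit_ball_facts(3)[OF z]] by auto
    then show ?thesis using k'(1,2) by (auto simp: power_form_def)
  qed
  obtain n k where nk: "\<And>i. power_form r (- g1 + real (n i)) (k i) (lam i)" "\<And>i. k i 0 \<noteq> 0" using ex by metis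
  obtain A \<sigma> k' where A: "det A \<noteq> 0" and \<sigma>: "inj \<sigma>" and Z: "\<And>i. power_form r (\<sigma> i) (k' i) (lincomb A lam i)" "\<And>i. k' i 0 \<noteq> 0"
    by (rule echelon[OF r(1) lam det_a_nonzero w nk]; (assumption | (rule that; assumption)))
  have "((\<lambda>z. - (of_real ?al * (z\<^sup>2 * wp \<tau> z) + B * z\<^sup>2)) \<longlongrightarrow> - (of_real ?al * 1 + B * 0\<^sup>2)) (at 0)"
    by (intro tendsto_intros wp_asymp)
  then have lp: "((\<lambda>z. z\<^sup>2 * cp z) \<longlongrightarrow> - of_real ?al) (at 0)" by (simp add: cp_def algebra_simps)
  have "((\<lambda>z. of_real ?be * (z ^ 3 * wp' \<tau> z)) \<longlongrightarrow> of_real ?be * - 2) (at 0)"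
    by (intro tendsto_intros wp_asymp)
  then have lq: "((\<lambda>z. z ^ 3 * cq z) \<longlongrightarrow> - of_real (2 * ?be)) (at 0)" by (simp add: cq_def mult_ac)
  have root: "\<sigma> i = - g1 \<or> \<sigma> i = 1 + g1 - g2 \<or> \<sigma> i = 2 + g2" for i
    using exponent_root[OF r(1) lincomb_ode3(1)[OF slit_ball_facts(1) lam] Z(1)[of i] Z(2) lp lq]
    unfolding exponent_polynomial g1_def[symmetric] g2_def[symmetric] by (auto simp: add_eq_0_iff)
  have o: "- g1 < 1 + g1 - g2" "1 + g1 - g2 < 2 + g2"
    unfolding g1_def g2_def gamma_differences(3,4) by simp_all
  note m = ordered_exponents[OF root \<sigma> o]
  have "asy r (sq lam) (- 2 * gamma1 n1 n2)"
    using asy_sq[where Z = "lincomb A lam" and \<sigma> = \<sigma> and k = k', OF r(1) Z] unfolding m lincomb_asy(1)[OF A lam, symmetric] by (simp add: g1_def)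
  moreover have "asy r (wsq lam) (- 2 * gamma2 n1 n2)"
    using asy_wsq[where Z = "lincomb A lam" and \<sigma> = \<sigma> and k = k', OF r(1) Z \<sigma>] unfolding m lincomb_asy(2)[OF A lam, symmetric] by (simp add: g1_def g2_def)
  ultimately show thesis using that[OF r lam F] w det_a by auto
qed

definition uu :: "complex \<Rightarrow> real" where "uu z = - ln (FF z)"
text \<open>Defined from \<open>uu\<close> through the first equation, so that no choice of a local
  basis enters and the symmetries of \<open>FF\<close> pass on to \<open>vv\<close>.\<close>

definition vv :: "complex \<Rightarrow> real" where
  "vv z = 2 * uu z - ln (- 4 * Re (dz (dzbar (\<lambda>z. complex_of_real (uu z))) z))"

abbreviation "UU \<equiv> (\<lambda>z. complex_of_real (uu z))"
abbreviation "VV \<equiv> (\<lambda>z. complex_of_real (vv z))"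

lemma local_potentials:
  assumes N: "open N" "N \<subseteq> - \<Lambda>" and Y: "\<And>k. ode3 N cp cq (Y k)"
    and w: "\<And>w. w \<in> N \<Longrightarrow> norm (wronsk Y w) = 1 / 8" and F: "\<And>w. w \<in> N \<Longrightarrow> FF w = sq Y w" and z: "z \<in> N"
  shows "uu z = - ln (sq Y z)" "vv z = - ln (4 * wsq Y z)" "wsq Y z > 0"
proof -
  have hol: "cp holomorphic_on N" "cq holomorphic_on N" using cp_cq_holomorphic N(2) holomorphic_on_subset by blast+
  note L = local_toda_from_basis[OF N(1) Y hol w]
  show u: "uu z = - ln (sq Y z)" using F[OF z] by (simp add: uu_def)
  have "dz (dzbar UU) z = dz (dzbar (\<lambda>z. complex_of_real (- ln (sq Y z)))) z"
    by (rule dz_dzbar_cong[OF N(1) z]) (simp add: uu_def F)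
  moreover have "- ln (4 * wsq Y z) = 2 * (- ln (sq Y z)) - ln (- 4 * Re (dz (dzbar (\<lambda>z. complex_of_real (- ln (sq Y z)))) z))"
    by (rule toda_domain_second_component[OF _ z]) (rule L(3), assumption)
  ultimately show "vv z = - ln (4 * wsq Y z)" by (simp add: vv_def u)
  show "wsq Y z > 0" by (rule L(2)[OF _ z])
qed

lemma potentials:
  "toda_domain (- \<Lambda>) UU VV uu vv" "z \<notin> \<Lambda> \<Longrightarrow> W2 UU VV z = cp z" "z \<notin> \<Lambda> \<Longrightarrow> W3 UU VV z = cq z"
proof -
  have loc: "\<exists>N. open N \<and> z \<in> N \<and> toda_domain N UU VV uu vv \<and> W2 UU VV z = cp z \<and> W3 UU VV z = cq z" if z: "z \<notin> \<Lambda>" for z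
  proof -
    obtain N Y where N: "open N" "z \<in> N" "N \<subseteq> - \<Lambda>" and Y: "\<And>k. ode3 N cp cq (Y k)"
      and w: "\<And>w. w \<in> N \<Longrightarrow> norm (wronsk Y w) = 1 / 8" and F: "\<And>w. w \<in> N \<Longrightarrow> FF w = sq Y w"
      by (rule FF_local[OF z]) (rule that, assumption+)
    have hol: "cp holomorphic_on N" "cq holomorphic_on N" using cp_cq_holomorphic N(3) holomorphic_on_subset by blast+
    note L = local_toda_from_basis[OF N(1) Y hol w]
    define u where "u = (\<lambda>z. - ln (sq Y z))"
    define v where "v = (\<lambda>z. - ln (4 * wsq Y z))"
    have uv: "UU y = of_real (u y)" "VV y = of_real (v y)" if "y \<in> N" for y
      using local_potentials[OF N(1,3) Y w F that] by (simp_all add: u_def v_def)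
    have T: "toda_domain N (\<lambda>z. of_real (u z)) (\<lambda>z. of_real (v z)) u v"
      unfolding u_def v_def by (rule L(3), assumption)
    have "toda_domain N UU VV uu vv"
    proof (unfold_locales)
      show "smooth_on N UU" by (rule smooth_on_cong[OF N(1) _ toda_domain.smooth(1)[OF T]]) (simp add: uv)
      show "smooth_on N VV" by (rule smooth_on_cong[OF N(1) _ toda_domain.smooth(2)[OF T]]) (simp add: uv)
      fix y assume y: "y \<in> N"
      have "dz (dzbar UU) y = dz (dzbar (\<lambda>z. complex_of_real (u z))) y"
        by (rule dz_dzbar_cong[OF N(1) y uv(1)])
      also note toda_domain.eqU[OF T y]
      finally show "dz (dzbar UU) y = - exp (2 * UU y - VV y) / 4" unfolding uv[OF y] .
      have "dz (dzbar VV) y = dz (dzbar (\<lambda>z. complex_of_real (v z))) y"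
        by (rule dz_dzbar_cong[OF N(1) y uv(2)])
      also note toda_domain.eqV[OF T y]
      finally show "dz (dzbar VV) y = - exp (2 * VV y - UU y) / 4" unfolding uv[OF y] .
    qed (use N in auto)
    moreover have "W2 UU VV z = cp z"
    proof -
      have "W2 UU VV z = W2 (\<lambda>z. of_real (u z)) (\<lambda>z. of_real (v z)) z" by (rule W_cong(1)[OF N(1) uv N(2)])
      also have "\<dots> = cp z" unfolding u_def v_def by (rule L(4)[OF _ N(2)])
      finally show ?thesis .
    qed
    moreover have "W3 UU VV z = cq z"
    proof -
      have "W3 UU VV z = W3 (\<lambda>z. of_real (u z)) (\<lambda>z. of_real (v z)) z" by (rule W_cong(2)[OF N(1) uv N(2)])
      also have "\<dots> = cq z" unfolding u_def v_def by (rule L(5)[OF _ N(2)])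
      finally show ?thesis .
    qed
    ultimately show ?thesis using N by blast
  qed
  show "toda_domain (- \<Lambda>) UU VV uu vv"
  proof (unfold_locales)
    have sl: "\<exists>N. open N \<and> z \<in> N \<and> smooth_on N UU \<and> smooth_on N VV" if z: "z \<in> - \<Lambda>" for z
    proof -
      obtain N where "open N" "z \<in> N" "toda_domain N UU VV uu vv" using loc z by blast
      then show ?thesis by (intro exI[of _ N] conjI toda_domain.smooth)
    qed
    show "smooth_on (- \<Lambda>) UU" by (rule smooth_on_local) (use sl in blast)
    show "smooth_on (- \<Lambda>) VV" by (rule smooth_on_local) (use sl in blast)
    fix z assume "z \<in> - \<Lambda>"
    then obtain N where N: "z \<in> N" "toda_domain N UU VV uu vv" using loc by blast
    show "dz (dzbar UU) z = - exp (2 * UU z - VV z) / 4" by (rule toda_domain.eqU[OF N(2,1)])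
    show "dz (dzbar VV) z = - exp (2 * VV z - UU z) / 4" by (rule toda_domain.eqV[OF N(2,1)])
  qed auto
  show "z \<notin> \<Lambda> \<Longrightarrow> W2 UU VV z = cp z" "z \<notin> \<Lambda> \<Longrightarrow> W3 UU VV z = cq z" using loc by blast+
qed

lemma potentials_affine:
  assumes e: "e = 1 \<or> e = -1" and p: "p \<in> \<Lambda>" and inv: "\<And>z. z \<notin> \<Lambda> \<Longrightarrow> FF (e * z + p) = FF z" and z: "z \<notin> \<Lambda>"
  shows "uu (e * z + p) = uu z" "vv (e * z + p) = vv z"
proof -
  have u: "uu (e * z + p) = uu z" if "z \<notin> \<Lambda>" for z using inv[OF that] by (simp add: uu_def)
  have m: "e * z + p \<in> - \<Lambda>" if "z \<in> - \<Lambda>" for z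
    using e that lattice_add_iff[OF p, of z] lattice_add_iff[OF p, of "- z"] lattice_minus_iff[of z] by auto
  have s: "smooth_on (- \<Lambda>) UU" using potentials(1) by (simp add: toda_domain_def)
  have "dz (dzbar UU) (e * z + p) = dz (dzbar UU) z"
    by (rule W_affine(3)[OF s s e m]) (use u z in auto)
  then show "uu (e * z + p) = uu z" "vv (e * z + p) = vv z" using u[OF z] by (simp_all add: vv_def)
qed

lemma potentials_bounds:
  obtains C \<delta> where "\<delta> > 0"
    "\<And>z. 0 < norm z \<Longrightarrow> norm z < \<delta> \<Longrightarrow> z \<notin> \<Lambda> \<and> \<bar>uu z - 2 * gamma1 n1 n2 * ln (norm z)\<bar> \<le> C \<and> \<bar>vv z - 2 * gamma2 n1 n2 * ln (norm z)\<bar> \<le> C"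
proof -
  obtain r lam where r: "r > 0" "ball 0 r \<inter> \<Lambda> = {0}" and lam: "\<And>k. ode3 (slit_ball r) cp cq (lam k)"
    and F: "\<And>z. z \<in> slit_ball r \<Longrightarrow> FF z = sq lam z" and w: "\<And>z. z \<in> slit_ball r \<Longrightarrow> norm (wronsk lam z) = 1 / 8"
    and as: "asy r (sq lam) (- 2 * gamma1 n1 n2)" "asy r (wsq lam) (- 2 * gamma2 n1 n2)"
    by (rule slit_asymptotics) (rule that, assumption+)
  have sub: "slit_ball r \<subseteq> - \<Lambda>" using r(2) slit_ball_facts(2)[of r] slit_ball_facts(3) by blast
  obtain C1 d1 where 1: "d1 > 0" "\<And>z. z \<in> slit_ball r \<Longrightarrow> norm z < d1 \<Longrightarrow> \<bar>ln (sq lam z) - (- 2 * gamma1 n1 n2) * ln (norm z)\<bar> \<le> C1"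
    by (rule asy_ln[OF as(1) r(1)]) (rule that, assumption+)
  obtain C2 d2 where 2: "d2 > 0" "\<And>z. z \<in> slit_ball r \<Longrightarrow> norm z < d2 \<Longrightarrow> \<bar>ln (wsq lam z) - (- 2 * gamma2 n1 n2) * ln (norm z)\<bar> \<le> C2"
    by (rule asy_ln[OF as(2) r(1)]) (rule that, assumption+)
  define \<delta> where "\<delta> = min r (min d1 d2)"
  define C where "C = \<bar>C1\<bar> + \<bar>C2\<bar> + ln 4"
  have sl: "\<bar>uu z - 2 * gamma1 n1 n2 * ln (norm z)\<bar> \<le> C \<and> \<bar>vv z - 2 * gamma2 n1 n2 * ln (norm z)\<bar> \<le> C"
    if z: "z \<in> slit_ball r" "norm z < \<delta>" for z
  proof -
    have lp: "uu z = - ln (sq lam z)" "vv z = - ln (4 * wsq lam z)" "wsq lam z > 0"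
      by (rule local_potentials[OF slit_ball_facts(1) sub lam w F z(1)]; assumption)+
    have v: "vv z = - ln 4 - ln (wsq lam z)" using lp(2,3) by (simp add: ln_mult)
    have "(0::real) \<le> ln 4" by simp
    moreover have "\<bar>ln (sq lam z) - (- 2 * gamma1 n1 n2) * ln (norm z)\<bar> \<le> C1" "\<bar>ln (wsq lam z) - (- 2 * gamma2 n1 n2) * ln (norm z)\<bar> \<le> C2"
      using 1(2)[OF z(1)] 2(2)[OF z(1)] z(2) by (simp_all add: \<delta>_def)
    ultimately show ?thesis unfolding lp(1) v C_def by (intro conjI; linarith)
  qed
  show thesis
  proof (rule that[of \<delta> C])
    show "\<delta> > 0" using r 1 2 by (simp add: \<delta>_def)
    fix z :: complex assume z: "0 < norm z" "norm z < \<delta>"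
    have "z \<in> ball 0 r" "z \<noteq> 0" using z by (simp_all add: \<delta>_def)
    then have nl: "z \<notin> \<Lambda>" using r(2) by blast
    show "z \<notin> \<Lambda> \<and> \<bar>uu z - 2 * gamma1 n1 n2 * ln (norm z)\<bar> \<le> C \<and> \<bar>vv z - 2 * gamma2 n1 n2 * ln (norm z)\<bar> \<le> C"
    proof (cases "z \<in> \<real>\<^sub>\<le>\<^sub>0")
      case False
      then have "z \<in> slit_ball r" using z by (simp add: slit_ball_facts(5) \<delta>_def)
      then show ?thesis using sl z(2) nl by blast
    next
      case True
      \<comment> \<open>On the cut the bound is transferred from \<open>- z\<close> by
        evenness.\<close>
      then have "- z \<notin> \<real>\<^sub>\<le>\<^sub>0" using z(1) by (auto simp: complex_nonpos_Reals_iff complex_eq_iff)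
      then have s: "- z \<in> slit_ball r" using z by (simp add: slit_ball_facts(5) \<delta>_def)
      have "uu (- 1 * z + 0) = uu z" "vv (- 1 * z + 0) = vv z"
        by (rule potentials_affine; use FF_minus nl in simp)+
      then show ?thesis using sl[OF s] z(2) nl by simp
    qed
  qed
qed

text \<open>Together with \<open>vs\<close> this inverts the passage to
  \<open>(2 * u + v) / 3\<close> and \<open>(u + 2 * v) / 3\<close>; the value 0 on the lattice is
  the convention of \<open>toda_solution\<close>.\<close>

definition us :: "complex \<Rightarrow> real" where "us z = (if z \<in> \<Lambda> then 0 else 2 * uu z - vv z)"
definition vs :: "complex \<Rightarrow> real" where "vs z = (if z \<in> \<Lambda> then 0 else 2 * vv z - uu z)"

lemma solution_exists: "(us, vs) \<in> even_toda_solutions \<tau> n1 n2" "is_associated_ode \<tau> n1 n2 (us, vs) (B, 0, 0)"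
proof -
  note T = potentials(1)
  have per: "uu (z + q) = uu z" "vv (z + q) = vv z" if "z \<notin> \<Lambda>" "q \<in> \<Lambda>" for z q
    using potentials_affine[of 1 q z] FF_lattice that by auto
  have ev: "uu (- z) = uu z" "vv (- z) = vv z" if "z \<notin> \<Lambda>" for z
    using potentials_affine[of "-1" 0 z] FF_minus that by auto
  have sm: "smooth_on (- \<Lambda>) UU" "smooth_on (- \<Lambda>) VV" using T by (auto simp: toda_domain_def)
  define us' where "us' = (\<lambda>z. 2 * UU z + (-1) * VV z)"
  define vs' where "vs' = (\<lambda>z. 2 * VV z + (-1) * UU z)"
  have e': "complex_of_real (us z) = us' z" "complex_of_real (vs z) = vs' z" if "z \<in> - \<Lambda>" for z
    using that by (simp_all add: us_def vs_def us'_def vs'_def)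
  have sm': "smooth_on (- \<Lambda>) us'" "smooth_on (- \<Lambda>) vs'"
    unfolding us'_def vs'_def by (intro smooth_on_add smooth_on_mult smooth_on_const open_compl_lattice sm)+
  have "smooth_on (- \<Lambda>) (\<lambda>z. complex_of_real (us z))" "smooth_on (- \<Lambda>) (\<lambda>z. complex_of_real (vs z))"
    by (rule smooth_on_cong[OF open_compl_lattice _ sm'(1)], simp add: e') (rule smooth_on_cong[OF open_compl_lattice _ sm'(2)], simp add: e')
  then have smr: "smooth_on (- \<Lambda>) us" "smooth_on (- \<Lambda>) vs" by (simp_all add: smooth_on_of_real_iff)
  have ex: "exp (2 * UU z - VV z) = of_real (exp (us z))" "exp (2 * VV z - UU z) = of_real (exp (vs z))" if "z \<notin> \<Lambda>" for z
    using that by (simp_all add: us_def vs_def flip: exp_of_real)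
  have lap: "laplacian (\<lambda>w. of_real (us w)) z + 2 * of_real (exp (us z)) - of_real (exp (vs z)) = 0"
    "laplacian (\<lambda>w. of_real (vs w)) z + 2 * of_real (exp (vs z)) - of_real (exp (us z)) = 0" if z: "z \<in> - \<Lambda>" for z
  proof -
    have nz: "z \<notin> \<Lambda>" using z by simp
    note E = toda_domain.eqU[OF T z, unfolded ex[OF nz]] toda_domain.eqV[OF T z, unfolded ex[OF nz]]
    have "dz (dzbar (\<lambda>w. of_real (us w))) z = 2 * dz (dzbar UU) z + (-1) * dz (dzbar VV) z"
      
    proof -
      have "dz (dzbar (\<lambda>w. complex_of_real (us w))) z = dz (dzbar us') z" by (rule dz_dzbar_cong[OF open_compl_lattice z e'(1)])
      also note dz_lincomb(3)[OF open_compl_lattice z sm, of 2 "-1", folded us'_def]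
      finally show ?thesis .
    qed
    then show "laplacian (\<lambda>w. of_real (us w)) z + 2 * of_real (exp (us z)) - of_real (exp (vs z)) = 0"
      unfolding laplacian_def E by (simp add: field_simps)
    have "dz (dzbar (\<lambda>w. of_real (vs w))) z = 2 * dz (dzbar VV) z + (-1) * dz (dzbar UU) z"
      
    proof -
      have "dz (dzbar (\<lambda>w. complex_of_real (vs w))) z = dz (dzbar vs') z" by (rule dz_dzbar_cong[OF open_compl_lattice z e'(2)])
      also note dz_lincomb(3)[OF open_compl_lattice z sm(2,1), of 2 "-1", folded vs'_def]
      finally show ?thesis .
    qed
    then show "laplacian (\<lambda>w. of_real (vs w)) z + 2 * of_real (exp (vs z)) - of_real (exp (us z)) = 0"
      unfolding laplacian_def E by (simp add: field_simps)
  qed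
  obtain C \<delta> where C: "\<delta> > 0" "\<And>z. 0 < norm z \<Longrightarrow> norm z < \<delta> \<Longrightarrow> z \<notin> \<Lambda> \<and> \<bar>uu z - 2 * gamma1 n1 n2 * ln (norm z)\<bar> \<le> C \<and> \<bar>vv z - 2 * gamma2 n1 n2 * ln (norm z)\<bar> \<le> C"
    by (rule potentials_bounds) (rule that, assumption+)
  have bo: "\<bar>us z - 2 * real n1 * ln (norm z)\<bar> \<le> 3 * C \<and> \<bar>vs z - 2 * real n2 * ln (norm z)\<bar> \<le> 3 * C" if "0 < norm z" "norm z < \<delta>" for z
  proof -
    have b: "z \<notin> \<Lambda>" "\<bar>uu z - 2 * gamma1 n1 n2 * ln (norm z)\<bar> \<le> C" "\<bar>vv z - 2 * gamma2 n1 n2 * ln (norm z)\<bar> \<le> C"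
      using C(2)[OF that] by simp_all
    have e: "us z - 2 * real n1 * ln (norm z) = 2 * (uu z - 2 * gamma1 n1 n2 * ln (norm z)) - (vv z - 2 * gamma2 n1 n2 * ln (norm z))"
      "vs z - 2 * real n2 * ln (norm z) = 2 * (vv z - 2 * gamma2 n1 n2 * ln (norm z)) - (uu z - 2 * gamma1 n1 n2 * ln (norm z))"
      unfolding gamma_differences(1,2)[of n1 n2, symmetric] using b(1) by (simp_all add: us_def vs_def algebra_simps)
    have t: "\<bar>2 * x - y\<bar> \<le> 3 * C" if "\<bar>x\<bar> \<le> C" "\<bar>y\<bar> \<le> C" for x y :: real using that by linarith
    show ?thesis unfolding e by (intro conjI t b(2,3))
  qed
  have evl: "\<forall>\<^sub>F z in at (0::complex). 0 < norm z \<and> norm z < \<delta>"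
    using C(1) unfolding eventually_at by (intro exI[of _ \<delta>]) auto
  have O: "(\<lambda>z. us z - 2 * real n1 * ln (norm z)) \<in> O[at 0](\<lambda>_. 1)" "(\<lambda>z. vs z - 2 * real n2 * ln (norm z)) \<in> O[at 0](\<lambda>_. 1)"
    by (rule bigoI[of _ "3 * C"], rule eventually_mono[OF evl], use bo in force)+
  have "toda_solution \<tau> n1 n2 (us, vs)"
    unfolding toda_solution_def prod.case
  proof (intro conjI ballI smr O lap)
    show "torus_function \<tau> us" "torus_function \<tau> vs"
      using per by (auto simp: torus_function_def us_def vs_def lattice_add_iff)
  qed (simp_all add: us_def vs_def)
  then show "(us, vs) \<in> even_toda_solutions \<tau> n1 n2"
    using ev by (auto simp: even_toda_solutions_def us_def vs_def lattice_minus_iff)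
  have "W2 (\<lambda>z. of_real ((2 * us z + vs z) / 3)) (\<lambda>z. of_real ((us z + 2 * vs z) / 3)) z = cp z \<and>
    W3 (\<lambda>z. of_real ((2 * us z + vs z) / 3)) (\<lambda>z. of_real ((us z + 2 * vs z) / 3)) z = cq z" if z: "z \<in> - \<Lambda>" for z
  proof -
    have e: "complex_of_real ((2 * us w + vs w) / 3) = UU w" "complex_of_real ((us w + 2 * vs w) / 3) = VV w" if "w \<in> - \<Lambda>" for w
      using that by (simp_all add: us_def vs_def)
    show ?thesis using W_cong[OF open_compl_lattice e z] potentials(2,3) z by simp
  qed
  then show "is_associated_ode \<tau> n1 n2 (us, vs) (B, 0, 0)"
    by (simp add: is_associated_ode_def Let_def cp_def cq_def)
qed

text \<open>A representing basis found on \<open>S\<close> also represents on \<open>T\<close>, by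
  its jets at \<open>z0\<close>. Periodicity of the solution makes these jets
  \<open>unitary_data\<close>, so \<open>exp (- u')\<close> is \<open>FF\<close>; the second
  potential then follows from the first equation.\<close>

lemma solution_unique:
  assumes s: "(u, v) \<in> even_toda_solutions \<tau> n1 n2" and as: "is_associated_ode \<tau> n1 n2 (u, v) (B, 0, 0)"
  shows "(u, v) = (us, vs)"
proof -
  define u' where "u' = (\<lambda>z. (2 * u z + v z) / 3)"
  define v' where "v' = (\<lambda>z. (u z + 2 * v z) / 3)"
  let ?U = "\<lambda>z. complex_of_real (u' z)" and ?V = "\<lambda>z. complex_of_real (v' z)"
  have ts: "toda_solution \<tau> n1 n2 (u, v)" using s by (simp add: even_toda_solutions_def)
  have T: "toda_domain (- \<Lambda>) ?U ?V u' v'" unfolding u'_def v'_def by (rule solution_toda_domain[OF ts])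
  have W: "W2 ?U ?V z = cp z" "W3 ?U ?V z = cq z" if "z \<notin> \<Lambda>" for z
    using as that by (simp_all add: is_associated_ode_def Let_def u'_def v'_def cp_def cq_def)
  have per: "u (z + 1) = u z" "u (z + \<tau>) = u z" "v (z + 1) = v z" "v (z + \<tau>) = v z" for z
    using ts by (auto simp: toda_solution_def torus_function_def)
  have per': "u' (z + 1) = u' z" "u' (z + \<tau>) = u' z" for z by (simp_all add: u'_def per)
  note TS = toda_domain_subset[OF T ST_open(1) cellD(4)[OF cell_ST(1)]]
  note TT = toda_domain_subset[OF T ST_open(2) cellD(4)[OF cell_ST(2)]]
  obtain Y where Y: "\<And>k. ode3 S (W2 ?U ?V) (W3 ?U ?V) (Y k)" and dY: "\<And>i j z. z \<in> S \<Longrightarrow> toda_domain.defect ?U ?V u' v' Y i j z = 0"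
    and wY: "\<And>z. z \<in> S \<Longrightarrow> wronsk Y z = 1 / 8"
    by (rule toda_domain.exists_representation[OF TS cellD(3)[OF cell_ST(1)] cellD(9)[OF cell_ST(1)] cellD(2)[OF cell_ST(1)]];
      (assumption | (rule that; assumption)))
  define x where "x = (\<lambda>k. jet (Y k) z0)"
  have zS: "z0 \<in> S" and zT: "z0 \<in> T" using cellD(3) cell_ST by blast+
  have YS: "Y k z = sol S (x k) z" if "z \<in> S" for k z
  proof (rule sol_unique[OF cell_ST(1) _ _ that])
    show "ode3 S cp cq (Y k)" by (rule ode3_cong_coeff[OF _ _ Y]) (use W ST_lattice(1) in auto)
  qed (simp add: x_def)
  have fS: "exp (- u' z) = Fsq S x z" if z: "z \<in> S" for z
  proof -
    have "complex_of_real (exp (- u' z)) = (\<Sum>k\<in>UNIV. Y k z * cnj (Y k z))"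
      by (rule toda_domain.defect_eq_diag(1)[OF TS]) (rule dY[OF z])
    also have "\<dots> = of_real (Fsq S x z)" unfolding Fsq_def sq_def of_real_sum complex_norm_square YS[OF z] ..
    finally show ?thesis using of_real_eq_iff by blast
  qed
  have oT: "ode3 T (W2 ?U ?V) (W3 ?U ?V) (sol T (x k))" for k
    by (rule ode3_cong_coeff[OF _ _ sol(1)[OF cell_ST(2)]]) (use W ST_lattice(2) in auto)
  have d0: "toda_domain.defect ?U ?V u' v' (\<lambda>k. sol T (x k)) i j z0 = 0" for i j
    using dY[OF zS, of i j] unfolding toda_domain.defect_def[OF T] by (simp add: sol(2)[OF cell_ST(2)] x_def)
  have fT: "exp (- u' z) = Fsq T x z" if z: "z \<in> T" for z
  proof -
    have "toda_domain.defect ?U ?V u' v' (\<lambda>k. sol T (x k)) i j z = 0" for i j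
      by (rule toda_domain.defect_extends[OF TT cellD(2)[OF cell_ST(2)] oT oT d0 zT refl z])
    then have "complex_of_real (exp (- u' z)) = (\<Sum>k\<in>UNIV. sol T (x k) z * cnj (sol T (x k) z))"
      by (rule toda_domain.defect_eq_diag(1)[OF TT])
    also have "\<dots> = of_real (Fsq T x z)" unfolding Fsq_def sq_def of_real_sum complex_norm_square ..
    finally show ?thesis using of_real_eq_iff by blast
  qed
  have "unitary_data x"
    unfolding unitary_data_def
  proof (intro conjI ballI)
    have d: "det (\<chi> k. x k) = 1 / 8" using wY[OF zS] unfolding wronsk_def jetmat_def x_def .
    show "norm (det (\<chi> k. x k)) = 1 / 8" unfolding d by simp
    fix z
    show "Fsq S x (z + 1) = Fsq S x z" if "z \<in> S" using fS[OF that] fS[of "z + 1"] that per'(1)[of z] by (simp add: S_def)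
    show "Fsq T x (z + \<tau>) = Fsq T x z" if "z \<in> T" using fT[OF that] fT[of "z + \<tau>"] that per'(2)[of z] by (simp add: T_def)
  qed
  note U = unitary_data_unique[OF this]
  have "u' z = uu z" if "z \<in> S \<or> z \<in> T" for z
    using that
  proof
    assume z: "z \<in> S"
    have "exp (- u' z) = FF z" using fS[OF z] U(1)[OF z] FF_S[OF z] by simp
    then show ?thesis unfolding uu_def by (metis ln_exp minus_minus)
  next
    assume z: "z \<in> T"
    have "exp (- u' z) = FF z" using fT[OF z] U(2)[OF z] FF_T[OF z] by simp
    then show ?thesis unfolding uu_def by (metis ln_exp minus_minus)
  qed
  then have u'u: "u' z = uu z" if z: "z \<notin> \<Lambda>" for z
  proof -
    obtain p where p: "p \<in> \<Lambda>" "z + p \<in> S \<or> z + p \<in> T" by (rule cell_cover[OF z])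
    have "u' z = u' (z + p)" using period_lattice[of u' p z] per' p(1) z by simp
    also have "\<dots> = uu (z + p)" using p(2) \<open>\<And>z. z \<in> S \<or> z \<in> T \<Longrightarrow> u' z = uu z\<close> by blast
    also have "\<dots> = uu z" using FF_lattice[OF z p(1)] by (simp add: uu_def)
    finally show ?thesis .
  qed
  have v'v: "v' z = vv z" if z: "z \<notin> \<Lambda>" for z
  proof -
    have z': "z \<in> - \<Lambda>" using z by simp
    have "dz (dzbar ?U) z = dz (dzbar UU) z" by (rule dz_dzbar_cong[OF open_compl_lattice z']) (simp add: u'u)
    then show ?thesis using toda_domain_second_component[OF T z'] by (simp add: vv_def u'u[OF z])
  qed
  have "u z = us z \<and> v z = vs z" for z
  proof (cases "z \<in> \<Lambda>")
    case True
    then show ?thesis using ts by (auto simp: toda_solution_def us_def vs_def)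
  next
    case False
    have "u z = 2 * u' z - v' z" "v z = 2 * v' z - u' z" by (simp_all add: u'_def v'_def field_simps)
    then show ?thesis using u'u[OF False] v'v[OF False] False by (simp add: us_def vs_def)
  qed
  then show ?thesis by auto
qed

end

lemma even_solution_of_apparent:
  assumes "Im \<tau> > 0" "n1 mod 3 \<noteq> n2 mod 3" "apparent_at_0 \<tau> n1 n2 (B, 0, 0)"
  shows "\<exists>!s. s \<in> even_toda_solutions \<tau> n1 n2 \<and> is_associated_ode \<tau> n1 n2 s (B, 0, 0)"
proof -
  interpret even_lame \<tau> n1 n2 B using assms by unfold_locales
  obtain a l c where e: "norm (det (\<chi> i. a i)) = 1 / 8" "\<And>i. mon S 1 (a i) = l i *s a i" "\<And>i. norm (l i) = 1" "inj l"
    "mon T \<tau> (a 1) = a 2" "mon T \<tau> (a 2) = a 3" "mon T \<tau> (a 3) = c *s a 1" "norm c = 1"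
    by (rule monodromy_eigenbasis) (rule that, assumption+)
  interpret lame_basis \<tau> n1 n2 B a l c by unfold_locales (fact e)+
  show ?thesis
  proof (rule ex1I[of _ "(us, vs)"])
    show "(us, vs) \<in> even_toda_solutions \<tau> n1 n2 \<and> is_associated_ode \<tau> n1 n2 (us, vs) (B, 0, 0)"
      using solution_exists by simp
    fix s assume "s \<in> even_toda_solutions \<tau> n1 n2 \<and> is_associated_ode \<tau> n1 n2 s (B, 0, 0)"
    moreover obtain u v where s: "s = (u, v)" by (cases s)
    ultimately show "s = (us, vs)" unfolding s by (intro solution_unique) auto
  qed
qed


theorem theorem1p12:
  fixes \<tau> :: complex and n1 n2 :: nat
  assumes "Im \<tau> > 0"
    and "n1 mod 3 \<noteq> n2 mod 3"
    and "n1 < n2"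
  shows "(\<forall>s\<in>even_toda_solutions \<tau> n1 n2. \<exists>!p. is_associated_ode \<tau> n1 n2 s p) \<and>
    bij_betw (associated_params \<tau> n1 n2)
      (even_toda_solutions \<tau> n1 n2)
      {(B, D0, D). D0 = 0 \<and> D = 0 \<and> apparent_at_0 \<tau> n1 n2 (B, D0, D)}"
proof -
  interpret torus \<tau> by unfold_locales (rule assms(1))
  let ?X = "even_toda_solutions \<tau> n1 n2" and ?f = "associated_params \<tau> n1 n2"
  let ?Y = "{(B, D0, D). D0 = 0 \<and> D = 0 \<and> apparent_at_0 \<tau> n1 n2 (B, D0, D)}"
  have ex: "\<exists>B. is_associated_ode \<tau> n1 n2 s (B, 0, 0) \<and> apparent_at_0 \<tau> n1 n2 (B, 0, 0)" if "s \<in> ?X" for s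
    using that by (cases s) (simp add: even_solution_params)
  have f: "?f s = p" if "is_associated_ode \<tau> n1 n2 s p" for s p
    unfolding associated_params_def by (rule the_equality) (use that associated_unique in blast)+
  have "bij_betw ?f ?X ?Y"
  proof (rule bij_betw_imageI)
    show "inj_on ?f ?X"
    proof (rule inj_onI)
      fix s t assume s: "s \<in> ?X" "t \<in> ?X" "?f s = ?f t"
      obtain B where B: "is_associated_ode \<tau> n1 n2 s (B, 0, 0)" "apparent_at_0 \<tau> n1 n2 (B, 0, 0)" using ex[OF s(1)] by blast
      obtain B' where B': "is_associated_ode \<tau> n1 n2 t (B', 0, 0)" using ex[OF s(2)] by blast
      have "B' = B" using f[OF B(1)] f[OF B'] s(3) by simp
      then show "s = t" using even_solution_of_apparent[OF assms(1,2) B(2)] B(1) B' s(1,2) by blast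
    qed
    show "?f ` ?X = ?Y"
    proof (intro equalityI subsetI)
      fix p assume "p \<in> ?f ` ?X"
      then obtain s where s: "s \<in> ?X" "p = ?f s" by blast
      obtain B where B: "is_associated_ode \<tau> n1 n2 s (B, 0, 0)" "apparent_at_0 \<tau> n1 n2 (B, 0, 0)" using ex[OF s(1)] by blast
      then show "p \<in> ?Y" unfolding s(2) f[OF B(1)] by simp
    next
      fix p assume "p \<in> ?Y"
      then obtain B where p: "p = (B, 0, 0)" "apparent_at_0 \<tau> n1 n2 (B, 0, 0)" by auto
      then obtain s where s: "s \<in> ?X" "is_associated_ode \<tau> n1 n2 s (B, 0, 0)"
        using even_solution_of_apparent[OF assms(1,2)] by blast
      show "p \<in> ?f ` ?X" unfolding p(1) f[OF s(2), symmetric] by (rule imageI[OF s(1)])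
    qed
  qed
  moreover have "\<exists>!p. is_associated_ode \<tau> n1 n2 s p" if "s \<in> ?X" for s
    using ex[OF that] associated_unique by blast
  ultimately show ?thesis by blast
qed

end
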